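(* Let $B>0$ and let $D=\{(x,y)\in\mathbb{R}^2: x\in(0,+\infty),\ y\in(0,B)\}$. Let $\gamma\in(0,\frac18)$, $k\in(0,\frac14)$, and let $a>0$ be given by $a^2=\frac{\pi^2}{B^2}$, where it is assumed that $a^2>1$. Let $u_0:D\to\mathbb{R}$ satisfy $$u_0\in H^4(D),\qquad \partial_x^5u_0\in L^2(D),\qquad \lim_{x\to+\infty}\partial_x^iu_0=0\ \ (i=0,1,2,3),$$ $$u_0(0,y)=u_{0x}(0,y)=u_0(x,0)=u_0(x,B)=u_{0yy}(x,0)=u_{0yy}(x,B)=0,$$ $$J_w=\int_De^{kx}\big[|\Delta^2u_0|^2+|\Delta u_0|^2+u_0^2u_{0x}^2+|\partial_x^5u_0|^2\big]\,dx\,dy<\infty,$$ $$\int_De^{kx}u_0^2\,dx\,dy<\frac{9}{8k}a^2.$$ Then every regular solution $u$ of the problem $$u_t+\Delta^2u+\gamma\Delta u+\Delta u_x+uu_x-\partial_x^5u=0\quad\text{in }D\times(0,\infty),$$ $$u|_{\partial D}=0,\quad u_{yy}(x,0,t)=u_{yy}(x,B,t)=0,\quad u_x(0,y,t)=0,$$ $$u(x,y,0)=u_0(x,y),\quad (x,y)\in D,$$ satisfies, for all $t\ge0$, $$\|u\|^2(t)\le\|u_0\|^2e^{-\chi t},\qquad \chi=\tfrac12a^2.$$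
   Context: Functions are real valued, $\Delta=\partial_x^2+\partial_y^2$, subscripts denote partial derivatives, $H^k(D)$ is the usual $L^2$-based Sobolev space, and $\|u\|(t)=\|u(\cdot,\cdot,t)\|_{L^2(D)}$. A regular solution is a function such that for every $T>0$: $u\in L^\infty(0,T;H^2(D))\cap L^2(0,T;H^4(D))$, $\partial_x^5u\in L^2(0,T;L^2(D))$, $u_t\in L^\infty(0,T;L^2(D))\cap L^2(0,T;H^2(D))$, the equation holds a.e. in $D\times(0,T)$, the boundary conditions hold in the sense of traces for a.e. $t$, and the initial condition holds in $L^2(D)$. Existence of such a solution is not part of the claim. *)

theory Defs
  imports "HOL-Analysis.Analysis"
begin

section \<open>Test functions and weak derivatives\<close>

definition dir_deriv :: "'a::euclidean_space \<Rightarrow> ('a \<Rightarrow> real) \<Rightarrow> 'a \<Rightarrow> real" where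
  "dir_deriv b f z = deriv (\<lambda>s. f (z + s *\<^sub>R b)) 0"

definition iter_deriv :: "'a::euclidean_space list \<Rightarrow> ('a \<Rightarrow> real) \<Rightarrow> 'a \<Rightarrow> real" where
  "iter_deriv bs f = foldr dir_deriv bs f"

text \<open>\<open>C\<^sup>\<infinity>\<close> on the whole space: all iterated partial derivatives exist and are continuous.\<close>

definition smooth :: "('a::euclidean_space \<Rightarrow> real) \<Rightarrow> bool" where
  "smooth f \<longleftrightarrow>
    (\<forall>bs. set bs \<subseteq> Basis \<longrightarrow>
       continuous_on UNIV (iter_deriv bs f) \<and>
       (\<forall>b\<in>Basis. \<forall>z. (\<lambda>s. iter_deriv bs f (z + s *\<^sub>R b)) field_differentiable (at 0)))"

definition test_function :: "'a::euclidean_space set \<Rightarrow> ('a \<Rightarrow> real) \<Rightarrow> bool" where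
  "test_function \<Omega> \<phi> \<longleftrightarrow>
     smooth \<phi> \<and> compact (closure {z. \<phi> z \<noteq> 0}) \<and> closure {z. \<phi> z \<noteq> 0} \<subseteq> \<Omega>"

definition locally_integrable :: "'a::euclidean_space set \<Rightarrow> ('a \<Rightarrow> real) \<Rightarrow> bool" where
  "locally_integrable \<Omega> f \<longleftrightarrow> (\<forall>K. compact K \<and> K \<subseteq> \<Omega> \<longrightarrow> f absolutely_integrable_on K)"

text \<open>\<open>weak_deriv \<Omega> [b\<^sub>1, \<dots>, b\<^sub>m] f g\<close>: on the open set \<open>\<Omega>\<close>, \<open>g\<close> is (a version of) the
  weak derivative of \<open>f\<close> in the coordinate directions \<open>b\<^sub>1, \<dots>, b\<^sub>m\<close>.\<close>

definition weak_deriv ::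
    "'a::euclidean_space set \<Rightarrow> 'a list \<Rightarrow> ('a \<Rightarrow> real) \<Rightarrow> ('a \<Rightarrow> real) \<Rightarrow> bool" where
  "weak_deriv \<Omega> bs f g \<longleftrightarrow>
     locally_integrable \<Omega> f \<and> locally_integrable \<Omega> g \<and>
     (\<forall>\<phi>. test_function \<Omega> \<phi> \<longrightarrow>
        (LINT z|lebesgue_on \<Omega>. f z * iter_deriv bs \<phi> z)
          = (- 1) ^ length bs * (LINT z|lebesgue_on \<Omega>. g z * \<phi> z))"

section \<open>\<open>L\<^sup>2\<close> and Sobolev spaces\<close>

text \<open>Functions are total; their values outside \<open>\<Omega>\<close> are irrelevant.\<close>

definition L2_on :: "'a::euclidean_space set \<Rightarrow> ('a \<Rightarrow> real) \<Rightarrow> bool" where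
  "L2_on \<Omega> f \<longleftrightarrow>
     f \<in> borel_measurable (lebesgue_on \<Omega>) \<and> integrable (lebesgue_on \<Omega>) (\<lambda>z. (f z)\<^sup>2)"

definition L2_norm :: "'a::euclidean_space set \<Rightarrow> ('a \<Rightarrow> real) \<Rightarrow> real" where
  "L2_norm \<Omega> f = sqrt (LINT z|lebesgue_on \<Omega>. (f z)\<^sup>2)"

text \<open>The multi-index \<open>\<partial>\<^sub>x\<^sup>i \<partial>\<^sub>y\<^sup>j\<close> in the plane.\<close>

definition xy :: "nat \<Rightarrow> nat \<Rightarrow> (real \<times> real) list" where
  "xy i j = replicate i (1, 0) @ replicate j (0, 1)"

definition sobolev :: "nat \<Rightarrow> (real \<times> real) set \<Rightarrow> (real \<times> real \<Rightarrow> real) \<Rightarrow> bool" where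
  "sobolev k \<Omega> f \<longleftrightarrow>
     L2_on \<Omega> f \<and> (\<forall>i j. i + j \<le> k \<longrightarrow> (\<exists>g. L2_on \<Omega> g \<and> weak_deriv \<Omega> (xy i j) f g))"

text \<open>A version of the weak derivative; determined up to a null set whenever one exists.\<close>

definition wd :: "(real \<times> real) set \<Rightarrow> nat \<Rightarrow> nat \<Rightarrow> (real \<times> real \<Rightarrow> real) \<Rightarrow> real \<times> real \<Rightarrow> real" where
  "wd \<Omega> i j f = (SOME g. weak_deriv \<Omega> (xy i j) f g)"

definition sobolev_norm :: "nat \<Rightarrow> (real \<times> real) set \<Rightarrow> (real \<times> real \<Rightarrow> real) \<Rightarrow> real" where
  "sobolev_norm k \<Omega> f = sqrt (\<Sum>(i, j) \<in> {(i, j). i + j \<le> k}. (L2_norm \<Omega> (wd \<Omega> i j f))\<^sup>2)"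

definition laplacian :: "(real \<times> real) set \<Rightarrow> (real \<times> real \<Rightarrow> real) \<Rightarrow> real \<times> real \<Rightarrow> real" where
  "laplacian \<Omega> f z = wd \<Omega> 2 0 f z + wd \<Omega> 0 2 f z"

definition bilaplacian :: "(real \<times> real) set \<Rightarrow> (real \<times> real \<Rightarrow> real) \<Rightarrow> real \<times> real \<Rightarrow> real" where
  "bilaplacian \<Omega> f z = wd \<Omega> 4 0 f z + 2 * wd \<Omega> 2 2 f z + wd \<Omega> 0 4 f z"

text \<open>Trace of \<open>f \<in> H\<^sup>1(\<Omega>)\<close> on the boundary piece \<open>p ` S\<close>, where \<open>p\<close> parametrises by arc length:
  the value of the continuous extension to \<open>H\<^sup>1(\<Omega>)\<close> of the restriction map, i.e. the
  \<open>L\<^sup>2\<close>-limit of the restrictions of smooth functions (up to the boundary) approximating \<open>f\<close>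
  in \<open>H\<^sup>1(\<Omega>)\<close>.\<close>

definition has_trace ::
    "(real \<times> real) set \<Rightarrow> real set \<Rightarrow> (real \<Rightarrow> real \<times> real) \<Rightarrow> (real \<times> real \<Rightarrow> real) \<Rightarrow> (real \<Rightarrow> real) \<Rightarrow> bool"
  where
  "has_trace \<Omega> S p f h \<longleftrightarrow>
     sobolev 1 \<Omega> f \<and> L2_on S h \<and>
     (\<exists>\<phi> :: nat \<Rightarrow> real \<times> real \<Rightarrow> real.
        (\<forall>n. test_function UNIV (\<phi> n)) \<and>
        (\<lambda>n. sobolev_norm 1 \<Omega> (\<lambda>z. \<phi> n z - f z)) \<longlonglongrightarrow> 0 \<and>
        (\<lambda>n. L2_norm S (\<lambda>s. \<phi> n (p s) - h s)) \<longlonglongrightarrow> 0)"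

section \<open>Spaces \<open>L\<^sup>p(0,T; H\<^sup>k(\<Omega>))\<close>\<close>

text \<open>Elements are represented by jointly measurable functions on \<open>\<Omega> \<times> (0,T)\<close>. Since \<open>H\<^sup>k(\<Omega>)\<close> is
  separable, joint measurability yields Bochner measurability of \<open>t \<mapsto> u(\<cdot>,t)\<close> (Pettis), and every
  Bochner class has a jointly measurable representative. Note \<open>H\<^sup>0 = L\<^sup>2\<close>.\<close>

definition time_Hk ::
    "nat \<Rightarrow> (real \<times> real) set \<Rightarrow> real \<Rightarrow> ((real \<times> real) \<times> real \<Rightarrow> real) \<Rightarrow> bool" where
  "time_Hk k \<Omega> T u \<longleftrightarrow>
     u \<in> borel_measurable (lebesgue_on (\<Omega> \<times> {0<..<T})) \<and>
     (AE t in lebesgue_on {0<..<T}. sobolev k \<Omega> (\<lambda>z. u (z, t)))"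

definition Linf_Hk ::
    "nat \<Rightarrow> (real \<times> real) set \<Rightarrow> real \<Rightarrow> ((real \<times> real) \<times> real \<Rightarrow> real) \<Rightarrow> bool" where
  "Linf_Hk k \<Omega> T u \<longleftrightarrow>
     time_Hk k \<Omega> T u \<and>
     (\<exists>C. AE t in lebesgue_on {0<..<T}. sobolev_norm k \<Omega> (\<lambda>z. u (z, t)) \<le> C)"

definition L2_Hk ::
    "nat \<Rightarrow> (real \<times> real) set \<Rightarrow> real \<Rightarrow> ((real \<times> real) \<times> real \<Rightarrow> real) \<Rightarrow> bool" where
  "L2_Hk k \<Omega> T u \<longleftrightarrow>
     time_Hk k \<Omega> T u \<and>
     (\<integral>\<^sup>+ t. ennreal ((sobolev_norm k \<Omega> (\<lambda>z. u (z, t)))\<^sup>2) \<partial>lebesgue_on {0<..<T}) < \<infinity>"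

text \<open>\<open>g\<close> is a jointly measurable version on \<open>\<Omega> \<times> (0,\<infinity>)\<close> of \<open>\<partial>\<^sub>x\<^sup>i \<partial>\<^sub>y\<^sup>j u\<close>, the derivative
  being taken in \<open>\<Omega>\<close> at almost every time.\<close>

definition space_deriv ::
    "(real \<times> real) set \<Rightarrow> nat \<Rightarrow> nat \<Rightarrow> ((real \<times> real) \<times> real \<Rightarrow> real) \<Rightarrow>
       ((real \<times> real) \<times> real \<Rightarrow> real) \<Rightarrow> bool" where
  "space_deriv \<Omega> i j u g \<longleftrightarrow>
     g \<in> borel_measurable (lebesgue_on (\<Omega> \<times> {0<..})) \<and>
     (AE t in lebesgue_on {0<..}. weak_deriv \<Omega> (xy i j) (\<lambda>z. u (z, t)) (\<lambda>z. g (z, t)))"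

definition time_deriv ::
    "(real \<times> real) set \<Rightarrow> ((real \<times> real) \<times> real \<Rightarrow> real) \<Rightarrow> ((real \<times> real) \<times> real \<Rightarrow> real) \<Rightarrow> bool" where
  "time_deriv \<Omega> u g \<longleftrightarrow> weak_deriv (\<Omega> \<times> {0<..}) [(0, 1)] u g"

definition continuous_in_L2 :: "(real \<times> real) set \<Rightarrow> ((real \<times> real) \<times> real \<Rightarrow> real) \<Rightarrow> bool" where
  "continuous_in_L2 \<Omega> u \<longleftrightarrow>
     (\<forall>t\<ge>0. L2_on \<Omega> (\<lambda>z. u (z, t)) \<and>
        ((\<lambda>s. L2_norm \<Omega> (\<lambda>z. u (z, s) - u (z, t))) \<longlongrightarrow> 0) (at t within {0..}))"

section \<open>The initial-boundary value problem\<close>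

definition half_strip :: "real \<Rightarrow> (real \<times> real) set" where
  "half_strip B = {0<..} \<times> {0<..<B}"

definition zero_trace_left :: "real \<Rightarrow> (real \<times> real \<Rightarrow> real) \<Rightarrow> bool" where
  "zero_trace_left B f \<longleftrightarrow> has_trace (half_strip B) {0<..<B} (\<lambda>y. (0, y)) f (\<lambda>_. 0)"

definition zero_trace_bottom :: "real \<Rightarrow> (real \<times> real \<Rightarrow> real) \<Rightarrow> bool" where
  "zero_trace_bottom B f \<longleftrightarrow> has_trace (half_strip B) {0<..} (\<lambda>x. (x, 0)) f (\<lambda>_. 0)"

definition zero_trace_top :: "real \<Rightarrow> (real \<times> real \<Rightarrow> real) \<Rightarrow> bool" where
  "zero_trace_top B f \<longleftrightarrow> has_trace (half_strip B) {0<..} (\<lambda>x. (x, B)) f (\<lambda>_. 0)"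

text \<open>\<open>f \<rightarrow> 0\<close> as \<open>x \<rightarrow> \<infinity>\<close>: for almost every \<open>y\<close>, along the version of \<open>f\<close> that is continuous
  in \<open>x\<close>. Applied to \<open>f = \<partial>\<^sub>x\<^sup>i u\<^sub>0\<close>, which lies in \<open>H\<^sup>1\<close> and hence has such a version.\<close>

definition vanishes_at_infinity :: "real \<Rightarrow> (real \<times> real \<Rightarrow> real) \<Rightarrow> bool" where
  "vanishes_at_infinity B f \<longleftrightarrow>
     (\<exists>g. (AE z in lebesgue_on (half_strip B). g z = f z) \<and>
          (AE y in lebesgue_on {0<..<B}.
             continuous_on {0<..} (\<lambda>x. g (x, y)) \<and> ((\<lambda>x. g (x, y)) \<longlongrightarrow> 0) at_top))"

text \<open>Here \<open>v i j\<close> stands for \<open>\<partial>\<^sub>x\<^sup>i \<partial>\<^sub>y\<^sup>j u\<close> and \<open>ut\<close> for \<open>u\<^sub>t\<close>. From \<open>u, u\<^sub>t \<in> L\<^sup>\<infinity>(0,T; L\<^sup>2)\<close> it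
  follows that \<open>u\<close> agrees for almost every \<open>t\<close> with a function in \<open>C([0,\<infinity>); L\<^sup>2)\<close>; as usual \<open>u\<close> is
  this representative, which is what gives a meaning to \<open>u(\<cdot>,t)\<close> for every \<open>t\<close>, in particular to
  the initial condition.\<close>

definition regular_solution ::
    "real \<Rightarrow> real \<Rightarrow> (real \<times> real \<Rightarrow> real) \<Rightarrow> ((real \<times> real) \<times> real \<Rightarrow> real) \<Rightarrow> bool" where
  "regular_solution B \<gamma> u0 u \<longleftrightarrow>
     (let D = half_strip B in
      continuous_in_L2 D u \<and>
      (AE z in lebesgue_on D. u (z, 0) = u0 z) \<and>
      (\<exists>ut v.
         time_deriv D u ut \<and>
         (\<forall>i j. i + j \<le> 4 \<or> (i = 5 \<and> j = 0) \<longrightarrow> space_deriv D i j u (v i j)) \<and>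
         (\<forall>T>0.
            Linf_Hk 2 D T u \<and> L2_Hk 4 D T u \<and>
            L2_Hk 0 D T (v 5 0) \<and>
            Linf_Hk 0 D T ut \<and> L2_Hk 2 D T ut \<and>
            (AE q in lebesgue_on (D \<times> {0<..<T}).
               ut q + (v 4 0 q + 2 * v 2 2 q + v 0 4 q) + \<gamma> * (v 2 0 q + v 0 2 q)
                 + (v 3 0 q + v 1 2 q) + u q * v 1 0 q - v 5 0 q = 0)) \<and>
         (AE t in lebesgue_on {0<..}.
            zero_trace_left B (\<lambda>z. u (z, t)) \<and>
            zero_trace_bottom B (\<lambda>z. u (z, t)) \<and>
            zero_trace_top B (\<lambda>z. u (z, t)) \<and>
            zero_trace_bottom B (\<lambda>z. v 0 2 (z, t)) \<and>
            zero_trace_top B (\<lambda>z. v 0 2 (z, t)) \<and>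
            zero_trace_left B (\<lambda>z. v 1 0 (z, t)))))"

end

(* The energy method. At almost every time the equation is multiplied by u and integrated over D. Since u
   vanishes on the boundary and u_x for x = 0, the odd-order and the nonlinear terms contribute nothing or have
   a favourable sign, and
     (u_t, u) <= -|Lap u|^2 + gamma |grad u|^2.
   As |grad u|^2 <= |u| |Lap u| and |u_y|^2 >= c a^2 |u|^2 (Poincare in y), the right-hand side is at most
   -(a^2/4) |u|^2, and Gronwall's argument gives the decay.

   Low regularity: a function with vanishing trace is, together with its derivative in the direction across the
   boundary, an L^2 limit of test functions and their derivatives. Indeed, the smooth approximants from the
   definition of the trace can be cut off in a layer of thickness e, as the norm of the function over this layer
   is at most e times that of its normal derivative. Integration by parts is then the definition of the weak
   derivative. Three products need an extra idea:
     u_xyy u    (integral zero, since u_x also vanishes for y = 0 and y = B),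
     u_xxx u_xx (integral nonpositive, by backward difference quotients of u_x),
     u^2 u_x    (integral zero, by truncating u^2).
   In time, only the integrated form of u_t against fixed test functions is used; it yields
   E(t) - E(s) <= (t - s) (-chi E(s) + o(1)) for E = |u|^2 as t decreases to s. *)

theory Submission
  imports Defs
begin

section \<open>Smooth functions\<close>

text \<open>Formally every step is an integration by parts, but traces are given only through
  approximants and u_t is only a weak derivative on space-time. Three choices follow from this.
  Boundary conditions are encoded one direction at a time (\<open>dir_H10\<close>): integration by
  parts in x needs a condition on x = 0 only, in y only on y = 0 and y = B, so the corners never
  matter. The product u u_x is not estimated by embeddings: the equation itself puts it in L^2, as
  all its other terms lie there. And the energy is never differentiated; only its increments are
  estimated, from above. Constants: the slice estimate with 5/8 gives |u|^2 <= (5/32) B^2 |u_y|^2,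
  and pi < 16/5 turns this into |u_y|^2 >= (5/8) a^2 |u|^2, hence |Lap u| >= (5/8) a^2 |u|. With
  gamma < 1/8 and a^2 > 1 there remains |Lap u|^2 - gamma |grad u|^2 >= (5/16) a^2 |u|^2, a little
  more than the required a^2/4; chi is twice a^2/4, as |u|^2 changes at the rate 2 (u_t, u).\<close>

lemma iter_deriv_Nil [simp]: "iter_deriv [] f = f"
  and iter_deriv_Cons [simp]: "iter_deriv (b # bs) f = dir_deriv b (iter_deriv bs f)"
  and iter_deriv_append: "iter_deriv (bs @ cs) f = iter_deriv bs (iter_deriv cs f)"
  by (simp_all add: iter_deriv_def)

text \<open>\<open>smooth\<close> quantifies over all words of coordinate directions. Induction on
  the word reduces it to a class of functions closed under partial derivatives; most closure
  properties below amount to finding such a class.\<close>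

lemma smooth_coinduct:
  assumes "P f"
    and "\<And>f. P f \<Longrightarrow> continuous_on UNIV f"
    and "\<And>f b z. P f \<Longrightarrow> b \<in> Basis \<Longrightarrow> (\<lambda>s. f (z + s *\<^sub>R b)) field_differentiable (at 0)"
    and "\<And>f b. P f \<Longrightarrow> b \<in> Basis \<Longrightarrow> P (dir_deriv b f)"
  shows "smooth f"
proof -
  have "P (iter_deriv bs f)" if "set bs \<subseteq> Basis" for bs
    using that by (induction bs) (auto intro: assms)
  then show ?thesis
    unfolding smooth_def using assms(2,3) by blast
qed

lemma smooth_continuous: "smooth f \<Longrightarrow> continuous_on S f"
  unfolding smooth_def by (metis continuous_on_subset iter_deriv_Nil empty_subsetI list.set(1) top_greatest)

lemma smooth_iter_deriv: "smooth f \<Longrightarrow> set bs \<subseteq> Basis \<Longrightarrow> smooth (iter_deriv bs f)"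
  unfolding smooth_def iter_deriv_append[symmetric] by simp

lemma smooth_dir_deriv: "smooth f \<Longrightarrow> b \<in> Basis \<Longrightarrow> smooth (dir_deriv b f)"
  using smooth_iter_deriv[of f "[b]"] by simp

text \<open>The definition speaks of \<open>s = 0\<close> only, but for every base point; moving the
  base point along \<open>b\<close> reaches every \<open>s\<close>.\<close>

lemma smooth_DERIV:
  assumes "smooth f" "b \<in> Basis"
  shows "((\<lambda>s. f (z + s *\<^sub>R b)) has_field_derivative dir_deriv b f (z + s *\<^sub>R b)) (at s)"
proof -
  have "(\<lambda>h. f ((z + s *\<^sub>R b) + h *\<^sub>R b)) field_differentiable (at 0)"
    using assms unfolding smooth_def by (metis iter_deriv_Nil empty_subsetI list.set(1))
  then have "((\<lambda>h. f ((z + s *\<^sub>R b) + h *\<^sub>R b)) has_field_derivative dir_deriv b f (z + s *\<^sub>R b)) (at 0)"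
    unfolding dir_deriv_def by (simp add: field_differentiable_derivI)
  then have "((\<lambda>h. f (z + (h + s) *\<^sub>R b)) has_field_derivative dir_deriv b f (z + s *\<^sub>R b)) (at 0)"
    by (simp add: algebra_simps)
  then show ?thesis
    using DERIV_shift[of "\<lambda>s. f (z + s *\<^sub>R b)" _ 0 s] by simp
qed

lemma smooth_DERIV_0:
  assumes "smooth f" "b \<in> Basis"
  shows "((\<lambda>s. f (z + s *\<^sub>R b)) has_field_derivative dir_deriv b f z) (at 0)"
  using smooth_DERIV[OF assms, of z 0] by simp

lemma dir_derivI:
  "((\<lambda>s. f (z + s *\<^sub>R b)) has_field_derivative d) (at 0) \<Longrightarrow> dir_deriv b f z = d"
  by (simp add: DERIV_imp_deriv dir_deriv_def)

lemma dir_deriv_const [simp]: "dir_deriv b (\<lambda>_. c) = (\<lambda>_. 0)"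
  by (simp add: dir_deriv_def fun_eq_iff)

lemma smooth_const: "smooth (\<lambda>_. c)"
proof (rule smooth_coinduct[where P = "\<lambda>f. \<exists>c. f = (\<lambda>_. c)"])
  show "\<exists>c. dir_deriv b f = (\<lambda>_. c)" if "\<exists>c. f = (\<lambda>_. c)" for f and b :: 'a
    using that by auto
qed (auto simp: field_differentiable_const)

lemma dir_deriv_mult:
  assumes "smooth f" "smooth g" "b \<in> Basis"
  shows "dir_deriv b (\<lambda>z. f z * g z) = (\<lambda>z. dir_deriv b f z * g z + f z * dir_deriv b g z)"
proof (intro ext dir_derivI)
  fix z
  show "((\<lambda>s. f (z + s *\<^sub>R b) * g (z + s *\<^sub>R b)) has_real_derivative
      dir_deriv b f z * g z + f z * dir_deriv b g z) (at 0)"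
    using DERIV_mult[OF smooth_DERIV_0[OF assms(1,3), of z] smooth_DERIV_0[OF assms(2,3), of z]]
    by (simp add: algebra_simps)
qed

text \<open>The Leibniz rule turns one product into a sum of two, so products alone are not closed
  under partial derivatives; their finite sums are.\<close>

inductive sum_of_products :: "('a::euclidean_space \<Rightarrow> real) \<Rightarrow> bool" where
  "smooth f \<Longrightarrow> smooth g \<Longrightarrow> sum_of_products (\<lambda>z. f z * g z)"
| "sum_of_products f \<Longrightarrow> sum_of_products g \<Longrightarrow> sum_of_products (\<lambda>z. f z + g z)"

lemma sum_of_products_smooth:
  assumes "sum_of_products f"
  shows "smooth f"
  using assms
proof (rule smooth_coinduct)
  have main: "continuous_on UNIV f \<and>
    (\<forall>b\<in>Basis. (\<forall>z. ((\<lambda>s. f (z + s *\<^sub>R b)) has_real_derivative dir_deriv b f z) (at 0)) \<and>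
      sum_of_products (dir_deriv b f))" if "sum_of_products f" for f :: "'a \<Rightarrow> real"
    using that
  proof induction
    case (1 f g)
    show ?case
    proof (intro conjI ballI allI)
      show "continuous_on UNIV (\<lambda>z. f z * g z)"
        by (intro continuous_intros smooth_continuous 1)
    next
      fix b :: 'a and z assume b: "b \<in> Basis"
      show "((\<lambda>s. f (z + s *\<^sub>R b) * g (z + s *\<^sub>R b)) has_real_derivative
          dir_deriv b (\<lambda>z. f z * g z) z) (at 0)"
        using DERIV_mult[OF smooth_DERIV_0[OF 1(1) b, of z] smooth_DERIV_0[OF 1(2) b, of z]]
        by (simp add: dir_deriv_mult[OF 1 b] algebra_simps)
      show "sum_of_products (dir_deriv b (\<lambda>z. f z * g z))"
        unfolding dir_deriv_mult[OF 1 b] by (intro sum_of_products.intros 1 smooth_dir_deriv b)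
    qed
  next
    case (2 f g)
    have D: "((\<lambda>s. f (z + s *\<^sub>R b) + g (z + s *\<^sub>R b)) has_real_derivative
          dir_deriv b f z + dir_deriv b g z) (at 0)" if "b \<in> Basis" for b z
      using 2 that by (intro DERIV_add) auto
    have eq: "dir_deriv b (\<lambda>z. f z + g z) = (\<lambda>z. dir_deriv b f z + dir_deriv b g z)" if "b \<in> Basis" for b
      using D[OF that] by (intro ext dir_derivI)
    show ?case
      using 2 D by (auto simp: eq intro!: continuous_on_add sum_of_products.intros)
  qed
  show "continuous_on UNIV f" if "sum_of_products f" for f :: "'a \<Rightarrow> real"
    using main[OF that] by blast
  show "(\<lambda>s. f (z + s *\<^sub>R b)) field_differentiable at 0"
    if "sum_of_products f" "b \<in> Basis" for f and b z :: 'a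
    using main[OF that(1)] that(2) by (auto simp: field_differentiable_def)
  show "sum_of_products (dir_deriv b f)" if "sum_of_products f" "b \<in> Basis" for f and b :: 'a
    using main[OF that(1)] that(2) by blast
qed

lemma smooth_mult: "smooth f \<Longrightarrow> smooth g \<Longrightarrow> smooth (\<lambda>z. f z * g z)"
  by (rule sum_of_products_smooth[OF sum_of_products.intros(1)])

lemma smooth_add:
  assumes "smooth f" "smooth g"
  shows "smooth (\<lambda>z. f z + g z)"
proof -
  \<comment> \<open>The factors 1 bring a plain sum into the shape of the class.\<close>
  have "sum_of_products (\<lambda>z. f z * 1 + g z * 1)"
    by (intro sum_of_products.intros(2) sum_of_products.intros(1) assms smooth_const)
  from sum_of_products_smooth[OF this] show ?thesis by simp
qed

lemma smooth_cmult: "smooth f \<Longrightarrow> smooth (\<lambda>z. c * f z)"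
  by (intro smooth_mult smooth_const)

lemma smooth_diff: "smooth f \<Longrightarrow> smooth g \<Longrightarrow> smooth (\<lambda>z. f z - g z)"
  using smooth_add[of f "\<lambda>z. - 1 * g z"] smooth_cmult[of g "- 1"] by simp

lemma dir_deriv_diff:
  assumes "smooth f" "smooth g" "b \<in> Basis"
  shows "dir_deriv b (\<lambda>z. f z - g z) = (\<lambda>z. dir_deriv b f z - dir_deriv b g z)"
  using assms by (intro ext dir_derivI DERIV_diff smooth_DERIV_0)

lemma dir_deriv_translate: "dir_deriv b (\<lambda>z. f (z + w)) = (\<lambda>z. dir_deriv b f (z + w))"
  by (simp add: dir_deriv_def fun_eq_iff add_ac)

lemma smooth_translate:
  assumes "smooth f"
  shows "smooth (\<lambda>z. f (z + w))"
proof (rule smooth_coinduct[where P = "\<lambda>g. \<exists>f. smooth f \<and> g = (\<lambda>z. f (z + w))"])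
  fix g :: "'a \<Rightarrow> real" assume "\<exists>f. smooth f \<and> g = (\<lambda>z. f (z + w))"
  then obtain f where f: "smooth f" and g: "g = (\<lambda>z. f (z + w))" by blast
  show "continuous_on UNIV g"
    unfolding g by (intro continuous_intros continuous_on_compose2[OF smooth_continuous[OF f, of UNIV]]) auto
  show "(\<lambda>s. g (z + s *\<^sub>R b)) field_differentiable at 0" if "b \<in> Basis" for b z
    using smooth_DERIV_0[OF f that, of "z + w"] unfolding g field_differentiable_def
    by (auto simp: add_ac)
  show "\<exists>f. smooth f \<and> dir_deriv b g = (\<lambda>z. f (z + w))" if "b \<in> Basis" for b
    using smooth_dir_deriv[OF f that] by (auto simp: g dir_deriv_translate)
qed (use assms in blast)

lemma dir_deriv_fst:
  "dir_deriv (b, c) (\<lambda>z. f (fst z)) = (\<lambda>z. dir_deriv b f (fst z))"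
  by (simp add: dir_deriv_def fun_eq_iff)

lemma dir_deriv_snd:
  "dir_deriv (b, c) (\<lambda>z. f (snd z)) = (\<lambda>z. dir_deriv c f (snd z))"
  by (simp add: dir_deriv_def fun_eq_iff)

lemma dir_deriv_zero [simp]: "dir_deriv 0 f = (\<lambda>_. 0)"
  by (simp add: dir_deriv_def fun_eq_iff)

text \<open>A basis vector of the product space lies in one of the two factors. Along the second
  factor the derivative is zero, and the class of functions \<open>f (fst z)\<close> stays closed
  because it contains the zero function.\<close>

lemma smooth_fst:
  fixes f :: "'a::euclidean_space \<Rightarrow> real"
  assumes "smooth f"
  shows "smooth (\<lambda>z::'a \<times> 'b::euclidean_space. f (fst z))"
proof (rule smooth_coinduct[where P = "\<lambda>g. \<exists>f. smooth f \<and> g = (\<lambda>z. f (fst z))"])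
  fix g :: "'a \<times> 'b \<Rightarrow> real" assume "\<exists>f. smooth f \<and> g = (\<lambda>z. f (fst z))"
  then obtain f where f: "smooth f" and g: "g = (\<lambda>z. f (fst z))" by blast
  show "continuous_on UNIV g"
    unfolding g by (intro continuous_intros continuous_on_compose2[OF smooth_continuous[OF f, of UNIV]]) auto
  show "(\<lambda>s. g (z + s *\<^sub>R b)) field_differentiable at 0" if "b \<in> Basis" for b z
    using that smooth_DERIV_0[OF f, of "fst b" "fst z"] unfolding g field_differentiable_def
    by (auto simp: Basis_prod_def intro: exI[of _ 0])
  show "\<exists>f. smooth f \<and> dir_deriv b g = (\<lambda>z. f (fst z))" if "b \<in> Basis" for b
    using that smooth_dir_deriv[OF f, of "fst b"] smooth_const[of 0]
    by (auto simp: g dir_deriv_fst Basis_prod_def)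
qed (use assms in blast)

lemma smooth_snd:
  fixes f :: "'b::euclidean_space \<Rightarrow> real"
  assumes "smooth f"
  shows "smooth (\<lambda>z::'a::euclidean_space \<times> 'b. f (snd z))"
proof (rule smooth_coinduct[where P = "\<lambda>g. \<exists>f. smooth f \<and> g = (\<lambda>z. f (snd z))"])
  fix g :: "'a \<times> 'b \<Rightarrow> real" assume "\<exists>f. smooth f \<and> g = (\<lambda>z. f (snd z))"
  then obtain f where f: "smooth f" and g: "g = (\<lambda>z. f (snd z))" by blast
  show "continuous_on UNIV g"
    unfolding g by (intro continuous_intros continuous_on_compose2[OF smooth_continuous[OF f, of UNIV]]) auto
  show "(\<lambda>s. g (z + s *\<^sub>R b)) field_differentiable at 0" if "b \<in> Basis" for b z
    using that smooth_DERIV_0[OF f, of "snd b" "snd z"] unfolding g field_differentiable_def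
    by (auto simp: Basis_prod_def intro: exI[of _ 0])
  show "\<exists>f. smooth f \<and> dir_deriv b g = (\<lambda>z. f (snd z))" if "b \<in> Basis" for b
    using that smooth_dir_deriv[OF f, of "snd b"] smooth_const[of 0]
    by (auto simp: g dir_deriv_snd Basis_prod_def)
qed (use assms in blast)

lemma smooth_affine:
  fixes f :: "real \<Rightarrow> real"
  assumes "smooth f"
  shows "smooth (\<lambda>x. f (c * x + d))"
proof (rule smooth_coinduct[where P = "\<lambda>g. \<exists>f. smooth f \<and> g = (\<lambda>x. f (c * x + d))"])
  fix g :: "real \<Rightarrow> real" assume "\<exists>f. smooth f \<and> g = (\<lambda>x. f (c * x + d))"
  then obtain f where f: "smooth f" and g: "g = (\<lambda>x. f (c * x + d))" by blast
  have D: "((\<lambda>s. g (z + s *\<^sub>R b)) has_real_derivative c * dir_deriv 1 f (c * z + d)) (at 0)" if "b \<in> Basis" for b z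
  proof -
    have "((\<lambda>s. f (c * z + d + s)) has_real_derivative dir_deriv 1 f (c * z + d)) (at (c * 0))"
      using smooth_DERIV_0[OF f, of 1 "c * z + d"] by simp
    from DERIV_chain2[where f = "\<lambda>s. f (c * z + d + s)" and g = "\<lambda>s. c * s" and s = UNIV, OF this DERIV_cmult_Id]
    show ?thesis using that by (simp add: g algebra_simps)
  qed
  show "continuous_on UNIV g"
    unfolding g by (intro continuous_intros continuous_on_compose2[OF smooth_continuous[OF f, of UNIV]]) auto
  show "(\<lambda>s. g (z + s *\<^sub>R b)) field_differentiable at 0" if "b \<in> Basis" for b z
    using D[OF that] by (auto simp: field_differentiable_def)
  show "\<exists>f. smooth f \<and> dir_deriv b g = (\<lambda>x. f (c * x + d))" if "b \<in> Basis" for b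
    using dir_derivI[OF D[OF that]] smooth_cmult[OF smooth_dir_deriv[OF f, of 1], of c]
    by (intro exI[of _ "\<lambda>x. c * dir_deriv 1 f x"]) auto
qed (use assms in blast)

lemma dir_deriv_affine:
  fixes f :: "real \<Rightarrow> real"
  assumes "smooth f"
  shows "dir_deriv 1 (\<lambda>x. f (c * x + d)) = (\<lambda>x. c * dir_deriv 1 f (c * x + d))"
proof (intro ext dir_derivI)
  fix z
  have "((\<lambda>s. f (c * z + d + s)) has_real_derivative dir_deriv 1 f (c * z + d)) (at (c * 0))"
    using smooth_DERIV_0[OF assms, of 1 "c * z + d"] by simp
  from DERIV_chain2[where f = "\<lambda>s. f (c * z + d + s)" and g = "\<lambda>s. c * s" and s = UNIV, OF this DERIV_cmult_Id]
  show "((\<lambda>s. f (c * (z + s *\<^sub>R 1) + d)) has_real_derivative c * dir_deriv 1 f (c * z + d)) (at 0)"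
    by (simp add: algebra_simps)
qed

lemma smooth_real_DERIV:
  fixes f :: "real \<Rightarrow> real"
  assumes "smooth f"
  shows "(f has_real_derivative dir_deriv 1 f x) (at x)"
  using smooth_DERIV[OF assms, of 1 0 x] by simp

text \<open>Meant for antiderivatives: the class made up of \<open>f\<close> and of all smooth
  functions is closed, since the derivative of \<open>f\<close> is the smooth \<open>g\<close>. The
  step function is obtained in this way.\<close>

lemma smooth_realI:
  fixes f g :: "real \<Rightarrow> real"
  assumes D: "\<And>x. (f has_real_derivative g x) (at x)" and g: "smooth g"
  shows "smooth f" "dir_deriv 1 f = g"
proof -
  have D0: "((\<lambda>s. f (z + s *\<^sub>R 1)) has_real_derivative g z) (at 0)" for z
    using D[of z] DERIV_shift[of f "g z" 0 z] by (simp add: add_ac)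
  show eq: "dir_deriv 1 f = g"
    using D0 by (intro ext dir_derivI)
  show "smooth f"
  proof (rule smooth_coinduct[where P = "\<lambda>h. h = f \<or> smooth h"])
    fix h :: "real \<Rightarrow> real" assume h: "h = f \<or> smooth h"
    show "continuous_on UNIV h"
      using h D by (metis DERIV_continuous_on smooth_continuous has_field_derivative_at_within)
    show "(\<lambda>s. h (z + s *\<^sub>R b)) field_differentiable at 0" if "b \<in> Basis" for b z
      using h D0 smooth_DERIV_0[of h b z] that by (auto simp: field_differentiable_def)
    show "dir_deriv b h = f \<or> smooth (dir_deriv b h)" if "b \<in> Basis" for b
      using h that eq g smooth_dir_deriv[of h b] by auto
  qed simp
qed

text \<open>Two applications of the mean value theorem express the second difference of
  \<open>f\<close> over a square of side h as h^2 times a mixed derivative at a point of the square,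
  in either order of the directions. Continuity of both mixed derivatives then identifies them as h
  tends to 0. Everything runs along coordinate lines, the only ones that \<open>smooth\<close>
  speaks of.\<close>

lemma dir_deriv_commute:
  fixes f :: "'a::euclidean_space \<Rightarrow> real"
  assumes f: "smooth f" and b: "b \<in> Basis" and c: "c \<in> Basis"
  shows "dir_deriv b (dir_deriv c f) = dir_deriv c (dir_deriv b f)"
proof
  fix z
  have mvt: "\<exists>s t. 0 < s \<and> s < h \<and> 0 < t \<and> t < h \<and>
      f (z + h *\<^sub>R b + h *\<^sub>R c) - f (z + h *\<^sub>R b) - f (z + h *\<^sub>R c) + f z
        = h * h * dir_deriv c (dir_deriv b f) (z + s *\<^sub>R b + t *\<^sub>R c)"
    if h: "h > 0" and b: "b \<in> Basis" and c: "c \<in> Basis" for h :: real and b c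
  proof -
    have D1: "((\<lambda>s. f (z + h *\<^sub>R c + s *\<^sub>R b) - f (z + s *\<^sub>R b)) has_real_derivative
        dir_deriv b f (z + h *\<^sub>R c + s *\<^sub>R b) - dir_deriv b f (z + s *\<^sub>R b)) (at s)" for s
      by (intro DERIV_diff smooth_DERIV f b)
    obtain s where s: "0 < s" "s < h" and eq1:
      "f (z + h *\<^sub>R c + h *\<^sub>R b) - f (z + h *\<^sub>R b) - (f (z + h *\<^sub>R c + 0 *\<^sub>R b) - f (z + 0 *\<^sub>R b))
        = (h - 0) * (dir_deriv b f (z + h *\<^sub>R c + s *\<^sub>R b) - dir_deriv b f (z + s *\<^sub>R b))"
      using MVT2[OF h, where f = "\<lambda>s. f (z + h *\<^sub>R c + s *\<^sub>R b) - f (z + s *\<^sub>R b)", OF D1] by blast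
    have D2: "((\<lambda>t. dir_deriv b f ((z + s *\<^sub>R b) + t *\<^sub>R c)) has_real_derivative
        dir_deriv c (dir_deriv b f) ((z + s *\<^sub>R b) + t *\<^sub>R c)) (at t)" for t
      by (intro smooth_DERIV smooth_dir_deriv f b c)
    obtain t where t: "0 < t" "t < h" and eq2:
      "dir_deriv b f ((z + s *\<^sub>R b) + h *\<^sub>R c) - dir_deriv b f ((z + s *\<^sub>R b) + 0 *\<^sub>R c)
        = (h - 0) * dir_deriv c (dir_deriv b f) ((z + s *\<^sub>R b) + t *\<^sub>R c)"
      using MVT2[OF h, where f = "\<lambda>t. dir_deriv b f ((z + s *\<^sub>R b) + t *\<^sub>R c)", OF D2] by blast
    show ?thesis
      using s t eq1 eq2 by (intro exI[of _ s] exI[of _ t]) (simp add: algebra_simps)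
  qed
  have lim: "(\<lambda>n. g (z + s n *\<^sub>R b + t n *\<^sub>R c)) \<longlonglongrightarrow> g z"
    if "smooth g" and "\<And>n. 0 < s n \<and> s n < 1 / real (Suc n)" "\<And>n. 0 < t n \<and> t n < 1 / real (Suc n)"
    for g :: "'a \<Rightarrow> real" and s t b c
  proof -
    have s: "s \<longlonglongrightarrow> 0"
      by (rule tendsto_sandwich[OF _ _ tendsto_const LIMSEQ_inverse_real_of_nat])
         (use that(2) in \<open>auto simp: inverse_eq_divide less_imp_le intro!: always_eventually\<close>)
    have t: "t \<longlonglongrightarrow> 0"
      by (rule tendsto_sandwich[OF _ _ tendsto_const LIMSEQ_inverse_real_of_nat])
         (use that(3) in \<open>auto simp: inverse_eq_divide less_imp_le intro!: always_eventually\<close>)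
    have "(\<lambda>n. z + s n *\<^sub>R b + t n *\<^sub>R c) \<longlonglongrightarrow> z + 0 *\<^sub>R b + 0 *\<^sub>R c"
      by (intro tendsto_intros s t)
    then show ?thesis
      using continuous_on_tendsto_compose[OF smooth_continuous[OF that(1), of UNIV]] by fastforce
  qed
  let ?h = "\<lambda>n. 1 / real (Suc n)"
  have h: "?h n > 0" for n by simp
  obtain s t where st: "\<And>n. 0 < s n \<and> s n < ?h n" "\<And>n. 0 < t n \<and> t n < ?h n"
    and 1: "\<And>n. f (z + ?h n *\<^sub>R b + ?h n *\<^sub>R c) - f (z + ?h n *\<^sub>R b) - f (z + ?h n *\<^sub>R c) + f z
        = ?h n * ?h n * dir_deriv c (dir_deriv b f) (z + s n *\<^sub>R b + t n *\<^sub>R c)"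
    using mvt[OF h b c] by metis
  obtain s' t' where st': "\<And>n. 0 < s' n \<and> s' n < ?h n" "\<And>n. 0 < t' n \<and> t' n < ?h n"
    and 2: "\<And>n. f (z + ?h n *\<^sub>R c + ?h n *\<^sub>R b) - f (z + ?h n *\<^sub>R c) - f (z + ?h n *\<^sub>R b) + f z
        = ?h n * ?h n * dir_deriv b (dir_deriv c f) (z + s' n *\<^sub>R c + t' n *\<^sub>R b)"
    using mvt[OF h c b] by metis
  have "dir_deriv b (dir_deriv c f) (z + s' n *\<^sub>R c + t' n *\<^sub>R b)
      = dir_deriv c (dir_deriv b f) (z + s n *\<^sub>R b + t n *\<^sub>R c)" for n
  proof -
    have "?h n * ?h n * dir_deriv b (dir_deriv c f) (z + s' n *\<^sub>R c + t' n *\<^sub>R b)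
        = ?h n * ?h n * dir_deriv c (dir_deriv b f) (z + s n *\<^sub>R b + t n *\<^sub>R c)"
      unfolding 1[symmetric] 2[symmetric] by (simp add: algebra_simps)
    moreover have "?h n * ?h n \<noteq> 0" by simp
    ultimately show ?thesis by (metis mult_left_cancel)
  qed
  moreover note lim[OF smooth_dir_deriv[OF smooth_dir_deriv[OF f b] c] st, of b c]
    lim[OF smooth_dir_deriv[OF smooth_dir_deriv[OF f c] b] st', of c b]
  ultimately show "dir_deriv b (dir_deriv c f) z = dir_deriv c (dir_deriv b f) z"
    by (simp add: LIMSEQ_unique)
qed

section \<open>A smooth step function\<close>

text \<open>In t = 1/x these are the functions p(t) exp(-t), continued by zero to x <= 0. The
  polynomial factor makes the family closed under differentiation, because d/dx acts as -t^2
  d/dt.\<close>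

definition exp_germ :: "real poly \<Rightarrow> real \<Rightarrow> real" where
  "exp_germ p x = (if x > 0 then poly p (1 / x) * exp (- (1 / x)) else 0)"

lemma poly_exp_tendsto_0: "((\<lambda>t::real. poly p t * exp (- t)) \<longlongrightarrow> 0) at_top"
proof -
  have "((\<lambda>t. \<Sum>i\<le>degree p. coeff p i * (t ^ i / exp t)) \<longlongrightarrow> (\<Sum>i\<le>degree p. coeff p i * 0)) at_top"
    by (intro tendsto_intros tendsto_power_div_exp_0)
  moreover have "(\<lambda>t. \<Sum>i\<le>degree p. coeff p i * (t ^ i / exp t)) = (\<lambda>t. poly p t * exp (- t))"
    by (auto simp: poly_altdef exp_minus field_simps sum_distrib_right fun_eq_iff sum_divide_distrib)
  ultimately show ?thesis by simp
qed

text \<open>The derivative of p(t) exp(-t) in x is t^2 (p - p') exp(-t), whence the factor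
  \<open>[:0, 0, 1:]\<close>. At x = 0 the right difference quotient is t p(t) exp(-t), which tends
  to 0 as t grows; the left one is zero.\<close>

lemma exp_germ_DERIV:
  "(exp_germ p has_real_derivative exp_germ ([:0, 0, 1:] * (p - pderiv p)) x) (at x)"
proof -
  consider "x > 0" | "x < 0" | "x = 0" by linarith
  then show ?thesis
  proof cases
    case 1
    have "((\<lambda>x. poly p (1 / x) * exp (- (1 / x))) has_real_derivative
        (poly (pderiv p) (1 / x) * (- (1 / x\<^sup>2))) * exp (- (1 / x)) +
        exp (- (1 / x)) * (1 / x\<^sup>2) * poly p (1 / x)) (at x)"
      using 1 by (auto intro!: derivative_eq_intros DERIV_chain2[OF poly_DERIV] simp: power2_eq_square)
    moreover have "(poly (pderiv p) (1 / x) * (- (1 / x\<^sup>2))) * exp (- (1 / x)) +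
        exp (- (1 / x)) * (1 / x\<^sup>2) * poly p (1 / x) = exp_germ ([:0, 0, 1:] * (p - pderiv p)) x"
      using 1 by (simp add: exp_germ_def power2_eq_square field_simps)
    moreover have "\<forall>\<^sub>F y in nhds x. exp_germ p y = poly p (1 / y) * exp (- (1 / y))"
      using eventually_nhds_in_open[OF open_greaterThan[of 0], of x] 1
      by (auto simp: exp_germ_def elim!: eventually_mono)
    ultimately show ?thesis
      by (simp add: DERIV_cong_ev)
  next
    case 2
    have "\<forall>\<^sub>F y in nhds x. exp_germ p y = 0"
      using eventually_nhds_in_open[OF open_lessThan[of 0], of x] 2
      by (auto simp: exp_germ_def elim!: eventually_mono)
    then show ?thesis
      using 2 by (subst DERIV_cong_ev[where g = "\<lambda>_. 0", OF refl _ refl]) (auto simp: exp_germ_def)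
  next
    case 3
    have "((\<lambda>h. poly ([:0, 1:] * p) (inverse h) * exp (- inverse h)) \<longlongrightarrow> 0) (at_right 0)"
      by (rule filterlim_compose[OF poly_exp_tendsto_0 filterlim_inverse_at_top_right])
    moreover have "\<forall>\<^sub>F h in at_right (0::real).
        poly ([:0, 1:] * p) (inverse h) * exp (- inverse h) = exp_germ p h / h"
      using eventually_at_right_real[OF zero_less_one]
      by eventually_elim (simp add: exp_germ_def divide_inverse mult_ac)
    ultimately have r: "((\<lambda>h. exp_germ p h / h) \<longlongrightarrow> 0) (at_right 0)"
      by (rule Lim_transform_eventually)
    have "\<forall>\<^sub>F h in at_left (0::real). 0 = exp_germ p h / h"
      using eventually_at_left_real[OF less_minus_one_simps(1)]
      by (auto simp: exp_germ_def elim!: eventually_mono)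
    then have l: "((\<lambda>h. exp_germ p h / h) \<longlongrightarrow> 0) (at_left 0)"
      by (rule Lim_transform_eventually[OF tendsto_const])
    show ?thesis
      using l r 3 by (simp add: DERIV_def exp_germ_def filterlim_split_at)
  qed
qed

lemma smooth_exp_germ: "smooth (exp_germ p)"
proof (rule smooth_coinduct[where P = "\<lambda>f. \<exists>p. f = exp_germ p"])
  fix f :: "real \<Rightarrow> real" and b z :: real
  assume "\<exists>p. f = exp_germ p"
  then obtain p where f: "f = exp_germ p" by blast
  show "continuous_on UNIV f"
    unfolding f using exp_germ_DERIV by (rule DERIV_continuous_on[OF has_field_derivative_at_within])
  assume b: "b \<in> Basis"
  have "((\<lambda>s. f (z + s *\<^sub>R b)) has_real_derivative exp_germ ([:0, 0, 1:] * (p - pderiv p)) z) (at 0)" for z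
    using exp_germ_DERIV[of p z] DERIV_shift[of "exp_germ p" _ 0 z] b by (simp add: f add_ac)
  then show "(\<lambda>s. f (z + s *\<^sub>R b)) field_differentiable at 0" "\<exists>p. dir_deriv b f = exp_germ p"
    by (auto simp: field_differentiable_def intro!: exI[of _ "[:0, 0, 1:] * (p - pderiv p)"] dir_derivI)
qed blast

text \<open>\<open>b\<close> is the bump exp(-1/x) exp(-1/(1-x)) on (0,1), and \<open>S\<close> is
  its antiderivative divided by the total mass \<open>c\<close>. As \<open>b\<close> is at most 1,
  the slope of \<open>S\<close> is at most \<open>1 / c\<close>.\<close>

lemma smooth_step_ex:
  "\<exists>S::real \<Rightarrow> real. \<exists>C. smooth S \<and> (\<forall>x\<le>0. S x = 0) \<and> (\<forall>x\<ge>1. S x = 1) \<and> (\<forall>x. 0 \<le> S x \<and> S x \<le> 1) \<and>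
     (\<forall>x. 0 \<le> dir_deriv 1 S x \<and> dir_deriv 1 S x \<le> C) \<and>
     (\<forall>x. x \<le> 0 \<or> x \<ge> 1 \<longrightarrow> dir_deriv 1 S x = 0)"
proof -
  define b where "b = (\<lambda>x. exp_germ 1 x * exp_germ 1 (1 - x))"
  have "smooth (\<lambda>x. exp_germ 1 (-1 * x + 1))"
    by (intro smooth_affine smooth_exp_germ)
  then have b: "smooth b"
    unfolding b_def by (intro smooth_mult smooth_exp_germ) (simp add: add.commute)
  have b0: "b x = 0" if "x \<le> 0 \<or> x \<ge> 1" for x
    using that by (auto simp: b_def exp_germ_def)
  have bpos: "b x > 0" if "0 < x" "x < 1" for x
    using that by (auto simp: b_def exp_germ_def)
  have b1: "0 \<le> b x" "b x \<le> 1" for x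
    by (auto simp: b_def exp_germ_def mult_le_one)
  have "\<exists>F. \<forall>x::real. -\<infinity> < ereal x \<longrightarrow> ereal x < \<infinity> \<longrightarrow> (F has_vector_derivative b x) (at x)"
    using smooth_continuous[OF b, of UNIV]
    by (intro einterval_antiderivative) (auto simp: continuous_on_eq_continuous_at)
  then obtain F where F: "(F has_real_derivative b x) (at x)" for x
    by (auto simp: has_real_derivative_iff_has_vector_derivative)
  define c where "c = F 1 - F 0"
  \<comment> \<open>The mean value theorem yields \<open>c > 0\<close> without any integral.\<close>
  obtain z where "0 < z" "z < 1" "F 1 - F 0 = (1 - 0) * b z"
    using MVT2[of 0 1 F b] F by auto
  then have "c > 0"
    using bpos by (simp add: c_def)
  define S where "S x = (F x - F 0) / c" for x
  have S: "(S has_real_derivative b x / c) (at x)" for x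
    unfolding S_def using \<open>c > 0\<close> by (auto intro!: derivative_eq_intros F)
  have mono: "S x \<le> S y" if "x \<le> y" for x y
  proof (rule DERIV_nonneg_imp_nondecreasing[OF that])
    show "\<exists>y. (S has_real_derivative y) (at x) \<and> 0 \<le> y" for x
      using S b1 \<open>c > 0\<close> by (intro exI[of _ "b x / c"]) simp
  qed
  have S0: "S x = 0" if "x \<le> 0" for x
  proof (cases "x = 0")
    case False
    moreover have "S 0 = 0" by (simp add: S_def)
    moreover have "x < 0" using that False by simp
    then obtain z where "z < 0" "S 0 - S x = (0 - x) * (b z / c)"
      using MVT2[of x 0 S, OF _ S] by blast
    ultimately show ?thesis
      using b0[of z] by simp
  qed (simp add: S_def)
  have S1: "S x = 1" if "x \<ge> 1" for x
  proof (cases "x = 1")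
    case True
    then show ?thesis using \<open>c > 0\<close> by (simp add: S_def c_def)
  next
    case False
    have "S 1 = 1" using \<open>c > 0\<close> by (simp add: S_def c_def)
    moreover have "1 < x" using that False by simp
    then obtain z where "z > 1" "S x - S 1 = (x - 1) * (b z / c)"
      using MVT2[of 1 x S, OF _ S] by blast
    ultimately show ?thesis
      using b0[of z] by simp
  qed
  have sm: "smooth (\<lambda>x. b x / c)"
    using smooth_cmult[OF b, of "1 / c"] by simp
  have eq: "dir_deriv 1 S = (\<lambda>x. b x / c)" and S_smooth: "smooth S"
    using smooth_realI[OF S sm] by simp_all
  have "0 \<le> S x" "S x \<le> 1" for x
    using mono[of "min x 0" x] mono[of x "max x 1"] S0[of "min x 0"] S1[of "max x 1"] by auto
  then show ?thesis
    using S_smooth S0 S1 b0 b1 \<open>c > 0\<close>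
    by (intro exI[of _ S] exI[of _ "1 / c"]) (auto simp: eq divide_right_mono)
qed

definition step :: "real \<Rightarrow> real" where
  "step = (SOME S. \<exists>C. smooth S \<and> (\<forall>x\<le>0. S x = 0) \<and> (\<forall>x\<ge>1. S x = 1) \<and> (\<forall>x. 0 \<le> S x \<and> S x \<le> 1) \<and>
     (\<forall>x. 0 \<le> dir_deriv 1 S x \<and> dir_deriv 1 S x \<le> C) \<and>
     (\<forall>x. x \<le> 0 \<or> x \<ge> 1 \<longrightarrow> dir_deriv 1 S x = 0))"

definition step_bound :: real where
  "step_bound = (SOME C. \<forall>x. dir_deriv 1 step x \<le> C)"

lemma step_props:
  "\<exists>C. smooth step \<and> (\<forall>x\<le>0. step x = 0) \<and> (\<forall>x\<ge>1. step x = 1) \<and> (\<forall>x. 0 \<le> step x \<and> step x \<le> 1) \<and>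
     (\<forall>x. 0 \<le> dir_deriv 1 step x \<and> dir_deriv 1 step x \<le> C) \<and>
     (\<forall>x. x \<le> 0 \<or> x \<ge> 1 \<longrightarrow> dir_deriv 1 step x = 0)"
  unfolding step_def by (rule someI_ex[OF smooth_step_ex])

lemma smooth_step: "smooth step"
  and step_eq_0: "x \<le> 0 \<Longrightarrow> step x = 0"
  and step_eq_1: "x \<ge> 1 \<Longrightarrow> step x = 1"
  and step_nonneg: "0 \<le> step x"
  and step_le_1: "step x \<le> 1"
  and step_deriv_nonneg: "0 \<le> dir_deriv 1 step x"
  and step_deriv_eq_0: "x \<le> 0 \<or> x \<ge> 1 \<Longrightarrow> dir_deriv 1 step x = 0"
  using step_props by blast+

lemma step_deriv_le: "dir_deriv 1 step x \<le> step_bound"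
  using someI_ex[of "\<lambda>C. \<forall>x. dir_deriv 1 step x \<le> C"] step_props unfolding step_bound_def by blast

lemma step_bound_nonneg: "0 \<le> step_bound"
  using step_deriv_le[of 0] step_deriv_nonneg[of 0] by simp

section \<open>Test functions\<close>

text \<open>Any compact set outside which the function vanishes may take the place of the closed
  support, so no closure has to be computed later.\<close>

lemma test_functionI:
  assumes "smooth \<phi>" "compact K" "K \<subseteq> \<Omega>" "\<And>z. z \<notin> K \<Longrightarrow> \<phi> z = 0"
  shows "test_function \<Omega> \<phi>"
proof -
  have sub: "closure {z. \<phi> z \<noteq> 0} \<subseteq> K"
    using assms by (intro closure_minimal compact_imp_closed) auto
  then have "compact (closure {z. \<phi> z \<noteq> 0})"
    using assms(2) by (metis closed_closure compact_Int_closed inf.absorb2)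
  with sub assms show ?thesis
    unfolding test_function_def by blast
qed

lemma test_functionE:
  assumes "test_function \<Omega> \<phi>"
  obtains K where "smooth \<phi>" "compact K" "K \<subseteq> \<Omega>" "\<And>z. z \<notin> K \<Longrightarrow> \<phi> z = 0"
proof -
  have "\<phi> z = 0" if "z \<notin> closure {z. \<phi> z \<noteq> 0}" for z
    using that closure_subset[of "{z. \<phi> z \<noteq> 0}"] by blast
  then show thesis
    using that[of "closure {z. \<phi> z \<noteq> 0}"] assms unfolding test_function_def by blast
qed

lemma test_function_smooth: "test_function \<Omega> \<phi> \<Longrightarrow> smooth \<phi>"
  by (simp add: test_function_def)

lemma test_function_mono: "test_function \<Omega> \<phi> \<Longrightarrow> \<Omega> \<subseteq> \<Omega>' \<Longrightarrow> test_function \<Omega>' \<phi>"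
  by (auto simp: test_function_def)

lemma test_function_outside: "test_function \<Omega> \<phi> \<Longrightarrow> z \<notin> \<Omega> \<Longrightarrow> \<phi> z = 0"
  by (metis test_functionE subsetD)

text \<open>The complement of \<open>K\<close> is open, so \<open>\<phi>\<close> vanishes on a whole
  segment through \<open>z\<close>.\<close>

lemma dir_deriv_eq_0_outside:
  assumes K: "closed K" and 0: "\<And>z. z \<notin> K \<Longrightarrow> \<phi> z = 0" and z: "z \<notin> K"
  shows "dir_deriv b \<phi> z = 0"
proof (rule dir_derivI)
  have "continuous_on UNIV (\<lambda>s::real. z + s *\<^sub>R b)"
    by (intro continuous_intros)
  then have "open ((\<lambda>s::real. z + s *\<^sub>R b) -` (- K))"
    using K open_vimage[of "- K" "\<lambda>s::real. z + s *\<^sub>R b"] by (simp add: open_Compl)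
  then have "\<forall>\<^sub>F s in nhds 0. s \<in> (\<lambda>s::real. z + s *\<^sub>R b) -` (- K)"
    using z by (intro eventually_nhds_in_open) auto
  then have "\<forall>\<^sub>F s in nhds 0. \<phi> (z + s *\<^sub>R b) = 0"
    by eventually_elim (use 0 in auto)
  then show "((\<lambda>s. \<phi> (z + s *\<^sub>R b)) has_real_derivative 0) (at 0)"
    by (subst DERIV_cong_ev[where g = "\<lambda>_. 0", OF refl _ refl]) auto
qed

lemma test_function_dir_deriv:
  assumes "test_function \<Omega> \<phi>" "b \<in> Basis"
  shows "test_function \<Omega> (dir_deriv b \<phi>)"
proof -
  obtain K where K: "smooth \<phi>" "compact K" "K \<subseteq> \<Omega>" "\<And>z. z \<notin> K \<Longrightarrow> \<phi> z = 0"
    using test_functionE[OF assms(1)] by blast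
  show ?thesis
    using K assms(2)
    by (intro test_functionI[of _ K] smooth_dir_deriv dir_deriv_eq_0_outside[of K] compact_imp_closed) auto
qed

lemma test_function_iter_deriv:
  assumes "test_function \<Omega> \<phi>" "set bs \<subseteq> Basis"
  shows "test_function \<Omega> (iter_deriv bs \<phi>)"
  using assms(2) by (induction bs) (auto intro: test_function_dir_deriv assms(1))

lemma test_function_mult_smooth:
  assumes "test_function \<Omega> \<phi>" "smooth \<psi>"
  shows "test_function \<Omega> (\<lambda>z. \<psi> z * \<phi> z)"
proof -
  obtain K where K: "smooth \<phi>" "compact K" "K \<subseteq> \<Omega>" "\<And>z. z \<notin> K \<Longrightarrow> \<phi> z = 0"
    using test_functionE[OF assms(1)] by blast
  show ?thesis
    using K assms(2) by (intro test_functionI[of _ K] smooth_mult) auto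
qed

text \<open>The approximants in the definition of a trace have compact support in the plane, not in
  \<open>\<Omega>\<close>. A factor supported in a closed subset of \<open>\<Omega>\<close> repairs
  this, even if that subset is unbounded, as the meet of a compact and a closed set is
  compact.\<close>

lemma test_function_cutoff:
  assumes "test_function UNIV \<phi>" "smooth \<psi>" "closed C" "C \<subseteq> \<Omega>" "\<And>z. z \<notin> C \<Longrightarrow> \<psi> z = 0"
  shows "test_function \<Omega> (\<lambda>z. \<psi> z * \<phi> z)"
proof -
  obtain K where K: "smooth \<phi>" "compact K" "K \<subseteq> UNIV" "\<And>z. z \<notin> K \<Longrightarrow> \<phi> z = 0"
    using test_functionE[OF assms(1)] by blast
  show ?thesis
    using K assms by (intro test_functionI[of _ "K \<inter> C"] smooth_mult compact_Int_closed) auto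
qed

lemma test_function_diff:
  assumes "test_function \<Omega> \<phi>" "test_function \<Omega> \<psi>"
  shows "test_function \<Omega> (\<lambda>z. \<phi> z - \<psi> z)"
proof -
  obtain K where K: "smooth \<phi>" "compact K" "K \<subseteq> \<Omega>" "\<And>z. z \<notin> K \<Longrightarrow> \<phi> z = 0"
    using test_functionE[OF assms(1)] by blast
  obtain L where L: "smooth \<psi>" "compact L" "L \<subseteq> \<Omega>" "\<And>z. z \<notin> L \<Longrightarrow> \<psi> z = 0"
    using test_functionE[OF assms(2)] by blast
  show ?thesis
    using K L by (intro test_functionI[of _ "K \<union> L"] smooth_diff) auto
qed

lemma test_function_bounded:
  assumes "test_function \<Omega> \<phi>"
  obtains C where "\<And>z. \<bar>\<phi> z\<bar> \<le> C" "C \<ge> 0"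
proof -
  obtain K where K: "smooth \<phi>" "compact K" "K \<subseteq> \<Omega>" "\<And>z. z \<notin> K \<Longrightarrow> \<phi> z = 0"
    using test_functionE[OF assms(1)] by blast
  then have "compact (\<phi> ` K)"
    by (intro compact_continuous_image smooth_continuous)
  then obtain C where "\<And>z. z \<in> K \<Longrightarrow> \<bar>\<phi> z\<bar> \<le> C"
    using compact_imp_bounded[of "\<phi> ` K"] unfolding bounded_iff by auto
  then have "\<bar>\<phi> z\<bar> \<le> max C 0" for z
    using K(4)[of z] by (cases "z \<in> K") (auto simp: le_max_iff_disj)
  then show ?thesis using that[of "max C 0"] by simp
qed

lemma test_function_measurable:
  "test_function \<Omega> \<phi> \<Longrightarrow> \<phi> \<in> borel_measurable borel"
  by (intro borel_measurable_continuous_onI smooth_continuous test_function_smooth)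

lemma integrable_lborel_test_function:
  assumes "test_function \<Omega> \<phi>"
  shows "integrable lborel \<phi>"
proof -
  obtain K where K: "smooth \<phi>" "compact K" "K \<subseteq> \<Omega>" "\<And>z. z \<notin> K \<Longrightarrow> \<phi> z = 0"
    using test_functionE[OF assms(1)] by blast
  have "integrable lborel (\<lambda>z. indicator K z *\<^sub>R \<phi> z)"
    by (intro borel_integrable_compact K smooth_continuous)
  moreover have "(\<lambda>z. indicator K z *\<^sub>R \<phi> z) = \<phi>"
    using K(4) by (force simp: indicator_def)
  ultimately show ?thesis by simp
qed

section \<open>Vanishing of the integral of a derivative\<close>

lemma integral_lborel_translate:
  fixes f :: "'a::euclidean_space \<Rightarrow> real"
  assumes "f \<in> borel_measurable borel"
  shows "(LINT z|lborel. f (z + c)) = (LINT z|lborel. f z)"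
proof -
  have "(LINT z|lborel. f z) = (LINT z|distr lborel borel ((+) c). f z)"
    by (simp add: lborel_distr_plus)
  also have "\<dots> = (LINT z|lborel. f (c + z))"
    using assms by (intro integral_distr) auto
  finally show ?thesis by (simp add: add.commute)
qed

lemma directional_difference_bound:
  fixes F F' :: "'a::real_vector \<Rightarrow> real"
  assumes D: "\<And>z s. ((\<lambda>s. F (z + s *\<^sub>R b)) has_real_derivative F' (z + s *\<^sub>R b)) (at s)"
    and C: "\<And>z. \<bar>F' z\<bar> \<le> C" and h: "h > 0"
  shows "\<bar>F (z + h *\<^sub>R b) - F z\<bar> \<le> C * h"
proof -
  obtain s where "F (z + h *\<^sub>R b) - F (z + 0 *\<^sub>R b) = (h - 0) * F' (z + s *\<^sub>R b)"
    using MVT2[OF h, of "\<lambda>s. F (z + s *\<^sub>R b)" "\<lambda>s. F' (z + s *\<^sub>R b)"] D by blast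
  then show ?thesis
    using C[of "z + s *\<^sub>R b"] h by (simp add: abs_mult mult.commute mult_left_mono)
qed

text \<open>The integral of \<open>F'\<close> is the limit of the integrals of difference quotients,
  and these vanish by translation invariance. Only differentiability along \<open>b\<close> is asked
  of \<open>F\<close>, so that compositions of a test function with a C^1 function are covered as
  well.\<close>

lemma integral_directional_derivative_eq_0:
  fixes F F' :: "'a::euclidean_space \<Rightarrow> real"
  assumes cont: "continuous_on UNIV F" "continuous_on UNIV F'"
    and D: "\<And>z s. ((\<lambda>s. F (z + s *\<^sub>R b)) has_real_derivative F' (z + s *\<^sub>R b)) (at s)"
    and b: "b \<in> Basis"
    and K: "compact K" "\<And>z. z \<notin> K \<Longrightarrow> F z = 0" "\<And>z. z \<notin> K \<Longrightarrow> F' z = 0"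
  shows "(LINT z|lborel. F' z) = 0"
proof -
  obtain R where R: "\<And>z. z \<in> K \<Longrightarrow> norm z \<le> R"
    using compact_imp_bounded[OF K(1)] unfolding bounded_iff by blast
  have "compact (F' ` K)"
    using cont(2) K(1) by (intro compact_continuous_image) (auto intro: continuous_on_subset)
  then obtain C0 where "\<And>z. z \<in> K \<Longrightarrow> \<bar>F' z\<bar> \<le> C0"
    using compact_imp_bounded[of "F' ` K"] unfolding bounded_iff by auto
  then have C: "\<bar>F' z\<bar> \<le> max C0 0" for z
    using K(3)[of z] by (cases "z \<in> K") (auto simp: le_max_iff_disj)
  define C where "C = max C0 0"
  let ?h = "\<lambda>n. 1 / real (Suc n)"
  let ?q = "\<lambda>n z. (F (z + ?h n *\<^sub>R b) - F z) / ?h n"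
  have m: "F \<in> borel_measurable borel" "F' \<in> borel_measurable borel"
    using cont by (auto intro: borel_measurable_continuous_onI)
  have mt: "(\<lambda>z. F (z + c)) \<in> borel_measurable borel" for c
    using m by measurable
  have "integrable lborel (\<lambda>z. indicator K z *\<^sub>R F z)"
    using cont(1) by (intro borel_integrable_compact K) (auto intro: continuous_on_subset)
  moreover have "(\<lambda>z. indicator K z *\<^sub>R F z) = F"
    using K(2) by (force simp: indicator_def)
  ultimately have int: "integrable lborel F" by simp
  \<comment> \<open>The step size is at most 1, so all quotients vanish outside the ball of radius
    \<open>R + 1\<close>; inside, the mean value theorem bounds them by \<open>C\<close>.\<close>
  have "(\<lambda>n. LINT z|lborel. ?q n z) \<longlonglongrightarrow> (LINT z|lborel. F' z)"
  proof (rule integral_dominated_convergence[where w = "\<lambda>z. indicator (cball 0 (R + 1)) z *\<^sub>R C"])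
    show "integrable lborel (\<lambda>z::'a. indicator (cball 0 (R + 1)) z *\<^sub>R C)"
      by (intro borel_integrable_compact) auto
    show "AE z in lborel. (\<lambda>n. ?q n z) \<longlonglongrightarrow> F' z"
    proof (intro AE_I2)
      fix z
      have "((\<lambda>h. (F (z + h *\<^sub>R b) - F z) / h) \<longlongrightarrow> F' z) (at 0)"
        using D[of z 0] by (simp add: DERIV_def)
      moreover have "filterlim ?h (at 0) sequentially"
        using LIMSEQ_inverse_real_of_nat by (auto simp: filterlim_at inverse_eq_divide)
      ultimately show "(\<lambda>n. ?q n z) \<longlonglongrightarrow> F' z"
        by (rule filterlim_compose)
    qed
    show "AE z in lborel. norm (?q n z) \<le> indicator (cball 0 (R + 1)) z *\<^sub>R C" for n
    proof (intro AE_I2)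
      fix z
      show "norm (?q n z) \<le> indicator (cball 0 (R + 1)) z *\<^sub>R C"
      proof (cases "z \<in> cball 0 (R + 1)")
        case True
        have "\<bar>F (z + ?h n *\<^sub>R b) - F z\<bar> \<le> C * ?h n"
          by (rule directional_difference_bound[OF D]) (auto simp: C_def C)
        then have "\<bar>F (z + ?h n *\<^sub>R b) - F z\<bar> / ?h n \<le> C"
          by (subst pos_divide_le_eq) auto
        then show ?thesis using True by (simp add: abs_mult)
      next
        case False
        then have n: "norm z > R + 1" by (simp add: dist_norm)
        have "norm z \<le> norm (z + ?h n *\<^sub>R b) + norm (?h n *\<^sub>R b)"
          using norm_triangle_ineq4[of "z + ?h n *\<^sub>R b" "?h n *\<^sub>R b"] by simp
        moreover have "norm (?h n *\<^sub>R b) \<le> 1" using b by simp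
        ultimately have "norm (z + ?h n *\<^sub>R b) > R" using n by linarith
        then have "F (z + ?h n *\<^sub>R b) = 0" "F z = 0"
          using R[of "z + ?h n *\<^sub>R b"] R[of z] n by (auto intro!: K(2))
        then show ?thesis using False by simp
      qed
    qed
  qed (use m mt in measurable)
  moreover have "(LINT z|lborel. ?q n z) = 0" for n
  proof -
    have "integrable (distr lborel borel ((+) (?h n *\<^sub>R b))) F"
      using int by (simp add: lborel_distr_plus)
    then have "integrable lborel (\<lambda>z. F (z + ?h n *\<^sub>R b))"
      by (subst (asm) integrable_distr_eq) (use m in \<open>auto simp: add.commute\<close>)
    then show ?thesis
      using integral_lborel_translate[OF m(1)] int by simp
  qed
  ultimately show ?thesis by (simp add: LIMSEQ_const_iff)
qed

lemma integral_dir_deriv_eq_0: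
  fixes \<phi> :: "'a::euclidean_space \<Rightarrow> real"
  assumes \<phi>: "test_function UNIV \<phi>" and b: "b \<in> Basis"
  shows "(LINT z|lborel. dir_deriv b \<phi> z) = 0"
proof -
  obtain K where K: "smooth \<phi>" "compact K" "K \<subseteq> UNIV" "\<And>z. z \<notin> K \<Longrightarrow> \<phi> z = 0"
    using test_functionE[OF \<phi>] by blast
  show ?thesis
    using K b
    by (intro integral_directional_derivative_eq_0[of \<phi> _ b K] smooth_continuous smooth_dir_deriv smooth_DERIV
          dir_deriv_eq_0_outside[of K] compact_imp_closed) auto
qed

section \<open>The space \<open>L\<^sup>2\<close>\<close>

lemma L2_on_measurable: "L2_on \<Omega> f \<Longrightarrow> f \<in> borel_measurable (lebesgue_on \<Omega>)"
  and L2_on_integrable: "L2_on \<Omega> f \<Longrightarrow> integrable (lebesgue_on \<Omega>) (\<lambda>z. (f z)\<^sup>2)"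
  by (simp_all add: L2_on_def)

lemma L2_norm_nonneg: "0 \<le> L2_norm \<Omega> f"
  by (simp add: L2_norm_def)

lemma L2_norm_power2: "(L2_norm \<Omega> f)\<^sup>2 = (LINT z|lebesgue_on \<Omega>. (f z)\<^sup>2)"
  by (simp add: L2_norm_def)

lemma L2_on_mult_integrable:
  assumes "L2_on \<Omega> f" "L2_on \<Omega> g"
  shows "integrable (lebesgue_on \<Omega>) (\<lambda>z. f z * g z)"
proof (rule Bochner_Integration.integrable_bound[where f = "\<lambda>z. (f z)\<^sup>2 + (g z)\<^sup>2"])
  show "AE z in lebesgue_on \<Omega>. norm (f z * g z) \<le> norm ((f z)\<^sup>2 + (g z)\<^sup>2)"
  proof (intro AE_I2)
    fix z
    have "2 * (\<bar>f z\<bar> * \<bar>g z\<bar>) \<le> (f z)\<^sup>2 + (g z)\<^sup>2"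
      using sum_squares_bound[of "\<bar>f z\<bar>" "\<bar>g z\<bar>"] by simp
    moreover have "0 \<le> \<bar>f z\<bar> * \<bar>g z\<bar>" by simp
    ultimately have "\<bar>f z\<bar> * \<bar>g z\<bar> \<le> (f z)\<^sup>2 + (g z)\<^sup>2" by linarith
    then show "norm (f z * g z) \<le> norm ((f z)\<^sup>2 + (g z)\<^sup>2)"
      by (simp add: abs_mult)
  qed
qed (use assms in \<open>auto simp: L2_on_def\<close>)

lemma L2_on_cmult: "L2_on \<Omega> f \<Longrightarrow> L2_on \<Omega> (\<lambda>z. c * f z)"
  by (auto simp: L2_on_def power_mult_distrib)

lemma L2_on_add:
  assumes "L2_on \<Omega> f" "L2_on \<Omega> g"
  shows "L2_on \<Omega> (\<lambda>z. f z + g z)"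
  using assms L2_on_mult_integrable[OF assms]
  by (auto simp: L2_on_def power2_sum mult.assoc)

lemma L2_on_diff:
  assumes "L2_on \<Omega> f" "L2_on \<Omega> g"
  shows "L2_on \<Omega> (\<lambda>z. f z - g z)"
  using L2_on_add[OF assms(1) L2_on_cmult[OF assms(2), of "- 1"]] by simp

lemma L2_on_uminus: "L2_on \<Omega> f \<Longrightarrow> L2_on \<Omega> (\<lambda>z. - f z)"
  using L2_on_cmult[of \<Omega> f "- 1"] by simp

lemma L2_on_bounded_mult:
  assumes "L2_on \<Omega> f" "h \<in> borel_measurable (lebesgue_on \<Omega>)" "\<And>z. z \<in> \<Omega> \<Longrightarrow> \<bar>h z\<bar> \<le> K"
  shows "L2_on \<Omega> (\<lambda>z. h z * f z)"
proof -
  have "integrable (lebesgue_on \<Omega>) (\<lambda>z. (h z * f z)\<^sup>2)"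
  proof (rule Bochner_Integration.integrable_bound[where f = "\<lambda>z. K\<^sup>2 * (f z)\<^sup>2"])
    show "AE z in lebesgue_on \<Omega>. norm ((h z * f z)\<^sup>2) \<le> norm (K\<^sup>2 * (f z)\<^sup>2)"
    proof (intro AE_I2)
      fix z assume "z \<in> space (lebesgue_on \<Omega>)"
      then have "\<bar>h z\<bar>\<^sup>2 \<le> K\<^sup>2"
        using assms(3)[of z] by (intro power_mono) auto
      then show "norm ((h z * f z)\<^sup>2) \<le> norm (K\<^sup>2 * (f z)\<^sup>2)"
        by (simp add: power_mult_distrib mult_right_mono)
    qed
  qed (use assms in \<open>auto simp: L2_on_def\<close>)
  then show ?thesis
    using assms by (auto simp: L2_on_def)
qed

lemma L2_norm_bounded_mult:
  assumes "L2_on \<Omega> f" "h \<in> borel_measurable (lebesgue_on \<Omega>)" "\<And>z. z \<in> \<Omega> \<Longrightarrow> \<bar>h z\<bar> \<le> K" "0 \<le> K"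
  shows "L2_norm \<Omega> (\<lambda>z. h z * f z) \<le> K * L2_norm \<Omega> f"
proof -
  have "(LINT z|lebesgue_on \<Omega>. (h z * f z)\<^sup>2) \<le> (LINT z|lebesgue_on \<Omega>. K\<^sup>2 * (f z)\<^sup>2)"
  proof (rule integral_mono)
    fix z assume "z \<in> space (lebesgue_on \<Omega>)"
    then have "\<bar>h z\<bar>\<^sup>2 \<le> K\<^sup>2"
      using assms(3)[of z] by (intro power_mono) auto
    then show "(h z * f z)\<^sup>2 \<le> K\<^sup>2 * (f z)\<^sup>2"
      by (simp add: power_mult_distrib mult_right_mono)
  qed (use L2_on_bounded_mult[OF assms(1-3)] assms(1) in \<open>auto simp: L2_on_def\<close>)
  then have "sqrt (LINT z|lebesgue_on \<Omega>. (h z * f z)\<^sup>2) \<le> sqrt (K\<^sup>2 * (LINT z|lebesgue_on \<Omega>. (f z)\<^sup>2))"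
    by simp
  then show ?thesis
    using assms(4) by (simp add: L2_norm_def real_sqrt_mult)
qed

lemma L2_norm_cmult: "L2_norm \<Omega> (\<lambda>z. c * f z) = \<bar>c\<bar> * L2_norm \<Omega> f"
  by (simp add: L2_norm_def power_mult_distrib real_sqrt_mult)

lemma L2_norm_uminus: "L2_norm \<Omega> (\<lambda>z. - f z) = L2_norm \<Omega> f"
  by (simp add: L2_norm_def)

lemma L2_norm_minus_commute: "L2_norm \<Omega> (\<lambda>z. f z - g z) = L2_norm \<Omega> (\<lambda>z. g z - f z)"
  by (simp add: L2_norm_def power2_commute)

text \<open>The square of the norm of \<open>f - l g\<close> is a quadratic in \<open>l\<close>
  without negative values; the vertex \<open>l = B / C\<close> gives the claim, with a separate
  argument for \<open>C = 0\<close>.\<close>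

lemma L2_Cauchy_Schwarz:
  assumes f: "L2_on \<Omega> f" and g: "L2_on \<Omega> g"
  shows "\<bar>LINT z|lebesgue_on \<Omega>. f z * g z\<bar> \<le> L2_norm \<Omega> f * L2_norm \<Omega> g"
proof -
  define A where "A = (LINT z|lebesgue_on \<Omega>. (f z)\<^sup>2)"
  define B where "B = (LINT z|lebesgue_on \<Omega>. f z * g z)"
  define C where "C = (LINT z|lebesgue_on \<Omega>. (g z)\<^sup>2)"
  have nonneg: "0 \<le> A - 2 * l * B + l\<^sup>2 * C" for l
  proof -
    have "0 \<le> (LINT z|lebesgue_on \<Omega>. (f z - l * g z)\<^sup>2)" by simp
    also have "\<dots> = (LINT z|lebesgue_on \<Omega>. ((f z)\<^sup>2 - 2 * l * (f z * g z)) + l\<^sup>2 * (g z)\<^sup>2)"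
      by (simp add: power2_diff algebra_simps power_mult_distrib)
    also have "\<dots> = A - 2 * l * B + l\<^sup>2 * C"
      using f g L2_on_mult_integrable[OF f g] by (simp add: A_def B_def C_def L2_on_def)
    finally show ?thesis .
  qed
  have "B\<^sup>2 \<le> A * C"
  proof (cases "C = 0")
    case True
    have "B = 0"
    proof (rule ccontr)
      assume "B \<noteq> 0"
      \<comment> \<open>For this \<open>l\<close> the quadratic, now affine, takes the value
        -1.\<close>
      then show False using nonneg[of "(A + 1) / (2 * B)"] True by simp
    qed
    then show ?thesis using True by simp
  next
    case False
    then have "C > 0" unfolding C_def by (simp add: less_le)
    then show ?thesis
      using nonneg[of "B / C"] by (simp add: field_simps power2_eq_square)
  qed
  then have "\<bar>B\<bar> \<le> sqrt A * sqrt C"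
    by (metis real_sqrt_abs real_sqrt_le_mono real_sqrt_mult)
  then show ?thesis
    by (simp add: A_def B_def C_def L2_norm_def)
qed

lemma L2_norm_triangle:
  assumes f: "L2_on \<Omega> f" and g: "L2_on \<Omega> g"
  shows "L2_norm \<Omega> (\<lambda>z. f z + g z) \<le> L2_norm \<Omega> f + L2_norm \<Omega> g"
proof -
  have "(L2_norm \<Omega> (\<lambda>z. f z + g z))\<^sup>2 = (LINT z|lebesgue_on \<Omega>. ((f z)\<^sup>2 + (g z)\<^sup>2) + 2 * (f z * g z))"
    unfolding L2_norm_power2 by (simp add: power2_sum algebra_simps)
  also have "\<dots> = (L2_norm \<Omega> f)\<^sup>2 + (L2_norm \<Omega> g)\<^sup>2 + 2 * (LINT z|lebesgue_on \<Omega>. f z * g z)"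
    unfolding L2_norm_power2 using f g L2_on_mult_integrable[OF f g] by (simp add: L2_on_def)
  also have "\<dots> \<le> (L2_norm \<Omega> f + L2_norm \<Omega> g)\<^sup>2"
    using L2_Cauchy_Schwarz[OF f g] by (simp add: power2_sum)
  finally show ?thesis
    by (rule power2_le_imp_le) (simp add: L2_norm_nonneg add_nonneg_nonneg)
qed

lemma L2_norm_triangle_diff:
  assumes "L2_on \<Omega> f" "L2_on \<Omega> g"
  shows "L2_norm \<Omega> (\<lambda>z. f z - g z) \<le> L2_norm \<Omega> f + L2_norm \<Omega> g"
  using L2_norm_triangle[OF assms(1) L2_on_uminus[OF assms(2)]]
  by (simp only: L2_norm_uminus add_uminus_conv_diff)

lemma L2_norm_triangle3:
  assumes "L2_on \<Omega> f" "L2_on \<Omega> g" "L2_on \<Omega> h"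
  shows "L2_norm \<Omega> (\<lambda>z. f z - h z) \<le> L2_norm \<Omega> (\<lambda>z. f z - g z) + L2_norm \<Omega> (\<lambda>z. g z - h z)"
proof -
  have "(\<lambda>z. f z - h z) = (\<lambda>z. (f z - g z) + (g z - h z))" by simp
  then show ?thesis
    using L2_norm_triangle[OF L2_on_diff[OF assms(1,2)] L2_on_diff[OF assms(2,3)]] by presburger
qed

lemma L2_norm_diff_ge:
  assumes "L2_on \<Omega> f" "L2_on \<Omega> g"
  shows "\<bar>L2_norm \<Omega> f - L2_norm \<Omega> g\<bar> \<le> L2_norm \<Omega> (\<lambda>z. f z - g z)"
proof -
  have "L2_norm \<Omega> f \<le> L2_norm \<Omega> (\<lambda>z. f z - g z) + L2_norm \<Omega> g"
    using L2_norm_triangle[OF L2_on_diff[OF assms] assms(2)] by simp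
  moreover have "L2_norm \<Omega> g \<le> L2_norm \<Omega> (\<lambda>z. g z - f z) + L2_norm \<Omega> f"
    using L2_norm_triangle[OF L2_on_diff[OF assms(2,1)] assms(1)] by simp
  ultimately show ?thesis
    unfolding L2_norm_minus_commute[of \<Omega> g f] by linarith
qed

lemma L2_on_cong_AE:
  assumes "L2_on \<Omega> f" "g \<in> borel_measurable (lebesgue_on \<Omega>)" "AE z in lebesgue_on \<Omega>. f z = g z"
  shows "L2_on \<Omega> g"
proof -
  have "integrable (lebesgue_on \<Omega>) (\<lambda>z. (g z)\<^sup>2) \<longleftrightarrow> integrable (lebesgue_on \<Omega>) (\<lambda>z. (f z)\<^sup>2)"
  proof (rule integrable_cong_AE)
    show "AE z in lebesgue_on \<Omega>. (g z)\<^sup>2 = (f z)\<^sup>2"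
      using assms(3) by eventually_elim simp
  qed (use assms(1,2) in \<open>auto simp: L2_on_def\<close>)
  then show ?thesis using assms by (simp add: L2_on_def)
qed

lemma L2_norm_cong_AE:
  assumes "f \<in> borel_measurable (lebesgue_on \<Omega>)" "g \<in> borel_measurable (lebesgue_on \<Omega>)"
    "AE z in lebesgue_on \<Omega>. f z = g z"
  shows "L2_norm \<Omega> f = L2_norm \<Omega> g"
proof -
  have "AE z in lebesgue_on \<Omega>. (f z)\<^sup>2 = (g z)\<^sup>2"
    using assms(3) by eventually_elim simp
  then show ?thesis
    unfolding L2_norm_def using assms(1,2) by (intro arg_cong[where f = sqrt] integral_cong_AE) simp_all
qed

text \<open>Holds by completeness of Lebesgue measure. It is needed because \<open>wd\<close> is an
  arbitrary choice, known only up to a null set.\<close>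

lemma lebesgue_on_measurable_AE_cong:
  fixes f g :: "'a::euclidean_space \<Rightarrow> real"
  assumes f: "f \<in> borel_measurable (lebesgue_on \<Omega>)" and ae: "AE z in lebesgue_on \<Omega>. f z = g z"
    and \<Omega>: "\<Omega> \<in> sets lebesgue"
  shows "g \<in> borel_measurable (lebesgue_on \<Omega>)"
proof -
  have "(\<lambda>z. if z \<in> \<Omega> then g z else 0) \<in> borel_measurable lebesgue"
  proof (rule borel_measurable_AE)
    show "(\<lambda>z. if z \<in> \<Omega> then f z else 0) \<in> borel_measurable lebesgue"
      using f \<Omega> by (simp add: borel_measurable_if)
    show "AE z in lebesgue. (if z \<in> \<Omega> then f z else 0) = (if z \<in> \<Omega> then g z else 0)"
    proof -
      have "AE z in lebesgue. z \<in> \<Omega> \<longrightarrow> f z = g z"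
        using ae \<Omega> by (simp add: AE_restrict_space_iff)
      then show ?thesis by eventually_elim simp
    qed
  qed
  then show ?thesis using \<Omega> by (simp add: borel_measurable_if)
qed

lemma L2_tendsto_inner:
  assumes \<phi>: "\<And>n. L2_on \<Omega> (\<phi> n)" and f: "L2_on \<Omega> f" and g: "L2_on \<Omega> g"
    and lim: "(\<lambda>n. L2_norm \<Omega> (\<lambda>z. \<phi> n z - f z)) \<longlonglongrightarrow> 0"
  shows "(\<lambda>n. LINT z|lebesgue_on \<Omega>. \<phi> n z * g z) \<longlonglongrightarrow> (LINT z|lebesgue_on \<Omega>. f z * g z)"
proof (rule LIM_zero_cancel, rule Lim_null_comparison)
  show "(\<lambda>n. L2_norm \<Omega> (\<lambda>z. \<phi> n z - f z) * L2_norm \<Omega> g) \<longlonglongrightarrow> 0"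
    using tendsto_mult_left_zero[OF lim] .
  have "norm ((LINT z|lebesgue_on \<Omega>. \<phi> n z * g z) - (LINT z|lebesgue_on \<Omega>. f z * g z))
      \<le> L2_norm \<Omega> (\<lambda>z. \<phi> n z - f z) * L2_norm \<Omega> g" for n
    using L2_Cauchy_Schwarz[OF L2_on_diff[OF \<phi>[of n] f] g]
      L2_on_mult_integrable[OF \<phi>[of n] g] L2_on_mult_integrable[OF f g]
    by (simp add: left_diff_distrib)
  then show "\<forall>\<^sub>F n in sequentially. norm ((LINT z|lebesgue_on \<Omega>. \<phi> n z * g z) - (LINT z|lebesgue_on \<Omega>. f z * g z))
      \<le> L2_norm \<Omega> (\<lambda>z. \<phi> n z - f z) * L2_norm \<Omega> g"
    by (intro always_eventually allI)
qed

lemma L2_tendsto_norm: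
  assumes \<phi>: "\<And>n. L2_on \<Omega> (\<phi> n)" and f: "L2_on \<Omega> f"
    and lim: "(\<lambda>n. L2_norm \<Omega> (\<lambda>z. \<phi> n z - f z)) \<longlonglongrightarrow> 0"
  shows "(\<lambda>n. L2_norm \<Omega> (\<phi> n)) \<longlonglongrightarrow> L2_norm \<Omega> f"
proof (rule LIM_zero_cancel, rule Lim_null_comparison[OF _ lim])
  show "\<forall>\<^sub>F n in sequentially. norm (L2_norm \<Omega> (\<phi> n) - L2_norm \<Omega> f) \<le> L2_norm \<Omega> (\<lambda>z. \<phi> n z - f z)"
    using L2_norm_diff_ge[OF \<phi> f] by (intro always_eventually) simp
qed

text \<open>Dominated convergence with majorant \<open>K\<^sup>2 * (f z)\<^sup>2\<close>. It serves
  both for indicators of shrinking layers and for one minus a cutoff.\<close>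

lemma L2_mult_tendsto_0:
  assumes f: "L2_on \<Omega> f" and h: "\<And>n. h n \<in> borel_measurable (lebesgue_on \<Omega>)"
    and K: "\<And>n z. z \<in> \<Omega> \<Longrightarrow> \<bar>h n z\<bar> \<le> K" and lim: "\<And>z. z \<in> \<Omega> \<Longrightarrow> (\<lambda>n. h n z) \<longlonglongrightarrow> 0"
  shows "(\<lambda>n. L2_norm \<Omega> (\<lambda>z. h n z * f z)) \<longlonglongrightarrow> 0"
proof -
  have "(\<lambda>n. LINT z|lebesgue_on \<Omega>. (h n z * f z)\<^sup>2) \<longlonglongrightarrow> (LINT z|lebesgue_on \<Omega>. 0)"
  proof (rule integral_dominated_convergence[where w = "\<lambda>z. K\<^sup>2 * (f z)\<^sup>2"])
    show "AE z in lebesgue_on \<Omega>. (\<lambda>n. (h n z * f z)\<^sup>2) \<longlonglongrightarrow> 0"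
    proof (intro AE_I2)
      fix z assume "z \<in> space (lebesgue_on \<Omega>)"
      then have "(\<lambda>n. (h n z * f z)\<^sup>2) \<longlonglongrightarrow> (0 * f z)\<^sup>2"
        by (intro tendsto_intros lim) simp
      then show "(\<lambda>n. (h n z * f z)\<^sup>2) \<longlonglongrightarrow> 0" by simp
    qed
    show "AE z in lebesgue_on \<Omega>. norm ((h n z * f z)\<^sup>2) \<le> K\<^sup>2 * (f z)\<^sup>2" for n
    proof (intro AE_I2)
      fix z assume "z \<in> space (lebesgue_on \<Omega>)"
      then have "\<bar>h n z\<bar>\<^sup>2 \<le> K\<^sup>2"
        using K[of z n] by (intro power_mono) auto
      then show "norm ((h n z * f z)\<^sup>2) \<le> K\<^sup>2 * (f z)\<^sup>2"
        by (simp add: power_mult_distrib mult_right_mono)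
    qed
  qed (use f h in \<open>auto simp: L2_on_def\<close>)
  then have "(\<lambda>n. sqrt (LINT z|lebesgue_on \<Omega>. (h n z * f z)\<^sup>2)) \<longlonglongrightarrow> sqrt 0"
    by (intro tendsto_real_sqrt) simp
  then show ?thesis by (simp add: L2_norm_def)
qed

section \<open>Restriction to subsets\<close>

lemma lebesgue_on_restrict:
  assumes "S \<in> sets lebesgue" "\<Omega> \<in> sets lebesgue" "S \<subseteq> \<Omega>"
  shows "lebesgue_on S = restrict_space (lebesgue_on \<Omega>) S"
  using assms by (simp add: restrict_restrict_space Int_absorb1)

lemma L2_on_subset:
  assumes f: "L2_on \<Omega> f" and S: "S \<in> sets lebesgue" "\<Omega> \<in> sets lebesgue" "S \<subseteq> \<Omega>"
  shows "L2_on S f"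
proof -
  have S': "S \<inter> space (lebesgue_on \<Omega>) \<in> sets (lebesgue_on \<Omega>)"
    using S by (simp add: sets_restrict_space_iff Int_absorb2)
  have "integrable (lebesgue_on \<Omega>) (\<lambda>z. indicator S z *\<^sub>R (f z)\<^sup>2)"
    using f S' S by (intro integrable_mult_indicator) (auto simp: L2_on_def Int_absorb2)
  then have 1: "integrable (restrict_space (lebesgue_on \<Omega>) S) (\<lambda>z. (f z)\<^sup>2)"
    by (subst integrable_restrict_space[OF S'])
  have 2: "f \<in> borel_measurable (restrict_space (lebesgue_on \<Omega>) S)"
    by (rule measurable_restrict_space1[OF L2_on_measurable[OF f]])
  show ?thesis
    unfolding L2_on_def using 1 2 by (simp only: lebesgue_on_restrict[OF S] simp_thms)
qed

lemma L2_norm_restrict: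
  assumes S: "S \<in> sets lebesgue" "\<Omega> \<in> sets lebesgue" "S \<subseteq> \<Omega>"
  shows "L2_norm S f = L2_norm \<Omega> (\<lambda>z. indicator S z * f z)"
proof -
  have S': "S \<inter> space (lebesgue_on \<Omega>) \<in> sets (lebesgue_on \<Omega>)"
    using S by (simp add: sets_restrict_space_iff Int_absorb2)
  have "(\<lambda>z. indicat_real S z *\<^sub>R (f z)\<^sup>2) = (\<lambda>z. (indicat_real S z * f z)\<^sup>2)"
    by (auto simp: indicator_def fun_eq_iff)
  then show ?thesis
    unfolding L2_norm_def by (simp only: lebesgue_on_restrict[OF S] integral_restrict_space[OF S'])
qed

lemma L2_norm_subset:
  assumes f: "L2_on \<Omega> f" and S: "S \<in> sets lebesgue" "\<Omega> \<in> sets lebesgue" "S \<subseteq> \<Omega>"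
  shows "L2_norm S f \<le> L2_norm \<Omega> f"
proof -
  have "indicat_real S \<in> borel_measurable (lebesgue_on \<Omega>)"
    using S by (intro borel_measurable_indicator) (simp add: sets_restrict_space_iff)
  with f have "L2_norm \<Omega> (\<lambda>z. indicator S z * f z) \<le> 1 * L2_norm \<Omega> f"
    by (rule L2_norm_bounded_mult) (auto simp: indicator_def)
  then show ?thesis by (simp add: L2_norm_restrict[OF S])
qed

text \<open>The source of every little-o in the boundary layer estimates: the norm over a shrinking
  layer tends to zero, without any rate.\<close>

lemma L2_norm_shrinking:
  assumes f: "L2_on \<Omega> f" and S: "\<And>n. S n \<in> sets lebesgue" "\<Omega> \<in> sets lebesgue" "\<And>n. S n \<subseteq> \<Omega>"
    and lim: "\<And>z. z \<in> \<Omega> \<Longrightarrow> \<forall>\<^sub>F n in sequentially. z \<notin> S n"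
  shows "(\<lambda>n. L2_norm (S n) f) \<longlonglongrightarrow> 0"
proof -
  have "(\<lambda>n. L2_norm \<Omega> (\<lambda>z. indicator (S n) z * f z)) \<longlonglongrightarrow> 0"
  proof (rule L2_mult_tendsto_0[OF f, of _ 1])
    show "indicat_real (S n) \<in> borel_measurable (lebesgue_on \<Omega>)" for n
      using S by (intro borel_measurable_indicator) (simp add: sets_restrict_space_iff)
    show "(\<lambda>n. indicat_real (S n) z) \<longlonglongrightarrow> 0" if "z \<in> \<Omega>" for z
      by (rule tendsto_eventually) (use lim[OF that] in eventually_elim, simp)
  qed (auto simp: indicator_def)
  then show ?thesis by (simp add: L2_norm_restrict[OF S])
qed

lemma borel_imp_lebesgue_on_measurable:
  "f \<in> borel_measurable borel \<Longrightarrow> f \<in> borel_measurable (lebesgue_on \<Omega>)"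
  by (intro measurable_restrict_space1 measurable_completion) simp

lemma smooth_measurable_lebesgue_on: "smooth f \<Longrightarrow> f \<in> borel_measurable (lebesgue_on \<Omega>)"
  by (intro borel_imp_lebesgue_on_measurable borel_measurable_continuous_onI smooth_continuous)

lemma integrable_lebesgue_on_test_function:
  assumes "test_function U \<phi>" "\<Omega> \<in> sets lebesgue"
  shows "integrable (lebesgue_on \<Omega>) \<phi>"
proof -
  have "integrable lebesgue \<phi>"
    using integrable_lborel_test_function[OF assms(1)] test_function_measurable[OF assms(1)]
    by (simp add: integrable_completion)
  then show ?thesis
    using assms(2) integrable_mult_indicator[of \<Omega> lebesgue \<phi>] by (simp add: integrable_restrict_space)
qed

lemma L2_on_test_function:
  assumes "test_function U \<phi>" "\<Omega> \<in> sets lebesgue"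
  shows "L2_on \<Omega> \<phi>"
  using integrable_lebesgue_on_test_function[OF test_function_mult_smooth[OF assms(1) test_function_smooth[OF assms(1)]] assms(2)]
    smooth_measurable_lebesgue_on[OF test_function_smooth[OF assms(1)]]
  by (simp add: L2_on_def power2_eq_square)

lemma integral_lebesgue_on_eq_lborel:
  fixes f :: "'a::euclidean_space \<Rightarrow> real"
  assumes "f \<in> borel_measurable borel" "\<And>z. z \<notin> \<Omega> \<Longrightarrow> f z = 0" "\<Omega> \<in> sets lebesgue"
  shows "(LINT z|lebesgue_on \<Omega>. f z) = (LINT z|lborel. f z)"
proof -
  have "(LINT z|lebesgue_on \<Omega>. f z) = (LINT z|lebesgue. indicator \<Omega> z *\<^sub>R f z)"
    using assms(3) by (simp add: integral_restrict_space)
  also have "\<dots> = (LINT z|lebesgue. f z)"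
    using assms(2) by (intro Bochner_Integration.integral_cong) (auto simp: indicator_def)
  finally show ?thesis
    using assms(1) by (simp add: integral_completion)
qed

lemma L2_norm_test_function_lborel:
  assumes "test_function \<Omega> \<phi>" "\<Omega> \<in> sets lebesgue"
  shows "(L2_norm \<Omega> \<phi>)\<^sup>2 = (LINT z|lborel. (\<phi> z)\<^sup>2)"
  unfolding L2_norm_power2 using assms test_function_outside[OF assms(1)]
  by (intro integral_lebesgue_on_eq_lborel borel_measurable_power)
     (auto intro: test_function_measurable)

section \<open>Weak derivatives\<close>

lemma open_imp_lebesgue: "open S \<Longrightarrow> S \<in> sets lebesgue"
  by (intro sets_completionI_sets) simp

lemma iter_deriv_commute:
  assumes "smooth f" "b \<in> Basis" "set bs \<subseteq> Basis"
  shows "iter_deriv bs (dir_deriv b f) = dir_deriv b (iter_deriv bs f)"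
  using assms(3)
  by (induction bs) (use assms(1,2) in \<open>auto simp: dir_deriv_commute smooth_iter_deriv\<close>)

lemma weak_deriv_eq:
  "weak_deriv \<Omega> bs f g \<Longrightarrow> test_function \<Omega> \<phi> \<Longrightarrow>
    (LINT z|lebesgue_on \<Omega>. f z * iter_deriv bs \<phi> z) = (- 1) ^ length bs * (LINT z|lebesgue_on \<Omega>. g z * \<phi> z)"
  by (simp add: weak_deriv_def)

text \<open>Testing the derivative along \<open>bs\<close> with \<open>dir_deriv b \<phi>\<close>
  yields the derivative along the longer word, so the given versions \<open>g\<close> and
  \<open>h\<close> are themselves related by one weak derivative. For x the new letter stands in
  front of the word and \<open>eq\<close> rests on commuting derivatives; for y it stands at the
  end.\<close>

lemma weak_deriv_step:
  assumes f: "weak_deriv \<Omega> bs f g" "weak_deriv \<Omega> cs f h" and len: "length cs = Suc (length bs)"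
    and b: "b \<in> Basis" and eq: "\<And>\<phi>. smooth \<phi> \<Longrightarrow> iter_deriv cs \<phi> = iter_deriv bs (dir_deriv b \<phi>)"
  shows "weak_deriv \<Omega> [b] g h"
  unfolding weak_deriv_def
proof (intro conjI allI impI)
  fix \<phi> assume \<phi>: "test_function \<Omega> \<phi>"
  have "(- 1) ^ length bs * (LINT z|lebesgue_on \<Omega>. g z * dir_deriv b \<phi> z)
      = (- 1) ^ Suc (length bs) * (LINT z|lebesgue_on \<Omega>. h z * \<phi> z)"
    using weak_deriv_eq[OF f(1) test_function_dir_deriv[OF \<phi> b]] weak_deriv_eq[OF f(2) \<phi>] len
    by (simp add: eq test_function_smooth[OF \<phi>])
  then show "(LINT z|lebesgue_on \<Omega>. g z * iter_deriv [b] \<phi> z)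
      = (- 1) ^ length [b] * (LINT z|lebesgue_on \<Omega>. h z * \<phi> z)"
    by (cases "even (length bs)") auto
qed (use f in \<open>auto simp: weak_deriv_def\<close>)

lemma xy_Basis: "set (xy i j) \<subseteq> Basis"
  by (auto simp: xy_def Basis_prod_def)

lemma Basis_xy [simp]: "(1, 0) \<in> (Basis :: (real \<times> real) set)" "(0, 1) \<in> (Basis :: (real \<times> real) set)"
  by (auto simp: Basis_prod_def)

lemma weak_deriv_x:
  assumes "weak_deriv \<Omega> (xy i j) f g" "weak_deriv \<Omega> (xy (Suc i) j) f h"
  shows "weak_deriv \<Omega> [(1, 0)] g h"
  by (rule weak_deriv_step[OF assms])
     (use iter_deriv_commute[OF _ _ xy_Basis] in \<open>auto simp: xy_def\<close>)

lemma weak_deriv_y: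
  assumes "weak_deriv \<Omega> (xy i j) f g" "weak_deriv \<Omega> (xy i (Suc j)) f h"
  shows "weak_deriv \<Omega> [(0, 1)] g h"
proof (rule weak_deriv_step[OF assms])
  have "xy i (Suc j) = xy i j @ [(0, 1)]"
    by (simp add: xy_def replicate_append_same)
  then show "iter_deriv (xy i (Suc j)) \<phi> = iter_deriv (xy i j) (dir_deriv (0, 1) \<phi>)" for \<phi>
    by (simp add: iter_deriv_append)
qed (auto simp: xy_def)

lemma integrable_mult_test_function:
  assumes f: "locally_integrable \<Omega> f" and \<phi>: "test_function \<Omega> \<phi>" and \<Omega>: "\<Omega> \<in> sets lebesgue"
  shows "integrable (lebesgue_on \<Omega>) (\<lambda>z. f z * \<phi> z)"
proof -
  obtain K where K: "smooth \<phi>" "compact K" "K \<subseteq> \<Omega>" "\<And>z. z \<notin> K \<Longrightarrow> \<phi> z = 0"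
    using test_functionE[OF \<phi>] by blast
  obtain C where C: "\<And>z. \<bar>\<phi> z\<bar> \<le> C" "C \<ge> 0"
    using test_function_bounded[OF \<phi>] by blast
  have f': "integrable lebesgue (\<lambda>z. indicator K z *\<^sub>R f z)"
    using f K by (auto simp: locally_integrable_def set_integrable_def)
  have "integrable lebesgue (\<lambda>z. indicator K z *\<^sub>R (\<phi> z * f z))"
  proof (rule Bochner_Integration.integrable_bound[where f = "\<lambda>z. C * (indicator K z *\<^sub>R f z)"])
    show "integrable lebesgue (\<lambda>z. C * (indicator K z *\<^sub>R f z))"
      using f' by (intro integrable_mult_right)
    have "(\<lambda>z. \<phi> z * (indicator K z *\<^sub>R f z)) \<in> borel_measurable lebesgue"
      using smooth_measurable_lebesgue_on[OF K(1), of UNIV] f'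
      by (intro borel_measurable_times) (auto simp: lebesgue_on_UNIV_eq)
    then show "(\<lambda>z. indicator K z *\<^sub>R (\<phi> z * f z)) \<in> borel_measurable lebesgue"
      by (simp add: mult_ac)
    show "AE z in lebesgue. norm (indicator K z *\<^sub>R (\<phi> z * f z)) \<le> norm (C * (indicator K z *\<^sub>R f z))"
      using C by (intro AE_I2) (auto simp: indicator_def abs_mult mult_right_mono)
  qed
  moreover have "(\<lambda>z. indicator K z *\<^sub>R (\<phi> z * f z)) = (\<lambda>z. indicator \<Omega> z *\<^sub>R (f z * \<phi> z))"
    using K(3,4) by (auto simp: indicator_def fun_eq_iff)
  ultimately show ?thesis
    using \<Omega> by (simp add: integrable_restrict_space)
qed

lemma locally_integrable_diff:
  "locally_integrable \<Omega> f \<Longrightarrow> locally_integrable \<Omega> g \<Longrightarrow> locally_integrable \<Omega> (\<lambda>z. f z - g z)"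
  by (auto simp: locally_integrable_def intro: set_integral_diff)

lemma weak_deriv_diff:
  assumes "weak_deriv \<Omega> bs f g" "weak_deriv \<Omega> bs f' g'" "set bs \<subseteq> Basis" "\<Omega> \<in> sets lebesgue"
  shows "weak_deriv \<Omega> bs (\<lambda>z. f z - f' z) (\<lambda>z. g z - g' z)"
  unfolding weak_deriv_def
proof (intro conjI allI impI locally_integrable_diff)
  fix \<phi> assume \<phi>: "test_function \<Omega> \<phi>"
  have loc: "locally_integrable \<Omega> f" "locally_integrable \<Omega> f'" "locally_integrable \<Omega> g" "locally_integrable \<Omega> g'"
    using assms by (auto simp: weak_deriv_def)
  show "(LINT z|lebesgue_on \<Omega>. (f z - f' z) * iter_deriv bs \<phi> z)
      = (- 1) ^ length bs * (LINT z|lebesgue_on \<Omega>. (g z - g' z) * \<phi> z)"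
    using loc[THEN integrable_mult_test_function[OF _ \<phi> assms(4)]]
      loc[THEN integrable_mult_test_function[OF _ test_function_iter_deriv[OF \<phi> assms(3)] assms(4)]]
      weak_deriv_eq[OF assms(1) \<phi>] weak_deriv_eq[OF assms(2) \<phi>]
    by (simp add: left_diff_distrib right_diff_distrib)
qed (use assms in \<open>auto simp: weak_deriv_def\<close>)

lemma locally_integrable_continuous:
  assumes "continuous_on UNIV f"
  shows "locally_integrable \<Omega> f"
  unfolding locally_integrable_def
proof (intro allI impI)
  fix K assume K: "compact K \<and> K \<subseteq> \<Omega>"
  have "integrable lborel (\<lambda>z. indicator K z *\<^sub>R f z)"
    using K assms by (intro borel_integrable_compact) (auto intro: continuous_on_subset)
  moreover have "(\<lambda>z. indicator K z *\<^sub>R f z) \<in> borel_measurable lborel"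
    using K borel_measurable_continuous_onI[OF assms]
    by (intro borel_measurable_scaleR borel_measurable_indicator) (auto intro: borel_compact)
  ultimately show "f absolutely_integrable_on K"
    unfolding set_integrable_def by (simp add: integrable_completion)
qed

lemma weak_deriv_Nil:
  "locally_integrable \<Omega> f \<Longrightarrow> weak_deriv \<Omega> [] f f"
  by (simp add: weak_deriv_def)

text \<open>The product of \<open>\<phi>\<close> and the test function has compact support, so its
  derivative integrates to zero; the Leibniz rule does the rest.\<close>

lemma weak_deriv_smooth:
  assumes \<phi>: "smooth \<phi>" and b: "b \<in> Basis" and \<Omega>: "\<Omega> \<in> sets lebesgue"
  shows "weak_deriv \<Omega> [b] \<phi> (dir_deriv b \<phi>)"
  unfolding weak_deriv_def
proof (intro conjI allI impI)
  show "locally_integrable \<Omega> \<phi>" "locally_integrable \<Omega> (dir_deriv b \<phi>)"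
    using \<phi> b by (auto intro!: locally_integrable_continuous smooth_continuous smooth_dir_deriv)
  fix \<eta> assume \<eta>: "test_function \<Omega> \<eta>"
  have s\<eta>: "smooth \<eta>" by (rule test_function_smooth[OF \<eta>])
  have d\<eta>: "test_function \<Omega> (dir_deriv b \<eta>)" by (rule test_function_dir_deriv[OF \<eta> b])
  have t1: "test_function \<Omega> (\<lambda>z. \<phi> z * dir_deriv b \<eta> z)"
    by (rule test_function_mult_smooth[OF d\<eta> \<phi>])
  have t2: "test_function \<Omega> (\<lambda>z. dir_deriv b \<phi> z * \<eta> z)"
    by (rule test_function_mult_smooth[OF \<eta> smooth_dir_deriv[OF \<phi> b]])
  have "0 = (LINT z|lborel. dir_deriv b (\<lambda>z. \<phi> z * \<eta> z) z)"
    using test_function_mono[OF test_function_mult_smooth[OF \<eta> \<phi>], of UNIV]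
    by (intro integral_dir_deriv_eq_0[symmetric] b) simp
  also have "\<dots> = (LINT z|lborel. dir_deriv b \<phi> z * \<eta> z) + (LINT z|lborel. \<phi> z * dir_deriv b \<eta> z)"
    unfolding dir_deriv_mult[OF \<phi> s\<eta> b]
    by (intro Bochner_Integration.integral_add integrable_lborel_test_function[OF t1] integrable_lborel_test_function[OF t2])
  also have "(LINT z|lborel. dir_deriv b \<phi> z * \<eta> z) = (LINT z|lebesgue_on \<Omega>. dir_deriv b \<phi> z * \<eta> z)"
    using test_function_outside[OF t2]
    by (intro integral_lebesgue_on_eq_lborel[symmetric] test_function_measurable[OF t2] \<Omega>)
  also have "(LINT z|lborel. \<phi> z * dir_deriv b \<eta> z) = (LINT z|lebesgue_on \<Omega>. \<phi> z * dir_deriv b \<eta> z)"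
    using test_function_outside[OF t1]
    by (intro integral_lebesgue_on_eq_lborel[symmetric] test_function_measurable[OF t1] \<Omega>)
  finally show "(LINT z|lebesgue_on \<Omega>. \<phi> z * iter_deriv [b] \<eta> z)
      = (- 1) ^ length [b] * (LINT z|lebesgue_on \<Omega>. dir_deriv b \<phi> z * \<eta> z)"
    by simp
qed

text \<open>Open boxes generate the Borel sets and are stable under intersection. A vanishing
  integral passes to complements by \<open>total\<close> and to countable disjoint unions, hence
  holds over all Borel sets.\<close>

lemma integrable_zero_on_boxes_imp_AE_zero:
  fixes f :: "'a::euclidean_space \<Rightarrow> real"
  assumes f: "integrable lborel f" and box: "\<And>a b. (LINT z:box a b|lborel. f z) = 0" and total: "(LINT z|lborel. f z) = 0"
  shows "AE z in lborel. f z = 0"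
proof -
  have int: "set_integrable lborel S f" if "S \<in> sets lborel" for S
    unfolding set_integrable_def by (rule integrable_mult_indicator[OF that f])
  have "(LINT z:A|lborel. f z) = 0" if "A \<in> sets lborel" for A
  proof -
    define G :: "'a set set" where "G = range (\<lambda>(a, b). box a b)"
    have sets_eq: "sets lborel = sigma_sets UNIV G"
      unfolding sets_lborel by (subst borel_eq_box) (simp add: G_def)
    have "Int_stable G" "G \<subseteq> Pow UNIV" "A \<in> sigma_sets UNIV G"
      using that unfolding sets_eq by (auto simp: G_def Int_stable_def box_Int_box)
    then show ?thesis
    proof (induction rule: sigma_sets_induct_disjoint)
      case (basic A)
      then show ?case using box by (auto simp: G_def)
    next
      case empty
      then show ?case by (simp add: set_lebesgue_integral_def)
    next
      case (compl A)
      then have A: "A \<in> sets lborel" unfolding sets_eq by simp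
      have "(LINT z|lborel. f z) = (LINT z:A|lborel. f z) + (LINT z:UNIV - A|lborel. f z)"
      proof -
        have "(LINT z:A \<union> (UNIV - A)|lborel. f z) = (LINT z:A|lborel. f z) + (LINT z:UNIV - A|lborel. f z)"
          using A by (intro set_integral_Un int) auto
        then show ?thesis by (simp add: set_lebesgue_integral_def)
      qed
      then show ?case using compl total by simp
    next
      case (union A)
      then have A: "\<And>i. A i \<in> sets lborel" unfolding sets_eq by auto
      have "(LINT z:(\<Union>i. A i)|lborel. f z) = (\<Sum>i. (LINT z:(A i)|lborel. f z))"
        using A union(1)
        by (intro lebesgue_integral_countable_add int) (auto simp: disjoint_family_on_def)
      then show ?case using union by simp
    qed
  qed
  then show ?thesis
    by (intro sigma_finite_measure.density_zero[OF sigma_finite_lborel f])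
qed

lemma mem_box_plane:
  fixes z p q :: "real \<times> real"
  shows "z \<in> box p q \<longleftrightarrow> fst p < fst z \<and> fst z < fst q \<and> snd p < snd z \<and> snd z < snd q"
  by (cases z; cases p; cases q) (auto simp: mem_box Basis_prod_def)

text \<open>Products of step functions are test functions that converge boundedly to the indicator
  of an open box, so testing with them gives vanishing integrals over boxes, and no mollifier is
  required. As \<open>d\<close> is only locally integrable, this is done in one closed box inside
  \<open>\<Omega>\<close> at a time; countably many of these exhaust
  \<open>\<Omega>\<close>.\<close>

lemma fundamental_lemma_plane:
  fixes d :: "real \<times> real \<Rightarrow> real"
  assumes \<Omega>: "open \<Omega>" and d: "locally_integrable \<Omega> d"
    and 0: "\<And>\<phi>. test_function \<Omega> \<phi> \<Longrightarrow> (LINT z|lebesgue_on \<Omega>. d z * \<phi> z) = 0"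
  shows "AE z in lebesgue_on \<Omega>. d z = 0"
proof -
  have L: "\<Omega> \<in> sets lebesgue" by (rule open_imp_lebesgue[OF \<Omega>])
  \<comment> \<open>Each factor climbs from 0 to 1 within distance 1/n of one side, measured
    inwards: zero off the open box for every n, and eventually one at each interior point.\<close>
  define step_box where "step_box n p q z = step (real n * (fst z - fst p)) * step (real n * (fst q - fst z))
      * (step (real n * (snd z - snd p)) * step (real n * (snd q - snd z)))" for n p q and z :: "real \<times> real"
  have sm: "smooth (step_box n p q)" for n p q
  proof -
    have aff: "smooth (\<lambda>x. step (real n * (x - c)))" "smooth (\<lambda>x. step (real n * (c - x)))" for c
      using smooth_affine[OF smooth_step, of "real n" "- real n * c"]
        smooth_affine[OF smooth_step, of "- real n" "real n * c"]
      by (simp_all add: right_diff_distrib)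
    show ?thesis
      unfolding step_box_def[abs_def]
      by (intro smooth_mult smooth_fst smooth_snd aff smooth_fst[OF aff(1)] smooth_fst[OF aff(2)]
          smooth_snd[OF aff(1)] smooth_snd[OF aff(2)])
  qed
  have sb0: "step_box n p q z = 0" if "z \<notin> box p q" for n p q z
  proof -
    have "fst z \<le> fst p \<or> fst q \<le> fst z \<or> snd z \<le> snd p \<or> snd q \<le> snd z"
      using that by (auto simp: mem_box_plane not_less)
    then show ?thesis
      by (auto simp: step_box_def step_eq_0 mult_nonneg_nonpos)
  qed
  have sb_bound: "\<bar>step_box n p q z\<bar> \<le> 1" for n p q z
    unfolding step_box_def abs_mult
    by (intro mult_le_one mult_nonneg_nonneg) (auto simp: step_nonneg step_le_1)
  have sb_lim: "(\<lambda>n. step_box n p q z) \<longlonglongrightarrow> indicator (box p q) z" for p q z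
  proof (cases "z \<in> box p q")
    case False
    then show ?thesis by (simp add: sb0)
  next
    case True
    have ev: "\<forall>\<^sub>F n in sequentially. step (real n * r) = 1" if "r > 0" for r
      using eventually_ge_at_top[of "nat \<lceil>1 / r\<rceil>"]
    proof eventually_elim
      case (elim n)
      then have "real n \<ge> 1 / r" by linarith
      then show ?case using that by (intro step_eq_1) (simp add: field_simps)
    qed
    have "fst p < fst z" "fst z < fst q" "snd p < snd z" "snd z < snd q"
      using True by (auto simp: mem_box_plane)
    then have "\<forall>\<^sub>F n in sequentially. step_box n p q z = 1"
      using ev[of "fst z - fst p"] ev[of "fst q - fst z"] ev[of "snd z - snd p"] ev[of "snd q - snd z"]
      by (simp add: step_box_def) (elim eventually_rev_mp, simp)
    then show ?thesis
      using True by (simp add: tendsto_eventually)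
  qed
  have cell: "AE z in lebesgue. z \<in> cbox p q \<longrightarrow> d z = 0" if sub: "cbox p q \<subseteq> \<Omega>" for p q
  proof -
    define f where "f z = indicator (box p q) z * d z" for z
    have dK: "d absolutely_integrable_on cbox p q"
      using d sub by (auto simp: locally_integrable_def)
    have fint: "integrable lebesgue f"
    proof -
      have "integrable lebesgue (\<lambda>z. indicator (box p q) z *\<^sub>R (indicator (cbox p q) z *\<^sub>R d z))"
        by (rule integrable_mult_indicator[OF _ dK[unfolded set_integrable_def]]) simp
      moreover have "(\<lambda>z. indicator (box p q) z *\<^sub>R (indicator (cbox p q) z *\<^sub>R d z)) = f"
        using box_subset_cbox[of p q] by (auto simp: f_def indicator_def fun_eq_iff)
      ultimately show ?thesis by simp
    qed
    have fbox: "(LINT z|lebesgue. indicator (box r s) z * f z) = 0" for r s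
    proof -
      \<comment> \<open>Two boxes meet in a box, so integrating \<open>f\<close> over any box means
        integrating \<open>d\<close> over a box inside \<open>cbox p q\<close>, where test functions
        in \<open>\<Omega>\<close> are at hand.\<close>
      obtain p' q' where pq': "box p q \<inter> box r s = box p' q'"
        using box_Int_box[of p q r s] by blast
      have sub': "box p' q' \<subseteq> cbox p q"
        using pq' box_subset_cbox[of p q] by blast
      have test: "test_function \<Omega> (step_box n p' q')" for n
      proof (rule test_functionI[OF sm, of "cbox p q"])
        show "step_box n p' q' z = 0" if "z \<notin> cbox p q" for z
          using that sub' by (intro sb0) blast
      qed (use sub in auto)
      have "(\<lambda>n. LINT z|lebesgue. step_box n p' q' z * f z) \<longlonglongrightarrow> (LINT z|lebesgue. indicator (box p' q') z * f z)"
      proof (rule integral_dominated_convergence[where w = "\<lambda>z. \<bar>f z\<bar>"])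
        show "AE z in lebesgue. (\<lambda>n. step_box n p' q' z * f z) \<longlonglongrightarrow> indicator (box p' q') z * f z"
          by (intro AE_I2 tendsto_mult_right sb_lim)
        show "AE z in lebesgue. norm (step_box n p' q' z * f z) \<le> \<bar>f z\<bar>" for n
          using sb_bound[of n p' q'] by (intro AE_I2) (simp add: abs_mult mult_left_le_one_le)
        show "(\<lambda>z. step_box n p' q' z * f z) \<in> borel_measurable lebesgue" for n
          using smooth_measurable_lebesgue_on[OF sm, where \<Omega> = UNIV] fint
          by (intro borel_measurable_times) (auto simp: lebesgue_on_UNIV_eq)
        show "(\<lambda>z. indicator (box p' q') z * f z) \<in> borel_measurable lebesgue"
          using fint by (intro borel_measurable_times borel_measurable_indicator) auto
      qed (use fint in auto)
      moreover have "(LINT z|lebesgue. step_box n p' q' z * f z) = 0" for n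
      proof -
        have "(LINT z|lebesgue. step_box n p' q' z * f z)
            = (LINT z|lebesgue. indicator \<Omega> z *\<^sub>R (d z * step_box n p' q' z))"
        proof (rule Bochner_Integration.integral_cong[OF refl])
          fix z
          have "step_box n p' q' z = 0" if "z \<notin> box p q"
            using that pq' by (intro sb0) blast
          moreover have "z \<in> \<Omega>" if "z \<in> box p q"
            using that sub box_subset_cbox[of p q] by blast
          ultimately show "step_box n p' q' z * f z = indicator \<Omega> z *\<^sub>R (d z * step_box n p' q' z)"
            by (cases "z \<in> box p q") (auto simp: f_def)
        qed
        also have "\<dots> = (LINT z|lebesgue_on \<Omega>. d z * step_box n p' q' z)"
          using L by (simp add: integral_restrict_space)
        finally show ?thesis using 0[OF test] by simp
      qed
      ultimately have "(LINT z|lebesgue. indicator (box p' q') z * f z) = 0"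
        by (simp add: LIMSEQ_const_iff)
      moreover have "indicator (box p' q') z * f z = indicator (box r s) z * f z" for z
        unfolding pq'[symmetric] by (auto simp: f_def indicator_def)
      ultimately show ?thesis by simp
    qed
    \<comment> \<open>The argument with generators is about Borel sets, so \<open>f\<close> is
      replaced by a Borel version.\<close>
    obtain f' where f': "f' \<in> borel_measurable lborel" "AE z in lborel. f z = f' z"
      using completion_ex_borel_measurable_real[of f lborel] fint by auto
    have ae: "AE z in lebesgue. f z = f' z"
      using f'(2) by (rule AE_completion)
    have f'm: "f' \<in> borel_measurable lebesgue"
      by (rule measurable_completion[OF f'(1)])
    have f'int: "integrable lborel f'"
      using fint integrable_cong_AE[OF _ f'm ae] f'(1) fint by (simp add: integrable_completion)
    have f'box: "(LINT z:box r s|lborel. f' z) = 0" for r s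
    proof -
      have "(LINT z:box r s|lborel. f' z) = (LINT z|lebesgue. indicator (box r s) z *\<^sub>R f' z)"
        unfolding set_lebesgue_integral_def using f'(1)
        by (intro integral_completion[symmetric] borel_measurable_scaleR borel_measurable_indicator) auto
      also have "\<dots> = (LINT z|lebesgue. indicator (box r s) z * f z)"
      proof (rule integral_cong_AE)
        show "AE z in lebesgue. indicator (box r s) z *\<^sub>R f' z = indicator (box r s) z * f z"
          using ae by eventually_elim simp
      qed (use fint f'm in \<open>auto intro!: borel_measurable_times borel_measurable_scaleR borel_measurable_indicator\<close>)
      finally show ?thesis using fbox by simp
    qed
    have "(LINT z|lborel. f' z) = (LINT z|lebesgue. f' z)"
      using f'(1) by (simp add: integral_completion)
    also have "\<dots> = (LINT z|lebesgue. indicator (box p q) z * f z)"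
    proof (rule integral_cong_AE)
      show "AE z in lebesgue. f' z = indicator (box p q) z * f z"
        using ae by eventually_elim (auto simp: f_def indicator_def)
    qed (use fint f'm in \<open>auto intro!: borel_measurable_times borel_measurable_indicator\<close>)
    finally have "(LINT z|lborel. f' z) = 0"
      using fbox by simp
    then have "AE z in lborel. f' z = 0"
      by (intro integrable_zero_on_boxes_imp_AE_zero f'int f'box)
    then have "AE z in lebesgue. f' z = 0"
      by (rule AE_completion)
    \<comment> \<open>The step functions reach only the open box; its boundary is a null
      set.\<close>
    moreover have "AE z in lebesgue. z \<notin> cbox p q - box p q"
      using negligible_frontier_interval[of p q] by (intro AE_not_in) (simp add: negligible_iff_null_sets)
    ultimately show ?thesis
      using ae by eventually_elim (auto simp: f_def)
  qed
  obtain \<D> where \<D>: "countable \<D>" "\<D> \<subseteq> Pow \<Omega>" "\<And>X. X \<in> \<D> \<Longrightarrow> \<exists>a b. X = cbox a b" "\<Union>\<D> = \<Omega>"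
    using open_countable_Union_open_cbox[OF \<Omega>] by blast
  have "AE z in lebesgue. \<forall>X\<in>\<D>. z \<in> X \<longrightarrow> d z = 0"
  proof (subst AE_ball_countable[OF \<D>(1)], intro ballI)
    fix X assume X: "X \<in> \<D>"
    then obtain p q where "X = cbox p q" using \<D>(3) by blast
    then show "AE z in lebesgue. z \<in> X \<longrightarrow> d z = 0"
      using cell[of p q] X \<D>(2) by auto
  qed
  then have "AE z in lebesgue. z \<in> \<Omega> \<longrightarrow> d z = 0"
    by eventually_elim (use \<D>(4) in blast)
  then show ?thesis
    using L by (simp add: AE_restrict_space_iff)
qed

lemma weak_deriv_unique:
  fixes f g h :: "real \<times> real \<Rightarrow> real"
  assumes "open \<Omega>" "weak_deriv \<Omega> bs f g" "weak_deriv \<Omega> bs f h"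
  shows "AE z in lebesgue_on \<Omega>. g z = h z"
proof -
  have L: "\<Omega> \<in> sets lebesgue" by (rule open_imp_lebesgue[OF assms(1)])
  have loc: "locally_integrable \<Omega> g" "locally_integrable \<Omega> h"
    using assms by (auto simp: weak_deriv_def)
  have "AE z in lebesgue_on \<Omega>. g z - h z = 0"
  proof (rule fundamental_lemma_plane[OF assms(1) locally_integrable_diff[OF loc]])
    fix \<phi> assume \<phi>: "test_function \<Omega> \<phi>"
    have "(- 1) ^ length bs * (LINT z|lebesgue_on \<Omega>. g z * \<phi> z) = (- 1) ^ length bs * (LINT z|lebesgue_on \<Omega>. h z * \<phi> z)"
      using weak_deriv_eq[OF assms(2) \<phi>] weak_deriv_eq[OF assms(3) \<phi>] by simp
    then have "(LINT z|lebesgue_on \<Omega>. g z * \<phi> z) = (LINT z|lebesgue_on \<Omega>. h z * \<phi> z)"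
      by simp
    then show "(LINT z|lebesgue_on \<Omega>. (g z - h z) * \<phi> z) = 0"
      using loc[THEN integrable_mult_test_function[OF _ \<phi> L]] by (simp add: left_diff_distrib)
  qed
  then show ?thesis by simp
qed

lemma wd_eq:
  assumes "open \<Omega>" "weak_deriv \<Omega> (xy i j) f g"
  shows "AE z in lebesgue_on \<Omega>. wd \<Omega> i j f z = g z"
  using weak_deriv_unique[OF assms(1) _ assms(2)] someI[of "weak_deriv \<Omega> (xy i j) f", OF assms(2)]
  unfolding wd_def by blast

lemma L2_norm_wd:
  assumes \<Omega>: "open \<Omega>" and g: "weak_deriv \<Omega> (xy i j) f g" "L2_on \<Omega> g"
  shows "L2_norm \<Omega> (wd \<Omega> i j f) = L2_norm \<Omega> g"
proof (rule L2_norm_cong_AE[OF _ L2_on_measurable[OF g(2)] wd_eq[OF \<Omega> g(1)]])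
  have "AE z in lebesgue_on \<Omega>. g z = wd \<Omega> i j f z"
    using wd_eq[OF \<Omega> g(1)] by eventually_elim simp
  then show "wd \<Omega> i j f \<in> borel_measurable (lebesgue_on \<Omega>)"
    by (rule lebesgue_on_measurable_AE_cong[OF L2_on_measurable[OF g(2)] _ open_imp_lebesgue[OF \<Omega>]])
qed

lemma sobolev_weak_deriv_L2:
  assumes \<Omega>: "open \<Omega>" and f: "sobolev k \<Omega> f" "i + j \<le> k" and g: "weak_deriv \<Omega> (xy i j) f g"
  shows "L2_on \<Omega> g"
proof -
  obtain h where h: "L2_on \<Omega> h" "weak_deriv \<Omega> (xy i j) f h"
    using f by (auto simp: sobolev_def)
  have ae: "AE z in lebesgue_on \<Omega>. h z = g z"
    by (rule weak_deriv_unique[OF \<Omega> h(2) g])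
  show ?thesis
    by (intro L2_on_cong_AE[OF h(1) _ ae] lebesgue_on_measurable_AE_cong[OF L2_on_measurable[OF h(1)] ae]
        open_imp_lebesgue[OF \<Omega>])
qed

section \<open>Functions vanishing on the boundary in one direction\<close>

text \<open>The closure of the test functions in the graph norm of the derivative along
  \<open>b\<close> alone. On the half strip it expresses zero boundary values on the edges
  transversal to \<open>b\<close>; nothing is asked on the other edges. The derivative
  \<open>f'\<close> is an argument, so that given versions can be used in place of
  \<open>wd\<close>.\<close>

definition dir_H10 :: "'a::euclidean_space set \<Rightarrow> 'a \<Rightarrow> ('a \<Rightarrow> real) \<Rightarrow> ('a \<Rightarrow> real) \<Rightarrow> bool" where
  "dir_H10 \<Omega> b f f' \<longleftrightarrow> L2_on \<Omega> f \<and> L2_on \<Omega> f' \<and>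
     (\<exists>\<phi>. (\<forall>n::nat. test_function \<Omega> (\<phi> n)) \<and>
        (\<lambda>n. L2_norm \<Omega> (\<lambda>z. \<phi> n z - f z)) \<longlonglongrightarrow> 0 \<and>
        (\<lambda>n. L2_norm \<Omega> (\<lambda>z. dir_deriv b (\<phi> n) z - f' z)) \<longlonglongrightarrow> 0)"

lemma dir_H10E:
  assumes "dir_H10 \<Omega> b f f'"
  obtains \<phi> where "L2_on \<Omega> f" "L2_on \<Omega> f'" "\<And>n::nat. test_function \<Omega> (\<phi> n)"
    "(\<lambda>n. L2_norm \<Omega> (\<lambda>z. \<phi> n z - f z)) \<longlonglongrightarrow> 0"
    "(\<lambda>n. L2_norm \<Omega> (\<lambda>z. dir_deriv b (\<phi> n) z - f' z)) \<longlonglongrightarrow> 0"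
  using assms unfolding dir_H10_def by blast

text \<open>Only \<open>f\<close> carries a boundary condition; \<open>g\<close> is any L^2 function
  with a weak derivative in L^2. Hence high derivatives of u, about whose traces nothing is known,
  can be paired with u, u_x and u_yy.\<close>

lemma dir_H10_integral_by_parts:
  assumes \<Omega>: "open \<Omega>" and b: "b \<in> Basis" and f: "dir_H10 \<Omega> b f f'"
    and g: "weak_deriv \<Omega> [b] g g'" "L2_on \<Omega> g" "L2_on \<Omega> g'"
  shows "(LINT z|lebesgue_on \<Omega>. f' z * g z) = - (LINT z|lebesgue_on \<Omega>. f z * g' z)"
proof -
  obtain \<phi> where \<phi>: "L2_on \<Omega> f" "L2_on \<Omega> f'" "\<And>n::nat. test_function \<Omega> (\<phi> n)"
    "(\<lambda>n. L2_norm \<Omega> (\<lambda>z. \<phi> n z - f z)) \<longlonglongrightarrow> 0"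
    "(\<lambda>n. L2_norm \<Omega> (\<lambda>z. dir_deriv b (\<phi> n) z - f' z)) \<longlonglongrightarrow> 0"
    using dir_H10E[OF f] by blast
  have L: "\<Omega> \<in> sets lebesgue" by (rule open_imp_lebesgue[OF \<Omega>])
  have "(\<lambda>n. LINT z|lebesgue_on \<Omega>. dir_deriv b (\<phi> n) z * g z) \<longlonglongrightarrow> (LINT z|lebesgue_on \<Omega>. f' z * g z)"
    by (intro L2_tendsto_inner L2_on_test_function[OF test_function_dir_deriv[OF \<phi>(3) b] L] \<phi> g)
  moreover have "(LINT z|lebesgue_on \<Omega>. dir_deriv b (\<phi> n) z * g z) = - (LINT z|lebesgue_on \<Omega>. \<phi> n z * g' z)" for n
    using weak_deriv_eq[OF g(1) \<phi>(3)[of n]] by (simp add: mult.commute)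
  moreover have "(\<lambda>n. - (LINT z|lebesgue_on \<Omega>. \<phi> n z * g' z)) \<longlonglongrightarrow> - (LINT z|lebesgue_on \<Omega>. f z * g' z)"
    by (intro tendsto_minus L2_tendsto_inner L2_on_test_function[OF \<phi>(3) L] \<phi> g)
  ultimately show ?thesis
    by (simp add: LIMSEQ_unique)
qed

text \<open>A factor that is constant along \<open>b\<close> passes through the derivative. It
  localises integration by parts in x to a layer in y without a commutator term.\<close>

lemma dir_H10_mult_tangential:
  assumes \<Omega>: "open \<Omega>" and b: "b \<in> Basis" and f: "dir_H10 \<Omega> b f f'"
    and \<zeta>: "smooth \<zeta>" "dir_deriv b \<zeta> = (\<lambda>_. 0)" "\<And>z. \<bar>\<zeta> z\<bar> \<le> 1"
  shows "dir_H10 \<Omega> b (\<lambda>z. \<zeta> z * f z) (\<lambda>z. \<zeta> z * f' z)"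
proof -
  obtain \<phi> where \<phi>: "L2_on \<Omega> f" "L2_on \<Omega> f'" "\<And>n::nat. test_function \<Omega> (\<phi> n)"
    "(\<lambda>n. L2_norm \<Omega> (\<lambda>z. \<phi> n z - f z)) \<longlonglongrightarrow> 0"
    "(\<lambda>n. L2_norm \<Omega> (\<lambda>z. dir_deriv b (\<phi> n) z - f' z)) \<longlonglongrightarrow> 0"
    using dir_H10E[OF f] by blast
  have L: "\<Omega> \<in> sets lebesgue" by (rule open_imp_lebesgue[OF \<Omega>])
  have m: "\<zeta> \<in> borel_measurable (lebesgue_on \<Omega>)" by (rule smooth_measurable_lebesgue_on[OF \<zeta>(1)])
  have lim: "(\<lambda>n. L2_norm \<Omega> (\<lambda>z. \<zeta> z * p n z - \<zeta> z * q z)) \<longlonglongrightarrow> 0"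
    if "(\<lambda>n. L2_norm \<Omega> (\<lambda>z. p n z - q z)) \<longlonglongrightarrow> 0" "\<And>n. L2_on \<Omega> (p n)" "L2_on \<Omega> q"
    for p q
  proof (rule Lim_null_comparison[OF _ that(1)], intro always_eventually allI)
    fix n
    have "L2_norm \<Omega> (\<lambda>z. \<zeta> z * (p n z - q z)) \<le> 1 * L2_norm \<Omega> (\<lambda>z. p n z - q z)"
      using \<zeta>(3) by (intro L2_norm_bounded_mult L2_on_diff that m) auto
    then show "norm (L2_norm \<Omega> (\<lambda>z. \<zeta> z * p n z - \<zeta> z * q z)) \<le> L2_norm \<Omega> (\<lambda>z. p n z - q z)"
      by (simp add: L2_norm_nonneg right_diff_distrib)
  qed
  have eq: "dir_deriv b (\<lambda>z. \<zeta> z * \<phi> n z) = (\<lambda>z. \<zeta> z * dir_deriv b (\<phi> n) z)" for n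
    using dir_deriv_mult[OF \<zeta>(1) test_function_smooth[OF \<phi>(3)[of n]] b] by (simp add: \<zeta>(2))
  show ?thesis
    unfolding dir_H10_def
  proof (intro conjI exI[of _ "\<lambda>n z. \<zeta> z * \<phi> n z"] allI)
    show "L2_on \<Omega> (\<lambda>z. \<zeta> z * f z)" "L2_on \<Omega> (\<lambda>z. \<zeta> z * f' z)"
      using \<phi>(1,2) \<zeta>(3) by (auto intro!: L2_on_bounded_mult m)
    show "test_function \<Omega> (\<lambda>z. \<zeta> z * \<phi> n z)" for n
      by (rule test_function_mult_smooth[OF \<phi>(3) \<zeta>(1)])
    show "(\<lambda>n. L2_norm \<Omega> (\<lambda>z. \<zeta> z * \<phi> n z - \<zeta> z * f z)) \<longlonglongrightarrow> 0"
      by (intro lim \<phi> L2_on_test_function[OF \<phi>(3) L])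
    show "(\<lambda>n. L2_norm \<Omega> (\<lambda>z. dir_deriv b (\<lambda>z. \<zeta> z * \<phi> n z) z - \<zeta> z * f' z)) \<longlonglongrightarrow> 0"
      unfolding eq by (intro lim \<phi> L2_on_test_function[OF test_function_dir_deriv[OF \<phi>(3) b] L])
  qed
qed

text \<open>The integrand is the derivative of \<open>G (\<phi> z) - G 0\<close> for an
  antiderivative \<open>G\<close> of \<open>g\<close>; subtracting \<open>G 0\<close> makes the
  support compact. Mere continuity of \<open>g\<close> is assumed because the truncated square has a
  kink.\<close>

lemma integral_bounded_composition_dir_deriv:
  fixes g :: "real \<Rightarrow> real"
  assumes \<phi>: "test_function UNIV \<phi>" and b: "b \<in> Basis" and g: "continuous_on UNIV g"
  shows "(LINT z|lborel. g (\<phi> z) * dir_deriv b \<phi> z) = 0"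
proof -
  obtain K where K: "smooth \<phi>" "compact K" "K \<subseteq> UNIV" "\<And>z. z \<notin> K \<Longrightarrow> \<phi> z = 0"
    using test_functionE[OF \<phi>] by blast
  have "\<exists>G. \<forall>x::real. -\<infinity> < ereal x \<longrightarrow> ereal x < \<infinity> \<longrightarrow> (G has_vector_derivative g x) (at x)"
    using g by (intro einterval_antiderivative) (auto simp: continuous_on_eq_continuous_at)
  then obtain G where G: "(G has_real_derivative g x) (at x)" for x
    by (auto simp: has_real_derivative_iff_has_vector_derivative)
  have contG: "continuous_on UNIV G"
    using G by (intro DERIV_continuous_on[OF has_field_derivative_at_within])
  show ?thesis
  proof (rule integral_directional_derivative_eq_0[where F = "\<lambda>z. G (\<phi> z) - G 0" and b = b and K = K])
    show "continuous_on UNIV (\<lambda>z. G (\<phi> z) - G 0)"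
      by (intro continuous_intros continuous_on_compose2[OF contG] smooth_continuous K) auto
    show "continuous_on UNIV (\<lambda>z. g (\<phi> z) * dir_deriv b \<phi> z)"
      by (intro continuous_intros continuous_on_compose2[OF g] smooth_continuous smooth_dir_deriv b K) auto
    show "((\<lambda>s. G (\<phi> (z + s *\<^sub>R b)) - G 0) has_real_derivative
        g (\<phi> (z + s *\<^sub>R b)) * dir_deriv b \<phi> (z + s *\<^sub>R b)) (at s)" for z s
      using DERIV_diff[OF DERIV_chain2[where f = G and g = "\<lambda>s. \<phi> (z + s *\<^sub>R b)", OF G smooth_DERIV[OF K(1) b]] DERIV_const]
      by simp
    show "g (\<phi> z) * dir_deriv b \<phi> z = 0" if "z \<notin> K" for z
      using dir_deriv_eq_0_outside[OF compact_imp_closed[OF K(2)] K(4) that, where b = b] by simp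
  qed (use K b in auto)
qed

lemma min_power2_Lipschitz:
  fixes x y m :: real
  assumes "m \<ge> 0"
  shows "\<bar>(min \<bar>x\<bar> m)\<^sup>2 - (min \<bar>y\<bar> m)\<^sup>2\<bar> \<le> 2 * m * \<bar>x - y\<bar>"
proof -
  have "\<bar>(min \<bar>x\<bar> m)\<^sup>2 - (min \<bar>y\<bar> m)\<^sup>2\<bar> = \<bar>min \<bar>x\<bar> m + min \<bar>y\<bar> m\<bar> * \<bar>min \<bar>x\<bar> m - min \<bar>y\<bar> m\<bar>"
    by (simp add: power2_eq_square abs_mult[symmetric] algebra_simps)
  also have "\<dots> \<le> (2 * m) * \<bar>x - y\<bar>"
    using assms by (intro mult_mono) auto
  finally show ?thesis .
qed

text \<open>Formally the integrand is the derivative of f^3/3. Convergence in L^2 does not control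
  the square of the approximants, but the truncated square is Lipschitz with constant 2m, and for it
  the limit is legitimate. The assumption \<open>ff'\<close> supplies the integrable majorant that
  removes the truncation.\<close>

lemma dir_H10_integral_square_mult_deriv:
  assumes \<Omega>: "open \<Omega>" and b: "b \<in> Basis" and f: "dir_H10 \<Omega> b f f'" and ff': "L2_on \<Omega> (\<lambda>z. f z * f' z)"
  shows "(LINT z|lebesgue_on \<Omega>. f z * (f z * f' z)) = 0"
proof -
  obtain \<phi> where \<phi>: "L2_on \<Omega> f" "L2_on \<Omega> f'" "\<And>n::nat. test_function \<Omega> (\<phi> n)"
    "(\<lambda>n. L2_norm \<Omega> (\<lambda>z. \<phi> n z - f z)) \<longlonglongrightarrow> 0"
    "(\<lambda>n. L2_norm \<Omega> (\<lambda>z. dir_deriv b (\<phi> n) z - f' z)) \<longlonglongrightarrow> 0"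
    using dir_H10E[OF f] by blast
  have L: "\<Omega> \<in> sets lebesgue" by (rule open_imp_lebesgue[OF \<Omega>])
  have d\<phi>: "test_function \<Omega> (dir_deriv b (\<phi> n))" for n
    by (rule test_function_dir_deriv[OF \<phi>(3) b])
  define g where "g m x = (min \<bar>x\<bar> (real m))\<^sup>2" for m and x :: real
  have gcont: "continuous_on UNIV (g m)" for m
    unfolding g_def by (intro continuous_intros)
  have gm: "(\<lambda>z. g m (h z)) \<in> borel_measurable M" if "h \<in> borel_measurable M" for m h and M :: "'a measure"
    using that unfolding g_def by measurable
  have gb: "\<bar>g m x\<bar> \<le> real m * \<bar>x\<bar>" for m x
    unfolding g_def power2_eq_square abs_mult by (intro mult_mono) auto
  have gL2: "L2_on \<Omega> (\<lambda>z. g m (h z))" if h: "L2_on \<Omega> h" for m h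
  proof -
    have "integrable (lebesgue_on \<Omega>) (\<lambda>z. (g m (h z))\<^sup>2)"
    proof (rule Bochner_Integration.integrable_bound[where f = "\<lambda>z. (real m)\<^sup>2 * (h z)\<^sup>2"])
      show "AE z in lebesgue_on \<Omega>. norm ((g m (h z))\<^sup>2) \<le> norm ((real m)\<^sup>2 * (h z)\<^sup>2)"
      proof (intro AE_I2)
        fix z
        have "\<bar>g m (h z)\<bar>\<^sup>2 \<le> (real m * \<bar>h z\<bar>)\<^sup>2"
          by (intro power_mono gb) auto
        then show "norm ((g m (h z))\<^sup>2) \<le> norm ((real m)\<^sup>2 * (h z)\<^sup>2)"
          by (simp add: power_mult_distrib)
      qed
    qed (use h gm[OF L2_on_measurable[OF h]] in \<open>auto simp: L2_on_def\<close>)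
    then show ?thesis using gm[OF L2_on_measurable[OF h]] by (simp add: L2_on_def)
  qed
  have zero: "(LINT z|lebesgue_on \<Omega>. g m (f z) * f' z) = 0" for m
  proof -
    \<comment> \<open>The Lipschitz bound carries convergence from the approximants over to their
      truncated squares.\<close>
    have "(\<lambda>n. L2_norm \<Omega> (\<lambda>z. g m (\<phi> n z) - g m (f z))) \<longlonglongrightarrow> 0"
    proof (rule Lim_null_comparison)
      show "(\<lambda>n. 2 * real m * L2_norm \<Omega> (\<lambda>z. \<phi> n z - f z)) \<longlonglongrightarrow> 0"
        by (rule tendsto_mult_right_zero[OF \<phi>(4)])
      show "\<forall>\<^sub>F n in sequentially. norm (L2_norm \<Omega> (\<lambda>z. g m (\<phi> n z) - g m (f z))) \<le> 2 * real m * L2_norm \<Omega> (\<lambda>z. \<phi> n z - f z)"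
      proof (intro always_eventually allI)
        fix n
        have l2: "L2_on \<Omega> (\<lambda>z. \<phi> n z - f z)"
          by (intro L2_on_diff L2_on_test_function[OF \<phi>(3) L] \<phi>)
        have l2': "L2_on \<Omega> (\<lambda>z. g m (\<phi> n z) - g m (f z))"
          by (intro L2_on_diff gL2 L2_on_test_function[OF \<phi>(3) L] \<phi>)
        have "(LINT z|lebesgue_on \<Omega>. (g m (\<phi> n z) - g m (f z))\<^sup>2) \<le> (LINT z|lebesgue_on \<Omega>. (2 * real m * (\<phi> n z - f z))\<^sup>2)"
        proof (rule integral_mono)
          fix z
          have "\<bar>g m (\<phi> n z) - g m (f z)\<bar>\<^sup>2 \<le> (2 * real m * \<bar>\<phi> n z - f z\<bar>)\<^sup>2"
            unfolding g_def by (intro power_mono min_power2_Lipschitz) auto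
          then show "(g m (\<phi> n z) - g m (f z))\<^sup>2 \<le> (2 * real m * (\<phi> n z - f z))\<^sup>2"
            by (simp add: power_mult_distrib)
        qed (use l2' L2_on_cmult[OF l2, of "2 * real m"] in \<open>auto simp: L2_on_def\<close>)
        then have "L2_norm \<Omega> (\<lambda>z. g m (\<phi> n z) - g m (f z)) \<le> L2_norm \<Omega> (\<lambda>z. 2 * real m * (\<phi> n z - f z))"
          unfolding L2_norm_def by simp
        then show "norm (L2_norm \<Omega> (\<lambda>z. g m (\<phi> n z) - g m (f z))) \<le> 2 * real m * L2_norm \<Omega> (\<lambda>z. \<phi> n z - f z)"
          unfolding L2_norm_cmult by (simp add: L2_norm_nonneg)
      qed
    qed
    then have l1: "(\<lambda>n. L2_norm \<Omega> (\<lambda>z. g m (\<phi> n z) - g m (f z)) * L2_norm \<Omega> (dir_deriv b (\<phi> n))) \<longlonglongrightarrow> 0 * L2_norm \<Omega> f'"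
      by (intro tendsto_mult L2_tendsto_norm L2_on_test_function[OF d\<phi> L] \<phi>)
    have l2: "(\<lambda>n. LINT z|lebesgue_on \<Omega>. dir_deriv b (\<phi> n) z * g m (f z)) \<longlonglongrightarrow> (LINT z|lebesgue_on \<Omega>. f' z * g m (f z))"
      by (intro L2_tendsto_inner L2_on_test_function[OF d\<phi> L] \<phi> gL2)
    have "norm (LINT z|lebesgue_on \<Omega>. dir_deriv b (\<phi> n) z * g m (f z))
        \<le> L2_norm \<Omega> (\<lambda>z. g m (\<phi> n z) - g m (f z)) * L2_norm \<Omega> (dir_deriv b (\<phi> n))" for n
    proof -
      have L2s: "L2_on \<Omega> (\<lambda>z. g m (\<phi> n z))" "L2_on \<Omega> (\<lambda>z. g m (f z))" "L2_on \<Omega> (dir_deriv b (\<phi> n))"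
        by (intro gL2 L2_on_test_function[OF \<phi>(3) L] L2_on_test_function[OF d\<phi> L] \<phi>)+
      \<comment> \<open>For the approximants the integral vanishes exactly, so only the difference
        of the two truncated squares remains to be estimated.\<close>
      have "(LINT z|lebesgue_on \<Omega>. g m (\<phi> n z) * dir_deriv b (\<phi> n) z) = (LINT z|lborel. g m (\<phi> n z) * dir_deriv b (\<phi> n) z)"
        using test_function_outside[OF d\<phi>[of n]] gm[OF test_function_measurable[OF \<phi>(3)], of m n]
          test_function_measurable[OF d\<phi>[of n]]
        by (intro integral_lebesgue_on_eq_lborel L) auto
      also have "\<dots> = 0"
        by (intro integral_bounded_composition_dir_deriv test_function_mono[OF \<phi>(3)] b gcont) simp
      finally have "(LINT z|lebesgue_on \<Omega>. g m (\<phi> n z) * dir_deriv b (\<phi> n) z) = 0" .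
      moreover have "(LINT z|lebesgue_on \<Omega>. (g m (\<phi> n z) - g m (f z)) * dir_deriv b (\<phi> n) z)
          = (LINT z|lebesgue_on \<Omega>. g m (\<phi> n z) * dir_deriv b (\<phi> n) z)
            - (LINT z|lebesgue_on \<Omega>. g m (f z) * dir_deriv b (\<phi> n) z)"
        using L2_on_mult_integrable[OF L2s(1,3)] L2_on_mult_integrable[OF L2s(2,3)]
        by (simp add: left_diff_distrib)
      moreover have "(LINT z|lebesgue_on \<Omega>. dir_deriv b (\<phi> n) z * g m (f z))
          = (LINT z|lebesgue_on \<Omega>. g m (f z) * dir_deriv b (\<phi> n) z)"
        by (simp only: mult.commute)
      ultimately have "(LINT z|lebesgue_on \<Omega>. dir_deriv b (\<phi> n) z * g m (f z))
          = - (LINT z|lebesgue_on \<Omega>. (g m (\<phi> n z) - g m (f z)) * dir_deriv b (\<phi> n) z)"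
        by linarith
      then show ?thesis
        using L2_Cauchy_Schwarz[OF L2_on_diff[OF L2s(1,2)] L2s(3)] by simp
    qed
    then have "(\<lambda>n. LINT z|lebesgue_on \<Omega>. dir_deriv b (\<phi> n) z * g m (f z)) \<longlonglongrightarrow> 0"
      by (intro Lim_null_comparison[OF always_eventually l1[unfolded mult_zero_left]] allI)
    from LIMSEQ_unique[OF this l2] show ?thesis
      by (simp add: mult.commute)
  qed
  have int: "integrable (lebesgue_on \<Omega>) (\<lambda>z. f z * (f z * f' z))"
    by (rule L2_on_mult_integrable[OF \<phi>(1) ff'])
  have "(\<lambda>m. LINT z|lebesgue_on \<Omega>. g m (f z) * f' z) \<longlonglongrightarrow> (LINT z|lebesgue_on \<Omega>. f z * (f z * f' z))"
  proof (rule integral_dominated_convergence[where w = "\<lambda>z. \<bar>f z * (f z * f' z)\<bar>"])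
    show "AE z in lebesgue_on \<Omega>. (\<lambda>m. g m (f z) * f' z) \<longlonglongrightarrow> f z * (f z * f' z)"
    proof (intro AE_I2 tendsto_eventually)
      fix z
      show "\<forall>\<^sub>F m in sequentially. g m (f z) * f' z = f z * (f z * f' z)"
        using eventually_ge_at_top[of "nat \<lceil>\<bar>f z\<bar>\<rceil>"]
      proof eventually_elim
        case (elim m)
        then have "min \<bar>f z\<bar> (real m) = \<bar>f z\<bar>" by linarith
        then show ?case by (simp add: g_def power2_eq_square)
      qed
    qed
    show "AE z in lebesgue_on \<Omega>. norm (g m (f z) * f' z) \<le> \<bar>f z * (f z * f' z)\<bar>" for m
    proof (intro AE_I2)
      fix z
      have "(min \<bar>f z\<bar> (real m))\<^sup>2 \<le> \<bar>f z\<bar>\<^sup>2"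
        by (intro power_mono) auto
      then have "\<bar>g m (f z)\<bar> * \<bar>f' z\<bar> \<le> \<bar>f z * f z\<bar> * \<bar>f' z\<bar>"
        by (intro mult_right_mono) (auto simp: g_def power2_eq_square)
      then show "norm (g m (f z) * f' z) \<le> \<bar>f z * (f z * f' z)\<bar>"
        by (simp add: abs_mult mult.assoc)
    qed
    show "(\<lambda>z. g m (f z) * f' z) \<in> borel_measurable (lebesgue_on \<Omega>)" for m
      by (intro borel_measurable_times gm L2_on_measurable \<phi>)
    show "(\<lambda>z. f z * (f z * f' z)) \<in> borel_measurable (lebesgue_on \<Omega>)"
      using int by (rule borel_measurable_integrable)
    show "integrable (lebesgue_on \<Omega>) (\<lambda>z. \<bar>f z * (f z * f' z)\<bar>)"
      using int by (rule integrable_abs)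
  qed
  then show ?thesis
    by (simp add: zero LIMSEQ_const_iff)
qed

section \<open>Backward difference quotients\<close>

lemma test_function_translate:
  assumes \<phi>: "test_function \<Omega> \<phi>" and sub: "\<And>z. z \<in> \<Omega> \<Longrightarrow> z + w \<in> \<Omega>"
  shows "test_function \<Omega> (\<lambda>z. \<phi> (z - w))"
proof -
  obtain K where K: "smooth \<phi>" "compact K" "K \<subseteq> \<Omega>" "\<And>z. z \<notin> K \<Longrightarrow> \<phi> z = 0"
    using test_functionE[OF \<phi>] by blast
  show ?thesis
  proof (rule test_functionI)
    show "smooth (\<lambda>z. \<phi> (z - w))"
      using smooth_translate[OF K(1), of "- w"] by simp
    show "compact ((\<lambda>z. z + w) ` K)"
      by (intro compact_continuous_image continuous_intros K)
    show "(\<lambda>z. z + w) ` K \<subseteq> \<Omega>"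
      using K(3) sub by blast
    show "\<phi> (z - w) = 0" if "z \<notin> (\<lambda>z. z + w) ` K" for z
    proof (rule K(4))
      show "z - w \<notin> K"
        using that by (metis diff_add_cancel image_eqI)
    qed
  qed
qed

lemma L2_norm_translate:
  assumes \<phi>: "test_function \<Omega> \<phi>" and sub: "\<And>z. z \<in> \<Omega> \<Longrightarrow> z + w \<in> \<Omega>" and \<Omega>: "\<Omega> \<in> sets lebesgue"
  shows "L2_norm \<Omega> (\<lambda>z. \<phi> (z - w)) = L2_norm \<Omega> \<phi>"
proof -
  have "(L2_norm \<Omega> (\<lambda>z. \<phi> (z - w)))\<^sup>2 = (LINT z|lborel. (\<phi> (z - w))\<^sup>2)"
    by (rule L2_norm_test_function_lborel[OF test_function_translate[OF \<phi> sub] \<Omega>])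
  also have "\<dots> = (LINT z|lborel. (\<phi> z)\<^sup>2)"
    using integral_lborel_translate[of "\<lambda>z. (\<phi> z)\<^sup>2" "- w"] test_function_measurable[OF \<phi>] by simp
  also have "\<dots> = (L2_norm \<Omega> \<phi>)\<^sup>2"
    by (rule L2_norm_test_function_lborel[OF \<phi> \<Omega>, symmetric])
  finally show ?thesis
    by (simp add: L2_norm_nonneg)
qed

text \<open>Backward, because then the support of a test function is only shifted in the direction
  \<open>+ b\<close>, under which \<open>\<Omega>\<close> is invariant by the assumption
  \<open>shift\<close> below; a forward quotient could leave \<open>\<Omega>\<close> through the
  boundary.\<close>

definition diff_quot :: "'a::real_vector \<Rightarrow> real \<Rightarrow> ('a \<Rightarrow> real) \<Rightarrow> 'a \<Rightarrow> real" where
  "diff_quot b h \<phi> z = (\<phi> z - \<phi> (z - h *\<^sub>R b)) / h"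

context
  fixes \<Omega> :: "'a::euclidean_space set" and b :: 'a
  assumes \<Omega>: "open \<Omega>" and b: "b \<in> Basis"
    and shift: "\<And>z h. z \<in> \<Omega> \<Longrightarrow> 0 \<le> h \<Longrightarrow> z + h *\<^sub>R b \<in> \<Omega>"
begin

lemma test_function_diff_quot:
  assumes \<phi>: "test_function \<Omega> \<phi>" and h: "h \<ge> 0"
  shows "test_function \<Omega> (diff_quot b h \<phi>)"
proof -
  have "test_function \<Omega> (\<lambda>z. (1 / h) * (\<phi> z - \<phi> (z - h *\<^sub>R b)))"
    using shift h
    by (intro test_function_mult_smooth[OF test_function_diff[OF \<phi> test_function_translate[OF \<phi>]] smooth_const]) auto
  then show ?thesis
    by (simp add: diff_quot_def[abs_def])
qed

text \<open>The quotient is the derivative at a point less than h away, so it differs from the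
  derivative at z by at most h times a bound \<open>C\<close> of the second derivative. For
  \<open>h \<le> 1\<close> all supports lie in one ball, of volume \<open>V\<close>, which gives
  \<open>M = C * sqrt V\<close>.\<close>

lemma diff_quot_error_bound:
  assumes \<phi>: "test_function \<Omega> \<phi>"
  obtains M where "\<And>h. 0 < h \<Longrightarrow> h \<le> 1 \<Longrightarrow> L2_norm \<Omega> (\<lambda>z. diff_quot b h \<phi> z - dir_deriv b \<phi> z) \<le> M * h"
proof -
  have L: "\<Omega> \<in> sets lebesgue" by (rule open_imp_lebesgue[OF \<Omega>])
  obtain K where K: "smooth \<phi>" "compact K" "K \<subseteq> \<Omega>" "\<And>z. z \<notin> K \<Longrightarrow> \<phi> z = 0"
    using test_functionE[OF \<phi>] by blast
  obtain R where R: "\<And>z. z \<in> K \<Longrightarrow> norm z \<le> R"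
    using compact_imp_bounded[OF K(2)] unfolding bounded_iff by blast
  have d\<phi>: "test_function \<Omega> (dir_deriv b \<phi>)"
    by (rule test_function_dir_deriv[OF \<phi> b])
  obtain C where C: "\<And>z. \<bar>dir_deriv b (dir_deriv b \<phi>) z\<bar> \<le> C" "C \<ge> 0"
    using test_function_bounded[OF test_function_dir_deriv[OF d\<phi> b]] by blast
  define V where "V = measure lborel (cball (0::'a) (R + 1))"
  have "L2_norm \<Omega> (\<lambda>z. diff_quot b h \<phi> z - dir_deriv b \<phi> z) \<le> (C * sqrt V) * h" if h: "0 < h" "h \<le> 1" for h
  proof -
    define \<rho> where "\<rho> = (\<lambda>z. diff_quot b h \<phi> z - dir_deriv b \<phi> z)"
    have \<rho>: "test_function \<Omega> \<rho>"
      unfolding \<rho>_def using h by (intro test_function_diff test_function_diff_quot \<phi> d\<phi>) auto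
    have bound: "\<bar>\<rho> z\<bar> \<le> C * h" for z
    proof -
      obtain s where s: "0 < s" "s < h"
        "\<phi> ((z - h *\<^sub>R b) + h *\<^sub>R b) - \<phi> ((z - h *\<^sub>R b) + 0 *\<^sub>R b) = (h - 0) * dir_deriv b \<phi> ((z - h *\<^sub>R b) + s *\<^sub>R b)"
        using MVT2[OF h(1), of "\<lambda>s. \<phi> ((z - h *\<^sub>R b) + s *\<^sub>R b)", OF smooth_DERIV[OF K(1) b]] by blast
      define y where "y = (z - h *\<^sub>R b) + s *\<^sub>R b"
      have "\<bar>dir_deriv b \<phi> (y + (h - s) *\<^sub>R b) - dir_deriv b \<phi> y\<bar> \<le> C * (h - s)"
        using s by (intro directional_difference_bound[OF smooth_DERIV[OF smooth_dir_deriv[OF K(1) b] b] C(1)]) auto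
      moreover have "y + (h - s) *\<^sub>R b = z"
        by (simp add: y_def algebra_simps)
      moreover have "\<rho> z = dir_deriv b \<phi> y - dir_deriv b \<phi> z"
        using s(3) h by (simp add: \<rho>_def diff_quot_def y_def)
      moreover have "C * (h - s) \<le> C * h"
        using s C(2) by (intro mult_left_mono) auto
      ultimately show ?thesis by (simp add: abs_minus_commute)
    qed
    have out: "\<rho> z = 0" if "z \<notin> cball 0 (R + 1)" for z
    proof -
      have n: "norm z > R + 1" using that by (simp add: dist_norm)
      have "norm z \<le> norm (z - h *\<^sub>R b) + norm (h *\<^sub>R b)"
        using norm_triangle_ineq[of "z - h *\<^sub>R b" "h *\<^sub>R b"] by simp
      moreover have "norm (h *\<^sub>R b) \<le> 1" using b h by simp
      ultimately have "norm (z - h *\<^sub>R b) > R" using n by linarith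
      then have "z - h *\<^sub>R b \<notin> K" "z \<notin> K"
        using R[of "z - h *\<^sub>R b"] R[of z] n by auto
      then show ?thesis
        using dir_deriv_eq_0_outside[OF compact_imp_closed[OF K(2)] K(4), where z = z and b = b] K(4)
        by (simp add: \<rho>_def diff_quot_def)
    qed
    have ind: "integrable lborel (\<lambda>z::'a. indicat_real (cball 0 (R + 1)) z * (C * h)\<^sup>2)"
      by (intro integrable_mult_left integrable_real_indicator) (simp_all only: emeasure_lborel_cball_finite, simp)
    have "(L2_norm \<Omega> \<rho>)\<^sup>2 = (LINT z|lborel. (\<rho> z)\<^sup>2)"
      by (rule L2_norm_test_function_lborel[OF \<rho> L])
    also have "\<dots> \<le> (LINT z|lborel. indicator (cball (0::'a) (R + 1)) z * (C * h)\<^sup>2)"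
    proof (rule integral_mono)
      show "integrable lborel (\<lambda>z. (\<rho> z)\<^sup>2)"
        using integrable_lborel_test_function[OF test_function_mult_smooth[OF \<rho> test_function_smooth[OF \<rho>]]]
        by (simp add: power2_eq_square)
      show "integrable lborel (\<lambda>z::'a. indicat_real (cball 0 (R + 1)) z * (C * h)\<^sup>2)"
        by (rule ind)
      fix z
      have "\<bar>\<rho> z\<bar>\<^sup>2 \<le> (C * h)\<^sup>2"
        by (intro power_mono bound) auto
      then show "(\<rho> z)\<^sup>2 \<le> indicator (cball 0 (R + 1)) z * (C * h)\<^sup>2"
        using out[of z] by (cases "z \<in> cball 0 (R + 1)") auto
    qed
    also have "\<dots> = V * (C * h)\<^sup>2"
      by (simp add: V_def)
    also have "\<dots> = ((C * sqrt V) * h)\<^sup>2"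
      by (simp add: power_mult_distrib V_def)
    finally have "(L2_norm \<Omega> \<rho>)\<^sup>2 \<le> ((C * sqrt V) * h)\<^sup>2" .
    then show ?thesis
      unfolding \<rho>_def[symmetric] using h C(2) by (elim power2_le_imp_le) (simp add: V_def)
  qed
  then show ?thesis by (rule that)
qed

lemma diff_quot_tendsto:
  assumes \<phi>: "test_function \<Omega> \<phi>" and h: "\<And>n. 0 < h n" "\<And>n. h n \<le> 1" "h \<longlonglongrightarrow> 0"
  shows "(\<lambda>n. L2_norm \<Omega> (\<lambda>z. diff_quot b (h n) \<phi> z - dir_deriv b \<phi> z)) \<longlonglongrightarrow> 0"
proof -
  obtain M where M: "\<And>h. 0 < h \<Longrightarrow> h \<le> 1 \<Longrightarrow> L2_norm \<Omega> (\<lambda>z. diff_quot b h \<phi> z - dir_deriv b \<phi> z) \<le> M * h"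
    using diff_quot_error_bound[OF \<phi>] by blast
  show ?thesis
    by (rule Lim_null_comparison[OF always_eventually tendsto_mult_right_zero[OF h(3), of M]])
       (use M h(1,2) in \<open>simp add: L2_norm_nonneg\<close>)
qed

text \<open>The bound follows from the limit of vanishing step size, as halving the step can only increase
  the norm: a difference quotient is the mean of two translates of the one with half the step.\<close>

lemma diff_quot_norm_le:
  assumes \<phi>: "test_function \<Omega> \<phi>" and h: "0 < h" "h \<le> 1"
  shows "L2_norm \<Omega> (diff_quot b h \<phi>) \<le> L2_norm \<Omega> (dir_deriv b \<phi>)"
proof -
  have L: "\<Omega> \<in> sets lebesgue" by (rule open_imp_lebesgue[OF \<Omega>])
  have half: "L2_norm \<Omega> (diff_quot b h \<phi>) \<le> L2_norm \<Omega> (diff_quot b (h / 2) \<phi>)" if h: "0 < h" for h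
  proof -
    define q where "q = diff_quot b (h / 2) \<phi>"
    have q: "test_function \<Omega> q"
      unfolding q_def using h by (intro test_function_diff_quot \<phi>) simp
    have sh: "z + (h / 2) *\<^sub>R b \<in> \<Omega>" if "z \<in> \<Omega>" for z
      using shift[OF that, of "h / 2"] h by simp
    have "z - h *\<^sub>R b = (z - (h / 2) *\<^sub>R b) - (h / 2) *\<^sub>R b" for z
      by (metis diff_diff_eq field_sum_of_halves scaleR_add_left)
    then have "diff_quot b h \<phi> = (\<lambda>z. (1 / 2) * (q z + q (z - (h / 2) *\<^sub>R b)))"
      using h by (auto simp: diff_quot_def q_def fun_eq_iff field_simps)
    then have "L2_norm \<Omega> (diff_quot b h \<phi>) = (1 / 2) * L2_norm \<Omega> (\<lambda>z. q z + q (z - (h / 2) *\<^sub>R b))"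
      by (simp only: L2_norm_cmult)
    also have "\<dots> \<le> (1 / 2) * (L2_norm \<Omega> q + L2_norm \<Omega> (\<lambda>z. q (z - (h / 2) *\<^sub>R b)))"
      using L2_norm_triangle[OF L2_on_test_function[OF q L] L2_on_test_function[OF test_function_translate[OF q sh] L]]
      by simp
    also have "\<dots> = L2_norm \<Omega> q"
      using L2_norm_translate[OF q sh L] by simp
    finally show ?thesis by (simp add: q_def)
  qed
  have le: "L2_norm \<Omega> (diff_quot b h \<phi>) \<le> L2_norm \<Omega> (diff_quot b (h / 2 ^ n) \<phi>)" for n
  proof (induction n)
    case (Suc n)
    then show ?case using half[of "h / 2 ^ n"] h(1) by (simp add: field_simps)
  qed simp
  have hn: "0 < h / 2 ^ n" "h / 2 ^ n \<le> 1" for n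
  proof -
    show "0 < h / 2 ^ n" using h by simp
    have "h / 2 ^ n \<le> h / 1"
      using h(1) by (intro divide_left_mono) auto
    then show "h / 2 ^ n \<le> 1" using h(2) by linarith
  qed
  have "(\<lambda>n. h * (1 / 2) ^ n) \<longlonglongrightarrow> h * 0"
    by (intro tendsto_intros LIMSEQ_power_zero) simp
  then have h0: "(\<lambda>n. h / 2 ^ n) \<longlonglongrightarrow> 0"
    by (simp add: power_one_over)
  have "(\<lambda>n. L2_norm \<Omega> (diff_quot b (h / 2 ^ n) \<phi>)) \<longlonglongrightarrow> L2_norm \<Omega> (dir_deriv b \<phi>)"
    using hn(1) by (intro L2_tendsto_norm diff_quot_tendsto[OF \<phi> hn h0]
        L2_on_test_function[OF test_function_diff_quot[OF \<phi>] L]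
        L2_on_test_function[OF test_function_dir_deriv[OF \<phi> b] L]) (simp add: less_imp_le)
  then show ?thesis
    by (rule LIMSEQ_le_const) (use le in blast)
qed

text \<open>Formally \<open>\<integral> w'' w' = - (1/2) \<integral> w'\<^sup>2\<close> over the boundary. To avoid traces of \<open>w'\<close>, the factor \<open>w'\<close> is
  replaced by a backward difference quotient of \<open>w\<close>, which still vanishes on the boundary.\<close>

lemma dir_H10_second_deriv_nonpos:
  assumes w: "dir_H10 \<Omega> b w w'" and w'': "weak_deriv \<Omega> [b] w' w''" "L2_on \<Omega> w''"
  shows "(LINT z|lebesgue_on \<Omega>. w'' z * w' z) \<le> 0"
proof -
  obtain \<phi> where \<phi>: "L2_on \<Omega> w" "L2_on \<Omega> w'" "\<And>n::nat. test_function \<Omega> (\<phi> n)"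
    "(\<lambda>n. L2_norm \<Omega> (\<lambda>z. \<phi> n z - w z)) \<longlonglongrightarrow> 0"
    "(\<lambda>n. L2_norm \<Omega> (\<lambda>z. dir_deriv b (\<phi> n) z - w' z)) \<longlonglongrightarrow> 0"
    using dir_H10E[OF w] by blast
  have L: "\<Omega> \<in> sets lebesgue" by (rule open_imp_lebesgue[OF \<Omega>])
  define d where "d n = dir_deriv b (\<phi> n)" for n
  have d: "test_function \<Omega> (d n)" for n
    unfolding d_def by (rule test_function_dir_deriv[OF \<phi>(3) b])
  have dL: "L2_on \<Omega> (d n)" for n by (rule L2_on_test_function[OF d L])
  have qL: "L2_on \<Omega> (diff_quot b h (\<phi> n))" if "h > 0" for h n
    using that by (intro L2_on_test_function[OF test_function_diff_quot[OF \<phi>(3)] L]) simp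
  have dlim: "(\<lambda>n. L2_norm \<Omega> (\<lambda>z. d n z - w' z)) \<longlonglongrightarrow> 0"
    unfolding d_def by (rule \<phi>(5))
  define I where "I = (LINT z|lebesgue_on \<Omega>. w'' z * w' z)"
  have "(\<lambda>n. LINT z|lebesgue_on \<Omega>. d n z * w'' z) \<longlonglongrightarrow> (LINT z|lebesgue_on \<Omega>. w' z * w'' z)"
    by (rule L2_tendsto_inner[OF dL \<phi>(2) w''(2) dlim])
  then have I_lim: "(\<lambda>n. LINT z|lebesgue_on \<Omega>. d n z * w'' z) \<longlonglongrightarrow> I"
    by (simp add: I_def mult.commute)
  \<comment> \<open>After integration by parts the left side is the pairing of w' with the shifted
    minus the unshifted derivative, over h. Cauchy-Schwarz is applied to the shifted term only; as n
    grows the numerator tends to |w'|^2 - |w'|^2 = 0.\<close>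
  have quot: "(LINT z|lebesgue_on \<Omega>. diff_quot b h (\<phi> n) z * w'' z)
      \<le> (L2_norm \<Omega> w' * L2_norm \<Omega> (d n) - (LINT z|lebesgue_on \<Omega>. d n z * w' z)) / h" if h: "h > 0" for h n
  proof -
    have sh: "z + h *\<^sub>R b \<in> \<Omega>" if "z \<in> \<Omega>" for z
      using shift[OF that, of h] h by simp
    have T: "test_function \<Omega> (\<lambda>z. \<phi> n (z - h *\<^sub>R b))"
      by (rule test_function_translate[OF \<phi>(3) sh])
    have Td: "test_function \<Omega> (\<lambda>z. d n (z - h *\<^sub>R b))"
      by (rule test_function_translate[OF d sh])
    have dT: "dir_deriv b (\<lambda>z. \<phi> n (z - h *\<^sub>R b)) = (\<lambda>z. d n (z - h *\<^sub>R b))"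
      using dir_deriv_translate[of b "\<phi> n" "- (h *\<^sub>R b)"] by (simp add: d_def)
    have 1: "(LINT z|lebesgue_on \<Omega>. \<phi> n z * w'' z) = - (LINT z|lebesgue_on \<Omega>. d n z * w' z)"
      using weak_deriv_eq[OF w''(1) \<phi>(3)[of n]] by (simp add: d_def mult.commute)
    have "(LINT z|lebesgue_on \<Omega>. \<phi> n (z - h *\<^sub>R b) * w'' z) = - (LINT z|lebesgue_on \<Omega>. d n (z - h *\<^sub>R b) * w' z)"
      using weak_deriv_eq[OF w''(1) T] by (simp add: dT mult.commute)
    moreover have "\<bar>LINT z|lebesgue_on \<Omega>. d n (z - h *\<^sub>R b) * w' z\<bar> \<le> L2_norm \<Omega> (d n) * L2_norm \<Omega> w'"
      using L2_Cauchy_Schwarz[OF L2_on_test_function[OF Td L] \<phi>(2)] L2_norm_translate[OF d sh L] by simp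
    ultimately have 2: "(LINT z|lebesgue_on \<Omega>. \<phi> n (z - h *\<^sub>R b) * w'' z) \<ge> - (L2_norm \<Omega> w' * L2_norm \<Omega> (d n))"
      by (simp add: mult.commute)
    have "(LINT z|lebesgue_on \<Omega>. diff_quot b h (\<phi> n) z * w'' z)
        = (LINT z|lebesgue_on \<Omega>. (\<phi> n z * w'' z - \<phi> n (z - h *\<^sub>R b) * w'' z) / h)"
      by (intro Bochner_Integration.integral_cong) (auto simp: diff_quot_def left_diff_distrib)
    also have "\<dots> = ((LINT z|lebesgue_on \<Omega>. \<phi> n z * w'' z) - (LINT z|lebesgue_on \<Omega>. \<phi> n (z - h *\<^sub>R b) * w'' z)) / h"
      using L2_on_mult_integrable[OF L2_on_test_function[OF \<phi>(3)[of n] L] w''(2)]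
        L2_on_mult_integrable[OF L2_on_test_function[OF T L] w''(2)] by simp
    also have "\<dots> \<le> (L2_norm \<Omega> w' * L2_norm \<Omega> (d n) - (LINT z|lebesgue_on \<Omega>. d n z * w' z)) / h"
      using 1 2 h by (intro divide_right_mono) auto
    finally show ?thesis .
  qed
  define \<rho> where "\<rho> h n = L2_norm \<Omega> (\<lambda>z. diff_quot b h (\<phi> n) z - d n z)" for h n
  \<comment> \<open>The quotient error of \<open>\<phi> n\<close> must be small uniformly in n while
    h is fixed. Comparison with a fixed \<open>\<phi> N\<close> achieves this, as quotients of the
    difference are bounded by its derivative.\<close>
  have \<rho>_le: "\<rho> h n \<le> \<rho> h N + 2 * L2_norm \<Omega> (\<lambda>z. d n z - d N z)" if h: "0 < h" "h \<le> 1" for h n N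
  proof -
    define \<psi> where "\<psi> = (\<lambda>z. \<phi> n z - \<phi> N z)"
    have \<psi>: "test_function \<Omega> \<psi>" unfolding \<psi>_def by (intro test_function_diff \<phi>)
    have d\<psi>: "dir_deriv b \<psi> = (\<lambda>z. d n z - d N z)"
      unfolding \<psi>_def d_def by (intro dir_deriv_diff test_function_smooth[OF \<phi>(3)] b)
    have q\<psi>: "L2_on \<Omega> (diff_quot b h \<psi>)"
      using h by (intro L2_on_test_function[OF test_function_diff_quot[OF \<psi>] L]) simp
    have dd: "L2_on \<Omega> (\<lambda>z. d n z - d N z)" by (intro L2_on_diff dL)
    have "(\<lambda>z. diff_quot b h (\<phi> n) z - d n z)
        = (\<lambda>z. (diff_quot b h (\<phi> N) z - d N z) + (diff_quot b h \<psi> z - (d n z - d N z)))"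
      by (auto simp: diff_quot_def \<psi>_def diff_divide_distrib fun_eq_iff)
    then have "\<rho> h n \<le> \<rho> h N + L2_norm \<Omega> (\<lambda>z. diff_quot b h \<psi> z - (d n z - d N z))"
      using L2_norm_triangle[OF L2_on_diff[OF qL[OF h(1), of N] dL[of N]] L2_on_diff[OF q\<psi> dd]]
      by (simp only: \<rho>_def)
    also have "L2_norm \<Omega> (\<lambda>z. diff_quot b h \<psi> z - (d n z - d N z)) \<le> L2_norm \<Omega> (diff_quot b h \<psi>) + L2_norm \<Omega> (\<lambda>z. d n z - d N z)"
      by (rule L2_norm_triangle_diff[OF q\<psi> dd])
    also have "L2_norm \<Omega> (diff_quot b h \<psi>) \<le> L2_norm \<Omega> (\<lambda>z. d n z - d N z)"
      using diff_quot_norm_le[OF \<psi> h] by (simp add: d\<psi>)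
    finally show ?thesis by simp
  qed
  \<comment> \<open>Order of the limits: n tends to infinity here for fixed h and N, then h tends to
    0 in \<open>step2\<close>, and N to infinity at the end.\<close>
  have step1: "I \<le> (\<rho> h N + 2 * L2_norm \<Omega> (\<lambda>z. w' z - d N z)) * L2_norm \<Omega> w''" if h: "0 < h" "h \<le> 1" for h N
  proof -
    let ?e = "\<lambda>n. (L2_norm \<Omega> w' * L2_norm \<Omega> (d n) - (LINT z|lebesgue_on \<Omega>. d n z * w' z)) / h"
    have "(\<lambda>n. ?e n) \<longlonglongrightarrow> (L2_norm \<Omega> w' * L2_norm \<Omega> w' - (LINT z|lebesgue_on \<Omega>. w' z * w' z)) / h"
      using h by (intro tendsto_intros L2_tendsto_norm[OF dL \<phi>(2) dlim] L2_tendsto_inner[OF dL \<phi>(2) \<phi>(2) dlim]) simp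
    also have "(L2_norm \<Omega> w' * L2_norm \<Omega> w' - (LINT z|lebesgue_on \<Omega>. w' z * w' z)) / h = 0"
      using L2_norm_power2[of \<Omega> w'] by (simp add: power2_eq_square)
    finally have e: "?e \<longlonglongrightarrow> 0" .
    have dw: "(\<lambda>n. L2_norm \<Omega> (\<lambda>z. d n z - d N z)) \<longlonglongrightarrow> L2_norm \<Omega> (\<lambda>z. w' z - d N z)"
      by (rule L2_tendsto_norm[OF L2_on_diff[OF dL dL] L2_on_diff[OF \<phi>(2) dL]]) (use dlim in simp)
    have lim: "(\<lambda>n. ?e n + (\<rho> h N + 2 * L2_norm \<Omega> (\<lambda>z. d n z - d N z)) * L2_norm \<Omega> w'')
        \<longlonglongrightarrow> 0 + (\<rho> h N + 2 * L2_norm \<Omega> (\<lambda>z. w' z - d N z)) * L2_norm \<Omega> w''"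
      by (intro tendsto_intros e dw)
    have "(LINT z|lebesgue_on \<Omega>. d n z * w'' z) \<le> ?e n + (\<rho> h N + 2 * L2_norm \<Omega> (\<lambda>z. d n z - d N z)) * L2_norm \<Omega> w''" for n
    proof -
      have "(LINT z|lebesgue_on \<Omega>. (diff_quot b h (\<phi> n) z - d n z) * w'' z)
          = (LINT z|lebesgue_on \<Omega>. diff_quot b h (\<phi> n) z * w'' z) - (LINT z|lebesgue_on \<Omega>. d n z * w'' z)"
        using L2_on_mult_integrable[OF qL[OF h(1)] w''(2)] L2_on_mult_integrable[OF dL w''(2)]
        by (simp add: left_diff_distrib)
      moreover have "\<bar>LINT z|lebesgue_on \<Omega>. (diff_quot b h (\<phi> n) z - d n z) * w'' z\<bar> \<le> \<rho> h n * L2_norm \<Omega> w''"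
        unfolding \<rho>_def by (intro L2_Cauchy_Schwarz L2_on_diff qL h dL w'')
      moreover have "\<rho> h n * L2_norm \<Omega> w'' \<le> (\<rho> h N + 2 * L2_norm \<Omega> (\<lambda>z. d n z - d N z)) * L2_norm \<Omega> w''"
        by (intro mult_right_mono \<rho>_le h L2_norm_nonneg)
      ultimately show ?thesis
        using quot[OF h(1), of n] by linarith
    qed
    then show ?thesis
      using LIMSEQ_le[OF I_lim lim] by auto
  qed
  let ?h = "\<lambda>n. 1 / real (Suc n)"
  have h0: "?h \<longlonglongrightarrow> 0"
    using LIMSEQ_inverse_real_of_nat by (simp add: inverse_eq_divide)
  have "(\<lambda>n. (\<rho> (?h n) N + 2 * L2_norm \<Omega> (\<lambda>z. w' z - d N z)) * L2_norm \<Omega> w'')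
      \<longlonglongrightarrow> (0 + 2 * L2_norm \<Omega> (\<lambda>z. w' z - d N z)) * L2_norm \<Omega> w''" for N
    unfolding \<rho>_def d_def by (intro tendsto_intros diff_quot_tendsto[OF \<phi>(3) _ _ h0]) auto
  then have step2: "I \<le> (0 + 2 * L2_norm \<Omega> (\<lambda>z. w' z - d N z)) * L2_norm \<Omega> w''" for N
    by (rule LIMSEQ_le_const) (use step1 in auto)
  have "(\<lambda>N. (0 + 2 * L2_norm \<Omega> (\<lambda>z. d N z - w' z)) * L2_norm \<Omega> w'') \<longlonglongrightarrow> (0 + 2 * 0) * L2_norm \<Omega> w''"
    by (intro tendsto_intros dlim)
  then have "I \<le> (0 + 2 * 0) * L2_norm \<Omega> w''"
    by (rule LIMSEQ_le_const) (use step2 L2_norm_minus_commute[of \<Omega> w'] in auto)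
  then show ?thesis by (simp add: I_def)
qed

end

section \<open>Boundary layers\<close>

lemma set_integrable_continuous_Icc:
  fixes g :: "real \<Rightarrow> real"
  assumes "continuous_on UNIV g"
  shows "set_integrable lborel {a..b} g"
  unfolding set_integrable_def
  by (intro borel_integrable_compact continuous_on_subset[OF assms]) auto

lemma set_integral_const_Icc: "0 \<le> e \<Longrightarrow> (LINT r:{0..e}|lborel. (c::real)) = e * c"
  by (simp add: set_lebesgue_integral_def)

lemma set_integral_id_Icc:
  fixes e :: real
  assumes "0 \<le> e"
  shows "(LINT r:{0..e}|lborel. r) = e\<^sup>2 / 2"
proof -
  have "(LINT r|lborel. indicator {0..e} r *\<^sub>R r) = e\<^sup>2 / 2 - 0\<^sup>2 / 2"
    by (rule integral_FTC_atLeastAtMost[OF assms])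
       (auto intro!: derivative_eq_intros simp: has_real_derivative_iff_has_vector_derivative[symmetric])
  then show ?thesis by (simp add: set_lebesgue_integral_def)
qed

text \<open>Cauchy-Schwarz for c = F r - F 0, in the form of the inequality c F' <= c^2/(2r) + (r/2)
  F'^2, half of c^2 being absorbed on the left. The factor r is kept, not replaced by e, since
  integrating it later gains a factor 1/2.\<close>

lemma slice_difference_bound:
  fixes F F' :: "real \<Rightarrow> real"
  assumes D: "\<And>r. (F has_real_derivative F' r) (at r)" and cont: "continuous_on UNIV F'"
    and r: "0 \<le> r" "r \<le> e"
  shows "(F r - F 0)\<^sup>2 \<le> r * (LINT t:{0..e}|lborel. (F' t)\<^sup>2)"
proof (cases "r = 0")
  case False
  with r have r0: "r > 0" by simp
  define c where "c = F r - F 0"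
  have contsq: "continuous_on UNIV (\<lambda>t. (F' t)\<^sup>2)"
    by (intro continuous_intros cont)
  have "(LINT t|lborel. indicator {0..r} t *\<^sub>R F' t) = F r - F 0"
    using D by (intro integral_FTC_atLeastAtMost r continuous_on_subset[OF cont])
       (auto simp: has_real_derivative_iff_has_vector_derivative[symmetric] intro: has_field_derivative_at_within)
  then have FTC: "(LINT t:{0..r}|lborel. F' t) = c"
    by (simp add: set_lebesgue_integral_def c_def)
  have "c\<^sup>2 = (LINT t:{0..r}|lborel. c * F' t)"
    by (simp add: FTC power2_eq_square)
  also have "\<dots> \<le> (LINT t:{0..r}|lborel. c\<^sup>2 / (2 * r) + (r / 2) * (F' t)\<^sup>2)"
  proof (rule set_integral_mono)
    show "set_integrable lborel {0..r} (\<lambda>t. c * F' t)"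
      by (intro set_integrable_continuous_Icc continuous_intros cont)
    show "set_integrable lborel {0..r} (\<lambda>t. c\<^sup>2 / (2 * r) + (r / 2) * (F' t)\<^sup>2)"
      by (intro set_integrable_continuous_Icc continuous_intros cont)
    show "c * F' t \<le> c\<^sup>2 / (2 * r) + (r / 2) * (F' t)\<^sup>2" for t
    proof -
      have "0 \<le> (c - r * F' t)\<^sup>2 / (2 * r)" using r0 by simp
      also have "\<dots> = c\<^sup>2 / (2 * r) + (r / 2) * (F' t)\<^sup>2 - c * F' t"
        using r0 by (simp add: field_simps power2_eq_square)
      finally show ?thesis by simp
    qed
  qed
  also have "\<dots> = (LINT t:{0..r}|lborel. c\<^sup>2 / (2 * r)) + (LINT t:{0..r}|lborel. (r / 2) * (F' t)\<^sup>2)"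
    by (intro set_integral_add set_integrable_continuous_Icc continuous_intros cont)
  also have "\<dots> = c\<^sup>2 / 2 + (r / 2) * (LINT t:{0..r}|lborel. (F' t)\<^sup>2)"
    using r0 by (simp add: set_integral_const_Icc)
  also have "(LINT t:{0..r}|lborel. (F' t)\<^sup>2) \<le> (LINT t:{0..e}|lborel. (F' t)\<^sup>2)"
    unfolding set_lebesgue_integral_def
    using set_integrable_continuous_Icc[OF contsq, of 0 r] set_integrable_continuous_Icc[OF contsq, of 0 e] r(2)
    by (intro integral_mono) (auto simp: set_integrable_def indicator_def)
  finally have "c\<^sup>2 \<le> c\<^sup>2 / 2 + (r / 2) * (LINT t:{0..e}|lborel. (F' t)\<^sup>2)"
    using r0 by (simp add: mult_left_mono)
  then show ?thesis by (simp add: c_def)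
qed simp

text \<open>The split of the square into 5 (F 0)^2 and 5/4 (F r - F 0)^2 is deliberately uneven. The
  first term disappears for zero traces, while the second fixes the constant 5/8 of the Poincare
  inequality; the even split with 2 and 2 would give 1 there, too weak for the decay rate by this
  route.\<close>

lemma slice_upper_bound:
  fixes F F' :: "real \<Rightarrow> real"
  assumes D: "\<And>r. (F has_real_derivative F' r) (at r)" and cont: "continuous_on UNIV F'" and e: "0 \<le> e"
  shows "(LINT r:{0..e}|lborel. (F r)\<^sup>2) \<le> 5 * e * (F 0)\<^sup>2 + 5 / 8 * e\<^sup>2 * (LINT r:{0..e}|lborel. (F' r)\<^sup>2)"
proof -
  define J where "J = (LINT r:{0..e}|lborel. (F' r)\<^sup>2)"
  have contF: "continuous_on UNIV F"
    using D by (intro DERIV_continuous_on[OF has_field_derivative_at_within])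
  have "(LINT r:{0..e}|lborel. (F r)\<^sup>2) \<le> (LINT r:{0..e}|lborel. 5 * (F 0)\<^sup>2 + (5 / 4 * J) * r)"
  proof (rule set_integral_mono)
    show "set_integrable lborel {0..e} (\<lambda>r. (F r)\<^sup>2)"
      by (intro set_integrable_continuous_Icc continuous_intros contF)
    show "set_integrable lborel {0..e} (\<lambda>r. 5 * (F 0)\<^sup>2 + (5 / 4 * J) * r)"
      by (intro set_integrable_continuous_Icc continuous_intros)
    fix r assume "r \<in> {0..e}"
    then have "(F r - F 0)\<^sup>2 \<le> r * J"
      unfolding J_def by (intro slice_difference_bound D cont) auto
    \<comment> \<open>The added square is chosen so that the mixed terms cancel.\<close>
    moreover have "(F r)\<^sup>2 + (2 * F 0 - 1 / 2 * (F r - F 0))\<^sup>2 = 5 * (F 0)\<^sup>2 + 5 / 4 * (F r - F 0)\<^sup>2"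
      by (simp add: power2_eq_square field_simps)
    then have "(F r)\<^sup>2 \<le> 5 * (F 0)\<^sup>2 + 5 / 4 * (F r - F 0)\<^sup>2"
      using zero_le_power2[of "2 * F 0 - 1 / 2 * (F r - F 0)"] by linarith
    moreover have "(5 / 4 * J) * r = 5 / 4 * (r * J)" by simp
    ultimately show "(F r)\<^sup>2 \<le> 5 * (F 0)\<^sup>2 + (5 / 4 * J) * r"
      by linarith
  qed
  also have "\<dots> = (LINT r:{0..e}|lborel. 5 * (F 0)\<^sup>2) + (LINT r:{0..e}|lborel. (5 / 4 * J) * r)"
    by (intro set_integral_add set_integrable_continuous_Icc continuous_intros)
  also have "\<dots> = 5 * e * (F 0)\<^sup>2 + 5 / 8 * e\<^sup>2 * J"
    using e by (simp add: set_integral_const_Icc set_integral_id_Icc)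
  finally show ?thesis by (simp add: J_def)
qed

text \<open>The converse direction: after division by e the boundary value is controlled by the mean
  square over the layer, which turns a layer norm of smaller order into a zero trace.\<close>

lemma slice_lower_bound:
  fixes F F' :: "real \<Rightarrow> real"
  assumes D: "\<And>r. (F has_real_derivative F' r) (at r)" and cont: "continuous_on UNIV F'" and e: "0 \<le> e"
  shows "e * (F 0)\<^sup>2 \<le> 2 * (LINT r:{0..e}|lborel. (F r)\<^sup>2) + e\<^sup>2 * (LINT r:{0..e}|lborel. (F' r)\<^sup>2)"
proof -
  define J where "J = (LINT r:{0..e}|lborel. (F' r)\<^sup>2)"
  have contF: "continuous_on UNIV F"
    using D by (intro DERIV_continuous_on[OF has_field_derivative_at_within])
  have "e * (F 0)\<^sup>2 = (LINT r:{0..e}|lborel. (F 0)\<^sup>2)"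
    using e by (simp add: set_integral_const_Icc)
  also have "\<dots> \<le> (LINT r:{0..e}|lborel. 2 * (F r)\<^sup>2 + (2 * J) * r)"
  proof (rule set_integral_mono)
    show "set_integrable lborel {0..e} (\<lambda>r. (F 0)\<^sup>2)"
      by (intro set_integrable_continuous_Icc continuous_intros)
    show "set_integrable lborel {0..e} (\<lambda>r. 2 * (F r)\<^sup>2 + (2 * J) * r)"
      by (intro set_integrable_continuous_Icc continuous_intros contF)
    fix r assume "r \<in> {0..e}"
    then have "(F r - F 0)\<^sup>2 \<le> r * J"
      unfolding J_def by (intro slice_difference_bound D cont) auto
    moreover have "(F 0)\<^sup>2 + (2 * F r - F 0)\<^sup>2 = 2 * (F r)\<^sup>2 + 2 * (F r - F 0)\<^sup>2"
      by (simp add: power2_eq_square field_simps)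
    then have "(F 0)\<^sup>2 \<le> 2 * (F r)\<^sup>2 + 2 * (F r - F 0)\<^sup>2"
      using zero_le_power2[of "2 * F r - F 0"] by linarith
    moreover have "(2 * J) * r = 2 * (r * J)" by simp
    ultimately show "(F 0)\<^sup>2 \<le> 2 * (F r)\<^sup>2 + (2 * J) * r"
      by linarith
  qed
  also have "\<dots> = (LINT r:{0..e}|lborel. 2 * (F r)\<^sup>2) + (LINT r:{0..e}|lborel. (2 * J) * r)"
    by (intro set_integral_add set_integrable_continuous_Icc continuous_intros contF)
  also have "\<dots> = 2 * (LINT r:{0..e}|lborel. (F r)\<^sup>2) + e\<^sup>2 * J"
    using e by (simp add: set_integral_id_Icc)
  finally show ?thesis by (simp add: J_def)
qed

text \<open>\<open>N\<close> is the layer of thickness \<open>e\<close> along the boundary piece \<open>p ` S\<close>, on the side to which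
  \<open>\<sigma> b\<close> points; the integral identity is Fubini's theorem in the coordinates \<open>(s, r)\<close> along and across
  the layer.\<close>

definition boundary_layer ::
    "(real \<Rightarrow> real \<times> real) \<Rightarrow> real \<Rightarrow> real \<times> real \<Rightarrow> real set \<Rightarrow> real \<Rightarrow> (real \<times> real) set \<Rightarrow> bool" where
  "boundary_layer p \<sigma> b S e N \<longleftrightarrow>
     N \<in> sets lebesgue \<and> S \<in> sets borel \<and> continuous_on UNIV p \<and> (\<forall>s. \<bar>s\<bar> \<le> norm (p s)) \<and> \<bar>\<sigma>\<bar> = 1 \<and> b \<in> Basis \<and> 0 < e \<and>
     (\<forall>h :: real \<times> real \<Rightarrow> real. continuous_on UNIV h \<longrightarrow> integrable lborel h \<longrightarrow>
        set_integrable lborel S (\<lambda>s. LINT r:{0..e}|lborel. h (p s + (\<sigma> * r) *\<^sub>R b)) \<and>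
        (LINT z|lebesgue_on N. h z) = (LINT s:S|lborel. LINT r:{0..e}|lborel. h (p s + (\<sigma> * r) *\<^sub>R b)))"

text \<open>The slice estimates, integrated along the boundary piece. The clause
  \<open>\<bar>s\<bar> \<le> norm (p s)\<close> of the definition confines
  \<open>\<phi> (p s)\<close> to a bounded set of s, hence it is square integrable even on an
  unbounded \<open>S\<close>; the sign \<open>\<sigma>\<close> drops out on squaring.\<close>

lemma boundary_layer_bounds:
  assumes layer: "boundary_layer p \<sigma> b S e N" and \<phi>: "test_function UNIV \<phi>"
  shows "(L2_norm N \<phi>)\<^sup>2 \<le> 5 * e * (L2_norm S (\<lambda>s. \<phi> (p s)))\<^sup>2 + 5 / 8 * e\<^sup>2 * (L2_norm N (dir_deriv b \<phi>))\<^sup>2"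
    and "e * (L2_norm S (\<lambda>s. \<phi> (p s)))\<^sup>2 \<le> 2 * (L2_norm N \<phi>)\<^sup>2 + e\<^sup>2 * (L2_norm N (dir_deriv b \<phi>))\<^sup>2"
    and "L2_on S (\<lambda>s. \<phi> (p s))"
proof -
  have L: "N \<in> sets lebesgue" "S \<in> sets borel" "continuous_on UNIV p" "\<And>s. \<bar>s\<bar> \<le> norm (p s)" "\<bar>\<sigma>\<bar> = 1" "b \<in> Basis" "0 < e"
    using layer by (auto simp: boundary_layer_def)
  obtain K where K: "smooth \<phi>" "compact K" "K \<subseteq> UNIV" "\<And>z. z \<notin> K \<Longrightarrow> \<phi> z = 0"
    using test_functionE[OF \<phi>] by blast
  obtain R where R: "\<And>z. z \<in> K \<Longrightarrow> norm z \<le> R"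
    using compact_imp_bounded[OF K(2)] unfolding bounded_iff by blast
  have d\<phi>: "test_function UNIV (dir_deriv b \<phi>)"
    by (rule test_function_dir_deriv[OF \<phi> L(6)])
  have sq: "continuous_on UNIV (\<lambda>z. (\<psi> z)\<^sup>2)" "integrable lborel (\<lambda>z. (\<psi> z)\<^sup>2)" if "test_function UNIV \<psi>" for \<psi> :: "real \<times> real \<Rightarrow> real"
    using integrable_lborel_test_function[OF test_function_mult_smooth[OF that test_function_smooth[OF that]]]
      smooth_continuous[OF test_function_smooth[OF that], of UNIV]
    by (auto simp: power2_eq_square intro: continuous_intros)
  define A where "A s = (LINT r:{0..e}|lborel. (\<phi> (p s + (\<sigma> * r) *\<^sub>R b))\<^sup>2)" for s
  define A' where "A' s = (LINT r:{0..e}|lborel. (dir_deriv b \<phi> (p s + (\<sigma> * r) *\<^sub>R b))\<^sup>2)" for s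
  have A: "set_integrable lborel S A" "(L2_norm N \<phi>)\<^sup>2 = (LINT s:S|lborel. A s)"
    using layer sq[OF \<phi>] unfolding boundary_layer_def L2_norm_power2 A_def[abs_def] by blast+
  have A': "set_integrable lborel S A'" "(L2_norm N (dir_deriv b \<phi>))\<^sup>2 = (LINT s:S|lborel. A' s)"
    using layer sq[OF d\<phi>] unfolding boundary_layer_def L2_norm_power2 A'_def[abs_def] by blast+
  have contp: "continuous_on UNIV (\<lambda>s. (\<phi> (p s))\<^sup>2)"
    by (intro continuous_intros continuous_on_compose2[OF smooth_continuous[OF K(1), of UNIV] L(3)]) auto
  have "integrable lborel (\<lambda>s. indicator (cball 0 R) s *\<^sub>R (\<phi> (p s))\<^sup>2)"
    by (intro borel_integrable_compact continuous_on_subset[OF contp]) auto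
  moreover have "(\<lambda>s. indicator (cball 0 R) s *\<^sub>R (\<phi> (p s))\<^sup>2) = (\<lambda>s. (\<phi> (p s))\<^sup>2)"
  proof
    fix s
    show "indicator (cball 0 R) s *\<^sub>R (\<phi> (p s))\<^sup>2 = (\<phi> (p s))\<^sup>2"
    proof (cases "p s \<in> K")
      case True
      then have "\<bar>s\<bar> \<le> R" using R[of "p s"] L(4)[of s] by linarith
      then show ?thesis by simp
    qed (simp add: K(4))
  qed
  ultimately have int_p: "integrable lborel (\<lambda>s. (\<phi> (p s))\<^sup>2)" by simp
  then have p: "set_integrable lborel S (\<lambda>s. (\<phi> (p s))\<^sup>2)"
    unfolding set_integrable_def using L(2) by (intro integrable_mult_indicator) auto
  have S: "S \<in> sets lebesgue" using L(2) by (intro sets_completionI_sets) simp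
  have "(L2_norm S (\<lambda>s. \<phi> (p s)))\<^sup>2 = (LINT s|lebesgue. indicator S s *\<^sub>R (\<phi> (p s))\<^sup>2)"
    unfolding L2_norm_power2 using S by (simp add: integral_restrict_space)
  also have "\<dots> = (LINT s:S|lborel. (\<phi> (p s))\<^sup>2)"
    unfolding set_lebesgue_integral_def using p
    by (intro integral_completion) (simp add: set_integrable_def borel_measurable_integrable)
  finally have P: "(L2_norm S (\<lambda>s. \<phi> (p s)))\<^sup>2 = (LINT s:S|lborel. (\<phi> (p s))\<^sup>2)" .
  show "L2_on S (\<lambda>s. \<phi> (p s))"
    unfolding L2_on_def
  proof
    have "continuous_on UNIV (\<lambda>s. \<phi> (p s))"
      by (rule continuous_on_compose2[OF smooth_continuous[OF K(1), of UNIV] L(3)]) simp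
    then show "(\<lambda>s. \<phi> (p s)) \<in> borel_measurable (lebesgue_on S)"
      by (intro borel_imp_lebesgue_on_measurable borel_measurable_continuous_onI)
    have "integrable lebesgue (\<lambda>s. indicator S s *\<^sub>R (\<phi> (p s))\<^sup>2)"
      using p by (subst integrable_completion) (auto simp: set_integrable_def dest: borel_measurable_integrable)
    then show "integrable (lebesgue_on S) (\<lambda>s. (\<phi> (p s))\<^sup>2)"
      using S by (simp add: integrable_restrict_space)
  qed
  have D: "((\<lambda>r. \<phi> (p s + (\<sigma> * r) *\<^sub>R b)) has_real_derivative \<sigma> * dir_deriv b \<phi> (p s + (\<sigma> * r) *\<^sub>R b)) (at r)" for s r
    using DERIV_chain2[where f = "\<lambda>r. \<phi> (p s + r *\<^sub>R b)" and g = "\<lambda>r. \<sigma> * r", OF smooth_DERIV[OF K(1) L(6)] DERIV_cmult_Id]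
    by (simp add: mult.commute[of _ \<sigma>])
  have cont: "continuous_on UNIV (\<lambda>r. \<sigma> * dir_deriv b \<phi> (p s + (\<sigma> * r) *\<^sub>R b))" for s
    by (intro continuous_intros continuous_on_compose2[OF smooth_continuous[OF smooth_dir_deriv[OF K(1) L(6)], of UNIV]]) auto
  have \<sigma>: "\<sigma>\<^sup>2 = 1" using L(5) by (metis power2_abs one_power2)
  have up: "A s \<le> (5 * e) * (\<phi> (p s))\<^sup>2 + (5 / 8 * e\<^sup>2) * A' s" for s
    using slice_upper_bound[OF D[of s] cont[of s], of e] L(7) by (simp add: A_def A'_def power_mult_distrib \<sigma>)
  have low: "e * (\<phi> (p s))\<^sup>2 \<le> 2 * A s + e\<^sup>2 * A' s" for s
    using slice_lower_bound[OF D[of s] cont[of s], of e] L(7) by (simp add: A_def A'_def power_mult_distrib \<sigma>)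
  have "(LINT s:S|lborel. A s) \<le> (LINT s:S|lborel. (5 * e) * (\<phi> (p s))\<^sup>2 + (5 / 8 * e\<^sup>2) * A' s)"
    by (intro set_integral_mono up A set_integral_add(1) set_integrable_mult_right A'(1) p)
  also have "\<dots> = (LINT s:S|lborel. (5 * e) * (\<phi> (p s))\<^sup>2) + (LINT s:S|lborel. (5 / 8 * e\<^sup>2) * A' s)"
    by (intro set_integral_add set_integrable_mult_right A'(1) p)
  finally show "(L2_norm N \<phi>)\<^sup>2 \<le> 5 * e * (L2_norm S (\<lambda>s. \<phi> (p s)))\<^sup>2 + 5 / 8 * e\<^sup>2 * (L2_norm N (dir_deriv b \<phi>))\<^sup>2"
    unfolding A A' P by simp
  have "(LINT s:S|lborel. e * (\<phi> (p s))\<^sup>2) \<le> (LINT s:S|lborel. 2 * A s + e\<^sup>2 * A' s)"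
    by (intro set_integral_mono low set_integral_add(1) set_integrable_mult_right A(1) A'(1) p)
  also have "\<dots> = (LINT s:S|lborel. 2 * A s) + (LINT s:S|lborel. e\<^sup>2 * A' s)"
    by (intro set_integral_add set_integrable_mult_right A(1) A'(1))
  finally show "e * (L2_norm S (\<lambda>s. \<phi> (p s)))\<^sup>2 \<le> 2 * (L2_norm N \<phi>)\<^sup>2 + e\<^sup>2 * (L2_norm N (dir_deriv b \<phi>))\<^sup>2"
    unfolding A A' P by simp
qed

lemma L2_norm_tendsto_subset:
  assumes \<phi>: "\<And>n. L2_on \<Omega> (\<phi> n)" and f: "L2_on \<Omega> f"
    and lim: "(\<lambda>n. L2_norm \<Omega> (\<lambda>z. \<phi> n z - f z)) \<longlonglongrightarrow> 0"
    and N: "N \<in> sets lebesgue" "\<Omega> \<in> sets lebesgue" "N \<subseteq> \<Omega>"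
  shows "(\<lambda>n. L2_norm N (\<phi> n)) \<longlonglongrightarrow> L2_norm N f"
proof (rule L2_tendsto_norm)
  show "L2_on N (\<phi> n)" "L2_on N f" for n
    by (intro L2_on_subset[OF \<phi> N] L2_on_subset[OF f N])+
  show "(\<lambda>n. L2_norm N (\<lambda>z. \<phi> n z - f z)) \<longlonglongrightarrow> 0"
    by (rule Lim_null_comparison[OF always_eventually lim])
       (use L2_norm_subset[OF L2_on_diff[OF \<phi> f] N] in \<open>simp add: L2_norm_nonneg\<close>)
qed

text \<open>Limit of the upper slice bound along approximants whose boundary values tend to
  zero.\<close>

lemma boundary_layer_zero_trace:
  assumes layer: "boundary_layer p \<sigma> b S e N" and N: "N \<subseteq> \<Omega>" "\<Omega> \<in> sets lebesgue"
    and \<phi>: "\<And>n. test_function UNIV (\<phi> n)" and f: "L2_on \<Omega> f" "L2_on \<Omega> f'"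
    and lim: "(\<lambda>n. L2_norm \<Omega> (\<lambda>z. \<phi> n z - f z)) \<longlonglongrightarrow> 0" "(\<lambda>n. L2_norm \<Omega> (\<lambda>z. dir_deriv b (\<phi> n) z - f' z)) \<longlonglongrightarrow> 0"
    and tr: "(\<lambda>n. L2_norm S (\<lambda>s. \<phi> n (p s))) \<longlonglongrightarrow> 0"
  shows "(L2_norm N f)\<^sup>2 \<le> 5 / 8 * e\<^sup>2 * (L2_norm N f')\<^sup>2"
proof -
  have b: "b \<in> Basis" and NL: "N \<in> sets lebesgue" using layer by (auto simp: boundary_layer_def)
  have "(\<lambda>n. (L2_norm N (\<phi> n))\<^sup>2) \<longlonglongrightarrow> (L2_norm N f)\<^sup>2"
    by (intro tendsto_power L2_norm_tendsto_subset[OF L2_on_test_function[OF \<phi> N(2)] f(1) lim(1) NL N(2,1)])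
  moreover have "(\<lambda>n. 5 * e * (L2_norm S (\<lambda>s. \<phi> n (p s)))\<^sup>2 + 5 / 8 * e\<^sup>2 * (L2_norm N (dir_deriv b (\<phi> n)))\<^sup>2)
      \<longlonglongrightarrow> 5 * e * 0\<^sup>2 + 5 / 8 * e\<^sup>2 * (L2_norm N f')\<^sup>2"
    by (intro tendsto_intros tr
          L2_norm_tendsto_subset[OF L2_on_test_function[OF test_function_dir_deriv[OF \<phi> b] N(2)] f(2) lim(2) NL N(2,1)])
  ultimately have "(L2_norm N f)\<^sup>2 \<le> 5 * e * 0\<^sup>2 + 5 / 8 * e\<^sup>2 * (L2_norm N f')\<^sup>2"
    by (rule LIMSEQ_le) (use boundary_layer_bounds(1)[OF layer \<phi>] in blast)
  then show ?thesis by simp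
qed

text \<open>Limit of the lower slice bound divided by \<open>e m\<close>: m is fixed first so that
  the bound for f lies below \<open>\<delta>\<close>, then n tends to infinity. The conclusion is
  about the given approximants, so no trace of f has to be defined.\<close>

lemma zero_trace_from_boundary_layer:
  assumes layer: "\<And>m::nat. boundary_layer p \<sigma> b S (e m) (N m)" and N: "\<And>m. N m \<subseteq> \<Omega>" "\<Omega> \<in> sets lebesgue"
    and e: "e \<longlonglongrightarrow> 0"
    and \<phi>: "\<And>n. test_function UNIV (\<phi> n)" and f: "L2_on \<Omega> f" "L2_on \<Omega> f'"
    and lim: "(\<lambda>n. L2_norm \<Omega> (\<lambda>z. \<phi> n z - f z)) \<longlonglongrightarrow> 0" "(\<lambda>n. L2_norm \<Omega> (\<lambda>z. dir_deriv b (\<phi> n) z - f' z)) \<longlonglongrightarrow> 0"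
    and small: "(\<lambda>m. (L2_norm (N m) f)\<^sup>2 / e m) \<longlonglongrightarrow> 0"
  shows "(\<lambda>n. L2_norm S (\<lambda>s. \<phi> n (p s))) \<longlonglongrightarrow> 0"
proof -
  have b: "b \<in> Basis" and NL: "\<And>m. N m \<in> sets lebesgue" and e0: "\<And>m. 0 < e m"
    using layer by (auto simp: boundary_layer_def)
  define T where "T n = L2_norm S (\<lambda>s. \<phi> n (p s))" for n
  have "(\<lambda>n. (T n)\<^sup>2) \<longlonglongrightarrow> 0"
  proof (rule LIMSEQ_I)
    fix \<delta> :: real assume \<delta>: "\<delta> > 0"
    have "(\<lambda>m. 2 * ((L2_norm (N m) f)\<^sup>2 / e m) + e m * (L2_norm \<Omega> f')\<^sup>2) \<longlonglongrightarrow> 2 * 0 + 0 * (L2_norm \<Omega> f')\<^sup>2"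
      by (intro tendsto_intros small e)
    then have "\<forall>\<^sub>F m in sequentially. 2 * ((L2_norm (N m) f)\<^sup>2 / e m) + e m * (L2_norm \<Omega> f')\<^sup>2 < \<delta>"
      using \<delta> by (intro order_tendstoD(2)) auto
    then obtain m where m: "2 * ((L2_norm (N m) f)\<^sup>2 / e m) + e m * (L2_norm \<Omega> f')\<^sup>2 < \<delta>"
      by (auto simp: eventually_sequentially)
    have "(L2_norm (N m) f')\<^sup>2 \<le> (L2_norm \<Omega> f')\<^sup>2"
      by (intro power_mono L2_norm_subset[OF f(2) NL N(2,1)] L2_norm_nonneg)
    then have "e m * (L2_norm (N m) f')\<^sup>2 \<le> e m * (L2_norm \<Omega> f')\<^sup>2"
      using e0[of m] by (intro mult_left_mono) auto
    then have lt: "2 * ((L2_norm (N m) f)\<^sup>2 / e m) + e m * (L2_norm (N m) f')\<^sup>2 < \<delta>"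
      using m by linarith
    have "(\<lambda>n. 2 * ((L2_norm (N m) (\<phi> n))\<^sup>2 / e m) + e m * (L2_norm (N m) (dir_deriv b (\<phi> n)))\<^sup>2)
        \<longlonglongrightarrow> 2 * ((L2_norm (N m) f)\<^sup>2 / e m) + e m * (L2_norm (N m) f')\<^sup>2"
      using e0[of m]
      by (intro tendsto_intros L2_norm_tendsto_subset[OF L2_on_test_function[OF \<phi> N(2)] f(1) lim(1) NL N(2,1)]
          L2_norm_tendsto_subset[OF L2_on_test_function[OF test_function_dir_deriv[OF \<phi> b] N(2)] f(2) lim(2) NL N(2,1)]) auto
    then have "\<forall>\<^sub>F n in sequentially. 2 * ((L2_norm (N m) (\<phi> n))\<^sup>2 / e m) + e m * (L2_norm (N m) (dir_deriv b (\<phi> n)))\<^sup>2 < \<delta>"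
      using lt by (rule order_tendstoD(2))
    moreover have "(T n)\<^sup>2 \<le> 2 * ((L2_norm (N m) (\<phi> n))\<^sup>2 / e m) + e m * (L2_norm (N m) (dir_deriv b (\<phi> n)))\<^sup>2" for n
      using boundary_layer_bounds(2)[OF layer[of m] \<phi>[of n]] e0[of m]
      by (simp add: T_def field_simps power2_eq_square)
    ultimately have "\<forall>\<^sub>F n in sequentially. (T n)\<^sup>2 < \<delta>"
      by (elim eventually_mono) (meson le_less_trans)
    then show "\<exists>no. \<forall>n\<ge>no. norm ((T n)\<^sup>2 - 0) < \<delta>"
      by (simp add: eventually_sequentially)
  qed
  then have "(\<lambda>n. sqrt ((T n)\<^sup>2)) \<longlonglongrightarrow> sqrt 0"
    by (rule tendsto_real_sqrt)
  then show ?thesis by (simp add: T_def L2_norm_nonneg)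
qed

section \<open>The layers along the three edges\<close>

lemma set_integral_Ioo_eq_Icc:
  fixes g :: "real \<Rightarrow> real"
  assumes "g \<in> borel_measurable borel"
  shows "(LINT r:{a<..<b}|lborel. g r) = (LINT r:{a..b}|lborel. g r)"
  unfolding set_lebesgue_integral_def
proof (rule integral_cong_AE)
  show "AE r in lborel. indicator {a<..<b} r *\<^sub>R g r = indicator {a..b} r *\<^sub>R g r"
    using AE_lborel_singleton[of a] AE_lborel_singleton[of b]
    by eventually_elim (auto simp: indicator_def)
qed (use assms in measurable)

text \<open>Both orders of integration are recorded: along the horizontal edges the boundary
  parameter is x, along the left edge it is y.\<close>

lemma integral_lebesgue_on_Times:
  fixes h :: "real \<times> real \<Rightarrow> real"
  assumes S: "S \<in> sets borel" and T: "T \<in> sets borel" and h: "integrable lborel h"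
  shows "S \<times> T \<in> sets lebesgue"
    and "set_integrable lborel S (\<lambda>s. LINT r:T|lborel. h (s, r))"
    and "(LINT z|lebesgue_on (S \<times> T). h z) = (LINT s:S|lborel. LINT r:T|lborel. h (s, r))"
    and "set_integrable lborel T (\<lambda>r. LINT s:S|lborel. h (s, r))"
    and "(LINT z|lebesgue_on (S \<times> T). h z) = (LINT r:T|lborel. LINT s:S|lborel. h (s, r))"
proof -
  have ST: "S \<times> T \<in> sets lborel"
    unfolding lborel_prod[symmetric] using S T by (intro pair_measureI) auto
  then show L: "S \<times> T \<in> sets lebesgue" by (rule sets_completionI_sets)
  define g where "g z = indicator (S \<times> T) z *\<^sub>R h z" for z
  have g: "integrable lborel g"
    unfolding g_def using ST h by (rule integrable_mult_indicator)
  have gprod: "integrable (lborel \<Otimes>\<^sub>M lborel) g" using g by (simp add: lborel_prod)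
  have gprod': "integrable (lborel \<Otimes>\<^sub>M lborel) (\<lambda>(s, r). g (s, r))" using gprod by simp
  have split1: "g (s, r) = indicator S s *\<^sub>R (indicator T r *\<^sub>R h (s, r))" for s r
    by (auto simp: g_def indicator_def)
  have split2: "g (s, r) = indicator T r *\<^sub>R (indicator S s *\<^sub>R h (s, r))" for s r
    by (auto simp: g_def indicator_def)
  have "(LINT z|lebesgue_on (S \<times> T). h z) = (LINT z|lebesgue. g z)"
    using L by (simp add: integral_restrict_space g_def)
  also have "\<dots> = (LINT z|lborel. g z)"
    using g by (intro integral_completion) (simp add: borel_measurable_integrable)
  finally have eq: "(LINT z|lebesgue_on (S \<times> T). h z) = (LINT z|(lborel \<Otimes>\<^sub>M lborel). g z)"
    by (simp add: lborel_prod)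
  have in1: "(LINT r|lborel. g (s, r)) = indicator S s *\<^sub>R (LINT r:T|lborel. h (s, r))" for s
    unfolding split1 set_lebesgue_integral_def by simp
  have in2: "(LINT s|lborel. g (s, r)) = indicator T r *\<^sub>R (LINT s:S|lborel. h (s, r))" for r
    unfolding split2 set_lebesgue_integral_def by simp
  show "set_integrable lborel S (\<lambda>s. LINT r:T|lborel. h (s, r))"
    using lborel_pair.integrable_fst'[OF gprod] by (simp add: set_integrable_def in1)
  show "(LINT z|lebesgue_on (S \<times> T). h z) = (LINT s:S|lborel. LINT r:T|lborel. h (s, r))"
    unfolding eq using lborel_pair.integral_fst'[OF gprod] by (simp add: set_lebesgue_integral_def[of _ S] in1)
  show "set_integrable lborel T (\<lambda>r. LINT s:S|lborel. h (s, r))"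
    using lborel_pair.integrable_snd[OF gprod'] by (simp add: set_integrable_def in2)
  show "(LINT z|lebesgue_on (S \<times> T). h z) = (LINT r:T|lborel. LINT s:S|lborel. h (s, r))"
    unfolding eq using lborel_pair.integral_snd[OF gprod'] by (simp add: set_lebesgue_integral_def[of _ T] in2)
qed

lemma borel_measurable_slice:
  fixes h :: "real \<times> real \<Rightarrow> real"
  assumes "continuous_on UNIV h"
  shows "(\<lambda>r. h (s, r)) \<in> borel_measurable borel" "(\<lambda>r. h (r, s)) \<in> borel_measurable borel"
  by (intro borel_measurable_continuous_onI continuous_on_compose2[OF assms] continuous_intros; simp)+

lemma boundary_layer_left:
  assumes "0 < e"
  shows "boundary_layer (\<lambda>y. (0, y)) 1 (1, 0) {c<..<d} e ({0<..<e} \<times> {c<..<d})"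
  unfolding boundary_layer_def
proof (intro conjI allI impI)
  show "{0<..<e} \<times> {c<..<d} \<in> sets lebesgue"
    by (intro open_imp_lebesgue open_Times) auto
  fix h :: "real \<times> real \<Rightarrow> real" assume h: "continuous_on UNIV h" "integrable lborel h"
  have eq: "(LINT r:{0<..<e}|lborel. h (r, s)) = (LINT r:{0..e}|lborel. h ((0, s) + (1 * r) *\<^sub>R (1, 0)))" for s
    using set_integral_Ioo_eq_Icc[OF borel_measurable_slice(2)[OF h(1)]] by simp
  show "set_integrable lborel {c<..<d} (\<lambda>s. LINT r:{0..e}|lborel. h ((0, s) + (1 * r) *\<^sub>R (1, 0)))"
    unfolding eq[symmetric] by (intro integral_lebesgue_on_Times h) auto
  show "(LINT z|lebesgue_on ({0<..<e} \<times> {c<..<d}). h z)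
      = (LINT s:{c<..<d}|lborel. LINT r:{0..e}|lborel. h ((0, s) + (1 * r) *\<^sub>R (1, 0)))"
    unfolding eq[symmetric] by (intro integral_lebesgue_on_Times h) auto
qed (use assms in \<open>auto simp: norm_Pair intro!: continuous_intros\<close>)

lemma abs_le_norm_Pair: "\<bar>s\<bar> \<le> norm (s, t::real)"
  using norm_fst_le[of s t] by simp

lemma boundary_layer_bottom:
  assumes "0 < e"
  shows "boundary_layer (\<lambda>x. (x, 0)) 1 (0, 1) {0<..} e ({0<..} \<times> {0<..<e})"
  unfolding boundary_layer_def
proof (intro conjI allI impI)
  show "{0::real<..} \<times> {0<..<e} \<in> sets lebesgue"
    by (intro open_imp_lebesgue open_Times) auto
  fix h :: "real \<times> real \<Rightarrow> real" assume h: "continuous_on UNIV h" "integrable lborel h"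
  have eq: "(LINT r:{0<..<e}|lborel. h (s, r)) = (LINT r:{0..e}|lborel. h ((s, 0) + (1 * r) *\<^sub>R (0, 1)))" for s
    using set_integral_Ioo_eq_Icc[OF borel_measurable_slice(1)[OF h(1)]] by simp
  show "set_integrable lborel {0<..} (\<lambda>s. LINT r:{0..e}|lborel. h ((s, 0) + (1 * r) *\<^sub>R (0, 1)))"
    unfolding eq[symmetric] by (intro integral_lebesgue_on_Times h) auto
  show "(LINT z|lebesgue_on ({0<..} \<times> {0<..<e}). h z)
      = (LINT s:{0<..}|lborel. LINT r:{0..e}|lborel. h ((s, 0) + (1 * r) *\<^sub>R (0, 1)))"
    unfolding eq[symmetric] by (intro integral_lebesgue_on_Times h) auto
qed (use assms in \<open>auto simp: abs_le_norm_Pair intro!: continuous_intros\<close>)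

lemma boundary_layer_top:
  assumes "0 < e"
  shows "boundary_layer (\<lambda>x. (x, B)) (- 1) (0, 1) {0<..} e ({0<..} \<times> {B - e<..<B})"
  unfolding boundary_layer_def
proof (intro conjI allI impI)
  show "{0::real<..} \<times> {B - e<..<B} \<in> sets lebesgue"
    by (intro open_imp_lebesgue open_Times) auto
  fix h :: "real \<times> real \<Rightarrow> real" assume h: "continuous_on UNIV h" "integrable lborel h"
  have eq: "(LINT r:{B - e<..<B}|lborel. h (s, r)) = (LINT r:{0..e}|lborel. h ((s, B) + (- 1 * r) *\<^sub>R (0, 1)))" for s
  proof -
    have "(LINT r:{B - e<..<B}|lborel. h (s, r)) = (LINT r:{B - e..B}|lborel. h (s, r))"
      by (rule set_integral_Ioo_eq_Icc[OF borel_measurable_slice(1)[OF h(1)]])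
    \<comment> \<open>Reflection of r to B - r, so that r measures the distance from the edge y =
      B.\<close>
    also have "\<dots> = (LINT r|lborel. indicator {B - e..B} (B + - 1 * r) *\<^sub>R h (s, B + - 1 * r))"
      unfolding set_lebesgue_integral_def
      using lborel_integral_real_affine[of "- 1" "\<lambda>r. indicator {B - e..B} r *\<^sub>R h (s, r)" B] by simp
    also have "\<dots> = (LINT r:{0..e}|lborel. h ((s, B) + (- 1 * r) *\<^sub>R (0, 1)))"
      unfolding set_lebesgue_integral_def
      by (intro Bochner_Integration.integral_cong) (auto simp: indicator_def)
    finally show ?thesis .
  qed
  show "set_integrable lborel {0<..} (\<lambda>s. LINT r:{0..e}|lborel. h ((s, B) + (- 1 * r) *\<^sub>R (0, 1)))"
    unfolding eq[symmetric] by (intro integral_lebesgue_on_Times h) auto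
  show "(LINT z|lebesgue_on ({0<..} \<times> {B - e<..<B}). h z)
      = (LINT s:{0<..}|lborel. LINT r:{0..e}|lborel. h ((s, B) + (- 1 * r) *\<^sub>R (0, 1)))"
    unfolding eq[symmetric] by (intro integral_lebesgue_on_Times h) auto
qed (use assms in \<open>auto simp: abs_le_norm_Pair intro!: continuous_intros\<close>)

section \<open>Traces on the half strip\<close>

lemma L2_norm_supported_mult:
  assumes f: "L2_on \<Omega> f" and h: "h \<in> borel_measurable (lebesgue_on \<Omega>)" "\<And>z. \<bar>h z\<bar> \<le> K" "0 \<le> K"
    and N: "N \<in> sets lebesgue" "\<Omega> \<in> sets lebesgue" "N \<subseteq> \<Omega>" "\<And>z. z \<in> \<Omega> \<Longrightarrow> z \<notin> N \<Longrightarrow> h z = 0"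
  shows "L2_norm \<Omega> (\<lambda>z. h z * f z) \<le> K * L2_norm N f"
proof -
  have m: "indicat_real N \<in> borel_measurable (lebesgue_on \<Omega>)"
    using N by (intro borel_measurable_indicator) (simp add: sets_restrict_space_iff)
  have Nf: "L2_on \<Omega> (\<lambda>z. indicator N z * f z)"
    by (rule L2_on_bounded_mult[OF f m, of 1]) (auto simp: indicator_def)
  have "L2_norm \<Omega> (\<lambda>z. h z * f z) = L2_norm \<Omega> (\<lambda>z. h z * (indicator N z * f z))"
    unfolding L2_norm_def using N(4)
    by (intro arg_cong[where f = sqrt] Bochner_Integration.integral_cong) (auto simp: indicator_def)
  also have "\<dots> \<le> K * L2_norm \<Omega> (\<lambda>z. indicator N z * f z)"
    by (rule L2_norm_bounded_mult[OF Nf h(1)]) (use h in auto)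
  finally show ?thesis by (simp add: L2_norm_restrict[OF N(1-3)])
qed

text \<open>A diagonal sequence: the slope bound \<open>K m\<close> of the cutoff may grow without
  limit, so the approximant is chosen after m and close enough to beat it. What remains is the term
  with the slope of the cutoff times f itself, which \<open>layer\<close> assumes to vanish in the
  limit.\<close>

lemma dir_H10_by_cutoff:
  fixes \<psi> :: "nat \<Rightarrow> 'a::euclidean_space \<Rightarrow> real"
  assumes \<Omega>: "open \<Omega>" and b: "b \<in> Basis" and f: "L2_on \<Omega> f" "L2_on \<Omega> f'"
    and \<phi>: "\<And>n::nat. test_function UNIV (\<phi> n)"
    and lim: "(\<lambda>n. L2_norm \<Omega> (\<lambda>z. \<phi> n z - f z)) \<longlonglongrightarrow> 0" "(\<lambda>n. L2_norm \<Omega> (\<lambda>z. dir_deriv b (\<phi> n) z - f' z)) \<longlonglongrightarrow> 0"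
    and \<psi>: "\<And>m. smooth (\<psi> m)" "\<And>m z. \<bar>\<psi> m z\<bar> \<le> 1" "\<And>z. z \<in> \<Omega> \<Longrightarrow> (\<lambda>m. \<psi> m z) \<longlonglongrightarrow> 1"
    and C: "\<And>m. closed (C m)" "\<And>m. C m \<subseteq> \<Omega>" "\<And>m z. z \<notin> C m \<Longrightarrow> \<psi> m z = 0"
    and K: "\<And>m z. \<bar>dir_deriv b (\<psi> m) z\<bar> \<le> K m"
    and layer: "(\<lambda>m. L2_norm \<Omega> (\<lambda>z. dir_deriv b (\<psi> m) z * f z)) \<longlonglongrightarrow> 0"
  shows "dir_H10 \<Omega> b f f'"
proof -
  have L: "\<Omega> \<in> sets lebesgue" by (rule open_imp_lebesgue[OF \<Omega>])
  have K0: "0 \<le> K m" for m using K[of m undefined] by linarith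
  have d\<psi>: "smooth (dir_deriv b (\<psi> m))" for m by (rule smooth_dir_deriv[OF \<psi>(1) b])
  have \<phi>L: "L2_on \<Omega> (\<phi> n)" "L2_on \<Omega> (dir_deriv b (\<phi> n))" for n
    by (intro L2_on_test_function[OF \<phi> L] L2_on_test_function[OF test_function_dir_deriv[OF \<phi> b] L])+
  have m: "g \<in> borel_measurable (lebesgue_on \<Omega>)" if "smooth g" for g
    by (rule smooth_measurable_lebesgue_on[OF that])
  have cut: "(\<lambda>m. L2_norm \<Omega> (\<lambda>z. (\<psi> m z - 1) * g z)) \<longlonglongrightarrow> 0" if g: "L2_on \<Omega> g" for g
  proof (rule L2_mult_tendsto_0[OF g, of _ 2])
    show "(\<lambda>z. \<psi> m z - 1) \<in> borel_measurable (lebesgue_on \<Omega>)" for m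
      by (intro m smooth_diff \<psi> smooth_const)
    show "\<bar>\<psi> m z - 1\<bar> \<le> 2" for m z using \<psi>(2)[of m z] by linarith
    show "(\<lambda>m. \<psi> m z - 1) \<longlonglongrightarrow> 0" if "z \<in> \<Omega>" for z
      using tendsto_diff[OF \<psi>(3)[OF that] tendsto_const[of 1]] by simp
  qed
  \<comment> \<open>The weight \<open>1 + K m\<close> serves both estimates: 1 for the functions,
    \<open>K m\<close> for the product with the derivative of the cutoff.\<close>
  have "\<exists>n. (1 + K m) * L2_norm \<Omega> (\<lambda>z. \<phi> n z - f z) + L2_norm \<Omega> (\<lambda>z. dir_deriv b (\<phi> n) z - f' z) < 1 / real (Suc m)" for m
  proof -
    have "(\<lambda>n. (1 + K m) * L2_norm \<Omega> (\<lambda>z. \<phi> n z - f z) + L2_norm \<Omega> (\<lambda>z. dir_deriv b (\<phi> n) z - f' z)) \<longlonglongrightarrow> (1 + K m) * 0 + 0"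
      by (intro tendsto_intros lim)
    then have "\<forall>\<^sub>F n in sequentially. (1 + K m) * L2_norm \<Omega> (\<lambda>z. \<phi> n z - f z) + L2_norm \<Omega> (\<lambda>z. dir_deriv b (\<phi> n) z - f' z) < 1 / real (Suc m)"
      by (rule order_tendstoD) simp
    then show ?thesis by (auto simp: eventually_sequentially)
  qed
  then obtain \<nu> where \<nu>: "\<And>m. (1 + K m) * L2_norm \<Omega> (\<lambda>z. \<phi> (\<nu> m) z - f z) + L2_norm \<Omega> (\<lambda>z. dir_deriv b (\<phi> (\<nu> m)) z - f' z) < 1 / real (Suc m)"
    by metis
  have inv: "(\<lambda>m. 1 / real (Suc m)) \<longlonglongrightarrow> 0"
    using LIMSEQ_inverse_real_of_nat by (simp add: inverse_eq_divide)
  define \<Phi> where "\<Phi> m = (\<lambda>z. \<psi> m z * \<phi> (\<nu> m) z)" for m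
  show ?thesis
    unfolding dir_H10_def
  proof (intro conjI exI[of _ \<Phi>] allI f)
    show "test_function \<Omega> (\<Phi> m)" for m
      unfolding \<Phi>_def by (rule test_function_cutoff[OF \<phi> \<psi>(1) C])
    have bound1: "L2_norm \<Omega> (\<lambda>z. \<psi> m z * g z) \<le> L2_norm \<Omega> g" if "L2_on \<Omega> g" for g m
      using L2_norm_bounded_mult[OF that m[OF \<psi>(1)] \<psi>(2)] by simp
    have L2\<psi>: "L2_on \<Omega> (\<lambda>z. \<psi> m z * g z)" "L2_on \<Omega> (\<lambda>z. (\<psi> m z - 1) * g z)"
      "L2_on \<Omega> (\<lambda>z. dir_deriv b (\<psi> m) z * g z)" if "L2_on \<Omega> g" for g m
    proof -
      have *: "\<bar>\<psi> m z - 1\<bar> \<le> 2" for z using \<psi>(2)[of m z] by linarith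
      show "L2_on \<Omega> (\<lambda>z. \<psi> m z * g z)" by (rule L2_on_bounded_mult[OF that m[OF \<psi>(1)] \<psi>(2)])
      show "L2_on \<Omega> (\<lambda>z. (\<psi> m z - 1) * g z)"
        by (rule L2_on_bounded_mult[OF that m[OF smooth_diff[OF \<psi>(1) smooth_const]] *])
      show "L2_on \<Omega> (\<lambda>z. dir_deriv b (\<psi> m) z * g z)" by (rule L2_on_bounded_mult[OF that m[OF d\<psi>] K])
    qed
    have df: "L2_on \<Omega> (\<lambda>z. \<phi> n z - f z)" and df': "L2_on \<Omega> (\<lambda>z. dir_deriv b (\<phi> n) z - f' z)" for n
      by (intro L2_on_diff \<phi>L f)+
    show "(\<lambda>m. L2_norm \<Omega> (\<lambda>z. \<Phi> m z - f z)) \<longlonglongrightarrow> 0"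
    proof (rule Lim_null_comparison[OF always_eventually])
      show "(\<lambda>m. 1 / real (Suc m) + L2_norm \<Omega> (\<lambda>z. (\<psi> m z - 1) * f z)) \<longlonglongrightarrow> 0"
        using tendsto_add[OF inv cut[OF f(1)]] by simp
      show "\<forall>m. norm (L2_norm \<Omega> (\<lambda>z. \<Phi> m z - f z)) \<le> 1 / real (Suc m) + L2_norm \<Omega> (\<lambda>z. (\<psi> m z - 1) * f z)"
      proof
        fix m
        have "(\<lambda>z. \<Phi> m z - f z) = (\<lambda>z. \<psi> m z * (\<phi> (\<nu> m) z - f z) + (\<psi> m z - 1) * f z)"
          by (auto simp: \<Phi>_def algebra_simps)
        then have "L2_norm \<Omega> (\<lambda>z. \<Phi> m z - f z) \<le> L2_norm \<Omega> (\<lambda>z. \<phi> (\<nu> m) z - f z) + L2_norm \<Omega> (\<lambda>z. (\<psi> m z - 1) * f z)"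
          using L2_norm_triangle[OF L2\<psi>(1)[OF df] L2\<psi>(2)[OF f(1)], of m "\<nu> m" m] bound1[OF df, of m "\<nu> m"] by simp
        moreover have "1 * L2_norm \<Omega> (\<lambda>z. \<phi> (\<nu> m) z - f z) \<le> (1 + K m) * L2_norm \<Omega> (\<lambda>z. \<phi> (\<nu> m) z - f z)"
          using K0[of m] by (intro mult_right_mono L2_norm_nonneg) simp
        ultimately show "norm (L2_norm \<Omega> (\<lambda>z. \<Phi> m z - f z)) \<le> 1 / real (Suc m) + L2_norm \<Omega> (\<lambda>z. (\<psi> m z - 1) * f z)"
          using \<nu>[of m] L2_norm_nonneg[of \<Omega> "\<lambda>z. dir_deriv b (\<phi> (\<nu> m)) z - f' z"]
            L2_norm_nonneg[of \<Omega> "\<lambda>z. \<Phi> m z - f z"] by (simp only: real_norm_def)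
      qed
    qed
    show "(\<lambda>m. L2_norm \<Omega> (\<lambda>z. dir_deriv b (\<Phi> m) z - f' z)) \<longlonglongrightarrow> 0"
    proof (rule Lim_null_comparison[OF always_eventually])
      show "(\<lambda>m. 1 / real (Suc m) + (L2_norm \<Omega> (\<lambda>z. (\<psi> m z - 1) * f' z) + L2_norm \<Omega> (\<lambda>z. dir_deriv b (\<psi> m) z * f z))) \<longlonglongrightarrow> 0"
        using tendsto_add[OF inv tendsto_add[OF cut[OF f(2)] layer]] by simp
      show "\<forall>m. norm (L2_norm \<Omega> (\<lambda>z. dir_deriv b (\<Phi> m) z - f' z))
          \<le> 1 / real (Suc m) + (L2_norm \<Omega> (\<lambda>z. (\<psi> m z - 1) * f' z) + L2_norm \<Omega> (\<lambda>z. dir_deriv b (\<psi> m) z * f z))"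
      proof
        fix m
        let ?n = "\<nu> m"
        \<comment> \<open>\<open>?A\<close> and \<open>?B\<close> hold the error of the approximant,
          controlled by the choice of \<open>\<nu>\<close>; \<open>?C\<close> and \<open>?E\<close>
          involve only f and f' and vanish by \<open>cut\<close> and \<open>layer\<close>.\<close>
        let ?A = "\<lambda>z. \<psi> m z * (dir_deriv b (\<phi> ?n) z - f' z)" and ?B = "\<lambda>z. dir_deriv b (\<psi> m) z * (\<phi> ?n z - f z)"
          and ?C = "\<lambda>z. (\<psi> m z - 1) * f' z" and ?E = "\<lambda>z. dir_deriv b (\<psi> m) z * f z"
        have "dir_deriv b (\<Phi> m) = (\<lambda>z. dir_deriv b (\<psi> m) z * \<phi> ?n z + \<psi> m z * dir_deriv b (\<phi> ?n) z)"
          unfolding \<Phi>_def by (rule dir_deriv_mult[OF \<psi>(1) test_function_smooth[OF \<phi>] b])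
        then have "(\<lambda>z. dir_deriv b (\<Phi> m) z - f' z) = (\<lambda>z. (?A z + ?B z) + (?C z + ?E z))"
          by (auto simp: algebra_simps)
        then have "L2_norm \<Omega> (\<lambda>z. dir_deriv b (\<Phi> m) z - f' z) \<le> L2_norm \<Omega> (\<lambda>z. ?A z + ?B z) + L2_norm \<Omega> (\<lambda>z. ?C z + ?E z)"
          using L2_norm_triangle[OF L2_on_add[OF L2\<psi>(1)[OF df'] L2\<psi>(3)[OF df]] L2_on_add[OF L2\<psi>(2)[OF f(2)] L2\<psi>(3)[OF f(1)]], of m ?n m ?n m m]
          by simp
        also have "L2_norm \<Omega> (\<lambda>z. ?A z + ?B z) \<le> L2_norm \<Omega> ?A + L2_norm \<Omega> ?B"
          by (rule L2_norm_triangle[OF L2\<psi>(1)[OF df'] L2\<psi>(3)[OF df]])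
        also have "L2_norm \<Omega> (\<lambda>z. ?C z + ?E z) \<le> L2_norm \<Omega> ?C + L2_norm \<Omega> ?E"
          by (rule L2_norm_triangle[OF L2\<psi>(2)[OF f(2)] L2\<psi>(3)[OF f(1)]])
        also have "L2_norm \<Omega> ?A \<le> L2_norm \<Omega> (\<lambda>z. dir_deriv b (\<phi> ?n) z - f' z)"
          by (rule bound1[OF df'])
        also have "L2_norm \<Omega> ?B \<le> K m * L2_norm \<Omega> (\<lambda>z. \<phi> ?n z - f z)"
          by (rule L2_norm_bounded_mult[OF df m[OF d\<psi>] K K0])
        finally have "L2_norm \<Omega> (\<lambda>z. dir_deriv b (\<Phi> m) z - f' z)
            \<le> L2_norm \<Omega> (\<lambda>z. dir_deriv b (\<phi> ?n) z - f' z) + K m * L2_norm \<Omega> (\<lambda>z. \<phi> ?n z - f z) + (L2_norm \<Omega> ?C + L2_norm \<Omega> ?E)"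
          by simp
        moreover have "K m * L2_norm \<Omega> (\<lambda>z. \<phi> ?n z - f z) \<le> (1 + K m) * L2_norm \<Omega> (\<lambda>z. \<phi> ?n z - f z)"
          by (intro mult_right_mono L2_norm_nonneg) simp
        ultimately show "norm (L2_norm \<Omega> (\<lambda>z. dir_deriv b (\<Phi> m) z - f' z))
          \<le> 1 / real (Suc m) + (L2_norm \<Omega> ?C + L2_norm \<Omega> ?E)"
          using \<nu>[of m] L2_norm_nonneg[of \<Omega> "\<lambda>z. dir_deriv b (\<Phi> m) z - f' z"]
          by (simp only: real_norm_def)
      qed
    qed
  qed
qed

lemma L2_norm_wd_le_sobolev_norm:
  assumes "i + j \<le> k"
  shows "L2_norm \<Omega> (wd \<Omega> i j f) \<le> sobolev_norm k \<Omega> f"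
proof -
  have fin: "finite {(i, j). i + j \<le> k}"
    by (rule finite_subset[of _ "{..k} \<times> {..k}"]) auto
  have "(L2_norm \<Omega> (wd \<Omega> i j f))\<^sup>2 = (\<Sum>(i, j)\<in>{(i, j)}. (L2_norm \<Omega> (wd \<Omega> i j f))\<^sup>2)" by simp
  also have "\<dots> \<le> (\<Sum>(i, j)\<in>{(i, j). i + j \<le> k}. (L2_norm \<Omega> (wd \<Omega> i j f))\<^sup>2)"
    using assms by (intro sum_mono2 fin) auto
  finally have "sqrt ((L2_norm \<Omega> (wd \<Omega> i j f))\<^sup>2) \<le> sobolev_norm k \<Omega> f"
    unfolding sobolev_norm_def by (rule real_sqrt_le_mono)
  then show ?thesis by (simp add: L2_norm_nonneg)
qed

lemma xy_simps: "xy 0 0 = []" "xy (Suc 0) 0 = [(1, 0)]" "xy 0 (Suc 0) = [(0, 1)]"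
  by (simp_all add: xy_def)

definition H1_approx ::
    "(real \<times> real) set \<Rightarrow> (real \<times> real \<Rightarrow> real) \<Rightarrow> (real \<times> real \<Rightarrow> real) \<Rightarrow> (real \<times> real \<Rightarrow> real) \<Rightarrow>
      (nat \<Rightarrow> real \<times> real \<Rightarrow> real) \<Rightarrow> bool" where
  "H1_approx \<Omega> f fx fy \<phi> \<longleftrightarrow> L2_on \<Omega> f \<and> L2_on \<Omega> fx \<and> L2_on \<Omega> fy \<and>
     (\<forall>n. test_function UNIV (\<phi> n)) \<and>
     (\<lambda>n. L2_norm \<Omega> (\<lambda>z. \<phi> n z - f z)) \<longlonglongrightarrow> 0 \<and>
     (\<lambda>n. L2_norm \<Omega> (\<lambda>z. dir_deriv (1, 0) (\<phi> n) z - fx z)) \<longlonglongrightarrow> 0 \<and>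
     (\<lambda>n. L2_norm \<Omega> (\<lambda>z. dir_deriv (0, 1) (\<phi> n) z - fy z)) \<longlonglongrightarrow> 0"

text \<open>The definition of a trace measures convergence through \<open>wd\<close>, a choice made
  anew for every difference. Uniqueness of weak derivatives trades this for convergence to the fixed
  versions \<open>fx\<close> and \<open>fy\<close>.\<close>

lemma has_zero_traceE:
  assumes \<Omega>: "open \<Omega>" and tr: "has_trace \<Omega> S p f (\<lambda>_. 0)"
    and wf: "weak_deriv \<Omega> [(1, 0)] f fx" "weak_deriv \<Omega> [(0, 1)] f fy" and L2: "L2_on \<Omega> f" "L2_on \<Omega> fx" "L2_on \<Omega> fy"
  obtains \<phi> where "H1_approx \<Omega> f fx fy \<phi>" "(\<lambda>n. L2_norm S (\<lambda>s. \<phi> n (p s))) \<longlonglongrightarrow> 0"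
proof -
  have L: "\<Omega> \<in> sets lebesgue" by (rule open_imp_lebesgue[OF \<Omega>])
  obtain \<phi> :: "nat \<Rightarrow> real \<times> real \<Rightarrow> real" where \<phi>: "\<And>n. test_function UNIV (\<phi> n)"
    "(\<lambda>n. sobolev_norm 1 \<Omega> (\<lambda>z. \<phi> n z - f z)) \<longlonglongrightarrow> 0"
    "(\<lambda>n. L2_norm S (\<lambda>s. \<phi> n (p s) - 0)) \<longlonglongrightarrow> 0"
    using tr unfolding has_trace_def by blast
  have conv: "(\<lambda>n. L2_norm \<Omega> (\<lambda>z. iter_deriv (xy i j) (\<phi> n) z - g z)) \<longlonglongrightarrow> 0"
    if ij: "i + j \<le> 1" and w: "\<And>n. weak_deriv \<Omega> (xy i j) (\<phi> n) (iter_deriv (xy i j) (\<phi> n))"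
      and g: "weak_deriv \<Omega> (xy i j) f g" "L2_on \<Omega> g" for i j g
  proof (rule Lim_null_comparison[OF always_eventually \<phi>(2)], intro allI)
    fix n
    have t: "test_function UNIV (iter_deriv (xy i j) (\<phi> n))"
      by (rule test_function_iter_deriv[OF \<phi>(1) xy_Basis])
    have "L2_norm \<Omega> (\<lambda>z. iter_deriv (xy i j) (\<phi> n) z - g z) = L2_norm \<Omega> (wd \<Omega> i j (\<lambda>z. \<phi> n z - f z))"
      by (rule L2_norm_wd[OF \<Omega> weak_deriv_diff[OF w g(1) xy_Basis L] L2_on_diff[OF L2_on_test_function[OF t L] g(2)], symmetric])
    also have "\<dots> \<le> sobolev_norm 1 \<Omega> (\<lambda>z. \<phi> n z - f z)"
      by (rule L2_norm_wd_le_sobolev_norm[OF ij])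
    finally show "norm (L2_norm \<Omega> (\<lambda>z. iter_deriv (xy i j) (\<phi> n) z - g z)) \<le> sobolev_norm 1 \<Omega> (\<lambda>z. \<phi> n z - f z)"
      by (simp add: L2_norm_nonneg)
  qed
  have s: "smooth (\<phi> n)" for n by (rule test_function_smooth[OF \<phi>(1)])
  have "(\<lambda>n. L2_norm \<Omega> (\<lambda>z. \<phi> n z - f z)) \<longlonglongrightarrow> 0"
    using conv[of 0 0 f] L2 wf locally_integrable_continuous[OF smooth_continuous[OF s]]
    by (simp add: xy_simps weak_deriv_Nil weak_deriv_def)
  moreover have "(\<lambda>n. L2_norm \<Omega> (\<lambda>z. dir_deriv (1, 0) (\<phi> n) z - fx z)) \<longlonglongrightarrow> 0"
    using conv[of 1 0 fx] L2 wf weak_deriv_smooth[OF s _ L, of "(1, 0)"] by (simp add: xy_simps)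
  moreover have "(\<lambda>n. L2_norm \<Omega> (\<lambda>z. dir_deriv (0, 1) (\<phi> n) z - fy z)) \<longlonglongrightarrow> 0"
    using conv[of 0 1 fy] L2 wf weak_deriv_smooth[OF s _ L, of "(0, 1)"] by (simp add: xy_simps)
  ultimately have "H1_approx \<Omega> f fx fy \<phi>"
    using L2 \<phi>(1) by (simp add: H1_approx_def)
  then show thesis using that \<phi>(3) by simp
qed

section \<open>Cutoffs on the half strip\<close>

definition layer_bottom :: "real \<Rightarrow> (real \<times> real) set" where
  "layer_bottom e = {0<..} \<times> {0<..<e}"

definition layer_top :: "real \<Rightarrow> real \<Rightarrow> (real \<times> real) set" where
  "layer_top B e = {0<..} \<times> {B - e<..<B}"

definition layer_left :: "real \<Rightarrow> real \<Rightarrow> (real \<times> real) set" where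
  "layer_left B e = {0<..<e} \<times> {0<..<B}"

lemma open_half_strip: "open (half_strip B)"
  unfolding half_strip_def by (intro open_Times) auto

lemma half_strip_lebesgue: "half_strip B \<in> sets lebesgue"
  by (rule open_imp_lebesgue[OF open_half_strip])

lemma layer_lebesgue:
  "layer_bottom e \<in> sets lebesgue" "layer_top B e \<in> sets lebesgue" "layer_left B e \<in> sets lebesgue"
  unfolding layer_bottom_def layer_top_def layer_left_def by (intro open_imp_lebesgue open_Times; simp)+

lemma layer_subset:
  "e \<le> B \<Longrightarrow> layer_bottom e \<subseteq> half_strip B" "e \<le> B \<Longrightarrow> layer_top B e \<subseteq> half_strip B" "layer_left B e \<subseteq> half_strip B"
  by (auto simp: layer_bottom_def layer_top_def layer_left_def half_strip_def)

lemma boundary_layers: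
  assumes "0 < e"
  shows "boundary_layer (\<lambda>x. (x, 0)) 1 (0, 1) {0<..} e (layer_bottom e)"
    and "boundary_layer (\<lambda>x. (x, B)) (- 1) (0, 1) {0<..} e (layer_top B e)"
    and "boundary_layer (\<lambda>y. (0, y)) 1 (1, 0) {0<..<B} e (layer_left B e)"
  unfolding layer_bottom_def layer_top_def layer_left_def
  by (intro boundary_layer_bottom boundary_layer_top boundary_layer_left assms)+

text \<open>Division by \<open>Suc m\<close> keeps every width at most \<open>B\<close>, so that all
  layers stay inside the strip.\<close>

definition width :: "real \<Rightarrow> nat \<Rightarrow> real" where
  "width B m = B / real (Suc m)"

lemma width_props:
  assumes "B > 0"
  shows "0 < width B m" "width B m \<le> B" "width B \<longlonglongrightarrow> 0"
proof -
  show "0 < width B m" using assms by (simp add: width_def)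
  show "width B m \<le> B" using assms by (simp add: width_def field_simps)
  have "(\<lambda>m. B * inverse (real (Suc m))) \<longlonglongrightarrow> B * 0"
    by (intro tendsto_intros LIMSEQ_inverse_real_of_nat)
  then show "width B \<longlonglongrightarrow> 0" by (simp add: width_def[abs_def] divide_inverse)
qed

lemma L2_norm_layer_tendsto_0:
  assumes "B > 0" "L2_on (half_strip B) f"
  shows "(\<lambda>m. L2_norm (layer_bottom (width B m)) f) \<longlonglongrightarrow> 0"
    and "(\<lambda>m. L2_norm (layer_top B (width B m)) f) \<longlonglongrightarrow> 0"
    and "(\<lambda>m. L2_norm (layer_left B (width B m)) f) \<longlonglongrightarrow> 0"
proof -
  have ev: "\<forall>\<^sub>F m in sequentially. width B m < c" if "c > 0" for c
    using order_tendstoD(2)[OF width_props(3)[OF assms(1)] that] .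
  show "(\<lambda>m. L2_norm (layer_bottom (width B m)) f) \<longlonglongrightarrow> 0"
  proof (rule L2_norm_shrinking[OF assms(2) layer_lebesgue(1) half_strip_lebesgue layer_subset(1)[OF width_props(2)[OF assms(1)]]])
    fix z assume "z \<in> half_strip B"
    then have "snd z > 0" by (auto simp: half_strip_def)
    from ev[OF this] show "\<forall>\<^sub>F m in sequentially. z \<notin> layer_bottom (width B m)"
      by eventually_elim (auto simp: layer_bottom_def)
  qed
  show "(\<lambda>m. L2_norm (layer_top B (width B m)) f) \<longlonglongrightarrow> 0"
  proof (rule L2_norm_shrinking[OF assms(2) layer_lebesgue(2) half_strip_lebesgue layer_subset(2)[OF width_props(2)[OF assms(1)]]])
    fix z assume "z \<in> half_strip B"
    then have "B - snd z > 0" by (auto simp: half_strip_def)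
    from ev[OF this] show "\<forall>\<^sub>F m in sequentially. z \<notin> layer_top B (width B m)"
      by eventually_elim (auto simp: layer_top_def)
  qed
  show "(\<lambda>m. L2_norm (layer_left B (width B m)) f) \<longlonglongrightarrow> 0"
  proof (rule L2_norm_shrinking[OF assms(2) layer_lebesgue(3) half_strip_lebesgue layer_subset(3)])
    fix z assume "z \<in> half_strip B"
    then have "fst z > 0" by (auto simp: half_strip_def)
    from ev[OF this] show "\<forall>\<^sub>F m in sequentially. z \<notin> layer_left B (width B m)"
      by eventually_elim (auto simp: layer_left_def)
  qed
qed

text \<open>For a distance r from an edge, 2 r / w - 1 is 0 at r = w/2 and 1 at r = w. So the
  product vanishes within w/2 of the boundary and each factor is 1 beyond w. No cutoff for large x
  is included, since the approximants already have compact support.\<close>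

definition strip_cutoff :: "real \<Rightarrow> nat \<Rightarrow> real \<times> real \<Rightarrow> real" where
  "strip_cutoff B m z = step (2 / width B m * fst z - 1) *
     (step (2 / width B m * snd z - 1) * step (2 / width B m * (B - snd z) - 1))"

lemma smooth_step_affine: "smooth (\<lambda>x. step (c * x - 1))" "smooth (\<lambda>x. step (c * (d - x) - 1))"
  and dir_deriv_step_affine: "dir_deriv 1 (\<lambda>x. step (c * x - 1)) = (\<lambda>x. c * dir_deriv 1 step (c * x - 1))"
    "dir_deriv 1 (\<lambda>x. step (c * (d - x) - 1)) = (\<lambda>x. - c * dir_deriv 1 step (c * (d - x) - 1))"
proof -
  have 1: "(\<lambda>x. step (c * x - 1)) = (\<lambda>x. step (c * x + - 1))" by simp
  have 2: "(\<lambda>x. step (c * (d - x) - 1)) = (\<lambda>x. step ((- c) * x + (c * d - 1)))"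
    by (simp add: algebra_simps)
  show "smooth (\<lambda>x. step (c * x - 1))" "smooth (\<lambda>x. step (c * (d - x) - 1))"
    unfolding 1 2 by (rule smooth_affine[OF smooth_step])+
  show "dir_deriv 1 (\<lambda>x. step (c * x - 1)) = (\<lambda>x. c * dir_deriv 1 step (c * x - 1))"
    unfolding 1 dir_deriv_affine[OF smooth_step] by simp
  show "dir_deriv 1 (\<lambda>x. step (c * (d - x) - 1)) = (\<lambda>x. - c * dir_deriv 1 step (c * (d - x) - 1))"
    unfolding 2 dir_deriv_affine[OF smooth_step] by (simp add: algebra_simps)
qed

lemma step_abs: "\<bar>step x\<bar> \<le> 1" "\<bar>dir_deriv 1 step x\<bar> \<le> step_bound"
  using step_nonneg[of x] step_le_1[of x] step_deriv_nonneg[of x] step_deriv_le[of x] by auto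

lemma smooth_strip_cutoff: "smooth (strip_cutoff B m)"
  unfolding strip_cutoff_def[abs_def]
  by (intro smooth_mult smooth_fst[OF smooth_step_affine(1)] smooth_snd[OF smooth_step_affine(1)] smooth_snd[OF smooth_step_affine(2)])

text \<open>The x-derivative hits only the first factor and lives in the left layer; the
  y-derivative has one term in the bottom layer and one in the top layer. This is why each direction
  needs zero values on its own edges only.\<close>

lemma dir_deriv_strip_cutoff:
  defines "c \<equiv> \<lambda>B m. 2 / width B m"
  shows "dir_deriv (1, 0) (strip_cutoff B m) = (\<lambda>z. c B m * dir_deriv 1 step (c B m * fst z - 1) *
      (step (c B m * snd z - 1) * step (c B m * (B - snd z) - 1)))"
    and "dir_deriv (0, 1) (strip_cutoff B m) = (\<lambda>z.
      step (c B m * fst z - 1) * (c B m * dir_deriv 1 step (c B m * snd z - 1) * step (c B m * (B - snd z) - 1)) +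
      step (c B m * fst z - 1) * (step (c B m * snd z - 1) * (- c B m * dir_deriv 1 step (c B m * (B - snd z) - 1))))"
proof -
  note sm = smooth_fst[OF smooth_step_affine(1)] smooth_snd[OF smooth_step_affine(1)] smooth_snd[OF smooth_step_affine(2)]
  have smy: "smooth (\<lambda>z::real \<times> real. step (c B m * snd z - 1) * step (c B m * (B - snd z) - 1))"
    by (intro smooth_mult sm)
  have eq: "strip_cutoff B m = (\<lambda>z. step (c B m * fst z - 1) * (step (c B m * snd z - 1) * step (c B m * (B - snd z) - 1)))"
    by (simp add: strip_cutoff_def[abs_def] c_def)
  note mult1 = dir_deriv_mult[OF sm(1)[of "c B m"] smy]
  note mult2 = dir_deriv_mult[OF sm(2)[of "c B m"] sm(3)[of "c B m" B]]
  note d = dir_deriv_fst[where f = "\<lambda>x. step (c B m * x - 1)"] dir_deriv_snd[where f = "\<lambda>x. step (c B m * x - 1)"]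
    dir_deriv_snd[where f = "\<lambda>x. step (c B m * (B - x) - 1)"]
  show "dir_deriv (1, 0) (strip_cutoff B m) = (\<lambda>z. c B m * dir_deriv 1 step (c B m * fst z - 1) *
      (step (c B m * snd z - 1) * step (c B m * (B - snd z) - 1)))"
    unfolding eq mult1[OF Basis_xy(1)] mult2[OF Basis_xy(1)] d dir_deriv_step_affine by simp
  show "dir_deriv (0, 1) (strip_cutoff B m) = (\<lambda>z.
      step (c B m * fst z - 1) * (c B m * dir_deriv 1 step (c B m * snd z - 1) * step (c B m * (B - snd z) - 1)) +
      step (c B m * fst z - 1) * (step (c B m * snd z - 1) * (- c B m * dir_deriv 1 step (c B m * (B - snd z) - 1))))"
    unfolding eq mult1[OF Basis_xy(2)] mult2[OF Basis_xy(2)] d dir_deriv_step_affine by (simp add: algebra_simps)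
qed

lemma strip_cutoff_bound: "\<bar>strip_cutoff B m z\<bar> \<le> 1"
  unfolding strip_cutoff_def abs_mult by (intro mult_le_one mult_nonneg_nonneg step_abs abs_ge_zero)

lemma strip_cutoff_tendsto:
  assumes B: "B > 0" and z: "z \<in> half_strip B"
  shows "(\<lambda>m. strip_cutoff B m z) \<longlonglongrightarrow> 1"
proof (rule tendsto_eventually)
  have ev: "\<forall>\<^sub>F m in sequentially. step (2 / width B m * r - 1) = 1" if "r > 0" for r
    using order_tendstoD(2)[OF width_props(3)[OF B] that]
  proof eventually_elim
    case (elim m)
    then show ?case using width_props(1)[OF B, of m] by (intro step_eq_1) (simp add: field_simps)
  qed
  have "fst z > 0" "snd z > 0" "B - snd z > 0" using z by (auto simp: half_strip_def)
  from this[THEN ev] show "\<forall>\<^sub>F m in sequentially. strip_cutoff B m z = 1"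
    by eventually_elim (simp add: strip_cutoff_def)
qed

lemma strip_cutoff_support:
  assumes B: "B > 0"
  defines "C \<equiv> \<lambda>m. {width B m / 2..} \<times> {width B m / 2..B - width B m / 2}"
  shows "closed (C m)" "C m \<subseteq> half_strip B" "z \<notin> C m \<Longrightarrow> strip_cutoff B m z = 0"
proof -
  note w = width_props(1)[OF B, of m]
  show "closed (C m)" unfolding C_def by (intro closed_Times) auto
  show "C m \<subseteq> half_strip B" using w by (auto simp: C_def half_strip_def)
  assume "z \<notin> C m"
  then have "fst z < width B m / 2 \<or> snd z < width B m / 2 \<or> B - snd z < width B m / 2"
    by (cases z) (auto simp: C_def not_le)
  then have "2 / width B m * fst z - 1 \<le> 0 \<or> 2 / width B m * snd z - 1 \<le> 0 \<or> 2 / width B m * (B - snd z) - 1 \<le> 0"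
    using w by (auto simp: field_simps)
  then show "strip_cutoff B m z = 0"
    by (auto simp: strip_cutoff_def step_eq_0)
qed

lemma layer_norm_bound:
  assumes "(L2_norm N f)\<^sup>2 \<le> 5 / 8 * e\<^sup>2 * (L2_norm N f')\<^sup>2" "0 \<le> e"
  shows "L2_norm N f \<le> e * L2_norm N f'"
proof -
  have "5 / 8 * e\<^sup>2 * (L2_norm N f')\<^sup>2 = 5 / 8 * (e * L2_norm N f')\<^sup>2"
    by (simp add: power_mult_distrib)
  then have "(L2_norm N f)\<^sup>2 \<le> (e * L2_norm N f')\<^sup>2"
    using assms(1) zero_le_power2[of "e * L2_norm N f'"] by linarith
  then show ?thesis
    by (rule power2_le_imp_le) (simp add: assms(2) L2_norm_nonneg)
qed

text \<open>The slope of the cutoff is of order 1/width, whereas f has norm at most width times that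
  of f' over the layer. The widths cancel, and the norm of f' over the shrinking layer tends to
  0.\<close>

lemma layer_term_tendsto_0:
  assumes B: "B > 0" and f: "L2_on (half_strip B) f"
    and h: "\<And>m. h m \<in> borel_measurable (lebesgue_on (half_strip B))" "\<And>m z. \<bar>h m z\<bar> \<le> 2 / width B m * step_bound"
    and N: "\<And>m. N m \<in> sets lebesgue" "\<And>m. N m \<subseteq> half_strip B" "\<And>m z. z \<in> half_strip B \<Longrightarrow> z \<notin> N m \<Longrightarrow> h m z = 0"
    and bound: "\<And>m. (L2_norm (N m) f)\<^sup>2 \<le> 5 / 8 * (width B m)\<^sup>2 * (L2_norm (N m) f')\<^sup>2"
    and lim: "(\<lambda>m. L2_norm (N m) f') \<longlonglongrightarrow> 0"
  shows "(\<lambda>m. L2_norm (half_strip B) (\<lambda>z. h m z * f z)) \<longlonglongrightarrow> 0"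
proof (rule Lim_null_comparison[OF always_eventually])
  show "(\<lambda>m. 2 * step_bound * L2_norm (N m) f') \<longlonglongrightarrow> 0"
    by (rule tendsto_mult_right_zero[OF lim])
  show "\<forall>m. norm (L2_norm (half_strip B) (\<lambda>z. h m z * f z)) \<le> 2 * step_bound * L2_norm (N m) f'"
  proof
    fix m
    note w = width_props(1)[OF B, of m]
    have c0: "0 \<le> 2 / width B m * step_bound" using w step_bound_nonneg by simp
    have "L2_norm (half_strip B) (\<lambda>z. h m z * f z) \<le> 2 / width B m * step_bound * L2_norm (N m) f"
      by (rule L2_norm_supported_mult[OF f h c0 N(1) half_strip_lebesgue N(2,3)])
    also have "\<dots> \<le> 2 / width B m * step_bound * (width B m * L2_norm (N m) f')"
      using w by (intro mult_left_mono layer_norm_bound bound c0) simp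
    also have "\<dots> = 2 * step_bound * L2_norm (N m) f'"
      using w by simp
    finally show "norm (L2_norm (half_strip B) (\<lambda>z. h m z * f z)) \<le> 2 * step_bound * L2_norm (N m) f'"
      by (simp add: L2_norm_nonneg)
  qed
qed

lemma dir_H10_x:
  assumes B: "B > 0" and \<phi>: "H1_approx (half_strip B) f fx fy \<phi>"
    and bound: "\<And>e. 0 < e \<Longrightarrow> (L2_norm (layer_left B e) f)\<^sup>2 \<le> 5 / 8 * e\<^sup>2 * (L2_norm (layer_left B e) fx)\<^sup>2"
  shows "dir_H10 (half_strip B) (1, 0) f fx"
proof -
  let ?D = "half_strip B" and ?c = "\<lambda>m. 2 / width B m"
  have \<phi>': "L2_on ?D f" "L2_on ?D fx" "\<And>n. test_function UNIV (\<phi> n)"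
    "(\<lambda>n. L2_norm ?D (\<lambda>z. \<phi> n z - f z)) \<longlonglongrightarrow> 0" "(\<lambda>n. L2_norm ?D (\<lambda>z. dir_deriv (1, 0) (\<phi> n) z - fx z)) \<longlonglongrightarrow> 0"
    using \<phi> by (auto simp: H1_approx_def)
  have c0: "0 \<le> ?c m" for m using width_props(1)[OF B, of m] by simp
  have K: "\<bar>dir_deriv (1, 0) (strip_cutoff B m) z\<bar> \<le> ?c m * step_bound" for m z
  proof -
    have "\<bar>dir_deriv (1, 0) (strip_cutoff B m) z\<bar> \<le> (?c m * step_bound) * (1 * 1)"
      unfolding dir_deriv_strip_cutoff abs_mult using c0[of m]
      by (intro mult_mono step_abs mult_nonneg_nonneg) (auto simp: step_bound_nonneg)
    then show ?thesis by simp
  qed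
  have out: "dir_deriv (1, 0) (strip_cutoff B m) z = 0" if "z \<in> ?D" "z \<notin> layer_left B (width B m)" for m z
  proof -
    have "fst z \<ge> width B m" using that by (cases z) (auto simp: half_strip_def layer_left_def)
    then have "?c m * fst z - 1 \<ge> 1" using width_props(1)[OF B, of m] by (simp add: field_simps)
    then show ?thesis by (simp add: dir_deriv_strip_cutoff step_deriv_eq_0)
  qed
  show ?thesis
  proof (rule dir_H10_by_cutoff[OF open_half_strip Basis_xy(1) \<phi>' smooth_strip_cutoff strip_cutoff_bound
        strip_cutoff_tendsto[OF B] strip_cutoff_support[OF B] K])
    show "(\<lambda>m. L2_norm ?D (\<lambda>z. dir_deriv (1, 0) (strip_cutoff B m) z * f z)) \<longlonglongrightarrow> 0"
      by (rule layer_term_tendsto_0[OF B \<phi>'(1)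
            smooth_measurable_lebesgue_on[OF smooth_dir_deriv[OF smooth_strip_cutoff Basis_xy(1)]] K
            layer_lebesgue(3) layer_subset(3) out bound[OF width_props(1)[OF B]] L2_norm_layer_tendsto_0(3)[OF B \<phi>'(2)]])
  qed
qed

lemma dir_H10_y:
  assumes B: "B > 0" and \<phi>: "H1_approx (half_strip B) f fx fy \<phi>"
    and bottom: "\<And>e. 0 < e \<Longrightarrow> e \<le> B \<Longrightarrow> (L2_norm (layer_bottom e) f)\<^sup>2 \<le> 5 / 8 * e\<^sup>2 * (L2_norm (layer_bottom e) fy)\<^sup>2"
    and top: "\<And>e. 0 < e \<Longrightarrow> e \<le> B \<Longrightarrow> (L2_norm (layer_top B e) f)\<^sup>2 \<le> 5 / 8 * e\<^sup>2 * (L2_norm (layer_top B e) fy)\<^sup>2"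
  shows "dir_H10 (half_strip B) (0, 1) f fy"
proof -
  let ?D = "half_strip B" and ?c = "\<lambda>m. 2 / width B m"
  have \<phi>': "L2_on ?D f" "L2_on ?D fy" "\<And>n. test_function UNIV (\<phi> n)"
    "(\<lambda>n. L2_norm ?D (\<lambda>z. \<phi> n z - f z)) \<longlonglongrightarrow> 0" "(\<lambda>n. L2_norm ?D (\<lambda>z. dir_deriv (0, 1) (\<phi> n) z - fy z)) \<longlonglongrightarrow> 0"
    using \<phi> by (auto simp: H1_approx_def)
  note w = width_props(1)[OF B] width_props(2)[OF B]
  have c0: "0 \<le> ?c m" for m using w(1)[of m] by simp
  \<comment> \<open>The derivative of the cutoff is split into its parts at the bottom and at the
    top, each of which is paired with the estimate in its own layer.\<close>
  define h1 where "h1 m z = step (?c m * fst z - 1) * (?c m * dir_deriv 1 step (?c m * snd z - 1) * step (?c m * (B - snd z) - 1))" for m and z :: "real \<times> real"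
  define h2 where "h2 m z = step (?c m * fst z - 1) * (step (?c m * snd z - 1) * (- ?c m * dir_deriv 1 step (?c m * (B - snd z) - 1)))" for m and z :: "real \<times> real"
  have eq: "dir_deriv (0, 1) (strip_cutoff B m) z = h1 m z + h2 m z" for m z
    by (simp add: dir_deriv_strip_cutoff h1_def h2_def)
  have h1: "\<bar>h1 m z\<bar> \<le> ?c m * step_bound" for m z
  proof -
    have "\<bar>h1 m z\<bar> \<le> 1 * ((?c m * step_bound) * 1)"
      unfolding h1_def abs_mult using c0[of m]
      by (intro mult_mono step_abs mult_nonneg_nonneg) (auto simp: step_bound_nonneg)
    then show ?thesis by simp
  qed
  have h2: "\<bar>h2 m z\<bar> \<le> ?c m * step_bound" for m z
  proof -
    have "\<bar>h2 m z\<bar> \<le> 1 * (1 * (?c m * step_bound))"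
      unfolding h2_def abs_mult using c0[of m]
      by (intro mult_mono step_abs mult_nonneg_nonneg) (auto simp: step_bound_nonneg)
    then show ?thesis by simp
  qed
  have out1: "h1 m z = 0" if "z \<in> ?D" "z \<notin> layer_bottom (width B m)" for m z
  proof -
    have "snd z \<ge> width B m" using that by (cases z) (auto simp: half_strip_def layer_bottom_def)
    then have "?c m * snd z - 1 \<ge> 1" using w(1)[of m] by (simp add: field_simps)
    then show ?thesis by (simp add: h1_def step_deriv_eq_0)
  qed
  have out2: "h2 m z = 0" if "z \<in> ?D" "z \<notin> layer_top B (width B m)" for m z
  proof -
    have "B - snd z \<ge> width B m" using that by (cases z) (auto simp: half_strip_def layer_top_def)
    then have "?c m * (B - snd z) - 1 \<ge> 1" using w(1)[of m] by (simp add: field_simps)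
    then show ?thesis by (simp add: h2_def step_deriv_eq_0)
  qed
  have sm: "smooth (h1 m)" "smooth (h2 m)" for m
  proof -
    have 1: "smooth (\<lambda>x. ?c m * dir_deriv 1 step (?c m * x - 1))"
      using smooth_dir_deriv[OF smooth_step_affine(1), of 1 "?c m"] unfolding dir_deriv_step_affine by simp
    have 2: "smooth (\<lambda>x. - ?c m * dir_deriv 1 step (?c m * (B - x) - 1))"
      using smooth_dir_deriv[OF smooth_step_affine(2), of 1 "?c m" B] unfolding dir_deriv_step_affine by simp
    show "smooth (h1 m)" unfolding h1_def
      by (rule smooth_mult[OF smooth_fst[OF smooth_step_affine(1)] smooth_mult[OF smooth_snd[OF 1] smooth_snd[OF smooth_step_affine(2)]]])
    show "smooth (h2 m)" unfolding h2_def
      by (rule smooth_mult[OF smooth_fst[OF smooth_step_affine(1)] smooth_mult[OF smooth_snd[OF smooth_step_affine(1)] smooth_snd[OF 2]]])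
  qed
  note m = smooth_measurable_lebesgue_on[OF sm(1), where \<Omega> = ?D] smooth_measurable_lebesgue_on[OF sm(2), where \<Omega> = ?D]
  have lim1: "(\<lambda>m. L2_norm ?D (\<lambda>z. h1 m z * f z)) \<longlonglongrightarrow> 0"
    by (rule layer_term_tendsto_0[OF B \<phi>'(1) m(1) h1 layer_lebesgue(1) layer_subset(1)[OF w(2)] out1
          bottom[OF w] L2_norm_layer_tendsto_0(1)[OF B \<phi>'(2)]])
  have lim2: "(\<lambda>m. L2_norm ?D (\<lambda>z. h2 m z * f z)) \<longlonglongrightarrow> 0"
    by (rule layer_term_tendsto_0[OF B \<phi>'(1) m(2) h2 layer_lebesgue(2) layer_subset(2)[OF w(2)] out2
          top[OF w] L2_norm_layer_tendsto_0(2)[OF B \<phi>'(2)]])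
  show ?thesis
  proof (rule dir_H10_by_cutoff[OF open_half_strip Basis_xy(2) \<phi>' smooth_strip_cutoff strip_cutoff_bound
        strip_cutoff_tendsto[OF B] strip_cutoff_support[OF B], where K = "\<lambda>m. ?c m * step_bound + ?c m * step_bound"])
    show "\<bar>dir_deriv (0, 1) (strip_cutoff B m) z\<bar> \<le> ?c m * step_bound + ?c m * step_bound" for m z
      unfolding eq using h1[of m z] h2[of m z] by linarith
    show "(\<lambda>m. L2_norm ?D (\<lambda>z. dir_deriv (0, 1) (strip_cutoff B m) z * f z)) \<longlonglongrightarrow> 0"
    proof (rule Lim_null_comparison[OF always_eventually])
      show "(\<lambda>m. L2_norm ?D (\<lambda>z. h1 m z * f z) + L2_norm ?D (\<lambda>z. h2 m z * f z)) \<longlonglongrightarrow> 0"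
        using tendsto_add[OF lim1 lim2] by simp
      show "\<forall>m. norm (L2_norm ?D (\<lambda>z. dir_deriv (0, 1) (strip_cutoff B m) z * f z))
          \<le> L2_norm ?D (\<lambda>z. h1 m z * f z) + L2_norm ?D (\<lambda>z. h2 m z * f z)"
        using L2_norm_triangle[OF L2_on_bounded_mult[OF \<phi>'(1) m(1) h1] L2_on_bounded_mult[OF \<phi>'(1) m(2) h2]]
        by (simp add: eq distrib_right L2_norm_nonneg)
    qed
  qed
qed

section \<open>The energy inequality at a fixed time\<close>

text \<open>If pi were at least 16/5, then sin(8/15) <= sin(pi/6) = 1/2, but the cubic Taylor
  polynomial with its remainder gives more than 1/2. The number 16/5 is exactly what is wanted
  later: (5/8) (5/32) = 25/256 is the reciprocal of its square.\<close>

lemma pi_less_16_5: "pi < 16 / 5"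
proof (rule ccontr)
  assume "\<not> pi < 16 / 5"
  then have pi: "pi \<ge> 16 / 5" by simp
  have "\<bar>sin (8 / 15) - (\<Sum>m<4. sin_coeff m * (8 / 15 :: real) ^ m)\<bar> \<le> inverse (fact 4) * \<bar>8 / 15 :: real\<bar> ^ 4"
    by (rule Maclaurin_sin_bound)
  moreover have "(\<Sum>m<4. sin_coeff m * (8 / 15 :: real) ^ m) = 8 / 15 - (8 / 15) ^ 3 / 6"
  proof -
    have "{..<4::nat} = {0, 1, 2, 3}" by auto
    then show ?thesis by (simp add: sin_coeff_def fact_numeral)
  qed
  moreover have "inverse (fact 4) * \<bar>8 / 15 :: real\<bar> ^ 4 = (8 / 15) ^ 4 / 24"
    by (simp add: fact_numeral)
  ultimately have "sin (8 / 15 :: real) \<ge> 8 / 15 - (8 / 15) ^ 3 / 6 - (8 / 15) ^ 4 / 24"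
    by linarith
  moreover have "8 / 15 - (8 / 15) ^ 3 / 6 - (8 / 15) ^ 4 / 24 > (1 / 2 :: real)"
    by (simp add: power_divide)
  moreover have "sin (8 / 15 :: real) \<le> sin (pi / 6)"
    using pi by (intro sin_monotone_2pi_le) auto
  ultimately show False by (simp add: sin_30)
qed

lemma zero_trace_layer_bounds:
  assumes \<phi>: "H1_approx (half_strip B) f fx fy \<phi>"
  shows "(\<lambda>n. L2_norm {0<..<B} (\<lambda>y. \<phi> n (0, y))) \<longlonglongrightarrow> 0 \<Longrightarrow> 0 < e \<Longrightarrow>
      (L2_norm (layer_left B e) f)\<^sup>2 \<le> 5 / 8 * e\<^sup>2 * (L2_norm (layer_left B e) fx)\<^sup>2"
    and "(\<lambda>n. L2_norm {0<..} (\<lambda>x. \<phi> n (x, 0))) \<longlonglongrightarrow> 0 \<Longrightarrow> 0 < e \<Longrightarrow> e \<le> B \<Longrightarrow>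
      (L2_norm (layer_bottom e) f)\<^sup>2 \<le> 5 / 8 * e\<^sup>2 * (L2_norm (layer_bottom e) fy)\<^sup>2"
    and "(\<lambda>n. L2_norm {0<..} (\<lambda>x. \<phi> n (x, B))) \<longlonglongrightarrow> 0 \<Longrightarrow> 0 < e \<Longrightarrow> e \<le> B \<Longrightarrow>
      (L2_norm (layer_top B e) f)\<^sup>2 \<le> 5 / 8 * e\<^sup>2 * (L2_norm (layer_top B e) fy)\<^sup>2"
proof -
  let ?D = "half_strip B"
  have \<phi>': "L2_on ?D f" "L2_on ?D fx" "L2_on ?D fy" "\<And>n. test_function UNIV (\<phi> n)"
    "(\<lambda>n. L2_norm ?D (\<lambda>z. \<phi> n z - f z)) \<longlonglongrightarrow> 0" "(\<lambda>n. L2_norm ?D (\<lambda>z. dir_deriv (1, 0) (\<phi> n) z - fx z)) \<longlonglongrightarrow> 0"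
    "(\<lambda>n. L2_norm ?D (\<lambda>z. dir_deriv (0, 1) (\<phi> n) z - fy z)) \<longlonglongrightarrow> 0"
    using \<phi> by (auto simp: H1_approx_def)
  show "(L2_norm (layer_left B e) f)\<^sup>2 \<le> 5 / 8 * e\<^sup>2 * (L2_norm (layer_left B e) fx)\<^sup>2"
    if "(\<lambda>n. L2_norm {0<..<B} (\<lambda>y. \<phi> n (0, y))) \<longlonglongrightarrow> 0" "0 < e"
    by (rule boundary_layer_zero_trace[OF boundary_layers(3)[OF that(2)] layer_subset(3) half_strip_lebesgue
          \<phi>'(4) \<phi>'(1,2) \<phi>'(5,6) that(1)])
  show "(L2_norm (layer_bottom e) f)\<^sup>2 \<le> 5 / 8 * e\<^sup>2 * (L2_norm (layer_bottom e) fy)\<^sup>2"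
    if "(\<lambda>n. L2_norm {0<..} (\<lambda>x. \<phi> n (x, 0))) \<longlonglongrightarrow> 0" "0 < e" "e \<le> B"
    by (rule boundary_layer_zero_trace[OF boundary_layers(1)[OF that(2)] layer_subset(1)[OF that(3)] half_strip_lebesgue
          \<phi>'(4) \<phi>'(1,3) \<phi>'(5,7) that(1)])
  show "(L2_norm (layer_top B e) f)\<^sup>2 \<le> 5 / 8 * e\<^sup>2 * (L2_norm (layer_top B e) fy)\<^sup>2"
    if "(\<lambda>n. L2_norm {0<..} (\<lambda>x. \<phi> n (x, B))) \<longlonglongrightarrow> 0" "0 < e" "e \<le> B"
    by (rule boundary_layer_zero_trace[OF boundary_layers(2)[OF that(2)] layer_subset(2)[OF that(3)] half_strip_lebesgue
          \<phi>'(4) \<phi>'(1,3) \<phi>'(5,7) that(1)])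
qed

text \<open>The indicator of \<open>N1\<close> is replaced by a smooth \<open>\<zeta>\<close> that
  does not depend on x, so integrating u_x^2 by parts in x produces neither a derivative of
  \<open>\<zeta>\<close> nor a boundary term. The price is the larger set \<open>N2\<close>, which
  carries the support of \<open>\<zeta>\<close>.\<close>

lemma tangential_deriv_layer_bound:
  assumes u: "dir_H10 (half_strip B) (1, 0) u ux" and uxx: "weak_deriv (half_strip B) [(1, 0)] ux uxx" "L2_on (half_strip B) uxx"
    and \<zeta>: "smooth \<zeta>" "dir_deriv (1, 0) \<zeta> = (\<lambda>_. 0)" "\<And>z. 0 \<le> \<zeta> z" "\<And>z. \<zeta> z \<le> 1" "\<And>z. z \<in> N1 \<Longrightarrow> \<zeta> z = 1"
      "\<And>z. z \<in> half_strip B \<Longrightarrow> z \<notin> N2 \<Longrightarrow> \<zeta> z = 0"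
    and N: "N1 \<in> sets lebesgue" "N2 \<in> sets lebesgue" "N1 \<subseteq> half_strip B" "N2 \<subseteq> half_strip B"
  shows "(L2_norm N1 ux)\<^sup>2 \<le> L2_norm N2 u * L2_norm N2 uxx"
proof -
  let ?D = "half_strip B"
  have L2: "L2_on ?D u" "L2_on ?D ux" using u by (auto simp: dir_H10_def)
  have abs: "\<bar>\<zeta> z\<bar> \<le> 1" for z using \<zeta>(3,4)[of z] by simp
  have m\<zeta>: "\<zeta> \<in> borel_measurable (lebesgue_on ?D)" by (rule smooth_measurable_lebesgue_on[OF \<zeta>(1)])
  have mi: "indicat_real N \<in> borel_measurable (lebesgue_on ?D)" if "N \<in> sets lebesgue" "N \<subseteq> ?D" for N
    using that by (intro borel_measurable_indicator) (simp add: sets_restrict_space_iff half_strip_lebesgue)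
  have \<zeta>L2: "L2_on ?D (\<lambda>z. \<zeta> z * g z)" if "L2_on ?D g" for g
    by (rule L2_on_bounded_mult[OF that m\<zeta> abs])
  have iL2: "L2_on ?D (\<lambda>z. indicator N z * g z)" if "L2_on ?D g" "N \<in> sets lebesgue" "N \<subseteq> ?D" for g N
    by (rule L2_on_bounded_mult[OF that(1) mi[OF that(2,3)], of 1]) (auto simp: indicator_def)
  have "(L2_norm N1 ux)\<^sup>2 = (LINT z|lebesgue_on ?D. (indicator N1 z * ux z)\<^sup>2)"
    unfolding L2_norm_restrict[OF N(1) half_strip_lebesgue N(3)] L2_norm_power2 ..
  also have "\<dots> \<le> (LINT z|lebesgue_on ?D. (\<zeta> z * ux z) * ux z)"
  proof (rule integral_mono)
    show "integrable (lebesgue_on ?D) (\<lambda>z. (indicator N1 z * ux z)\<^sup>2)"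
      using iL2[OF L2(2) N(1,3)] by (simp add: L2_on_def)
    show "integrable (lebesgue_on ?D) (\<lambda>z. (\<zeta> z * ux z) * ux z)"
      by (rule L2_on_mult_integrable[OF \<zeta>L2[OF L2(2)] L2(2)])
    fix z
    have "indicat_real N1 z \<le> \<zeta> z" using \<zeta>(3)[of z] \<zeta>(5)[of z] by (simp add: indicator_def)
    then have "indicat_real N1 z * (ux z)\<^sup>2 \<le> \<zeta> z * (ux z)\<^sup>2"
      by (rule mult_right_mono) simp
    moreover have "(indicator N1 z * ux z)\<^sup>2 = indicat_real N1 z * (ux z)\<^sup>2"
      by (simp add: indicator_def)
    moreover have "(\<zeta> z * ux z) * ux z = \<zeta> z * (ux z)\<^sup>2"
      by (simp add: power2_eq_square)
    ultimately show "(indicator N1 z * ux z)\<^sup>2 \<le> (\<zeta> z * ux z) * ux z"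
      by linarith
  qed
  also have "\<dots> = - (LINT z|lebesgue_on ?D. (\<zeta> z * u z) * uxx z)"
    by (rule dir_H10_integral_by_parts[OF open_half_strip Basis_xy(1)
          dir_H10_mult_tangential[OF open_half_strip Basis_xy(1) u \<zeta>(1,2) abs] uxx(1) L2(2) uxx(2)])
  also have "\<dots> \<le> \<bar>LINT z|lebesgue_on ?D. (\<zeta> z * u z) * uxx z\<bar>" by simp
  also have "(LINT z|lebesgue_on ?D. (\<zeta> z * u z) * uxx z) = (LINT z|lebesgue_on ?D. (indicator N2 z * u z) * (\<zeta> z * uxx z))"
    using \<zeta>(6) by (intro Bochner_Integration.integral_cong) (auto simp: indicator_def)
  also have "\<bar>LINT z|lebesgue_on ?D. (indicator N2 z * u z) * (\<zeta> z * uxx z)\<bar>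
      \<le> L2_norm ?D (\<lambda>z. indicator N2 z * u z) * L2_norm ?D (\<lambda>z. \<zeta> z * uxx z)"
    by (rule L2_Cauchy_Schwarz[OF iL2[OF L2(1) N(2,4)] \<zeta>L2[OF uxx(2)]])
  also have "\<dots> \<le> L2_norm N2 u * (1 * L2_norm N2 uxx)"
    unfolding L2_norm_restrict[OF N(2) half_strip_lebesgue N(4), of u, symmetric]
    by (intro mult_left_mono L2_norm_nonneg L2_norm_supported_mult[OF uxx(2) m\<zeta> abs _ N(2) half_strip_lebesgue N(4) \<zeta>(6)]) auto
  finally show ?thesis by simp
qed

lemma zero_trace_left_imp_dir_H10:
  assumes B: "B > 0" and tr: "zero_trace_left B f"
    and wf: "weak_deriv (half_strip B) [(1, 0)] f fx" "weak_deriv (half_strip B) [(0, 1)] f fy"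
    and L2: "L2_on (half_strip B) f" "L2_on (half_strip B) fx" "L2_on (half_strip B) fy"
  shows "dir_H10 (half_strip B) (1, 0) f fx"
proof -
  obtain \<phi> where \<phi>: "H1_approx (half_strip B) f fx fy \<phi>" "(\<lambda>n. L2_norm {0<..<B} (\<lambda>y. \<phi> n (0, y))) \<longlonglongrightarrow> 0"
    using has_zero_traceE[OF open_half_strip tr[unfolded zero_trace_left_def] wf L2] by blast
  show ?thesis
    by (rule dir_H10_x[OF B \<phi>(1) zero_trace_layer_bounds(1)[OF \<phi>]])
qed

text \<open>Integration by parts in \<open>x\<close> turns \<open>\<integral> u\<^sub>x\<^sup>2\<close> over a layer of thickness \<open>e\<close> into \<open>- \<integral> u u\<^sub>x\<^sub>x\<close>, which
  is \<open>o(e)\<close>; hence the trace of \<open>u\<^sub>x\<close> vanishes as well.\<close>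

lemma dir_H10_tangential_deriv:
  assumes B: "B > 0" and u: "dir_H10 (half_strip B) (1, 0) u ux" and uy: "L2_on (half_strip B) uy"
    and uxx: "weak_deriv (half_strip B) [(1, 0)] ux uxx"
    and \<phi>: "H1_approx (half_strip B) ux uxx uxy \<phi>"
    and bottom: "\<And>e. 0 < e \<Longrightarrow> e \<le> B \<Longrightarrow> (L2_norm (layer_bottom e) u)\<^sup>2 \<le> 5 / 8 * e\<^sup>2 * (L2_norm (layer_bottom e) uy)\<^sup>2"
    and top: "\<And>e. 0 < e \<Longrightarrow> e \<le> B \<Longrightarrow> (L2_norm (layer_top B e) u)\<^sup>2 \<le> 5 / 8 * e\<^sup>2 * (L2_norm (layer_top B e) uy)\<^sup>2"
  shows "dir_H10 (half_strip B) (0, 1) ux uxy"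
proof -
  let ?D = "half_strip B"
  have \<phi>': "L2_on ?D ux" "L2_on ?D uxx" "L2_on ?D uxy" "\<And>n. test_function UNIV (\<phi> n)"
    "(\<lambda>n. L2_norm ?D (\<lambda>z. \<phi> n z - ux z)) \<longlonglongrightarrow> 0"
    "(\<lambda>n. L2_norm ?D (\<lambda>z. dir_deriv (0, 1) (\<phi> n) z - uxy z)) \<longlonglongrightarrow> 0"
    using \<phi> by (auto simp: H1_approx_def)
  define e where "e m = width B m / 2" for m
  note w = width_props[OF B]
  have e: "0 < e m" "e m \<le> B" "2 * e m = width B m" for m
    using w(1)[of m] w(2)[of m] B by (auto simp: e_def)
  have elim: "e \<longlonglongrightarrow> 0"
    using tendsto_divide[OF w(3) tendsto_const[of 2]] by (simp add: e_def[abs_def])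
  \<comment> \<open>The zero trace of u yields one factor of the width, which cancels
    \<open>e m\<close> up to a factor 2; the norms of u_y and u_xx over the layer then tend to
    0.\<close>
  have small: "(\<lambda>m. (L2_norm (N m) ux)\<^sup>2 / e m) \<longlonglongrightarrow> 0"
    if N: "\<And>m. (L2_norm (N m) ux)\<^sup>2 \<le> L2_norm (N' m) u * L2_norm (N' m) uxx"
      and N': "\<And>m. (L2_norm (N' m) u)\<^sup>2 \<le> 5 / 8 * (width B m)\<^sup>2 * (L2_norm (N' m) uy)\<^sup>2"
      and l: "(\<lambda>m. L2_norm (N' m) uy) \<longlonglongrightarrow> 0" "(\<lambda>m. L2_norm (N' m) uxx) \<longlonglongrightarrow> 0" for N N'
  proof (rule Lim_null_comparison[OF always_eventually])
    show "(\<lambda>m. 2 * (L2_norm (N' m) uy * L2_norm (N' m) uxx)) \<longlonglongrightarrow> 0"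
      using tendsto_mult_right_zero[OF tendsto_mult_zero[OF l], of 2] .
    show "\<forall>m. norm ((L2_norm (N m) ux)\<^sup>2 / e m) \<le> 2 * (L2_norm (N' m) uy * L2_norm (N' m) uxx)"
    proof
      fix m
      have "(L2_norm (N m) ux)\<^sup>2 \<le> (width B m * L2_norm (N' m) uy) * L2_norm (N' m) uxx"
        using N[of m] mult_right_mono[OF layer_norm_bound[OF N'] L2_norm_nonneg, of m "N' m" uxx] w(1)[of m]
        by simp
      then show "norm ((L2_norm (N m) ux)\<^sup>2 / e m) \<le> 2 * (L2_norm (N' m) uy * L2_norm (N' m) uxx)"
        using e(1)[of m] unfolding e(3)[symmetric] by (simp add: field_simps)
    qed
  qed
  have le: "width B m \<le> B" for m by (rule w(2))
  have cut: "smooth (\<lambda>z::real \<times> real. 1 - g (snd z))" "dir_deriv (1, 0) (\<lambda>z::real \<times> real. 1 - g (snd z)) = (\<lambda>_. 0)"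
    if g: "smooth g" for g :: "real \<Rightarrow> real"
  proof -
    show "smooth (\<lambda>z::real \<times> real. 1 - g (snd z))"
      by (intro smooth_diff smooth_const smooth_snd g)
    show "dir_deriv (1, 0) (\<lambda>z::real \<times> real. 1 - g (snd z)) = (\<lambda>_. 0)"
      unfolding dir_deriv_diff[OF smooth_const smooth_snd[OF g] Basis_xy(1)] dir_deriv_snd by simp
  qed
  have b: "(L2_norm (layer_bottom (e m)) ux)\<^sup>2 \<le> L2_norm (layer_bottom (width B m)) u * L2_norm (layer_bottom (width B m)) uxx" for m
  proof (rule tangential_deriv_layer_bound[OF u uxx \<phi>'(2) cut[OF smooth_step_affine(1)[of "1 / e m"]]])
    show "1 - step (1 / e m * snd z - 1) = 1" if "z \<in> layer_bottom (e m)" for z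
    proof -
      have "1 / e m * snd z - 1 \<le> 0" using that e(1)[of m] by (auto simp: layer_bottom_def field_simps)
      then show ?thesis by (simp add: step_eq_0)
    qed
    show "1 - step (1 / e m * snd z - 1) = 0" if "z \<in> ?D" "z \<notin> layer_bottom (width B m)" for z
    proof -
      have "snd z \<ge> 2 * e m" using that by (auto simp: layer_bottom_def half_strip_def e(3))
      then have "1 / e m * snd z - 1 \<ge> 1" using e(1)[of m] by (simp add: field_simps)
      then show ?thesis by (simp add: step_eq_1)
    qed
  qed (auto simp: step_nonneg step_le_1 layer_lebesgue layer_subset(1)[OF e(2), THEN subsetD] layer_subset(1)[OF le, THEN subsetD])
  have t: "(L2_norm (layer_top B (e m)) ux)\<^sup>2 \<le> L2_norm (layer_top B (width B m)) u * L2_norm (layer_top B (width B m)) uxx" for m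
  proof (rule tangential_deriv_layer_bound[OF u uxx \<phi>'(2) cut[OF smooth_step_affine(2)[of "1 / e m" B]]])
    show "1 - step (1 / e m * (B - snd z) - 1) = 1" if "z \<in> layer_top B (e m)" for z
    proof -
      have "1 / e m * (B - snd z) - 1 \<le> 0" using that e(1)[of m] by (auto simp: layer_top_def field_simps)
      then show ?thesis by (simp add: step_eq_0)
    qed
    show "1 - step (1 / e m * (B - snd z) - 1) = 0" if "z \<in> ?D" "z \<notin> layer_top B (width B m)" for z
    proof -
      have "B - snd z \<ge> 2 * e m" using that by (auto simp: layer_top_def half_strip_def e(3))
      then have "1 / e m * (B - snd z) - 1 \<ge> 1" using e(1)[of m] by (simp add: field_simps)
      then show ?thesis by (simp add: step_eq_1)
    qed
  qed (auto simp: step_nonneg step_le_1 layer_lebesgue layer_subset(2)[OF e(2), THEN subsetD] layer_subset(2)[OF le, THEN subsetD])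
  have tr_b: "(\<lambda>n. L2_norm {0<..} (\<lambda>x. \<phi> n (x, 0))) \<longlonglongrightarrow> 0"
    by (rule zero_trace_from_boundary_layer[OF boundary_layers(1)[OF e(1)] layer_subset(1)[OF e(2)] half_strip_lebesgue elim
          \<phi>'(4,1,3,5,6) small[OF b bottom[OF w(1) w(2)] L2_norm_layer_tendsto_0(1)[OF B uy] L2_norm_layer_tendsto_0(1)[OF B \<phi>'(2)]]])
  have tr_t: "(\<lambda>n. L2_norm {0<..} (\<lambda>x. \<phi> n (x, B))) \<longlonglongrightarrow> 0"
    by (rule zero_trace_from_boundary_layer[OF boundary_layers(2)[OF e(1)] layer_subset(2)[OF e(2)] half_strip_lebesgue elim
          \<phi>'(4,1,3,5,6) small[OF t top[OF w(1) w(2)] L2_norm_layer_tendsto_0(2)[OF B uy] L2_norm_layer_tendsto_0(2)[OF B \<phi>'(2)]]])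
  show ?thesis
    by (rule dir_H10_y[OF B \<phi> zero_trace_layer_bounds(2)[OF \<phi> tr_b] zero_trace_layer_bounds(3)[OF \<phi> tr_t]])
qed

text \<open>The constant \<open>5/32\<close> is not optimal (that would be \<open>1/\<pi>\<^sup>2\<close>) but suffices for the decay rate.\<close>

lemma poincare_strip:
  assumes B: "B > 0" and u: "L2_on (half_strip B) u" and uy: "L2_on (half_strip B) uy"
    and bottom: "(L2_norm (layer_bottom (B / 2)) u)\<^sup>2 \<le> 5 / 8 * (B / 2)\<^sup>2 * (L2_norm (layer_bottom (B / 2)) uy)\<^sup>2"
    and top: "(L2_norm (layer_top B (B / 2)) u)\<^sup>2 \<le> 5 / 8 * (B / 2)\<^sup>2 * (L2_norm (layer_top B (B / 2)) uy)\<^sup>2"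
  shows "(L2_norm (half_strip B) u)\<^sup>2 \<le> 5 / 32 * B\<^sup>2 * (L2_norm (half_strip B) uy)\<^sup>2"
proof -
  let ?D = "half_strip B" and ?N = "layer_bottom (B / 2)" and ?M = "layer_top B (B / 2)"
  have sub: "?N \<subseteq> ?D" "?M \<subseteq> ?D" using B by (auto intro!: layer_subset)
  have mi: "indicat_real N \<in> borel_measurable (lebesgue_on ?D)" if "N \<in> sets lebesgue" "N \<subseteq> ?D" for N
    using that by (intro borel_measurable_indicator) (simp add: sets_restrict_space_iff half_strip_lebesgue)
  have iL2: "L2_on ?D (\<lambda>z. indicator N z * g z)" if "L2_on ?D g" "N \<in> sets lebesgue" "N \<subseteq> ?D" for g N
    by (rule L2_on_bounded_mult[OF that(1) mi[OF that(2,3)], of 1]) (auto simp: indicator_def)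
  \<comment> \<open>The open halves of the strip miss only the middle line.\<close>
  have null: "AE z in lebesgue_on ?D. snd z \<noteq> B / 2"
  proof -
    have "negligible {z::real \<times> real. z \<bullet> (0, 1) = B / 2}"
      by (rule negligible_standard_hyperplane) simp
    then have "AE z in lebesgue. z \<notin> {z::real \<times> real. z \<bullet> (0, 1) = B / 2}"
      by (intro AE_not_in) (simp add: negligible_iff_null_sets)
    then have "AE z::real \<times> real in lebesgue. z \<in> ?D \<longrightarrow> snd z \<noteq> B / 2"
      by eventually_elim (auto simp: inner_prod_def)
    then show ?thesis by (simp add: AE_restrict_space_iff half_strip_lebesgue)
  qed
  \<comment> \<open>Each half is a layer of thickness B/2 along an edge where u vanishes. Using both
    edges replaces B by B/2, hence 5/32 = (5/8)/4.\<close>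
  have split: "(L2_norm ?D g)\<^sup>2 = (L2_norm ?N g)\<^sup>2 + (L2_norm ?M g)\<^sup>2" if g: "L2_on ?D g" for g
  proof -
    note iN = iL2[OF g layer_lebesgue(1) sub(1)] and iM = iL2[OF g layer_lebesgue(2) sub(2)]
    have "(L2_norm ?D g)\<^sup>2 = (LINT z|lebesgue_on ?D. (indicator ?N z * g z)\<^sup>2 + (indicator ?M z * g z)\<^sup>2)"
      unfolding L2_norm_power2
    proof (rule integral_cong_AE)
      have "AE z in lebesgue_on ?D. z \<in> ?D"
        using AE_space[of "lebesgue_on ?D"] by simp
      with null show "AE z in lebesgue_on ?D. (g z)\<^sup>2 = (indicator ?N z * g z)\<^sup>2 + (indicator ?M z * g z)\<^sup>2"
        by eventually_elim (auto simp: layer_bottom_def layer_top_def half_strip_def indicator_def)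
    qed (use g iN iM in \<open>auto simp: L2_on_def\<close>)
    also have "\<dots> = (LINT z|lebesgue_on ?D. (indicator ?N z * g z)\<^sup>2) + (LINT z|lebesgue_on ?D. (indicator ?M z * g z)\<^sup>2)"
      using iN iM by (intro Bochner_Integration.integral_add) (auto simp: L2_on_def)
    finally show ?thesis
      unfolding L2_norm_restrict[OF layer_lebesgue(1) half_strip_lebesgue sub(1)]
        L2_norm_restrict[OF layer_lebesgue(2) half_strip_lebesgue sub(2)] L2_norm_power2 .
  qed
  have "(L2_norm ?D u)\<^sup>2 \<le> 5 / 8 * (B / 2)\<^sup>2 * ((L2_norm ?N uy)\<^sup>2 + (L2_norm ?M uy)\<^sup>2)"
    unfolding split[OF u] using add_mono[OF bottom top] by (simp only: distrib_left)
  also have "\<dots> = 5 / 32 * B\<^sup>2 * (L2_norm ?D uy)\<^sup>2"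
    unfolding split[OF uy] by (simp add: power_divide)
  finally show ?thesis .
qed

text \<open>\<open>N\<close> and \<open>X\<close> are the norms of u and of its Laplacian,
  \<open>G\<close> and \<open>Y\<close> the squared norms of the gradient and of u_y. From c N^2 <=
  Y <= G <= N X follows X >= c N, while X^2 - \<gamma> G >= X (X - N/8).\<close>

lemma dissipation_arith:
  fixes N X G Y a B \<gamma> :: real
  assumes "N \<ge> 0" "X \<ge> 0" "G \<le> N * X" "Y \<le> G" "N\<^sup>2 \<le> 5 / 32 * B\<^sup>2 * Y" "B > 0"
    and a: "a\<^sup>2 = pi\<^sup>2 / B\<^sup>2" "a\<^sup>2 > 1" and \<gamma>: "0 < \<gamma>" "\<gamma> < 1 / 8"
  shows "a\<^sup>2 / 4 * N\<^sup>2 \<le> X\<^sup>2 - \<gamma> * G"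
proof -
  define c where "c = 5 / 8 * a\<^sup>2"
  have Y: "Y \<ge> 0"
  proof (rule ccontr)
    assume "\<not> Y \<ge> 0"
    then have "5 / 32 * B\<^sup>2 * Y < 0" using \<open>B > 0\<close> by (simp add: mult_pos_neg)
    then show False using assms(5) zero_le_power2[of N] by linarith
  qed
  have pi2: "pi\<^sup>2 \<le> 256 / 25"
  proof -
    have "pi\<^sup>2 \<le> (16 / 5)\<^sup>2" using pi_less_16_5 pi_gt_zero by (intro power_mono) auto
    then show ?thesis by (simp add: power2_eq_square)
  qed
  \<comment> \<open>Here pi < 16/5 enters: the coefficient 25/256 of pi^2 becomes at most 1.\<close>
  have "c * N\<^sup>2 \<le> Y"
  proof -
    have "c * N\<^sup>2 \<le> c * (5 / 32 * B\<^sup>2 * Y)"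
      using assms(5) by (intro mult_left_mono) (simp_all add: c_def)
    also have "\<dots> = 25 / 256 * pi\<^sup>2 * Y"
      using \<open>B > 0\<close> by (simp add: c_def a(1))
    also have "\<dots> \<le> 1 * Y"
      using pi2 Y by (intro mult_right_mono) auto
    finally show ?thesis by simp
  qed
  then have G: "c * N\<^sup>2 \<le> N * X" using assms(3,4) by linarith
  show ?thesis
  proof (cases "N = 0")
    case True
    then have "\<gamma> * G \<le> 0" using assms(3) \<gamma> by (simp add: mult_nonneg_nonpos)
    then have "0 \<le> X\<^sup>2 - \<gamma> * G" using zero_le_power2[of X] by linarith
    then show ?thesis using True by simp
  next
    case False
    then have N: "N > 0" using assms(1) by simp
    have X: "c * N \<le> X"
    proof -
      have "N * (c * N) \<le> N * X" using G by (simp add: power2_eq_square mult_ac)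
      then show ?thesis using N by (simp only: mult_le_cancel_left_pos)
    qed
    have c: "c > 5 / 8" using a(2) by (simp add: c_def)
    have "\<gamma> * G \<le> \<gamma> * (N * X)"
      using assms(3) \<gamma> by (intro mult_left_mono) auto
    also have "\<dots> \<le> 1 / 8 * (N * X)"
      using \<gamma> N assms(2) by (intro mult_right_mono) auto
    finally have 1: "\<gamma> * G \<le> 1 / 8 * (N * X)" .
    \<comment> \<open>c > 5/8 comes from a^2 > 1, and 5/8 - 1/8 = 1/2. The product of c N and N/2 is
      (5/16) a^2 N^2.\<close>
    have half: "N / 2 \<le> X - N / 8"
    proof -
      have "5 / 8 * N \<le> c * N" using c N by (intro mult_right_mono) auto
      then show ?thesis using X by linarith
    qed
    have "a\<^sup>2 / 4 * N\<^sup>2 \<le> c / 2 * N\<^sup>2"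
      by (intro mult_right_mono) (auto simp: c_def)
    also have "\<dots> = (c * N) * (N / 2)" by (simp add: power2_eq_square)
    also have "\<dots> \<le> X * (X - N / 8)"
      using X half N assms(2) c by (intro mult_mono) auto
    also have "\<dots> = X\<^sup>2 - 1 / 8 * (N * X)"
      by (simp add: power2_eq_square algebra_simps)
    finally show ?thesis using 1 by linarith
  qed
qed

text \<open>Only a.e. identities on one time slice enter. All derivatives are the given versions
  \<open>v i j\<close>, so each integration by parts refers to the same representatives as the
  equation.\<close>

lemma energy_dissipation:
  fixes u ut :: "real \<times> real \<Rightarrow> real" and v :: "nat \<Rightarrow> nat \<Rightarrow> real \<times> real \<Rightarrow> real"
  assumes B: "B > 0" and \<gamma>: "0 < \<gamma>" "\<gamma> < 1 / 8" and a: "a\<^sup>2 = pi\<^sup>2 / B\<^sup>2" "a\<^sup>2 > 1"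
    and W: "\<And>i j. i + j \<le> 4 \<or> (i = 5 \<and> j = 0) \<Longrightarrow> weak_deriv (half_strip B) (xy i j) u (v i j)"
    and L2: "\<And>i j. i + j \<le> 4 \<or> (i = 5 \<and> j = 0) \<Longrightarrow> L2_on (half_strip B) (v i j)"
      "L2_on (half_strip B) u" "L2_on (half_strip B) ut"
    and pde: "AE z in lebesgue_on (half_strip B). ut z + (v 4 0 z + 2 * v 2 2 z + v 0 4 z) + \<gamma> * (v 2 0 z + v 0 2 z)
        + (v 3 0 z + v 1 2 z) + u z * v 1 0 z - v 5 0 z = 0"
    and tr: "zero_trace_left B u" "zero_trace_bottom B u" "zero_trace_top B u"
      "zero_trace_bottom B (v 0 2)" "zero_trace_top B (v 0 2)" "zero_trace_left B (v 1 0)"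
  shows "(LINT z|lebesgue_on (half_strip B). ut z * u z) \<le> - (a\<^sup>2 / 4) * (L2_norm (half_strip B) u)\<^sup>2"
proof -
  let ?D = "half_strip B"
  define I where "I f g = (LINT z|lebesgue_on ?D. f z * g z)" for f g :: "real \<times> real \<Rightarrow> real"
  have Icomm: "I f g = I g f" for f g 
    unfolding I_def by (intro Bochner_Integration.integral_cong refl) (rule mult.commute)
  note O = open_half_strip[of B]
  have Wx: "weak_deriv ?D [(1, 0)] (v i j) (v (Suc i) j)" if "i + j \<le> 3 \<or> (i = 4 \<and> j = 0)" for i j
    using that by (intro weak_deriv_x[OF W W]) auto
  have Wy: "weak_deriv ?D [(0, 1)] (v i j) (v i (Suc j))" if "i + j \<le> 3" for i j
    using that by (intro weak_deriv_y[OF W W]) auto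
  have Ux: "weak_deriv ?D [(1, 0)] u (v 1 0)" and Uy: "weak_deriv ?D [(0, 1)] u (v 0 1)"
    using W[of 1 0] W[of 0 1] by (simp_all add: xy_simps)
  obtain \<phi>b where \<phi>b: "H1_approx ?D u (v 1 0) (v 0 1) \<phi>b" "(\<lambda>n. L2_norm {0<..} (\<lambda>x. \<phi>b n (x, 0))) \<longlonglongrightarrow> 0"
    using has_zero_traceE[OF O tr(2)[unfolded zero_trace_bottom_def] Ux Uy L2(2) L2(1) L2(1)] by auto
  obtain \<phi>t where \<phi>t: "H1_approx ?D u (v 1 0) (v 0 1) \<phi>t" "(\<lambda>n. L2_norm {0<..} (\<lambda>x. \<phi>t n (x, B))) \<longlonglongrightarrow> 0"
    using has_zero_traceE[OF O tr(3)[unfolded zero_trace_top_def] Ux Uy L2(2) L2(1) L2(1)] by auto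
  obtain \<chi>b where \<chi>b: "H1_approx ?D (v 0 2) (v 1 2) (v 0 3) \<chi>b" "(\<lambda>n. L2_norm {0<..} (\<lambda>x. \<chi>b n (x, 0))) \<longlonglongrightarrow> 0"
    using has_zero_traceE[OF O tr(4)[unfolded zero_trace_bottom_def], of "v 1 2" "v 0 3"] Wx[of 0 2] Wy[of 0 2] L2(1)
    by (auto simp: eval_nat_numeral)
  obtain \<chi>t where \<chi>t: "H1_approx ?D (v 0 2) (v 1 2) (v 0 3) \<chi>t" "(\<lambda>n. L2_norm {0<..} (\<lambda>x. \<chi>t n (x, B))) \<longlonglongrightarrow> 0"
    using has_zero_traceE[OF O tr(5)[unfolded zero_trace_top_def], of "v 1 2" "v 0 3"] Wx[of 0 2] Wy[of 0 2] L2(1)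
    by (auto simp: eval_nat_numeral)
  obtain \<omega> where \<omega>: "H1_approx ?D (v 1 0) (v 2 0) (v 1 1) \<omega>" "(\<lambda>n. L2_norm {0<..<B} (\<lambda>y. \<omega> n (0, y))) \<longlonglongrightarrow> 0"
    using has_zero_traceE[OF O tr(6)[unfolded zero_trace_left_def], of "v 2 0" "v 1 1"] Wx[of 1 0] Wy[of 1 0] L2(1)
    by (auto simp: eval_nat_numeral)
  note ubot = zero_trace_layer_bounds(2)[OF \<phi>b] and utop = zero_trace_layer_bounds(3)[OF \<phi>t]
  \<comment> \<open>In the next five facts \<open>h\<close> stands for direction x and
    \<open>k\<close> for direction y; the suffixes \<open>u\<close>, \<open>1\<close>,
    \<open>2\<close> stand for u, u_x, u_yy.\<close>
  have hu: "dir_H10 ?D (1, 0) u (v 1 0)"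
    using L2(1) by (intro zero_trace_left_imp_dir_H10[OF B tr(1) Ux Uy L2(2)]) auto
  have ku: "dir_H10 ?D (0, 1) u (v 0 1)"
    by (rule dir_H10_y[OF B \<phi>b(1) ubot utop])
  have k2: "dir_H10 ?D (0, 1) (v 0 2) (v 0 3)"
    by (rule dir_H10_y[OF B \<chi>b(1) zero_trace_layer_bounds(2)[OF \<chi>b] zero_trace_layer_bounds(3)[OF \<chi>t]])
  have h1: "dir_H10 ?D (1, 0) (v 1 0) (v 2 0)"
    by (rule dir_H10_x[OF B \<omega>(1) zero_trace_layer_bounds(1)[OF \<omega>]])
  \<comment> \<open>The only one of the five that is not a given boundary condition: u_x on the
    horizontal edges inherits its zero trace from u.\<close>
  have k1: "dir_H10 ?D (0, 1) (v 1 0) (v 1 1)"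
    using Wx[of 1 0] by (intro dir_H10_tangential_deriv[OF B hu _ _ \<omega>(1) ubot utop] L2(1)) (auto simp: eval_nat_numeral)
  note ibx = dir_H10_integral_by_parts[OF O Basis_xy(1), folded I_def]
  note iby = dir_H10_integral_by_parts[OF O Basis_xy(2), folded I_def]
  have E1: "I (v 1 0) (v 3 0) = - I u (v 4 0)"
    using Wx[of 3 0] by (intro ibx[OF hu] L2(1)) (auto simp: eval_nat_numeral)
  have E2: "I (v 2 0) (v 2 0) = - I (v 1 0) (v 3 0)"
    using Wx[of 2 0] by (intro ibx[OF h1] L2(1)) (auto simp: eval_nat_numeral)
  have E3: "I (v 1 0) (v 1 2) = - I u (v 2 2)"
    using Wx[of 1 2] by (intro ibx[OF hu] L2(1)) (auto simp: eval_nat_numeral)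
  have E4: "I (v 2 0) (v 0 2) = - I (v 1 0) (v 1 2)"
    using Wx[of 0 2] by (intro ibx[OF h1] L2(1)) (auto simp: eval_nat_numeral)
  have E5: "I (v 0 1) (v 0 3) = - I u (v 0 4)"
    using Wy[of 0 3] by (intro iby[OF ku] L2(1)) (auto simp: eval_nat_numeral)
  have E6: "I (v 0 3) (v 0 1) = - I (v 0 2) (v 0 2)"
    using Wy[of 0 1] by (intro iby[OF k2] L2(1)) (auto simp: eval_nat_numeral)
  have E7: "I (v 1 0) (v 1 0) = - I u (v 2 0)"
    using Wx[of 1 0] by (intro ibx[OF hu] L2(1)) (auto simp: eval_nat_numeral)
  have E8: "I (v 0 1) (v 0 1) = - I u (v 0 2)"
    using Wy[of 0 1] by (intro iby[OF ku] L2(1)) (auto simp: eval_nat_numeral)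
  have E9: "I (v 1 0) (v 2 0) = - I u (v 3 0)"
    using Wx[of 2 0] by (intro ibx[OF hu] L2(1)) (auto simp: eval_nat_numeral)
  have E10: "I (v 2 0) (v 1 0) = - I (v 1 0) (v 2 0)"
    using Wx[of 1 0] by (intro ibx[OF h1] L2(1)) (auto simp: eval_nat_numeral)
  have E11: "I (v 1 0) (v 0 2) = - I u (v 1 2)"
    using Wx[of 0 2] by (intro ibx[OF hu] L2(1)) (auto simp: eval_nat_numeral)
  have E12: "I (v 0 1) (v 1 1) = - I u (v 1 2)"
    using Wy[of 1 1] by (intro iby[OF ku] L2(1)) (auto simp: eval_nat_numeral)
  have E13: "I (v 1 1) (v 0 1) = - I (v 1 0) (v 0 2)"
    using Wy[of 0 1] by (intro iby[OF k1] L2(1)) (auto simp: eval_nat_numeral)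
  have E14: "I (v 1 0) (v 4 0) = - I u (v 5 0)"
    using Wx[of 4 0] by (intro ibx[OF hu] L2(1)) (auto simp: eval_nat_numeral)
  have E15: "I (v 2 0) (v 3 0) = - I (v 1 0) (v 4 0)"
    using Wx[of 3 0] by (intro ibx[OF h1] L2(1)) (auto simp: eval_nat_numeral)
  have shift: "z + h *\<^sub>R (1, 0) \<in> ?D" if "z \<in> ?D" "0 \<le> h" for z and h :: real
    using that by (cases z) (auto simp: half_strip_def)
  have E16: "I (v 3 0) (v 2 0) \<le> 0"
    unfolding I_def using Wx[of 2 0]
    by (intro dir_H10_second_deriv_nonpos[OF O Basis_xy(1) shift h1] L2(1)) (auto simp: eval_nat_numeral)
  \<comment> \<open>u u_x solved for from the equation. Every term of \<open>R\<close> lies in L^2,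
    hence so does u u_x, which is what the treatment of the nonlinear term demands.\<close>
  define R where "R = (\<lambda>z. v 5 0 z - ut z - (v 4 0 z + 2 * v 2 2 z + v 0 4 z) - \<gamma> * (v 2 0 z + v 0 2 z) - (v 3 0 z + v 1 2 z))"
  have RL2: "L2_on ?D R"
    unfolding R_def by (intro L2_on_diff L2_on_add L2_on_cmult L2(1) L2(2,3)) auto
  have RAE: "AE z in lebesgue_on ?D. R z = u z * v 1 0 z"
    using pde by eventually_elim (simp add: R_def algebra_simps)
  have nl_meas: "(\<lambda>z. u z * v 1 0 z) \<in> borel_measurable (lebesgue_on ?D)"
    by (intro borel_measurable_times L2_on_measurable L2) auto
  have nlL2: "L2_on ?D (\<lambda>z. u z * v 1 0 z)"
    by (rule L2_on_cong_AE[OF RL2 nl_meas RAE])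
  have "I u R = I u (\<lambda>z. u z * v 1 0 z)"
    unfolding I_def
  proof (rule integral_cong_AE)
    show "AE z in lebesgue_on ?D. u z * R z = u z * (u z * v 1 0 z)"
      using RAE by eventually_elim simp
  qed (intro borel_measurable_times nl_meas L2_on_measurable L2 RL2)+
  also have "\<dots> = 0"
    unfolding I_def by (rule dir_H10_integral_square_mult_deriv[OF O Basis_xy(1) hu nlL2])
  finally have IR: "I u R = 0" .
  have int: "integrable (lebesgue_on ?D) (\<lambda>z. u z * v i j z)" if "i + j \<le> 4 \<or> (i = 5 \<and> j = 0)" for i j
    by (rule L2_on_mult_integrable[OF L2(2) L2(1)[OF that]])
  have int_ut: "integrable (lebesgue_on ?D) (\<lambda>z. u z * ut z)"
    by (rule L2_on_mult_integrable[OF L2(2,3)])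
  have "I u R = (LINT z|lebesgue_on ?D. u z * v 5 0 z - u z * ut z - (u z * v 4 0 z + 2 * (u z * v 2 2 z) + u z * v 0 4 z)
      - \<gamma> * (u z * v 2 0 z + u z * v 0 2 z) - (u z * v 3 0 z + u z * v 1 2 z))"
    unfolding I_def R_def by (simp add: algebra_simps)
  also have "\<dots> = I u (v 5 0) - I u ut - (I u (v 4 0) + 2 * I u (v 2 2) + I u (v 0 4))
      - \<gamma> * (I u (v 2 0) + I u (v 0 2)) - (I u (v 3 0) + I u (v 1 2))"
    unfolding I_def using int int_ut by simp
  finally have eq: "I u ut = I u (v 5 0) - (I u (v 4 0) + 2 * I u (v 2 2) + I u (v 0 4))
      - \<gamma> * (I u (v 2 0) + I u (v 0 2)) - (I u (v 3 0) + I u (v 1 2))"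
    using IR by linarith
  define lap where "lap = (\<lambda>z. v 2 0 z + v 0 2 z)"
  have lapL2: "L2_on ?D lap" unfolding lap_def by (intro L2_on_add L2(1)) auto
  have X2: "(L2_norm ?D lap)\<^sup>2 = I (v 2 0) (v 2 0) + 2 * I (v 2 0) (v 0 2) + I (v 0 2) (v 0 2)"
  proof -
    have i: "integrable (lebesgue_on ?D) (\<lambda>z. v 2 0 z * v 2 0 z)" "integrable (lebesgue_on ?D) (\<lambda>z. v 2 0 z * v 0 2 z)"
      "integrable (lebesgue_on ?D) (\<lambda>z. v 0 2 z * v 0 2 z)"
      by (intro L2_on_mult_integrable L2(1); simp)+
    have "(L2_norm ?D lap)\<^sup>2 = (LINT z|lebesgue_on ?D. v 2 0 z * v 2 0 z + 2 * (v 2 0 z * v 0 2 z) + v 0 2 z * v 0 2 z)"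
      unfolding L2_norm_power2 lap_def by (simp add: power2_eq_square algebra_simps)
    also have "\<dots> = I (v 2 0) (v 2 0) + 2 * I (v 2 0) (v 0 2) + I (v 0 2) (v 0 2)"
      unfolding I_def using i by simp
    finally show ?thesis .
  qed
  define G where "G = I (v 1 0) (v 1 0) + I (v 0 1) (v 0 1)"
  have Glap: "G = - I u lap"
  proof -
    have "I u lap = I u (v 2 0) + I u (v 0 2)"
      unfolding I_def lap_def using int[of 2 0] int[of 0 2] by (simp add: distrib_left)
    then show ?thesis using E7 E8 by (simp add: G_def)
  qed
  have GNX: "G \<le> L2_norm ?D u * L2_norm ?D lap"
    using L2_Cauchy_Schwarz[OF L2(2) lapL2] Glap by (simp add: I_def)
  have sq: "I f f = (L2_norm ?D f)\<^sup>2" for f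
    unfolding I_def L2_norm_power2 by (simp add: power2_eq_square)
  have YG: "(L2_norm ?D (v 0 1))\<^sup>2 \<le> G"
    \<comment> \<open>The squared norm of u_x is dropped; the Poincare inequality uses u_y
      only.\<close>
    unfolding G_def sq by simp
  have poin: "(L2_norm ?D u)\<^sup>2 \<le> 5 / 32 * B\<^sup>2 * (L2_norm ?D (v 0 1))\<^sup>2"
    using B by (intro poincare_strip[OF B L2(2) L2(1)] ubot utop) auto
  have "a\<^sup>2 / 4 * (L2_norm ?D u)\<^sup>2 \<le> (L2_norm ?D lap)\<^sup>2 - \<gamma> * G"
    by (rule dissipation_arith[OF L2_norm_nonneg L2_norm_nonneg GNX YG poin B a \<gamma>])
  moreover have "I u ut = - ((L2_norm ?D lap)\<^sup>2) + \<gamma> * G + I (v 3 0) (v 2 0)"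
  proof -
    have i1: "I u (v 4 0) = I (v 2 0) (v 2 0)" using E1 E2 by simp
    have i2: "I u (v 2 2) = I (v 2 0) (v 0 2)" using E3 E4 by simp
    have i3: "I u (v 0 4) = I (v 0 2) (v 0 2)" using E5 E6 Icomm[of "v 0 3" "v 0 1"] by simp
    \<comment> \<open>(u, u_xxx) = -(u_x, u_xx), and the latter equals its own negative since u_x
      vanishes for x = 0.\<close>
    have i4: "I u (v 3 0) = 0" using E9 E10 Icomm[of "v 1 0" "v 2 0"] by simp
    \<comment> \<open>Moving y-derivatives gives (u, u_xyy) = -(u_y, u_xy) = (u_x, u_yy), where the
      last equality needs \<open>k1\<close>; moving the x-derivative gives -(u_x, u_yy). So the
      integral equals its own negative.\<close>
    have i5: "I u (v 1 2) = 0" using E11 E12 E13 Icomm[of "v 1 1" "v 0 1"] by simp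
    \<comment> \<open>Two integrations by parts use up both conditions at x = 0; the remaining
      integral has a sign by \<open>E16\<close>.\<close>
    have i6: "I u (v 5 0) = I (v 3 0) (v 2 0)" using E14 E15 Icomm[of "v 3 0" "v 2 0"] by simp
    have i7: "I u (v 2 0) + I u (v 0 2) = - G" using E7 E8 by (simp add: G_def)
    show ?thesis unfolding eq i1 i2 i3 i4 i5 i6 i7 X2 by simp
  qed
  ultimately have "I ut u \<le> - (a\<^sup>2 / 4) * (L2_norm ?D u)\<^sup>2"
    using E16 Icomm[of ut u] by simp
  then show ?thesis unfolding I_def .
qed

section \<open>Evolution in time\<close>

text \<open>Fubini for null sets. Lebesgue measure on the product is not the product of the
  completed measures, so the exceptional set is first enlarged to a Borel null set.\<close>

lemma AE_lebesgue_on_Times: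
  fixes P :: "'a::euclidean_space \<times> 'b::euclidean_space \<Rightarrow> bool"
  assumes D: "open D" and J: "open J" and P: "AE q in lebesgue_on (D \<times> J). P q"
  shows "AE t in lebesgue_on J. AE z in lebesgue_on D. P (z, t)"
proof -
  have "AE q in lebesgue. q \<in> D \<times> J \<longrightarrow> P q"
    using P by (subst (asm) AE_restrict_space_iff) (simp_all add: open_imp_lebesgue[OF open_Times[OF D J]])
  then have "AE q in lborel. q \<in> D \<times> J \<longrightarrow> P q"
    by (simp add: AE_completion_iff)
  then obtain N where N: "{q. \<not> (q \<in> D \<times> J \<longrightarrow> P q)} \<subseteq> N" "N \<in> null_sets lborel"
    by (auto simp: eventually_ae_filter)
  have "AE q in lborel \<Otimes>\<^sub>M lborel. q \<notin> N"
    unfolding lborel_prod by (rule AE_not_in[OF N(2)])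
  then have "AE z in lborel. AE t in lborel. (z, t) \<notin> N"
    by (rule lborel_pair.AE_pair)
  moreover have "{q \<in> space (lborel \<Otimes>\<^sub>M lborel). (fst q, snd q) \<notin> N} \<in> sets (lborel \<Otimes>\<^sub>M lborel)"
  proof -
    have "{q \<in> space (lborel \<Otimes>\<^sub>M lborel). (fst q, snd q) \<notin> N} = space (lborel \<Otimes>\<^sub>M lborel) - N" by auto
    moreover have "N \<in> sets (lborel \<Otimes>\<^sub>M lborel)" using N(2) unfolding lborel_prod by auto
    ultimately show ?thesis by (simp only: sets.compl_sets)
  qed
  ultimately have "AE t in lborel. AE z in lborel. (z, t) \<notin> N"
    using lborel_pair.AE_commute[of "\<lambda>z t. (z, t) \<notin> N"] by blast
  then have "AE t in lborel. t \<in> J \<longrightarrow> (AE z in lborel. z \<in> D \<longrightarrow> P (z, t))"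
  proof eventually_elim
    case (elim t)
    show ?case
    proof
      assume "t \<in> J"
      with elim N(1) show "AE z in lborel. z \<in> D \<longrightarrow> P (z, t)"
        by (elim eventually_mono) blast
    qed
  qed
  then have "AE t in lborel. t \<in> J \<longrightarrow> (AE z in lebesgue_on D. P (z, t))"
    by (simp add: AE_restrict_space_iff open_imp_lebesgue[OF D] AE_completion_iff)
  then show ?thesis
    by (simp add: AE_restrict_space_iff open_imp_lebesgue[OF J] AE_completion_iff)
qed

text \<open>As for null sets: g is replaced by a Borel function, for which Fubini is standard. For
  almost every t the slices of the two agree almost everywhere, so even the measurability of the
  inner integral carries over.\<close>

lemma lebesgue_on_Fubini:
  fixes g :: "'a::euclidean_space \<times> 'b::euclidean_space \<Rightarrow> real"
  assumes D: "open D" and J: "open J" and g: "integrable (lebesgue_on (D \<times> J)) g"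
  shows "integrable (lebesgue_on J) (\<lambda>t. LINT z|lebesgue_on D. g (z, t))"
    and "(LINT q|lebesgue_on (D \<times> J). g q) = (LINT t|lebesgue_on J. LINT z|lebesgue_on D. g (z, t))"
proof -
  note LDJ = open_imp_lebesgue[OF open_Times[OF D J]] and LD = open_imp_lebesgue[OF D] and LJ = open_imp_lebesgue[OF J]
  define G where "G q = indicator (D \<times> J) q *\<^sub>R g q" for q
  have G: "integrable lebesgue G"
    using g LDJ by (simp add: integrable_restrict_space G_def[abs_def])
  obtain G' where G': "G' \<in> borel_measurable lborel" "AE q in lborel. G q = G' q"
    using completion_ex_borel_measurable_real[of G lborel] G by auto
  have ae: "AE q in lebesgue. G q = G' q" using G'(2) by (rule AE_completion)
  have G'm: "G' \<in> borel_measurable lebesgue" by (rule measurable_completion[OF G'(1)])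
  have G'leb: "integrable lebesgue G'"
    using integrable_cong_AE[OF borel_measurable_integrable[OF G] G'm ae] G by simp
  then have G'int: "integrable lborel G'"
    using G'(1) by (simp add: integrable_completion)
  have G'prod: "integrable (lborel \<Otimes>\<^sub>M lborel) (\<lambda>(z, t). G' (z, t))"
    using G'int by (simp add: lborel_prod)
  have "(LINT q|lebesgue_on (D \<times> J). g q) = (LINT q|lebesgue. G q)"
    using LDJ by (simp add: integral_restrict_space G_def)
  also have "\<dots> = (LINT q|lebesgue. G' q)"
    by (rule integral_cong_AE[OF borel_measurable_integrable[OF G] G'm ae])
  also have "\<dots> = (LINT q|lborel. G' q)"
    using G'(1) by (simp add: integral_completion)
  also have "\<dots> = (LINT t|lborel. LINT z|lborel. G' (z, t))"
    using lborel_pair.integral_snd[OF G'prod] by (simp add: lborel_prod)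
  finally have eq: "(LINT q|lebesgue_on (D \<times> J). g q) = (LINT t|lborel. LINT z|lborel. G' (z, t))" .
  define H where "H t = (LINT z|lborel. G' (z, t))" for t
  have H: "integrable lborel H"
    using lborel_pair.integrable_snd[OF G'prod] by (simp add: H_def[abs_def])
  have Hleb: "integrable lebesgue H"
    using H by (simp add: integrable_completion borel_measurable_integrable)
  have "AE q in lebesgue_on (UNIV \<times> UNIV :: ('a \<times> 'b) set). G q = G' q"
    unfolding UNIV_Times_UNIV lebesgue_on_UNIV_eq by (rule ae)
  then have "AE t in lebesgue_on (UNIV :: 'b set). AE z in lebesgue_on (UNIV :: 'a set). G (z, t) = G' (z, t)"
    by (rule AE_lebesgue_on_Times[OF open_UNIV open_UNIV])
  then have slice: "AE t in lebesgue. AE z in lebesgue. G (z, t) = G' (z, t)"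
    by (simp only: lebesgue_on_UNIV_eq)
  have H_eq: "AE t in lebesgue. H t = indicator J t *\<^sub>R (LINT z|lebesgue_on D. g (z, t))"
    using slice
  proof eventually_elim
    case (elim t)
    have m: "(\<lambda>z. G' (z, t)) \<in> borel_measurable lborel"
      using G'(1) by simp
    have ml: "(\<lambda>z. G' (z, t)) \<in> borel_measurable lebesgue"
      by (rule measurable_completion[OF m])
    have "AE z in lebesgue. G' (z, t) = G (z, t)" using elim by eventually_elim simp
    then have mG: "(\<lambda>z. G (z, t)) \<in> borel_measurable lebesgue"
      by (rule borel_measurable_AE[OF ml])
    have "H t = (LINT z|lebesgue. G' (z, t))"
      unfolding H_def by (rule integral_completion[OF m, symmetric])
    also have "\<dots> = (LINT z|lebesgue. G (z, t))"
      by (rule integral_cong_AE[OF mG ml elim, symmetric])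
    also have "\<dots> = (LINT z|lebesgue. indicator J t *\<^sub>R (indicator D z *\<^sub>R g (z, t)))"
      by (intro Bochner_Integration.integral_cong) (auto simp: G_def indicator_def)
    also have "\<dots> = indicator J t *\<^sub>R (LINT z|lebesgue_on D. g (z, t))"
      using LD by (simp add: integral_restrict_space)
    finally show ?case .
  qed
  have m: "(\<lambda>t. indicator J t *\<^sub>R (LINT z|lebesgue_on D. g (z, t))) \<in> borel_measurable lebesgue"
    by (rule borel_measurable_AE[OF borel_measurable_integrable[OF Hleb] H_eq])
  have "integrable lebesgue (\<lambda>t. indicator J t *\<^sub>R (LINT z|lebesgue_on D. g (z, t)))"
    using integrable_cong_AE[OF borel_measurable_integrable[OF Hleb] m H_eq] Hleb by simp
  then show "integrable (lebesgue_on J) (\<lambda>t. LINT z|lebesgue_on D. g (z, t))"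
    using LJ by (simp add: integrable_restrict_space)
  have "(LINT t|lborel. H t) = (LINT t|lebesgue. H t)"
    using H by (simp add: integral_completion borel_measurable_integrable)
  also have "\<dots> = (LINT t|lebesgue. indicator J t *\<^sub>R (LINT z|lebesgue_on D. g (z, t)))"
    by (rule integral_cong_AE[OF borel_measurable_integrable[OF Hleb] m H_eq])
  also have "\<dots> = (LINT t|lebesgue_on J. LINT z|lebesgue_on D. g (z, t))"
    using LJ by (simp add: integral_restrict_space)
  finally show "(LINT q|lebesgue_on (D \<times> J). g q) = (LINT t|lebesgue_on J. LINT z|lebesgue_on D. g (z, t))"
    unfolding eq by (simp add: H_def)
qed

section \<open>From a weak derivative to increments\<close>

lemma integral_lebesgue_on_Icc:
  fixes F :: "real \<Rightarrow> real"
  assumes F: "continuous_on {c..d} F" "\<And>x. x \<notin> {c..d} \<Longrightarrow> F x = 0" and J: "{c..d} \<subseteq> J" "J \<in> sets lebesgue"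
  shows "integrable (lebesgue_on J) F" "(LINT x|lebesgue_on J. F x) = (LINT x:{c..d}|lborel. F x)"
proof -
  have "integrable lborel (\<lambda>x. indicator {c..d} x *\<^sub>R F x)"
    by (intro borel_integrable_compact F) auto
  moreover have eq: "(\<lambda>x. indicator {c..d} x *\<^sub>R F x) = F"
    using F(2) by (force simp: indicator_def)
  ultimately have int: "integrable lborel F" by simp
  then have leb: "integrable lebesgue F"
    by (simp add: integrable_completion borel_measurable_integrable)
  then show "integrable (lebesgue_on J) F"
    using J(2) integrable_mult_indicator[of J lebesgue F] by (simp add: integrable_restrict_space)
  have "(LINT x|lebesgue_on J. F x) = (LINT x|lborel. F x)"
  proof (rule integral_lebesgue_on_eq_lborel[OF _ _ J(2)])
    show "F \<in> borel_measurable borel" using borel_measurable_integrable[OF int] by simp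
    show "F x = 0" if "x \<notin> J" for x using F(2)[of x] J(1) that by blast
  qed
  then show "(LINT x|lebesgue_on J. F x) = (LINT x:{c..d}|lborel. F x)"
    by (simp only: set_lebesgue_integral_def eq)
qed

text \<open>The derivative of a step that climbs from 0 to 1 on [s, s + e]: an approximate point
  mass to the right of s, with an explicit antiderivative.\<close>

definition bump :: "real \<Rightarrow> real \<Rightarrow> real \<Rightarrow> real" where
  "bump e s x = 1 / e * dir_deriv 1 step (1 / e * x + (- s / e))"

lemma bump_props:
  assumes e: "0 < e"
  shows "continuous_on S (bump e s)" "0 \<le> bump e s x" "x \<notin> {s..s + e} \<Longrightarrow> bump e s x = 0"
    and "(LINT x:{s..s + e}|lborel. bump e s x) = 1"
    and "((\<lambda>x. step (1 / e * x + (- s / e))) has_real_derivative bump e s x) (at x)"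
proof -
  have cont: "continuous_on S (bump e s)" for S
    unfolding bump_def
    by (intro continuous_intros continuous_on_compose2[OF smooth_continuous[OF smooth_dir_deriv[OF smooth_step], of 1 UNIV]]) auto
  then show "continuous_on S (bump e s)" .
  show "0 \<le> bump e s x" using e by (simp add: bump_def step_deriv_nonneg)
  show "bump e s x = 0" if "x \<notin> {s..s + e}"
  proof -
    have "1 / e * x + (- s / e) = (x - s) / e" by (simp add: diff_divide_distrib)
    moreover have "(x - s) / e \<le> 0 \<or> (x - s) / e \<ge> 1"
      using that e by (auto simp: field_simps not_le)
    ultimately show ?thesis by (simp add: bump_def step_deriv_eq_0)
  qed
  have D: "((\<lambda>x. step (1 / e * x + (- s / e))) has_real_derivative bump e s x) (at x)" for x
    using smooth_real_DERIV[OF smooth_affine[OF smooth_step]] unfolding dir_deriv_affine[OF smooth_step] bump_def .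
  then show "((\<lambda>x. step (1 / e * x + (- s / e))) has_real_derivative bump e s x) (at x)" .
  have "(LINT x|lborel. indicator {s..s + e} x *\<^sub>R bump e s x) = step (1 / e * (s + e) + (- s / e)) - step (1 / e * s + (- s / e))"
    using e D cont
    by (intro integral_FTC_atLeastAtMost)
       (auto simp: has_real_derivative_iff_has_vector_derivative[symmetric] intro: has_field_derivative_at_within)
  also have "1 / e * (s + e) + (- s / e) = 1" using e by (simp add: field_simps)
  also have "1 / e * s + (- s / e) = 0" by simp
  finally show "(LINT x:{s..s + e}|lborel. bump e s x) = 1"
    by (simp add: set_lebesgue_integral_def step_eq_0 step_eq_1)
qed

lemma bump_average:
  assumes e: "0 < e" and h: "continuous_on {s..s + e} h" "\<And>x. x \<in> {s..s + e} \<Longrightarrow> \<bar>h x - c\<bar> \<le> d"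
    and J: "{s..s + e} \<subseteq> J" "J \<in> sets lebesgue"
  shows "integrable (lebesgue_on J) (\<lambda>x. h x * bump e s x)" "\<bar>(LINT x|lebesgue_on J. h x * bump e s x) - c\<bar> \<le> d"
proof -
  note b = bump_props[OF e]
  have 1: "continuous_on {s..s + e} (\<lambda>x. h x * bump e s x)" "x \<notin> {s..s + e} \<Longrightarrow> h x * bump e s x = 0" for x
    by (intro continuous_intros h b) (simp add: b(3))
  show "integrable (lebesgue_on J) (\<lambda>x. h x * bump e s x)"
    by (rule integral_lebesgue_on_Icc(1)[OF 1 J])
  have si: "set_integrable lborel {s..s + e} g" if "continuous_on {s..s + e} g" for g :: "real \<Rightarrow> real"
    unfolding set_integrable_def by (intro borel_integrable_compact that) auto
  have "(LINT x|lebesgue_on J. h x * bump e s x) = (LINT x:{s..s + e}|lborel. h x * bump e s x)"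
    by (rule integral_lebesgue_on_Icc(2)[OF 1 J])
  moreover have "(LINT x:{s..s + e}|lborel. h x * bump e s x) \<le> (LINT x:{s..s + e}|lborel. (c + d) * bump e s x)"
    using h(2) by (intro set_integral_mono si continuous_intros h b mult_right_mono) (auto simp: abs_le_iff algebra_simps)
  moreover have "(LINT x:{s..s + e}|lborel. (c - d) * bump e s x) \<le> (LINT x:{s..s + e}|lborel. h x * bump e s x)"
    using h(2) by (intro set_integral_mono si continuous_intros h b mult_right_mono) (auto simp: abs_le_iff algebra_simps)
  ultimately show "\<bar>(LINT x|lebesgue_on J. h x * bump e s x) - c\<bar> \<le> d"
    using b(4) by (simp add: abs_le_iff)
qed

text \<open>The test function is a smoothed indicator of [s, t]: minus its derivative is a bump just
  left of t minus a bump just right of s, and against these h has almost the values h t and h s. The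
  ramps lie inside [s, t], so the bound on the weak derivative is used only there.\<close>

lemma weak_derivative_bound_imp_increment_bound:
  fixes h :: "real \<Rightarrow> real"
  assumes h: "continuous_on {0<..} h" and st: "0 < s" "s < t"
    and weak: "\<And>\<theta>. test_function {0<..} \<theta> \<Longrightarrow> (\<And>x. 0 \<le> \<theta> x) \<Longrightarrow> (\<And>x. x \<notin> {s..t} \<Longrightarrow> \<theta> x = 0) \<Longrightarrow>
      - (LINT x|lebesgue_on {0<..}. h x * dir_deriv 1 \<theta> x) \<le> K * (LINT x|lebesgue_on {0<..}. \<theta> x)"
  shows "h t - h s \<le> K * (t - s)"
proof (rule field_le_epsilon)
  fix \<eta>' :: real assume "0 < \<eta>'"
  \<comment> \<open>Two parts for the averages of h at s and t, two for replacing the integral of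
    \<open>\<theta>\<close> by t - s.\<close>
  define \<eta> where "\<eta> = \<eta>' / 4"
  have \<eta>: "\<eta> > 0" using \<open>0 < \<eta>'\<close> by (simp add: \<eta>_def)
  have J: "{0::real<..} \<in> sets lebesgue" by (rule open_imp_lebesgue) simp
  have near: "\<exists>d>0. \<forall>x. x > 0 \<and> \<bar>x - y\<bar> < d \<longrightarrow> \<bar>h x - h y\<bar> \<le> \<eta>" if "y > 0" for y
  proof -
    have "\<forall>\<eta>>0. \<exists>d>0. \<forall>x\<in>{0<..}. dist x y < d \<longrightarrow> dist (h x) (h y) < \<eta>"
      using h that unfolding continuous_on_iff by auto
    then show ?thesis using \<eta> by (metis dist_real_def greaterThan_iff less_imp_le)
  qed
  obtain d1 where d1: "d1 > 0" "\<And>x. x > 0 \<Longrightarrow> \<bar>x - s\<bar> < d1 \<Longrightarrow> \<bar>h x - h s\<bar> \<le> \<eta>"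
    using near[OF st(1)] by blast
  obtain d2 where d2: "d2 > 0" "\<And>x. x > 0 \<Longrightarrow> \<bar>x - t\<bar> < d2 \<Longrightarrow> \<bar>h x - h t\<bar> \<le> \<eta>"
    using near[of t] st by fastforce
  \<comment> \<open>In turn: continuity of h at s and at t, disjoint ramps, and |K| e <=
    \<open>\<eta>\<close>.\<close>
  define e where "e = Min {d1 / 2, d2 / 2, (t - s) / 2, \<eta> / (1 + \<bar>K\<bar>)}"
  have e: "0 < e" "e \<le> d1 / 2" "e \<le> d2 / 2" "e \<le> (t - s) / 2" "e \<le> \<eta> / (1 + \<bar>K\<bar>)"
  proof -
    show "0 < e" using d1(1) d2(1) st \<eta> by (simp add: e_def)
    show "e \<le> d1 / 2" "e \<le> d2 / 2" "e \<le> (t - s) / 2" "e \<le> \<eta> / (1 + \<bar>K\<bar>)"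
      unfolding e_def by (rule Min_le; simp)+
  qed
  define \<theta> where "\<theta> x = step (1 / e * x + (- s / e)) - step (1 / e * x + (- (t - e) / e))" for x
  have \<theta>sm: "smooth \<theta>"
    unfolding \<theta>_def[abs_def] by (intro smooth_diff smooth_affine smooth_step)
  have dir: "dir_deriv 1 \<theta> x = bump e s x - bump e (t - e) x" for x
  proof (rule dir_derivI)
    have "(\<theta> has_real_derivative bump e s x - bump e (t - e) x) (at x)"
      unfolding \<theta>_def[abs_def] by (intro DERIV_diff bump_props(5) e)
    then show "((\<lambda>s. \<theta> (x + s *\<^sub>R 1)) has_real_derivative bump e s x - bump e (t - e) x) (at 0)"
      using DERIV_shift[of \<theta> _ 0 x] by (simp add: add_ac)
  qed
  have arg: "1 / e * x + (- r / e) = (x - r) / e" for x r by (simp add: diff_divide_distrib)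
  have \<theta>eq: "\<theta> x = step ((x - s) / e) - step ((x - (t - e)) / e)" for x
    unfolding \<theta>_def arg ..
  have \<theta>_cases: "x \<le> s \<Longrightarrow> \<theta> x = 0" "x \<ge> t \<Longrightarrow> \<theta> x = 0" "s + e \<le> x \<Longrightarrow> x \<le> t - e \<Longrightarrow> \<theta> x = 1"
    "x \<le> t - e \<Longrightarrow> \<theta> x = step ((x - s) / e)" "x \<ge> s + e \<Longrightarrow> \<theta> x = 1 - step ((x - (t - e)) / e)" for x
  proof -
    have z: "r \<ge> x \<Longrightarrow> step ((x - r) / e) = 0" "r + e \<le> x \<Longrightarrow> step ((x - r) / e) = 1" for x r
      using e(1) by (auto intro!: step_eq_0 step_eq_1 simp: field_simps)
    show "x \<le> s \<Longrightarrow> \<theta> x = 0" "x \<ge> t \<Longrightarrow> \<theta> x = 0" "s + e \<le> x \<Longrightarrow> x \<le> t - e \<Longrightarrow> \<theta> x = 1"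
      "x \<le> t - e \<Longrightarrow> \<theta> x = step ((x - s) / e)" "x \<ge> s + e \<Longrightarrow> \<theta> x = 1 - step ((x - (t - e)) / e)"
      using e st by (auto simp: \<theta>eq z)
  qed
  have \<theta>01: "0 \<le> \<theta> x" "\<theta> x \<le> 1" for x
  proof -
    \<comment> \<open>At every point at most one of the two ramps is active, so
      \<open>\<theta>\<close> is a single step or one minus a single step.\<close>
    have "x \<le> t - e \<or> x \<ge> s + e" using e(4) by auto
    then consider "x \<le> t - e" | "x \<ge> s + e" by blast
    then have "0 \<le> \<theta> x \<and> \<theta> x \<le> 1"
    proof cases
      case 1
      show ?thesis unfolding \<theta>_cases(4)[OF 1] by (simp add: step_nonneg step_le_1)
    next
      case 2
      show ?thesis unfolding \<theta>_cases(5)[OF 2] by (simp add: step_nonneg step_le_1)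
    qed
    then show "0 \<le> \<theta> x" "\<theta> x \<le> 1" by auto
  qed
  have \<theta>0: "\<theta> x = 0" if "x \<notin> {s..t}" for x using that \<theta>_cases(1,2)[of x] by auto
  have sub: "{s..t} \<subseteq> {0<..}" using st by auto
  have test: "test_function {0<..} \<theta>"
    by (rule test_functionI[OF \<theta>sm, of "{s..t}"]) (use sub \<theta>0 in auto)
  have ineq: "- (LINT x|lebesgue_on {0<..}. h x * dir_deriv 1 \<theta> x) \<le> K * (LINT x|lebesgue_on {0<..}. \<theta> x)"
    by (rule weak[OF test \<theta>01(1) \<theta>0])
  have sub1: "{s..s + e} \<subseteq> {0<..}" and sub2: "{t - e..t - e + e} \<subseteq> {0<..}" using st e by auto
  have A: "integrable (lebesgue_on {0<..}) (\<lambda>x. h x * bump e s x)" "\<bar>(LINT x|lebesgue_on {0<..}. h x * bump e s x) - h s\<bar> \<le> \<eta>"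
    using d1(1) e st by (intro bump_average[OF e(1) continuous_on_subset[OF h sub1] d1(2) sub1 J]; auto)+
  have A': "integrable (lebesgue_on {0<..}) (\<lambda>x. h x * bump e (t - e) x)" "\<bar>(LINT x|lebesgue_on {0<..}. h x * bump e (t - e) x) - h t\<bar> \<le> \<eta>"
    using d2(1) e st by (intro bump_average[OF e(1) continuous_on_subset[OF h sub2] d2(2) sub2 J]; auto)+
  have "(LINT x|lebesgue_on {0<..}. h x * dir_deriv 1 \<theta> x)
      = (LINT x|lebesgue_on {0<..}. h x * bump e s x) - (LINT x|lebesgue_on {0<..}. h x * bump e (t - e) x)"
    using A(1) A'(1) by (simp add: dir right_diff_distrib)
  then have 1: "h t - h s \<le> K * (LINT x|lebesgue_on {0<..}. \<theta> x) + 2 * \<eta>"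
    using ineq A(2) A'(2) by (simp add: abs_le_iff)
  have \<theta>cont: "continuous_on S \<theta>" for S by (rule smooth_continuous[OF \<theta>sm])
  have int\<theta>: "(LINT x|lebesgue_on {0<..}. \<theta> x) = (LINT x:{s..t}|lborel. \<theta> x)"
    by (rule integral_lebesgue_on_Icc(2)[OF \<theta>cont \<theta>0 sub J])
  have "(LINT x:{s..t}|lborel. \<theta> x) \<le> (LINT x:{s..t}|lborel. 1)"
    using \<theta>01 by (intro set_integral_mono set_integrable_continuous_Icc \<theta>cont continuous_intros) auto
  also have "\<dots> = t - s" using st by (simp add: set_lebesgue_integral_def)
  finally have up: "(LINT x|lebesgue_on {0<..}. \<theta> x) \<le> t - s" by (simp add: int\<theta>)
  \<comment> \<open>\<open>K\<close> may be negative, so the integral of \<open>\<theta>\<close> is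
    needed from below as well.\<close>
  have "t - s - 2 * e = (LINT x:{s + e..t - e}|lborel. 1)" using e by (simp add: set_lebesgue_integral_def)
  also have "\<dots> \<le> (LINT x:{s..t}|lborel. \<theta> x)"
    unfolding set_lebesgue_integral_def
    using set_integrable_continuous_Icc[OF \<theta>cont, of s t] set_integrable_continuous_Icc[of "\<lambda>_. 1" "s + e" "t - e"] \<theta>_cases(3) \<theta>01(1) e(1)
    by (intro integral_mono) (auto simp: set_integrable_def indicator_def)
  finally have low: "t - s - 2 * e \<le> (LINT x|lebesgue_on {0<..}. \<theta> x)" by (simp add: int\<theta>)
  have "\<bar>K\<bar> * e \<le> \<eta>"
  proof -
    have "\<bar>K\<bar> * e \<le> (1 + \<bar>K\<bar>) * e" using e(1) by (intro mult_right_mono) auto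
    also have "\<dots> \<le> \<eta>" using e(5) by (simp add: field_simps)
    finally show ?thesis .
  qed
  moreover have "K * ((LINT x|lebesgue_on {0<..}. \<theta> x) - (t - s)) \<le> \<bar>K\<bar> * (2 * e)"
  proof -
    have "K * ((LINT x|lebesgue_on {0<..}. \<theta> x) - (t - s)) \<le> \<bar>K\<bar> * \<bar>(LINT x|lebesgue_on {0<..}. \<theta> x) - (t - s)\<bar>"
      by (metis abs_ge_self abs_mult)
    also have "\<dots> \<le> \<bar>K\<bar> * (2 * e)" using up low by (intro mult_left_mono) auto
    finally show ?thesis .
  qed
  ultimately show "h t - h s \<le> K * (t - s) + \<eta>'"
    using 1 by (simp add: \<eta>_def algebra_simps)
qed

text \<open>Only the upper right derivative is known to be nonpositive. With slope \<open>e\<close>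
  subtracted, let c be the infimum of the points where the function exceeds its initial value: by
  continuity it does not do so at c, and the condition at c keeps it from doing so shortly
  afterwards.\<close>

lemma Dini_nonincreasing:
  fixes F :: "real \<Rightarrow> real"
  assumes pq: "p \<le> q" and F: "continuous_on {p..q} F"
    and dini: "\<And>s e. p \<le> s \<Longrightarrow> s < q \<Longrightarrow> 0 < e \<Longrightarrow> \<exists>d>0. \<forall>t. s < t \<and> t < s + d \<longrightarrow> F t - F s \<le> e * (t - s)"
  shows "F q \<le> F p"
proof (rule field_le_epsilon)
  fix e' :: real assume e': "0 < e'"
  \<comment> \<open>The summand 1 covers the case p = q.\<close>
  define e where "e = e' / (1 + (q - p))"
  have e: "e > 0" using e' pq by (simp add: e_def add_pos_nonneg)
  define g where "g r = F r - F p - e * (r - p)" for r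
  have g: "continuous_on {p..q} g" unfolding g_def by (intro continuous_intros F)
  have "g q \<le> 0"
  proof (rule ccontr)
    assume "\<not> g q \<le> 0"
    define Bad where "Bad = {r \<in> {p..q}. g r > 0}"
    have ne: "Bad \<noteq> {}" and bdd: "bdd_below Bad"
      using \<open>\<not> g q \<le> 0\<close> pq by (auto simp: Bad_def intro!: bdd_belowI[of _ p])
    define c where "c = Inf Bad"
    have c: "p \<le> c" "c \<le> q"
    proof -
      show "p \<le> c" unfolding c_def using ne by (intro cInf_greatest) (auto simp: Bad_def)
      obtain r where "r \<in> Bad" using ne by blast
      then have "c \<le> r" unfolding c_def by (intro cInf_lower bdd)
      with \<open>r \<in> Bad\<close> show "c \<le> q" by (auto simp: Bad_def)
    qed
    have below: "g r \<le> 0" if "p \<le> r" "r < c" for r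
    proof (rule ccontr)
      assume "\<not> g r \<le> 0"
      then have "r \<in> Bad" using that c by (simp add: Bad_def)
      then have "c \<le> r" unfolding c_def by (intro cInf_lower bdd)
      then show False using that by simp
    qed
    have gc: "g c \<le> 0"
    proof (cases "c = p")
      case True
      then show ?thesis by (simp add: g_def)
    next
      case False
      show ?thesis
      proof (rule ccontr)
        assume "\<not> g c \<le> 0"
        then obtain d where d: "d > 0" "\<And>r. r \<in> {p..q} \<Longrightarrow> dist r c < d \<Longrightarrow> dist (g r) (g c) < g c"
          using g c unfolding continuous_on_iff by (metis atLeastAtMost_iff not_le)
        define r where "r = max p (c - d / 2)"
        have r: "p \<le> r" "r < c" "\<bar>r - c\<bar> < d" using False c d(1) by (auto simp: r_def max_def)
        then have "dist (g r) (g c) < g c" using d(2)[of r] c by (simp add: dist_real_def)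
        then have "g r > 0" by (simp add: dist_real_def)
        then show False using below[OF r(1,2)] by simp
      qed
    qed
    have "c < q" using gc \<open>\<not> g q \<le> 0\<close> c by (cases "c = q") auto
    \<comment> \<open>Bad points accumulate at c from the right, yet g does not exceed g c
      there.\<close>
    from dini[OF c(1) this e] obtain d where d: "d > 0" "\<And>t. c < t \<Longrightarrow> t < c + d \<Longrightarrow> F t - F c \<le> e * (t - c)"
      by blast
    have "\<exists>r\<in>Bad. r < c + d"
      using cInf_lessD[OF ne, of "c + d"] d(1) by (simp add: c_def)
    then obtain r where r: "r \<in> Bad" "r < c + d" by blast
    have "c \<le> r" unfolding c_def by (intro cInf_lower bdd r)
    moreover have "r \<noteq> c" using r(1) gc by (auto simp: Bad_def)
    ultimately have "F r - F c \<le> e * (r - c)" using d(2) r(2) by simp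
    then have "g r \<le> g c" by (simp add: g_def algebra_simps)
    then show False using r(1) gc by (simp add: Bad_def)
  qed
  moreover have "e * (q - p) \<le> e'"
  proof -
    have "e * (q - p) \<le> e * (1 + (q - p))" using e by (intro mult_left_mono) auto
    also have "\<dots> = e'" using pq by (simp add: e_def)
    finally show ?thesis .
  qed
  ultimately show "F q \<le> F p + e'" by (simp add: g_def)
qed

text \<open>The function E exp(c t) has nonpositive upper right derivative. The hypothesis concerns
  s > 0 only, where the equation is available; the initial time is reached by continuity.\<close>

lemma exponential_decay:
  fixes E :: "real \<Rightarrow> real"
  assumes cont: "continuous_on {0..} E" and nonneg: "\<And>t. 0 \<le> E t" and \<chi>: "0 \<le> c"
    and dini: "\<And>s e. 0 < s \<Longrightarrow> 0 < e \<Longrightarrow> \<exists>d>0. \<forall>t. s < t \<and> t < s + d \<longrightarrow> E t - E s \<le> (t - s) * (- c * E s + e)"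
    and t: "0 \<le> t"
  shows "E t \<le> E 0 * exp (- c * t)"
proof -
  define F where "F t = E t * exp (c * t)" for t
  have contF: "continuous_on {0..} F" unfolding F_def by (intro continuous_intros cont)
  have mono: "F q \<le> F p" if p0: "0 < p" and pq: "p \<le> q" for p q
  proof (rule Dini_nonincreasing[OF pq])
    show "continuous_on {p..q} F" by (rule continuous_on_subset[OF contF]) (use p0 in auto)
    fix s e :: real assume s: "p \<le> s" and "s < q" and e: "0 < e"
    \<comment> \<open>A bound for exp(c t) on the times considered, which lie before s + 1; it is
      divided out of the slack in advance.\<close>
    define M where "M = exp (c * (s + 1))"
    have "e / M > 0" using e by (simp add: M_def)
    then obtain d where d: "d > 0" "\<And>t. s < t \<Longrightarrow> t < s + d \<Longrightarrow> E t - E s \<le> (t - s) * (- c * E s + e / M)"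
      using dini[OF less_le_trans[OF p0 s] \<open>e / M > 0\<close>] by blast
    show "\<exists>d>0. \<forall>t. s < t \<and> t < s + d \<longrightarrow> F t - F s \<le> e * (t - s)"
    proof (intro exI[of _ "min d 1"] conjI allI impI)
      fix t assume t: "s < t \<and> t < s + min d 1"
      \<comment> \<open>Convexity of exp bounds exp(c t) - exp(c s) by c (t - s) exp(c t). Both
        parts of the increment of F then carry exp(c t), and the terms c E s cancel.\<close>
      have "exp (c * s) = exp (c * t) * exp (- c * (t - s))"
        by (simp add: exp_add[symmetric] algebra_simps)
      moreover have "exp (- c * (t - s)) \<ge> 1 + (- c * (t - s))" by (rule exp_ge_add_one_self)
      ultimately have "exp (c * s) \<ge> exp (c * t) * (1 + (- c * (t - s)))"
        by (simp add: mult_left_mono)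
      then have 1: "E s * (exp (c * t) - exp (c * s)) \<le> E s * (exp (c * t) * (c * (t - s)))"
        by (intro mult_left_mono nonneg) (simp add: algebra_simps)
      have 2: "exp (c * t) * (E t - E s) \<le> exp (c * t) * ((t - s) * (- c * E s + e / M))"
        using t by (intro mult_left_mono d(2)) auto
      have "F t - F s = exp (c * t) * (E t - E s) + E s * (exp (c * t) - exp (c * s))"
        by (simp add: F_def algebra_simps)
      also have "\<dots> \<le> exp (c * t) * ((t - s) * (- c * E s + e / M)) + E s * (exp (c * t) * (c * (t - s)))"
        using 1 2 by linarith
      also have "\<dots> = (exp (c * t) / M) * (e * (t - s))"
        by (simp add: algebra_simps diff_divide_distrib)
      also have "\<dots> \<le> 1 * (e * (t - s))"
        using t e \<chi> by (intro mult_right_mono) (auto simp: M_def mult_left_mono)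
      finally show "F t - F s \<le> e * (t - s)" by simp
    qed (use d in simp)
  qed
  have "F t \<le> F 0"
  proof (cases "t = 0")
    case False
    \<comment> \<open>F t <= F p for all p in (0, t), and p decreases to 0.\<close>
    have "((\<lambda>p. F p) \<longlongrightarrow> F 0) (at 0 within {0..})"
      using contF by (simp add: continuous_on_def)
    then have "((\<lambda>p. F p) \<longlongrightarrow> F 0) (at_right 0)"
      by (rule tendsto_within_subset) auto
    moreover have "\<forall>\<^sub>F p in at_right 0. F t \<le> F p"
      using eventually_at_right_real[of 0 t] False t by (auto elim!: eventually_mono intro!: mono)
    ultimately show ?thesis
      by (intro tendsto_lowerbound) auto
  qed simp
  then have "E t * exp (c * t) * exp (- (c * t)) \<le> E 0 * exp (- (c * t))"
    by (intro mult_right_mono) (auto simp: F_def)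
  then show ?thesis by (simp add: exp_minus field_simps)
qed

lemma AE_lebesgue_on_Ioi:
  assumes "\<And>n::nat. AE t in lebesgue_on {0<..<real (Suc n)}. P t"
  shows "AE t in lebesgue_on {0<..}. P t"
proof -
  have "AE t in lebesgue. \<forall>n::nat. t \<in> {0<..<real (Suc n)} \<longrightarrow> P t"
    using assms by (subst AE_all_countable) (simp add: AE_restrict_space_iff open_imp_lebesgue)
  then have "AE t in lebesgue. t \<in> {0<..} \<longrightarrow> P t"
  proof eventually_elim
    case (elim t)
    obtain n :: nat where "t < real n" using reals_Archimedean2 by blast
    then have "t < real (Suc n)" by simp
    then show ?case using elim by auto
  qed
  then show ?thesis by (simp add: AE_restrict_space_iff open_imp_lebesgue)
qed

text \<open>A property that holds at almost every time holds at some time in every interval;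
  combined with continuity in L^2 it can be carried to a prescribed time.\<close>

lemma AE_lebesgue_on_Ioi_ex:
  fixes c d :: real
  assumes "AE t in lebesgue_on {0<..}. P t" "0 \<le> c" "c < d"
  shows "\<exists>t\<in>{c<..<d}. P t"
proof (rule ccontr)
  assume not: "\<not> (\<exists>t\<in>{c<..<d}. P t)"
  have "AE t in lebesgue. t \<in> {0<..} \<longrightarrow> P t"
    using assms(1) by (simp add: AE_restrict_space_iff open_imp_lebesgue)
  then have "AE t in lebesgue. t \<notin> {c<..<d}"
    by eventually_elim (use not assms(2) in auto)
  then have "AE t in lborel. t \<notin> {c<..<d}"
    by (simp add: AE_completion_iff)
  then have "{c<..<d} \<in> null_sets lborel"
    by (subst AE_iff_null_sets) auto
  then have "emeasure lborel {c<..<d} = 0" by auto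
  then show False using assms(3) by simp
qed

text \<open>Testing the weak time derivative with products \<open>\<phi>\<close> times
  \<open>\<theta>\<close> and applying Fubini shows that the pairing of \<open>ut\<close> with the
  fixed \<open>\<phi>\<close> is the weak derivative of the pairing of u with \<open>\<phi>\<close>.
  Thus no derivative of u with values in a function space is needed.\<close>

lemma time_deriv_increment_bound:
  fixes u ut :: "(real \<times> real) \<times> real \<Rightarrow> real"
  assumes D: "open D" and u: "time_deriv D u ut" and \<phi>: "test_function D \<phi>"
    and h: "continuous_on {0<..} (\<lambda>r. LINT z|lebesgue_on D. u (z, r) * \<phi> z)"
    and K: "AE r in lebesgue_on {0<..}. r \<in> {s..t} \<longrightarrow> (LINT z|lebesgue_on D. ut (z, r) * \<phi> z) \<le> K"
    and st: "0 < s" "s < t"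
  shows "(LINT z|lebesgue_on D. u (z, t) * \<phi> z) - (LINT z|lebesgue_on D. u (z, s) * \<phi> z) \<le> K * (t - s)"
proof (rule weak_derivative_bound_imp_increment_bound[OF h st])
  fix \<theta> :: "real \<Rightarrow> real"
  assume \<theta>: "test_function {0<..} \<theta>" and \<theta>0: "\<And>x. 0 \<le> \<theta> x" and supp: "\<And>x. x \<notin> {s..t} \<Longrightarrow> \<theta> x = 0"
  let ?J = "{0::real<..}" and ?k = "\<lambda>r. LINT z|lebesgue_on D. ut (z, r) * \<phi> z"
  have J: "open ?J" by simp
  have L: "D \<times> ?J \<in> sets lebesgue" by (rule open_imp_lebesgue[OF open_Times[OF D J]])
  obtain K1 where K1: "smooth \<phi>" "compact K1" "K1 \<subseteq> D" "\<And>z. z \<notin> K1 \<Longrightarrow> \<phi> z = 0"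
    using test_functionE[OF \<phi>] by blast
  obtain K2 where K2: "smooth \<theta>" "compact K2" "K2 \<subseteq> ?J" "\<And>z. z \<notin> K2 \<Longrightarrow> \<theta> z = 0"
    using test_functionE[OF \<theta>] by blast
  define \<Phi> where "\<Phi> = (\<lambda>q. \<phi> (fst q) * \<theta> (snd q))"
  have \<Phi>: "test_function (D \<times> ?J) \<Phi>"
  proof (rule test_functionI)
    show "smooth \<Phi>" unfolding \<Phi>_def by (intro smooth_mult smooth_fst smooth_snd K1 K2)
    show "compact (K1 \<times> K2)" by (intro compact_Times K1 K2)
    show "K1 \<times> K2 \<subseteq> D \<times> ?J" using K1(3) K2(3) by blast
    show "\<Phi> q = 0" if "q \<notin> K1 \<times> K2" for q
    proof -
      have "fst q \<notin> K1 \<or> snd q \<notin> K2" using that by (cases q) auto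
      then show ?thesis using K1(4) K2(4) unfolding \<Phi>_def by (elim disjE) simp_all
    qed
  qed
  have b: "(0, 1) \<in> (Basis :: ((real \<times> real) \<times> real) set)" by (simp add: Basis_prod_def)
  have d\<Phi>: "dir_deriv (0, 1) \<Phi> = (\<lambda>q. \<phi> (fst q) * dir_deriv 1 \<theta> (snd q))"
    unfolding \<Phi>_def dir_deriv_mult[OF smooth_fst[OF K1(1)] smooth_snd[OF K2(1)] b] dir_deriv_fst dir_deriv_snd by simp
  have loc: "locally_integrable (D \<times> ?J) u" "locally_integrable (D \<times> ?J) ut"
    using u by (auto simp: time_deriv_def weak_deriv_def)
  have i1: "integrable (lebesgue_on (D \<times> ?J)) (\<lambda>q. u q * dir_deriv (0, 1) \<Phi> q)"
    by (rule integrable_mult_test_function[OF loc(1) test_function_dir_deriv[OF \<Phi> b] L])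
  have i2: "integrable (lebesgue_on (D \<times> ?J)) (\<lambda>q. ut q * \<Phi> q)"
    by (rule integrable_mult_test_function[OF loc(2) \<Phi> L])
  have in1: "(LINT z|lebesgue_on D. u (z, r) * dir_deriv (0, 1) \<Phi> (z, r)) = (LINT z|lebesgue_on D. u (z, r) * \<phi> z) * dir_deriv 1 \<theta> r" for r
    unfolding d\<Phi> by (simp add: mult.assoc[symmetric])
  have in2: "(LINT z|lebesgue_on D. ut (z, r) * \<Phi> (z, r)) = ?k r * \<theta> r" for r
    unfolding \<Phi>_def by (simp add: mult.assoc[symmetric])
  have "- (LINT r|lebesgue_on ?J. (LINT z|lebesgue_on D. u (z, r) * \<phi> z) * dir_deriv 1 \<theta> r)
      = - (LINT q|lebesgue_on (D \<times> ?J). u q * dir_deriv (0, 1) \<Phi> q)"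
    unfolding lebesgue_on_Fubini(2)[OF D J i1] in1 ..
  also have "\<dots> = (LINT q|lebesgue_on (D \<times> ?J). ut q * \<Phi> q)"
    using weak_deriv_eq[OF u[unfolded time_deriv_def] \<Phi>] by simp
  also have "\<dots> = (LINT r|lebesgue_on ?J. ?k r * \<theta> r)"
    unfolding lebesgue_on_Fubini(2)[OF D J i2] in2 ..
  also have "\<dots> \<le> (LINT r|lebesgue_on ?J. K * \<theta> r)"
  proof (rule integral_mono_AE)
    show "integrable (lebesgue_on ?J) (\<lambda>r. ?k r * \<theta> r)"
      using lebesgue_on_Fubini(1)[OF D J i2] unfolding in2 .
    show "integrable (lebesgue_on ?J) (\<lambda>r. K * \<theta> r)"
      by (intro integrable_mult_right integrable_lebesgue_on_test_function[OF \<theta>] open_imp_lebesgue J)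
    show "AE r in lebesgue_on ?J. ?k r * \<theta> r \<le> K * \<theta> r"
      using K
    proof eventually_elim
      case (elim r)
      show ?case
      proof (cases "r \<in> {s..t}")
        case True
        then show ?thesis using elim \<theta>0[of r] by (intro mult_right_mono) auto
      qed (simp add: supp)
    qed
  qed
  finally show "- (LINT r|lebesgue_on ?J. (LINT z|lebesgue_on D. u (z, r) * \<phi> z) * dir_deriv 1 \<theta> r)
      \<le> K * (LINT r|lebesgue_on ?J. \<theta> r)"
    by simp
qed

lemma sobolev_0_weak_deriv: "sobolev 0 \<Omega> f \<Longrightarrow> weak_deriv \<Omega> (xy 0 0) f f"
  by (auto simp: sobolev_def xy_simps weak_deriv_def)

text \<open>Besides continuity in L^2 and the initial condition, these four facts are all that the
  argument in time uses. Statements on space-time and on bounded time intervals become statements at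
  almost every time.\<close>

lemma regular_solution_slices:
  fixes B \<gamma> a :: real and u :: "(real \<times> real) \<times> real \<Rightarrow> real"
  assumes B: "B > 0" and \<gamma>: "0 < \<gamma>" "\<gamma> < 1 / 8" and a: "a\<^sup>2 = pi\<^sup>2 / B\<^sup>2" "a\<^sup>2 > 1"
    and reg: "regular_solution B \<gamma> u0 u"
  obtains ut where "time_deriv (half_strip B) u ut"
    and "\<And>T. T > 0 \<Longrightarrow> \<exists>C. AE t in lebesgue_on {0<..<T}. L2_norm (half_strip B) (\<lambda>z. ut (z, t)) \<le> C"
    and "AE t in lebesgue_on {0<..}. L2_on (half_strip B) (\<lambda>z. ut (z, t)) \<and>
      (LINT z|lebesgue_on (half_strip B). ut (z, t) * u (z, t)) \<le> - (a\<^sup>2 / 4) * (L2_norm (half_strip B) (\<lambda>z. u (z, t)))\<^sup>2"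
    and "AE t in lebesgue_on {0<..}. \<forall>e>0. \<exists>\<phi>. test_function (half_strip B) \<phi> \<and> L2_norm (half_strip B) (\<lambda>z. \<phi> z - u (z, t)) < e"
proof -
  let ?D = "half_strip B"
  obtain ut v where td: "time_deriv ?D u ut"
    and sd: "\<And>i j. i + j \<le> 4 \<or> (i = 5 \<and> j = 0) \<Longrightarrow> space_deriv ?D i j u (v i j)"
    and T: "\<And>T. T > 0 \<Longrightarrow> Linf_Hk 2 ?D T u \<and> L2_Hk 4 ?D T u \<and> L2_Hk 0 ?D T (v 5 0) \<and> Linf_Hk 0 ?D T ut \<and> L2_Hk 2 ?D T ut \<and>
            (AE q in lebesgue_on (?D \<times> {0<..<T}).
               ut q + (v 4 0 q + 2 * v 2 2 q + v 0 4 q) + \<gamma> * (v 2 0 q + v 0 2 q)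
                 + (v 3 0 q + v 1 2 q) + u q * v 1 0 q - v 5 0 q = 0)"
    and tr: "AE t in lebesgue_on {0<..}.
            zero_trace_left B (\<lambda>z. u (z, t)) \<and> zero_trace_bottom B (\<lambda>z. u (z, t)) \<and> zero_trace_top B (\<lambda>z. u (z, t)) \<and>
            zero_trace_bottom B (\<lambda>z. v 0 2 (z, t)) \<and> zero_trace_top B (\<lambda>z. v 0 2 (z, t)) \<and> zero_trace_left B (\<lambda>z. v 1 0 (z, t))"
    using reg unfolding regular_solution_def Let_def by blast
  note O = open_half_strip[of B]
  have S4: "AE t in lebesgue_on {0<..}. sobolev 4 ?D (\<lambda>z. u (z, t))"
    by (rule AE_lebesgue_on_Ioi) (use T in \<open>simp add: L2_Hk_def time_Hk_def\<close>)
  have S5: "AE t in lebesgue_on {0<..}. sobolev 0 ?D (\<lambda>z. v 5 0 (z, t))"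
    by (rule AE_lebesgue_on_Ioi) (use T in \<open>simp add: L2_Hk_def time_Hk_def\<close>)
  have St: "AE t in lebesgue_on {0<..}. sobolev 0 ?D (\<lambda>z. ut (z, t))"
    by (rule AE_lebesgue_on_Ioi) (use T in \<open>simp add: Linf_Hk_def time_Hk_def\<close>)
  \<comment> \<open>The pairs (i, j) are countable, so one null set of times serves for all
    derivatives.\<close>
  have W: "AE t in lebesgue_on {0<..}. \<forall>i j. i + j \<le> 4 \<or> (i = 5 \<and> j = 0) \<longrightarrow>
      weak_deriv ?D (xy i j) (\<lambda>z. u (z, t)) (\<lambda>z. v i j (z, t))"
  proof (subst AE_all_countable, intro allI, subst AE_all_countable, intro allI)
    fix i j :: nat
    show "AE t in lebesgue_on {0<..}. i + j \<le> 4 \<or> (i = 5 \<and> j = 0) \<longrightarrow>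
        weak_deriv ?D (xy i j) (\<lambda>z. u (z, t)) (\<lambda>z. v i j (z, t))"
    proof (cases "i + j \<le> 4 \<or> (i = 5 \<and> j = 0)")
      case True
      then have "AE t in lebesgue_on {0<..}. weak_deriv ?D (xy i j) (\<lambda>z. u (z, t)) (\<lambda>z. v i j (z, t))"
        using sd[OF True] by (simp add: space_deriv_def)
      then show ?thesis by eventually_elim blast
    next
      case False
      then show ?thesis by (intro AE_I2) blast
    qed
  qed
  have pde: "AE t in lebesgue_on {0<..}. AE z in lebesgue_on ?D.
      ut (z, t) + (v 4 0 (z, t) + 2 * v 2 2 (z, t) + v 0 4 (z, t)) + \<gamma> * (v 2 0 (z, t) + v 0 2 (z, t))
        + (v 3 0 (z, t) + v 1 2 (z, t)) + u (z, t) * v 1 0 (z, t) - v 5 0 (z, t) = 0"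
  proof (rule AE_lebesgue_on_Ioi)
    fix n :: nat
    have J: "open {0<..<real (Suc n)}" by simp
    show "AE t in lebesgue_on {0<..<real (Suc n)}. AE z in lebesgue_on ?D.
      ut (z, t) + (v 4 0 (z, t) + 2 * v 2 2 (z, t) + v 0 4 (z, t)) + \<gamma> * (v 2 0 (z, t) + v 0 2 (z, t))
        + (v 3 0 (z, t) + v 1 2 (z, t)) + u (z, t) * v 1 0 (z, t) - v 5 0 (z, t) = 0"
    proof (rule AE_lebesgue_on_Times[OF O J])
      have "0 < real (Suc n)" by simp
      from T[OF this] show "AE q in lebesgue_on (?D \<times> {0<..<real (Suc n)}).
               ut q + (v 4 0 q + 2 * v 2 2 q + v 0 4 q) + \<gamma> * (v 2 0 q + v 0 2 q)
                 + (v 3 0 q + v 1 2 q) + u q * v 1 0 q - v 5 0 q = 0"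
        by (elim conjE)
    qed
  qed
  have slice: "AE t in lebesgue_on {0<..}. L2_on ?D (\<lambda>z. u (z, t)) \<and>
      (\<forall>i j. i + j \<le> 4 \<or> (i = 5 \<and> j = 0) \<longrightarrow> weak_deriv ?D (xy i j) (\<lambda>z. u (z, t)) (\<lambda>z. v i j (z, t)) \<and> L2_on ?D (\<lambda>z. v i j (z, t)))"
    using S4 S5 W
  proof eventually_elim
    case (elim t)
    have "L2_on ?D (\<lambda>z. v i j (z, t))" if "i + j \<le> 4 \<or> (i = 5 \<and> j = 0)" for i j
    proof (cases "i + j \<le> 4")
      case True
      then show ?thesis using elim(3) by (intro sobolev_weak_deriv_L2[OF O elim(1) True]) blast
    next
      case False
      then have "i = 5" "j = 0" using that by auto
      then show ?thesis using elim(2) by (simp add: sobolev_def)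
    qed
    moreover have "L2_on ?D (\<lambda>z. u (z, t))" using elim(1) by (simp add: sobolev_def)
    ultimately show ?case using elim(3) by blast
  qed
  show thesis
  proof (rule that[OF td])
    show "\<exists>C. AE t in lebesgue_on {0<..<T}. L2_norm ?D (\<lambda>z. ut (z, t)) \<le> C" if T0: "T > 0" for T
    proof -
      obtain C where C: "AE t in lebesgue_on {0<..<T}. sobolev_norm 0 ?D (\<lambda>z. ut (z, t)) \<le> C"
        and S: "AE t in lebesgue_on {0<..<T}. sobolev 0 ?D (\<lambda>z. ut (z, t))"
        using T[OF T0] unfolding Linf_Hk_def time_Hk_def by blast
      have "AE t in lebesgue_on {0<..<T}. L2_norm ?D (\<lambda>z. ut (z, t)) \<le> C"
        using C S
      proof eventually_elim
        case (elim t)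
        have "L2_on ?D (\<lambda>z. ut (z, t))" using elim(2) by (simp add: sobolev_def)
        then have "L2_norm ?D (\<lambda>z. ut (z, t)) = L2_norm ?D (wd ?D 0 0 (\<lambda>z. ut (z, t)))"
          using L2_norm_wd[OF O sobolev_0_weak_deriv[OF elim(2)]] by simp
        also have "\<dots> \<le> sobolev_norm 0 ?D (\<lambda>z. ut (z, t))"
          by (rule L2_norm_wd_le_sobolev_norm) simp
        finally show ?case using elim(1) by simp
      qed
      then show ?thesis by blast
    qed
    show "AE t in lebesgue_on {0<..}. L2_on ?D (\<lambda>z. ut (z, t)) \<and>
      (LINT z|lebesgue_on ?D. ut (z, t) * u (z, t)) \<le> - (a\<^sup>2 / 4) * (L2_norm ?D (\<lambda>z. u (z, t)))\<^sup>2"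
      using slice St pde tr
    proof eventually_elim
      case (elim t)
      have ut: "L2_on ?D (\<lambda>z. ut (z, t))" using elim(2) by (simp add: sobolev_def)
      moreover have "(LINT z|lebesgue_on ?D. ut (z, t) * u (z, t)) \<le> - (a\<^sup>2 / 4) * (L2_norm ?D (\<lambda>z. u (z, t)))\<^sup>2"
        by (rule energy_dissipation[OF B \<gamma> a, where v = "\<lambda>i j z. v i j (z, t)"]) (use elim ut in blast)+
      ultimately show ?case by blast
    qed
    show "AE t in lebesgue_on {0<..}. \<forall>e>0. \<exists>\<phi>. test_function ?D \<phi> \<and> L2_norm ?D (\<lambda>z. \<phi> z - u (z, t)) < e"
      using slice tr
    proof eventually_elim
      case (elim t)
      have w: "weak_deriv ?D [(1, 0)] (\<lambda>z. u (z, t)) (\<lambda>z. v 1 0 (z, t))" "weak_deriv ?D [(0, 1)] (\<lambda>z. u (z, t)) (\<lambda>z. v 0 1 (z, t))"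
        using conjunct2[OF elim(1), rule_format, of 1 0] conjunct2[OF elim(1), rule_format, of 0 1] by (auto simp: xy_simps)
      have "dir_H10 ?D (1, 0) (\<lambda>z. u (z, t)) (\<lambda>z. v 1 0 (z, t))"
        using elim by (intro zero_trace_left_imp_dir_H10[OF B _ w]) auto
      then obtain \<phi> where \<phi>: "\<And>n::nat. test_function ?D (\<phi> n)" "(\<lambda>n. L2_norm ?D (\<lambda>z. \<phi> n z - u (z, t))) \<longlonglongrightarrow> 0"
        unfolding dir_H10_def by blast
      show ?case
      proof (intro allI impI)
        fix e :: real assume "e > 0"
        from order_tendstoD(2)[OF \<phi>(2) this] obtain n where "L2_norm ?D (\<lambda>z. \<phi> n z - u (z, t)) < e"
          by (auto simp: eventually_sequentially)
        then show "\<exists>\<phi>. test_function ?D \<phi> \<and> L2_norm ?D (\<lambda>z. \<phi> z - u (z, t)) < e"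
          using \<phi>(1) by blast
      qed
    qed
  qed
qed

text \<open>|f|^2 - |g|^2 is the pairing of f - g with f + g. Replacing f + g by p costs the last
  term; p will be a test function, since only pairings with fixed test functions can be followed in
  time.\<close>

lemma L2_norm_square_increment:
  assumes f: "L2_on \<Omega> f" and g: "L2_on \<Omega> g" and p: "L2_on \<Omega> p"
  shows "(L2_norm \<Omega> f)\<^sup>2 - (L2_norm \<Omega> g)\<^sup>2 \<le> (LINT z|lebesgue_on \<Omega>. f z * p z) - (LINT z|lebesgue_on \<Omega>. g z * p z)
    + L2_norm \<Omega> (\<lambda>z. f z - g z) * L2_norm \<Omega> (\<lambda>z. f z + g z - p z)"
proof -
  have i: "integrable (lebesgue_on \<Omega>) (\<lambda>z. (f z)\<^sup>2)" "integrable (lebesgue_on \<Omega>) (\<lambda>z. (g z)\<^sup>2)"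
    "integrable (lebesgue_on \<Omega>) (\<lambda>z. f z * p z)" "integrable (lebesgue_on \<Omega>) (\<lambda>z. g z * p z)"
    by (intro L2_on_integrable L2_on_mult_integrable f g p)+
  have "(LINT z|lebesgue_on \<Omega>. (f z - g z) * (f z + g z - p z))
      = (LINT z|lebesgue_on \<Omega>. (f z)\<^sup>2 - (g z)\<^sup>2 - (f z * p z - g z * p z))"
    by (intro Bochner_Integration.integral_cong) (auto simp: algebra_simps power2_eq_square)
  also have "\<dots> = (L2_norm \<Omega> f)\<^sup>2 - (L2_norm \<Omega> g)\<^sup>2 - ((LINT z|lebesgue_on \<Omega>. f z * p z) - (LINT z|lebesgue_on \<Omega>. g z * p z))"
    unfolding L2_norm_power2 using i by simp
  finally show ?thesis
    using L2_Cauchy_Schwarz[OF L2_on_diff[OF f g] L2_on_diff[OF L2_on_add[OF f g] p]] by linarith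
qed

theorem theorem6p3:
  fixes B \<gamma> k a chi :: real
    and D :: "(real \<times> real) set"
    and u0 :: "real \<times> real \<Rightarrow> real"
    and u :: "(real \<times> real) \<times> real \<Rightarrow> real"
  assumes "B > 0"
    and "D = half_strip B"
    and "0 < \<gamma>" and "\<gamma> < 1 / 8"
    and "0 < k" and "k < 1 / 4"
    and "a > 0" and "a\<^sup>2 = pi\<^sup>2 / B\<^sup>2" and "a\<^sup>2 > 1"
    and "sobolev 4 D u0"
    and "\<exists>g. L2_on D g \<and> weak_deriv D (xy 5 0) u0 g"
    and "\<forall>i\<le>3. vanishes_at_infinity B (wd D i 0 u0)"
    and "zero_trace_left B u0" and "zero_trace_left B (wd D 1 0 u0)"
    and "zero_trace_bottom B u0" and "zero_trace_top B u0"
    and "zero_trace_bottom B (wd D 0 2 u0)" and "zero_trace_top B (wd D 0 2 u0)"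
    and "(\<integral>\<^sup>+ z. ennreal (exp (k * fst z) *
            ((bilaplacian D u0 z)\<^sup>2 + (laplacian D u0 z)\<^sup>2
              + (u0 z)\<^sup>2 * (wd D 1 0 u0 z)\<^sup>2 + (wd D 5 0 u0 z)\<^sup>2)) \<partial>lebesgue_on D) < \<infinity>"
    and "(\<integral>\<^sup>+ z. ennreal (exp (k * fst z) * (u0 z)\<^sup>2) \<partial>lebesgue_on D) < ennreal (9 / (8 * k) * a\<^sup>2)"
    and "chi = a\<^sup>2 / 2"
    and "regular_solution B \<gamma> u0 u"
  shows "\<forall>t\<ge>0. (L2_norm D (\<lambda>z. u (z, t)))\<^sup>2 \<le> (L2_norm D u0)\<^sup>2 * exp (- chi * t)"
proof -
  note B = assms(1) and reg = assms(22)
  have DB: "half_strip B = D" using assms(2) by simp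
  obtain ut where td: "time_deriv D u ut"
    and bound: "\<And>T. T > 0 \<Longrightarrow> \<exists>C. AE t in lebesgue_on {0<..<T}. L2_norm D (\<lambda>z. ut (z, t)) \<le> C"
    and energy: "AE t in lebesgue_on {0<..}. L2_on D (\<lambda>z. ut (z, t)) \<and>
      (LINT z|lebesgue_on D. ut (z, t) * u (z, t)) \<le> - (a\<^sup>2 / 4) * (L2_norm D (\<lambda>z. u (z, t)))\<^sup>2"
    and dense: "AE t in lebesgue_on {0<..}. \<forall>e>0. \<exists>\<phi>. test_function D \<phi> \<and> L2_norm D (\<lambda>z. \<phi> z - u (z, t)) < e"
    using regular_solution_slices[OF B assms(3,4,8,9) reg, unfolded DB] by blast
  have O: "open D" unfolding assms(2) by (rule open_half_strip)
  have L: "D \<in> sets lebesgue" by (rule open_imp_lebesgue[OF O])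
  define U where "U t = (\<lambda>z. u (z, t))" for t
  define E where "E t = (L2_norm D (U t))\<^sup>2" for t
  have chi: "0 < chi" using assms(9,21) by simp
  have cont: "continuous_in_L2 D u" and init: "AE z in lebesgue_on D. u (z, 0) = u0 z"
    using reg unfolding regular_solution_def Let_def DB by blast+
  have UL2: "L2_on D (U t)" if "t \<ge> 0" for t
    using cont that by (simp add: continuous_in_L2_def U_def)
  have Utend: "((\<lambda>s. L2_norm D (\<lambda>z. U s z - U t z)) \<longlongrightarrow> 0) (at t within {0..})" if "t \<ge> 0" for t
    using cont that by (simp add: continuous_in_L2_def U_def)
  have cont_from_bound: "continuous_on {0..} F"
    if F: "\<And>s t. s \<ge> 0 \<Longrightarrow> t \<ge> 0 \<Longrightarrow> \<bar>F s - F t\<bar> \<le> M * L2_norm D (\<lambda>z. U s z - U t z)" for F :: "real \<Rightarrow> real" and M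
    unfolding continuous_on_def
  proof
    fix t :: real assume t: "t \<in> {0..}"
    have "((\<lambda>s. F s - F t) \<longlongrightarrow> 0) (at t within {0..})"
    proof (rule Lim_null_comparison)
      show "((\<lambda>s. M * L2_norm D (\<lambda>z. U s z - U t z)) \<longlongrightarrow> 0) (at t within {0..})"
        using t by (intro tendsto_mult_right_zero Utend) simp
      show "\<forall>\<^sub>F s in at t within {0..}. norm (F s - F t) \<le> M * L2_norm D (\<lambda>z. U s z - U t z)"
        using t F by (auto simp: eventually_at intro!: exI[of _ 1])
    qed
    then show "(F \<longlongrightarrow> F t) (at t within {0..})" by (rule LIM_zero_cancel)
  qed
  have contN: "continuous_on {0..} (\<lambda>t. L2_norm D (U t))"
    by (rule cont_from_bound[where M = 1]) (simp add: L2_norm_diff_ge UL2)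
  have contE: "continuous_on {0..} E"
    unfolding E_def by (intro continuous_intros contN)
  \<comment> \<open>Approximation is known at almost every time; a good time s close to t serves for
    t by continuity in L^2.\<close>
  have approx: "\<exists>\<phi>. test_function D \<phi> \<and> L2_norm D (\<lambda>z. U t z - \<phi> z) < e" if t: "t \<ge> 0" and e: "e > 0" for t e
  proof -
    have "\<forall>\<^sub>F s in at t within {0..}. L2_norm D (\<lambda>z. U s z - U t z) < e / 2"
      using e by (intro order_tendstoD(2)[OF Utend[OF t]]) simp
    then obtain d where d: "d > 0" "\<And>s. s \<in> {0..} \<Longrightarrow> s \<noteq> t \<Longrightarrow> dist s t < d \<Longrightarrow> L2_norm D (\<lambda>z. U s z - U t z) < e / 2"
      unfolding eventually_at by blast
    obtain s where s: "s \<in> {t<..<t + d}" "\<forall>e>0. \<exists>\<phi>. test_function D \<phi> \<and> L2_norm D (\<lambda>z. \<phi> z - u (z, s)) < e"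
      using AE_lebesgue_on_Ioi_ex[OF dense t, of "t + d"] d(1) by auto
    then obtain \<phi> where \<phi>: "test_function D \<phi>" "L2_norm D (\<lambda>z. \<phi> z - U s z) < e / 2"
      using e unfolding U_def by (meson half_gt_zero)
    have "L2_norm D (\<lambda>z. \<phi> z - U t z) \<le> L2_norm D (\<lambda>z. \<phi> z - U s z) + L2_norm D (\<lambda>z. U s z - U t z)"
      using s t by (intro L2_norm_triangle3 L2_on_test_function[OF \<phi>(1) L] UL2) auto
    also have "\<dots> < e"
      using \<phi>(2) d(2)[of s] s(1) t by (simp add: dist_real_def)
    finally show ?thesis using \<phi>(1) L2_norm_minus_commute[of D \<phi>] by auto
  qed
  have dini: "\<exists>d>0. \<forall>t. s < t \<and> t < s + d \<longrightarrow> E t - E s \<le> (t - s) * (- chi * E s + e)" if s: "0 < s" and e: "0 < e" for s e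
  proof -
    obtain C0 where C0: "AE t in lebesgue_on {0<..<s + 1}. L2_norm D (\<lambda>z. ut (z, t)) \<le> C0"
      using bound[of "s + 1"] s by auto
    define C where "C = max C0 0"
    have C: "0 \<le> C" by (simp add: C_def)
    \<comment> \<open>Makes 3 C w at most e/2. The other half of e pays for the variation of E,
      through the radius \<open>e / (2 * chi)\<close> below. Adding 6 in the denominator covers C =
      0.\<close>
    define w where "w = e / (6 * C + 6)"
    have w: "0 < w" and Cw: "3 * (C * w) \<le> e / 2"
    proof -
      show "0 < w" using e C by (simp add: w_def)
      have "C * e \<le> (C + 1) * e" using e by simp
      then show "3 * (C * w) \<le> e / 2" using C by (simp add: w_def field_simps)
    qed
    obtain d1 where d1: "d1 > 0" "\<And>t. t \<in> {0..} \<Longrightarrow> t \<noteq> s \<Longrightarrow> dist t s < d1 \<Longrightarrow> L2_norm D (\<lambda>z. U t z - U s z) < w"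
      using order_tendstoD(2)[OF Utend w, of s] s unfolding eventually_at by auto
    have "(E \<longlongrightarrow> E s) (at s within {0..})" using contE s by (simp add: continuous_on_def)
    moreover have "E s - e / (2 * chi) < E s" using e chi by simp
    ultimately have "\<forall>\<^sub>F t in at s within {0..}. E s - e / (2 * chi) < E t" by (rule order_tendstoD(1))
    then obtain d2 where d2: "d2 > 0" "\<And>t. t \<in> {0..} \<Longrightarrow> t \<noteq> s \<Longrightarrow> dist t s < d2 \<Longrightarrow> E s - e / (2 * chi) < E t"
      unfolding eventually_at by blast
    \<comment> \<open>The 1 keeps all times before s + 1, where u_t is bounded by
      \<open>C\<close>.\<close>
    define d where "d = Min {d1, d2, 1}"
    have d: "0 < d" "d \<le> d1" "d \<le> d2" "d \<le> 1" using d1(1) d2(1) by (auto simp: d_def)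
    have near: "L2_norm D (\<lambda>z. U r z - U s z) \<le> w" "E s - e / (2 * chi) \<le> E r" if "s \<le> r" "r < s + d" for r
    proof -
      show "L2_norm D (\<lambda>z. U r z - U s z) \<le> w"
      proof (cases "r = s")
        case True
        then show ?thesis using w by (simp add: L2_norm_def)
      qed (use d1(2)[of r] that d s in \<open>auto simp: dist_real_def less_imp_le\<close>)
      show "E s - e / (2 * chi) \<le> E r"
      proof (cases "r = s")
        case True
        then show ?thesis using e chi by simp
      qed (use d2(2)[of r] that d s in \<open>auto simp: dist_real_def less_imp_le\<close>)
    qed
    show ?thesis
    proof (intro exI[of _ d] conjI allI impI)
      fix t assume t: "s < t \<and> t < s + d"
      have t0: "0 \<le> t" "0 \<le> s" using s t by auto
      show "E t - E s \<le> (t - s) * (- chi * E s + e)"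
      \<comment> \<open>The radius \<open>d\<close> depends on s and e only. The test function may
        depend on t as well, and its quality is measured by the further error \<open>\<eta>\<close>,
        which disappears for each fixed t.\<close>
      proof (rule field_le_epsilon)
        fix \<eta> :: real assume \<eta>: "0 < \<eta>"
        \<comment> \<open>\<open>M - 1\<close> is the total factor with which the error
          \<open>\<delta>\<close> of the test function enters; the added 1 makes \<open>M\<close>
          positive.\<close>
        define M where "M = C * (t - s) + L2_norm D (\<lambda>z. U t z - U s z) + 1"
        have M: "M > 0" using C t L2_norm_nonneg[of D "\<lambda>z. U t z - U s z"] by (simp add: M_def add_nonneg_pos)
        define \<delta> where "\<delta> = \<eta> / M"
        have \<delta>: "\<delta> > 0" using \<eta> M by (simp add: \<delta>_def)
        obtain p q where p: "test_function D p" "L2_norm D (\<lambda>z. U t z - p z) < \<delta> / 2"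
          and q: "test_function D q" "L2_norm D (\<lambda>z. U s z - q z) < \<delta> / 2"
          using approx[OF t0(1), of "\<delta> / 2"] approx[OF t0(2), of "\<delta> / 2"] \<delta> by auto
        \<comment> \<open>The sum p + q, close to U t + U s, written as a difference of test
          functions.\<close>
        define \<phi> where "\<phi> = (\<lambda>z. p z - - 1 * q z)"
        have \<phi>: "test_function D \<phi>"
          unfolding \<phi>_def by (intro test_function_diff p test_function_mult_smooth[OF q(1) smooth_const])
        have \<phi>L: "L2_on D \<phi>" and pL: "L2_on D p" and qL: "L2_on D q"
          by (intro L2_on_test_function[OF \<phi> L] L2_on_test_function[OF p(1) L] L2_on_test_function[OF q(1) L])+
        have close: "L2_norm D (\<lambda>z. U t z + U s z - \<phi> z) \<le> \<delta>"
        proof -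
          have "(\<lambda>z. U t z + U s z - \<phi> z) = (\<lambda>z. (U t z - p z) + (U s z - q z))"
            by (auto simp: \<phi>_def)
          then have "L2_norm D (\<lambda>z. U t z + U s z - \<phi> z) \<le> L2_norm D (\<lambda>z. U t z - p z) + L2_norm D (\<lambda>z. U s z - q z)"
            using L2_norm_triangle[OF L2_on_diff[OF UL2[OF t0(1)] pL] L2_on_diff[OF UL2[OF t0(2)] qL]] by simp
          then show ?thesis using p(2) q(2) by linarith
        qed
        define K where "K = - chi * E s + e + C * \<delta>"
        have AEk: "AE r in lebesgue_on {0<..}. r \<in> {s..t} \<longrightarrow> (LINT z|lebesgue_on D. ut (z, r) * \<phi> z) \<le> K"
        proof -
          have "AE r in lebesgue. r \<in> {0<..<s + 1} \<longrightarrow> L2_norm D (\<lambda>z. ut (z, r)) \<le> C0"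
            using C0 by (simp add: AE_restrict_space_iff open_imp_lebesgue)
          then have "AE r in lebesgue_on {0<..}. r \<in> {0<..<s + 1} \<longrightarrow> L2_norm D (\<lambda>z. ut (z, r)) \<le> C0"
            by (subst AE_restrict_space_iff) (auto simp: open_imp_lebesgue elim!: eventually_mono)
          with energy show ?thesis
          proof eventually_elim
            case (elim r)
            show ?case
            proof
              assume r: "r \<in> {s..t}"
              then have r0: "0 \<le> r" and rd: "s \<le> r" "r < s + d" using s t by auto
              have utL: "L2_on D (\<lambda>z. ut (z, r))" using elim(1) by blast
              have utC: "L2_norm D (\<lambda>z. ut (z, r)) \<le> C"
                using elim(2) r s rd d by (auto simp: C_def)
              have U2: "L2_on D (\<lambda>z. \<phi> z - 2 * U r z)" by (intro L2_on_diff \<phi>L L2_on_cmult UL2 r0)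
              \<comment> \<open>\<open>\<phi>\<close> is within \<open>\<delta>\<close> of U t + U
                s. Passing from there to 2 U r costs w for U t and 2 w for the two copies of U
                s.\<close>
              have "L2_norm D (\<lambda>z. \<phi> z - 2 * U r z) \<le> \<delta> + 3 * w"
              proof -
                have l1: "L2_on D (\<lambda>z. \<phi> z - (U t z + U s z))" "L2_on D (\<lambda>z. U t z - U s z)" "L2_on D (\<lambda>z. U s z - U r z)"
                  by (intro L2_on_diff L2_on_add \<phi>L UL2 t0 r0)+
                have "(\<lambda>z. \<phi> z - 2 * U r z) = (\<lambda>z. (\<phi> z - (U t z + U s z)) + ((U t z - U s z) + 2 * (U s z - U r z)))"
                  by (auto simp: algebra_simps)
                then have "L2_norm D (\<lambda>z. \<phi> z - 2 * U r z) \<le> L2_norm D (\<lambda>z. \<phi> z - (U t z + U s z))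
                    + L2_norm D (\<lambda>z. (U t z - U s z) + 2 * (U s z - U r z))"
                  using L2_norm_triangle[OF l1(1) L2_on_add[OF l1(2) L2_on_cmult[OF l1(3), of 2]]] by simp
                moreover have "L2_norm D (\<lambda>z. (U t z - U s z) + 2 * (U s z - U r z))
                    \<le> L2_norm D (\<lambda>z. U t z - U s z) + 2 * L2_norm D (\<lambda>z. U s z - U r z)"
                  using L2_norm_triangle[OF l1(2) L2_on_cmult[OF l1(3), of 2]] unfolding L2_norm_cmult by simp
                moreover have "L2_norm D (\<lambda>z. \<phi> z - (U t z + U s z)) \<le> \<delta>"
                  using close L2_norm_minus_commute[of D \<phi> "\<lambda>z. U t z + U s z"] by simp
                moreover have "L2_norm D (\<lambda>z. U t z - U s z) \<le> w" "L2_norm D (\<lambda>z. U s z - U r z) \<le> w"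
                  using near(1)[of t] near(1)[of r] t rd L2_norm_minus_commute[of D "U s" "U r"] by auto
                ultimately show ?thesis by linarith
              qed
              then have "L2_norm D (\<lambda>z. ut (z, r)) * L2_norm D (\<lambda>z. \<phi> z - 2 * U r z) \<le> C * (\<delta> + 3 * w)"
                using utC C by (intro mult_mono L2_norm_nonneg) auto
              then have rest: "(LINT z|lebesgue_on D. ut (z, r) * (\<phi> z - 2 * U r z)) \<le> C * (\<delta> + 3 * w)"
                using L2_Cauchy_Schwarz[OF utL U2] by linarith
              have "(LINT z|lebesgue_on D. ut (z, r) * \<phi> z)
                  = (LINT z|lebesgue_on D. 2 * (ut (z, r) * U r z) + ut (z, r) * (\<phi> z - 2 * U r z))"
                by (intro Bochner_Integration.integral_cong) (auto simp: algebra_simps)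
              also have "\<dots> = 2 * (LINT z|lebesgue_on D. ut (z, r) * U r z) + (LINT z|lebesgue_on D. ut (z, r) * (\<phi> z - 2 * U r z))"
                using L2_on_mult_integrable[OF utL UL2[OF r0]] L2_on_mult_integrable[OF utL U2] by simp
              \<comment> \<open>Twice the energy inequality at time r: 2 a^2/4 = chi.\<close>
              also have "\<dots> \<le> - chi * E r + C * (\<delta> + 3 * w)"
                using elim(1) rest by (simp add: U_def E_def assms(21))
              also have "\<dots> \<le> - chi * (E s - e / (2 * chi)) + C * (\<delta> + 3 * w)"
                using near(2)[OF rd] chi by (intro add_right_mono) (simp add: mult_left_mono)
              also have "\<dots> \<le> K"
                using Cw chi by (simp add: K_def field_simps)
              finally show "(LINT z|lebesgue_on D. ut (z, r) * \<phi> z) \<le> K" .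
            qed
          qed
        qed
        have "continuous_on {0..} (\<lambda>r. LINT z|lebesgue_on D. u (z, r) * \<phi> z)"
        proof (rule cont_from_bound[where M = "L2_norm D \<phi>"])
          fix r1 r2 :: real assume r: "r1 \<ge> 0" "r2 \<ge> 0"
          show "\<bar>(LINT z|lebesgue_on D. u (z, r1) * \<phi> z) - (LINT z|lebesgue_on D. u (z, r2) * \<phi> z)\<bar>
              \<le> L2_norm D \<phi> * L2_norm D (\<lambda>z. U r1 z - U r2 z)"
          proof -
            have "(LINT z|lebesgue_on D. (U r1 z - U r2 z) * \<phi> z)
                = (LINT z|lebesgue_on D. u (z, r1) * \<phi> z) - (LINT z|lebesgue_on D. u (z, r2) * \<phi> z)"
              using L2_on_mult_integrable[OF UL2[OF r(1)] \<phi>L] L2_on_mult_integrable[OF UL2[OF r(2)] \<phi>L]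
              by (simp add: U_def left_diff_distrib)
            then show ?thesis
              using L2_Cauchy_Schwarz[OF L2_on_diff[OF UL2[OF r(1)] UL2[OF r(2)]] \<phi>L]
              by (simp only: mult.commute[of "L2_norm D \<phi>"])
          qed
        qed
        then have hc: "continuous_on {0<..} (\<lambda>r. LINT z|lebesgue_on D. u (z, r) * \<phi> z)"
          by (rule continuous_on_subset) auto
        have inc: "(LINT z|lebesgue_on D. U t z * \<phi> z) - (LINT z|lebesgue_on D. U s z * \<phi> z) \<le> K * (t - s)"
          using time_deriv_increment_bound[OF O td \<phi> hc AEk s] t by (simp add: U_def)
        have "E t - E s \<le> K * (t - s) + L2_norm D (\<lambda>z. U t z - U s z) * L2_norm D (\<lambda>z. U t z + U s z - \<phi> z)"
          using L2_norm_square_increment[OF UL2[OF t0(1)] UL2[OF t0(2)] \<phi>L] inc by (simp add: E_def)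
        also have "\<dots> \<le> K * (t - s) + L2_norm D (\<lambda>z. U t z - U s z) * \<delta>"
          by (intro add_left_mono mult_left_mono close L2_norm_nonneg)
        also have "\<dots> = (t - s) * (- chi * E s + e) + (M - 1) * \<delta>"
          by (simp add: K_def M_def algebra_simps)
        also have "(M - 1) * \<delta> \<le> M * \<delta>" using \<delta> by (intro mult_right_mono) auto
        also have "M * \<delta> = \<eta>" using M by (simp add: \<delta>_def)
        finally show "E t - E s \<le> (t - s) * (- chi * E s + e) + \<eta>" by simp
      qed
    qed (use d in simp)
  qed
  have "L2_norm D (U 0) = L2_norm D u0"
    using init L2_on_measurable[OF UL2[of 0]] assms(10)
    by (intro L2_norm_cong_AE) (auto simp: U_def sobolev_def L2_on_def)
  then have E0: "E 0 = (L2_norm D u0)\<^sup>2" by (simp add: E_def)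
  show ?thesis
  proof (intro allI impI)
    fix t :: real assume "0 \<le> t"
    have "E t \<le> E 0 * exp (- chi * t)"
      by (rule exponential_decay[OF contE _ _ dini \<open>0 \<le> t\<close>]) (use chi in \<open>auto simp: E_def\<close>)
    then show "(L2_norm D (\<lambda>z. u (z, t)))\<^sup>2 \<le> (L2_norm D u0)\<^sup>2 * exp (- chi * t)"
      unfolding E0 by (simp add: E_def U_def)
  qed
qed

end
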